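(* Let $\phi\colon S_n \to \operatorname{Aut}(\mathfrak{S}^n)$ be given by $\pi \mapsto \phi_\pi$, where $\phi_\pi(\hat\gamma) = \hat\gamma\pi^{-1}$. Then $\phi$ is a homomorphism, and the semidirect product $\mathfrak{S}^n \rtimes_\phi S_n$ acts on $\mathcal{G}_{or(n)}$ by $$(\hat\gamma,\pi)(G,\ell) = \hat\gamma(G,\ell\pi^{-1}) = \left(G^{\Gamma(\hat\gamma,\ell\pi^{-1})},\, \ell\pi^{-1}\right) = \left(G^{\Gamma(\hat\gamma\pi,\ell)},\, \ell\pi^{-1}\right).$$
   Context: **Ribbon graphs.** A (finite) ribbon graph $G=(V(G),E(G))$ is a surface with boundary presented as the union of a set $V(G)$ of discs (vertices) and a set $E(G)$ of discs (edges) such that vertices and edges intersect in disjoint line segments, each such segment lies on the boundary of precisely one vertex and precisely one edge, and every edge contains exactly two such segments. Two ribbon graphs are isomorphic if there is a homeomorphism (not required to preserve any orientation) taking vertices to vertices and edges to edges; equivalently, if the corresponding cellularly embedded graphs are isomorphic. **Arrow presentations.** A ribbon graph is encoded by drawing each vertex boundary as a circle and recording, for each edge $e$, two directed arcs (arrows) labelled $e$ on the circles, namely the two segments where $e$ meets vertices, directed by an arbitrary orientation of the boundary of the disc $e$. **Operations on one edge.** Let $A,B$ be the two arrows labelled $e$. The partial Petrial (twist) $\tau$ at $e$ reverses the direction of exactly one of $A,B$. The partial dual $\delta$ at $e$: draw a segment with an arrow on it labelled $e$ directed from the head of $A$ to the tail of $B$, and another with an arrow labelled $e$ directed from the head of $B$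 to the tail of $A$; then delete $A$, $B$ and the arcs containing them. Vertices may change; the set of edges (labels) is unchanged. It is known that the group $\mathfrak{S} = \langle \delta,\tau \mid \delta^2,\tau^2,(\tau\delta)^3\rangle \cong S_3$ thereby acts on the left on any fixed edge (in a product the rightmost factor is applied first), and operations on distinct edges commute. **Ordered graphs.** $[n]=\{1,\dots,n\}$. $\mathcal{G}_{or(n)}$ is the set of isomorphism classes of pairs $(G,\ell)$, where $G$ is a ribbon graph with exactly $n$ edges ($n\ge 1$) and $\ell\colon[n]\to E(G)$ is a bijection (a linear ordering of the edges). $(G,\ell_G)$ and $(H,\ell_H)$ are isomorphic if there is a ribbon graph isomorphism $G\to H$ whose edge bijection $g$ satisfies $g\circ\ell_G=\ell_H$. **Notation.** An element $\hat\gamma\in\mathfrak{S}^n$ is regarded as a map $\hat\gamma\colon[n]\to\mathfrak{S}$; multiplication in $\mathfrak{S}^n$ is entrywise, and $\hat\gamma\pi$, for $\pi\in S_n$, is composition of maps. $G^{\Gamma(\hat\gamma,\ell)}$ denotes the ribbon graph obtained from $G$ by applying to each edge $e$ the operation $\hat\gamma(\ell^{-1}(e))\in\mathfrak{S}$. The group $\mathfrak{S}^n$ acts on $\mathcal{G}_{or(n)}$ by $\hat\gamma(G,\ell)=(G^{\Gamma(\hat\gamma,\ell)},\ell)$. The multiplication of $\mathfrak{S}^n\rtimes_\phi S_n$ is $(\hat\gamma_1,\pi_1)(\hat\gamma_2,\pi_2)=(\hat\gamma_1\,\phi_{\pi_1}(\hat\gamma_2),\,\pi_1\pi_2)$. 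*)

theory Defs
  imports "HOL-Analysis.Analysis" "HOL-Algebra.Bij" "HOL-Algebra.Group_Action"
    "HOL-Algebra.Sym_Groups" "HOL-Algebra.Product_Groups"
begin

section \<open>Ribbon graphs\<close>

record 'a ribbon =
  surface :: "'a topology"
  verts :: "'a set set"
  edges :: "'a set set"

definition disc_chart :: "'a topology \<Rightarrow> 'a set \<Rightarrow> (complex \<Rightarrow> 'a) \<Rightarrow> bool" where
  "disc_chart X D h \<longleftrightarrow>
     D \<subseteq> topspace X \<and> homeomorphic_map (top_of_set (cball 0 1)) (subtopology X D) h"

definition is_disc :: "'a topology \<Rightarrow> 'a set \<Rightarrow> bool" where
  "is_disc X D \<longleftrightarrow> (\<exists>h. disc_chart X D h)"

definition disc_boundary :: "'a topology \<Rightarrow> 'a set \<Rightarrow> 'a set" where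
  "disc_boundary X D = {h z |h z. disc_chart X D h \<and> norm z = 1}"

definition is_segment :: "'a topology \<Rightarrow> 'a set \<Rightarrow> bool" where
  "is_segment X s \<longleftrightarrow> s \<subseteq> topspace X \<and> subtopology X s homeomorphic_space top_of_set {0..1::real}"

definition segments :: "'a ribbon \<Rightarrow> 'a set \<Rightarrow> 'a set \<Rightarrow> 'a set set" where
  "segments G v e = connected_components_of (subtopology (surface G) (v \<inter> e))"

text \<open>
  The requirement that each segment lies on precisely one vertex and one edge is the disjointness
  of the vertices and of the edges.  That the space is a surface with boundary
  is a consequence of the conditions: it is a Hausdorff union of finitely many
  discs, glued along disjoint closed arcs of their boundary circles.
\<close>

definition ribbon_graph :: "'a ribbon \<Rightarrow> bool" where
  "ribbon_graph G \<longleftrightarrow>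
     Hausdorff_space (surface G) \<and>
     topspace (surface G) = \<Union> (verts G) \<union> \<Union> (edges G) \<and>
     finite (verts G) \<and> finite (edges G) \<and>
     (\<forall>D \<in> verts G \<union> edges G. is_disc (surface G) D) \<and>
     disjoint (verts G) \<and> disjoint (edges G) \<and>
     (\<forall>v \<in> verts G. \<forall>e \<in> edges G. \<forall>s \<in> segments G v e.
        is_segment (surface G) s \<and>
        s \<subseteq> disc_boundary (surface G) v \<and> s \<subseteq> disc_boundary (surface G) e) \<and>
     (\<forall>e \<in> edges G. card (\<Union>v \<in> verts G. segments G v e) = 2)"

definition ribbon_iso :: "'a ribbon \<Rightarrow> 'b ribbon \<Rightarrow> ('a \<Rightarrow> 'b) \<Rightarrow> bool" where
  "ribbon_iso G H F \<longleftrightarrow>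
     homeomorphic_map (surface G) (surface H) F \<and>
     (`) F ` verts G = verts H \<and> (`) F ` edges G = edges H"


section \<open>Arrow presentations\<close>

text \<open>
  An arrow is the pair of its tail and its head.  Cutting the circles of an arrow presentation
  at all ends of arrows leaves the arrows themselves and the complementary arcs; an element of
  \<open>gaps\<close> is the set of the two end points of such a complementary arc, so that the circles
  carrying arrows are recovered by joining arrows and gaps at common end points.  Circles
  without arrows carry no further information and are only counted, by \<open>bare\<close>.
\<close>

type_synonym 'p arrow = "'p \<times> 'p"

record ('p, 'e) arrow_presentation =
  arrows :: "'e \<Rightarrow> 'p arrow \<times> 'p arrow"
  gaps :: "'p set set"
  bare :: nat

definition ribbon_gaps :: "'a ribbon \<Rightarrow> 'a set set" where
  "ribbon_gaps G = {{h (cis s), h (cis t)} |v h s t.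
     v \<in> verts G \<and> disc_chart (surface G) v h \<and> s < t \<and>
     h (cis s) \<in> \<Union> (edges G) \<and> h (cis t) \<in> \<Union> (edges G) \<and>
     (\<forall>u. s < u \<and> u < t \<longrightarrow> h (cis u) \<notin> \<Union> (edges G))}"

text \<open>
  A chart \<open>k\<close> of the disc \<open>e\<close> orients its boundary (as \<open>t\<close> increases in \<open>k (cis t)\<close>), and all
  orientations arise in this way.
\<close>

definition arrow_pair_of :: "'a ribbon \<Rightarrow> 'a set \<Rightarrow> 'a arrow \<times> 'a arrow \<Rightarrow> bool" where
  "arrow_pair_of G e AB \<longleftrightarrow>
     (\<exists>k a b c d. disc_chart (surface G) e k \<and>
        a < b \<and> b < c \<and> c < d \<and> d < a + 2 * pi \<and>
        e \<inter> \<Union> (verts G) = k ` cis ` {a..b} \<union> k ` cis ` {c..d} \<and>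
        AB = ((k (cis a), k (cis b)), (k (cis c), k (cis d))))"

definition presents :: "'a ribbon \<Rightarrow> ('a, 'a set) arrow_presentation \<Rightarrow> bool" where
  "presents G P \<longleftrightarrow>
     (\<forall>e \<in> edges G. arrow_pair_of G e (arrows P e)) \<and>
     gaps P = ribbon_gaps G \<and>
     bare P = card {v \<in> verts G. v \<inter> \<Union> (edges G) = {}}"

fun reverse_arrow :: "'p arrow \<Rightarrow> 'p arrow" where
  "reverse_arrow (t, h) = (h, t)"

text \<open>
  The order of the two arrows with the same label, and the orientation of the edge that directs
  them, are immaterial.
\<close>

fun same_arrow_pair :: "'p arrow \<times> 'p arrow \<Rightarrow> 'p arrow \<times> 'p arrow \<Rightarrow> bool" where
  "same_arrow_pair (A, B) AB' \<longleftrightarrow>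
     AB' \<in> {(A, B), (B, A),
            (reverse_arrow A, reverse_arrow B), (reverse_arrow B, reverse_arrow A)}"

definition arrow_points :: "'e set \<Rightarrow> ('p, 'e) arrow_presentation \<Rightarrow> 'p set" where
  "arrow_points L P = (\<Union>e \<in> L. case arrows P e of ((a, b), (c, d)) \<Rightarrow> {a, b, c, d})"

definition presentation_iso ::
  "'e set \<Rightarrow> ('e \<Rightarrow> 'f) \<Rightarrow> ('p \<Rightarrow> 'q) \<Rightarrow>
   ('p, 'e) arrow_presentation \<Rightarrow> ('q, 'f) arrow_presentation \<Rightarrow> bool" where
  "presentation_iso L \<iota> f P Q \<longleftrightarrow>
     inj_on f (arrow_points L P) \<and>
     (\<forall>e \<in> L. same_arrow_pair (map_prod (map_prod f f) (map_prod f f) (arrows P e))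
                              (arrows Q (\<iota> e))) \<and>
     gaps Q = (`) f ` gaps P \<and>
     bare Q = bare P"


section \<open>Partial duals and partial Petrials\<close>

datatype generator = Delta | Tau

text \<open>
  The new arrows of a partial dual replace the old ones between the same arrow ends, so the gaps
  are not affected by either operation.
\<close>

fun generator_op :: "generator \<Rightarrow> 'p arrow \<times> 'p arrow \<Rightarrow> 'p arrow \<times> 'p arrow" where
  "generator_op Delta ((tailA, headA), (tailB, headB)) = ((headA, tailB), (headB, tailA))"
| "generator_op Tau (A, B) = (reverse_arrow A, B)"

definition word_op :: "generator list \<Rightarrow> 'p arrow \<times> 'p arrow \<Rightarrow> 'p arrow \<times> 'p arrow" where
  "word_op w AB = foldr generator_op w AB"

definition apply_words ::
  "('e \<Rightarrow> generator list) \<Rightarrow> ('p, 'e) arrow_presentation \<Rightarrow> ('p, 'e) arrow_presentation" where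
  "apply_words w P = P\<lparr>arrows := (\<lambda>e. word_op (w e) (arrows P e))\<rparr>"

text \<open>
  The group presented by \<open>\<langle>\<delta>, \<tau> | \<delta>\<^sup>2, \<tau>\<^sup>2, (\<tau>\<delta>)\<^sup>3\<rangle>\<close>.  As the relations make the generators
  involutions, words in positive powers of the generators suffice.
\<close>

inductive word_eq :: "generator list \<Rightarrow> generator list \<Rightarrow> bool" where
  refl: "word_eq u u"
| sym: "word_eq u v \<Longrightarrow> word_eq v u"
| trans: "word_eq u v \<Longrightarrow> word_eq v w \<Longrightarrow> word_eq u w"
| append: "word_eq u u' \<Longrightarrow> word_eq v v' \<Longrightarrow> word_eq (u @ v) (u' @ v')"
| Delta2: "word_eq [Delta, Delta] []"
| Tau2: "word_eq [Tau, Tau] []"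
| TauDelta3: "word_eq [Tau, Delta, Tau, Delta, Tau, Delta] []"

type_synonym twist = "generator list set"

definition twist_group :: "twist monoid" where
  "twist_group =
     \<lparr>carrier = UNIV // {(u, v). word_eq u v},
      mult = (\<lambda>A B. {w. \<exists>u \<in> A. \<exists>v \<in> B. word_eq w (u @ v)}),
      one = {w. word_eq w []}\<rparr>"

text \<open>
  \<open>H\<close>, whose edges are identified with those of \<open>G\<close> by \<open>\<iota>\<close>, is (a representative of) the ribbon
  graph obtained from \<open>G\<close> by applying \<open>\<Gamma> e\<close> to each edge \<open>e\<close>.  The identification is needed since
  the operations preserve edges as labels only, not as subsets of the surface.
\<close>

definition is_twisted_dual ::
  "'a ribbon \<Rightarrow> ('a set \<Rightarrow> twist) \<Rightarrow> 'a ribbon \<Rightarrow> ('a set \<Rightarrow> 'a set) \<Rightarrow> bool" where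
  "is_twisted_dual G \<Gamma> H \<iota> \<longleftrightarrow>
     ribbon_graph H \<and> bij_betw \<iota> (edges G) (edges H) \<and>
     (\<exists>P Q w f. presents G P \<and> presents H Q \<and> (\<forall>e \<in> edges G. w e \<in> \<Gamma> e) \<and>
        presentation_iso (edges G) \<iota> f (apply_words w P) Q)"


section \<open>Ordered ribbon graphs\<close>

type_synonym 'a ordered_ribbon = "'a ribbon \<times> (nat \<Rightarrow> 'a set)"

definition ordered_ribbon_graphs :: "nat \<Rightarrow> 'a ordered_ribbon set" where
  "ordered_ribbon_graphs n =
     {(G, l). ribbon_graph G \<and> l \<in> extensional {1..n} \<and> bij_betw l {1..n} (edges G)}"

definition ordered_iso :: "nat \<Rightarrow> ('a ordered_ribbon \<times> 'a ordered_ribbon) set" where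
  "ordered_iso n =
     {((G, l), (H, m)). (G, l) \<in> ordered_ribbon_graphs n \<and> (H, m) \<in> ordered_ribbon_graphs n \<and>
        (\<exists>F. ribbon_iso G H F \<and> (\<forall>i \<in> {1..n}. F ` l i = m i))}"

definition iso_class :: "nat \<Rightarrow> 'a ordered_ribbon \<Rightarrow> 'a ordered_ribbon set" where
  "iso_class n x = ordered_iso n `` {x}"

definition G_or :: "nat \<Rightarrow> 'a ordered_ribbon set set" where
  "G_or n = ordered_ribbon_graphs n // ordered_iso n"

text \<open>The isomorphism class of the twisted dual of \<open>G\<close> by \<open>\<Gamma>\<close>, with the edge order \<open>l\<close> of \<open>G\<close>.\<close>

definition twisted_dual_class ::
  "nat \<Rightarrow> 'a ribbon \<Rightarrow> ('a set \<Rightarrow> twist) \<Rightarrow> (nat \<Rightarrow> 'a set) \<Rightarrow> 'a ordered_ribbon set" where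
  "twisted_dual_class n G \<Gamma> l =
     {(H, m) \<in> ordered_ribbon_graphs n.
        \<exists>\<iota>. is_twisted_dual G \<Gamma> H \<iota> \<and> (\<forall>i \<in> {1..n}. m i = \<iota> (l i))}"

definition edge_twists :: "nat \<Rightarrow> (nat \<Rightarrow> twist) \<Rightarrow> (nat \<Rightarrow> 'a set) \<Rightarrow> 'a set \<Rightarrow> twist" where
  "edge_twists n \<gamma> l e = \<gamma> (inv_into {1..n} l e)"

definition twist_power :: "nat \<Rightarrow> (nat \<Rightarrow> twist) monoid" where
  "twist_power n = product_group {1..n} (\<lambda>_. twist_group)"

definition twist_power_act ::
  "nat \<Rightarrow> (nat \<Rightarrow> twist) \<Rightarrow> 'a ordered_ribbon set \<Rightarrow> 'a ordered_ribbon set" where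
  "twist_power_act n \<gamma> C = (\<Union>(G, l) \<in> C. twisted_dual_class n G (edge_twists n \<gamma> l) l)"


section \<open>The semidirect product\<close>

definition permute_twists :: "nat \<Rightarrow> (nat \<Rightarrow> nat) \<Rightarrow> (nat \<Rightarrow> twist) \<Rightarrow> (nat \<Rightarrow> twist)" where
  "permute_twists n \<pi> = (\<lambda>\<gamma> \<in> carrier (twist_power n). \<gamma> \<circ> inv' \<pi>)"

definition semidirect_product ::
  "('a, 'm) monoid_scheme \<Rightarrow> ('b, 'k) monoid_scheme \<Rightarrow> ('b \<Rightarrow> 'a \<Rightarrow> 'a) \<Rightarrow> ('a \<times> 'b) monoid" where
  "semidirect_product N K \<phi> =
     \<lparr>carrier = carrier N \<times> carrier K,
      mult = (\<lambda>(x\<^sub>1, y\<^sub>1) (x\<^sub>2, y\<^sub>2). (x\<^sub>1 \<otimes>\<^bsub>N\<^esub> \<phi> y\<^sub>1 x\<^sub>2, y\<^sub>1 \<otimes>\<^bsub>K\<^esub> y\<^sub>2)),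
      one = (\<one>\<^bsub>N\<^esub>, \<one>\<^bsub>K\<^esub>)\<rparr>"

end

theory Submission imports Defs
begin

text \<open>
  The action is defined through arrow presentations, but it acts on isomorphism classes of
  spaces that are unions of discs. So the core of the statement is topological: a twisted dual
  of a ribbon graph exists and is unique up to an isomorphism that respects the labels of the
  edges. With this at hand, the action of tuples and the formula for permutations are
  bookkeeping with the order of the edges.

  Uniqueness. The vertices and edges of a ribbon graph meet in segments, and the ends of these
  cut the boundary circles of all discs into arcs: the segments, the gaps between them on the
  vertices, and the free sides of the edges. An arrow presentation records which ends bound
  which arcs. An isomorphism of presentations therefore gives a homeomorphism between the
  graphs formed by the arcs; it maps boundary circles of edges to boundary circles of edges by
  the labels, and of vertices to vertices since these are the components of the union of
  segments and gaps. Homeomorphisms of circles extend radially to discs, and the extensions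
  paste (\<open>disc_system_unique\<close>, \<open>ribbon_iso_of_presentation_iso\<close>).
  Conversely two presentations of one ribbon graph differ only in the choices that isomorphisms
  of presentations ignore (\<open>presents_unique\<close>).

  Existence. Arrows and gaps are two pairings of the finite set of arrow ends, so the ends are
  arranged in cycles along which arrows and gaps alternate. Drawing these cycles as disjoint
  circles in a plane, and attaching for each label a disc along the two arcs of its arrows,
  yields a ribbon graph with the given presentation (\<open>realization\<close>). The
  construction takes place in a fixed space; since a disc has the cardinality of the continuum,
  it can be copied into the type of points of the given ribbon graph
  (\<open>twisted_dual_exists\<close>).

  Algebra. The relations of the group generated by \<open>\<delta>\<close> and
  \<open>\<tau>\<close> hold for pairs of arrows up to the changes that do not affect the edge
  (\<open>word_eq_op\<close>), concatenated words give iterated twisted duals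
  (\<open>twisted_dual_comp\<close>), and a change of the order of the edges commutes with
  twisting up to the same permutation of the tuple of twists
  (\<open>reorder_twist_power_act\<close>). The last rule is the multiplication of the
  semidirect product.
\<close>

section \<open>Arcs and discs in Hausdorff spaces\<close>

text \<open>
  A continuous bijection from a compact space onto a Hausdorff space is a homeomorphism. Charts
  of discs and of arcs may therefore be replaced by continuous injective parametrisations of
  subsets, which are easier to compose and restrict.
\<close>

lemma embedded_copy_iff:
  assumes "Hausdorff_space X" "compact_space T"
  shows "A \<subseteq> topspace X \<and> homeomorphic_map T (subtopology X A) h \<longleftrightarrow>
    continuous_map T X h \<and> inj_on h (topspace T) \<and> h ` topspace T = A"
proof
  assume L: "A \<subseteq> topspace X \<and> homeomorphic_map T (subtopology X A) h"
  then have "h ` topspace T = A"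
    using homeomorphic_imp_surjective_map [of T "subtopology X A" h] by (simp add: Int_absorb1)
  moreover have "continuous_map T X h"
    using L homeomorphic_imp_continuous_map [of T "subtopology X A" h]
    by (simp add: continuous_map_in_subtopology)
  moreover have "inj_on h (topspace T)"
    using L homeomorphic_imp_injective_map by auto
  ultimately show "continuous_map T X h \<and> inj_on h (topspace T) \<and> h ` topspace T = A"
    by simp
next
  assume R: "continuous_map T X h \<and> inj_on h (topspace T) \<and> h ` topspace T = A"
  then have sub: "A \<subseteq> topspace X"
    using continuous_map_image_subset_topspace by blast
  have "continuous_map T (subtopology X A) h"
    using R by (simp add: continuous_map_in_subtopology image_subset_iff_funcset [symmetric])
  then have "homeomorphic_map T (subtopology X A) h"
    using R sub assms
    by (intro continuous_imp_homeomorphic_map Hausdorff_space_subtopology) (auto simp: Int_absorb1)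
  with sub show "A \<subseteq> topspace X \<and> homeomorphic_map T (subtopology X A) h" by simp
qed

lemma compact_space_top_of_set [simp]: "compact_space (top_of_set K) \<longleftrightarrow> compact K"
  unfolding compact_space_def by (simp add: compactin_subtopology)

definition disc_param :: "'a topology \<Rightarrow> 'a set \<Rightarrow> (complex \<Rightarrow> 'a) \<Rightarrow> bool" where
  "disc_param X D h \<longleftrightarrow> continuous_map (top_of_set (cball 0 1)) X h \<and>
     inj_on h (cball 0 1) \<and> h ` cball 0 1 = D"

lemma disc_chart_iff: "Hausdorff_space X \<Longrightarrow> disc_chart X D h \<longleftrightarrow> disc_param X D h"
  unfolding disc_chart_def disc_param_def
  using embedded_copy_iff [of X "top_of_set (cball 0 1)" D h] by simp

definition arc_param :: "'a topology \<Rightarrow> 'a set \<Rightarrow> (real \<Rightarrow> 'a) \<Rightarrow> bool" where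
  "arc_param X A g \<longleftrightarrow> continuous_map (top_of_set {0..1}) X g \<and> inj_on g {0..1} \<and> g ` {0..1} = A"

lemma is_segment_iff:
  assumes "Hausdorff_space X"
  shows "is_segment X A \<longleftrightarrow> (\<exists>g. arc_param X A g)"
proof -
  have "is_segment X A \<longleftrightarrow>
    (\<exists>g. A \<subseteq> topspace X \<and> homeomorphic_map (top_of_set {0..1::real}) (subtopology X A) g)"
    unfolding is_segment_def by (metis homeomorphic_space homeomorphic_space_sym)
  then show ?thesis
    unfolding arc_param_def using embedded_copy_iff [of X "top_of_set {0..1::real}" A] assms by simp
qed

lemma param_compactin:
  assumes "continuous_map (top_of_set K) X h" "compact S" "S \<subseteq> K"
  shows "compactin X (h ` S)"
  using image_compactin [OF _ assms(1)] assms(2,3) by (simp add: compactin_subtopology)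

lemma param_connectedin:
  assumes "continuous_map (top_of_set K) X h" "connected S" "S \<subseteq> K"
  shows "connectedin X (h ` S)"
  using connectedin_continuous_map_image [OF assms(1)] assms(2,3) by (simp add: connectedin_subtopology)

lemma is_segment_compactin: "\<lbrakk>Hausdorff_space X; is_segment X A\<rbrakk> \<Longrightarrow> compactin X A"
  unfolding is_segment_iff arc_param_def by (metis compact_Icc order_refl param_compactin)

lemma is_segment_connectedin: "\<lbrakk>Hausdorff_space X; is_segment X A\<rbrakk> \<Longrightarrow> connectedin X A"
  unfolding is_segment_iff arc_param_def by (metis connected_Icc order_refl param_connectedin)

lemma is_segment_closedin: "\<lbrakk>Hausdorff_space X; is_segment X A\<rbrakk> \<Longrightarrow> closedin X A"
  by (simp add: compactin_imp_closedin is_segment_compactin)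

lemma is_segment_nonempty: "\<lbrakk>Hausdorff_space X; is_segment X A\<rbrakk> \<Longrightarrow> A \<noteq> {}"
  unfolding is_segment_iff arc_param_def by force

lemma param_continuous_inverse:
  assumes "Hausdorff_space X" "compact K" "continuous_map (top_of_set K) X h" "inj_on h K"
  shows "continuous_map (subtopology X (h ` K)) (top_of_set K) (inv_into K h)"
  using continuous_inverse_map [of "top_of_set K" X h "inv_into K h" "h ` K"] assms by auto


text \<open>
  The ends of an arc are its non-cut points. Put in this way they are independent of a
  parametrisation and preserved by homeomorphisms.
\<close>

definition ends :: "'a topology \<Rightarrow> 'a set \<Rightarrow> 'a set" where
  "ends X A = {x \<in> A. connectedin X (A - {x})}"

lemma ends_subset: "ends X A \<subseteq> A"
  by (auto simp: ends_def)

lemma ends_arc_param: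
  assumes X: "Hausdorff_space X" and g: "arc_param X A g"
  shows "ends X A = {g 0, g 1}"
proof -
  have cg: "continuous_map (top_of_set {0..1}) X g" and inj: "inj_on g {0..1}" and A: "A = g ` {0..1}"
    using g by (auto simp: arc_param_def)
  have "connectedin X (A - {g t}) \<longleftrightarrow> t = 0 \<or> t = 1" if t: "t \<in> {0..1}" for t
  proof -
    have eq: "A - {g t} = g ` ({0..1} - {t})"
      using inj t by (auto simp: A inj_on_def)
    have "inv_into {0..1} g ` (A - {g t}) = {0..1} - {t}"
      using inj by (force simp: eq image_image)
    moreover have "connectedin (top_of_set {0..1}) (inv_into {0..1} g ` (A - {g t}))"
      if "connectedin X (A - {g t})"
    proof (rule connectedin_continuous_map_image)
      show "continuous_map (subtopology X A) (top_of_set {0..1}) (inv_into {0..1} g)"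
        unfolding A using X cg inj by (simp add: param_continuous_inverse)
      show "connectedin (subtopology X A) (A - {g t})"
        using that by (simp add: connectedin_subtopology)
    qed
    ultimately have "connected ({0..1} - {t})" if "connectedin X (A - {g t})"
      using that by (simp add: connectedin_subtopology)
    moreover have "\<not> connected ({0..1} - {t})" if "0 < t" "t < 1"
    proof
      assume "connected ({0..1} - {t})"
      then have "{0..1} \<subseteq> {0..1} - {t}"
        by (rule connected_contains_Icc) (use that in auto)
      then show False using t by auto
    qed
    moreover have "connectedin X (A - {g t})" if "t = 0 \<or> t = 1"
    proof -
      have "{0..1} - {0} = {0<..1::real}" "{0..1} - {1} = {0..<1::real}" by auto
      then have "connected ({0..1} - {t})"
        using that by (elim disjE) simp_all
      then show ?thesis unfolding eq by (intro param_connectedin [OF cg]) auto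
    qed
    ultimately show ?thesis using t by fastforce
  qed
  then show ?thesis unfolding ends_def A by auto
qed

lemma is_segment_ends:
  assumes "Hausdorff_space X" "is_segment X A"
  obtains p q where "p \<noteq> q" "ends X A = {p, q}"
proof -
  obtain g where g: "arc_param X A g"
    using assms is_segment_iff by blast
  show ?thesis
  proof
    show "ends X A = {g 0, g 1}" using ends_arc_param assms(1) g by blast
    show "g 0 \<noteq> g 1" using g inj_onD [of g "{0..1}" 0 1] by (auto simp: arc_param_def)
  qed
qed

lemma arc_param_reverse:
  assumes "arc_param X A g" shows "arc_param X A (\<lambda>t. g (1 - t))"
proof -
  have "continuous_map (top_of_set {0..1}) (top_of_set {0..1::real}) (\<lambda>t. 1 - t)"
    by (auto simp: continuous_intros)
  then have "continuous_map (top_of_set {0..1}) X (g \<circ> (\<lambda>t. 1 - t))"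
    using assms continuous_map_compose unfolding arc_param_def by blast
  moreover have "(\<lambda>t. 1 - t) ` {0..1} = {0..1::real}"
    by (auto simp: image_iff intro!: bexI [of _ "1 - _"])
  then have "(\<lambda>t. g (1 - t)) ` {0..1} = g ` {0..1}"
    by (metis image_image)
  moreover have "inj_on (\<lambda>t. g (1 - t)) {0..1}"
    using assms inj_onD [of g "{0..1}" "1 - _" "1 - _"] by (force simp: arc_param_def intro: inj_onI)
  ultimately show ?thesis
    using assms by (simp add: arc_param_def o_def)
qed

lemma arc_param_from:
  assumes X: "Hausdorff_space X" and A: "is_segment X A" and "ends X A = {p, q}"
  obtains g where "arc_param X A g" "g 0 = p" "g 1 = q"
proof -
  obtain g where g: "arc_param X A g"
    using X A is_segment_iff by blast
  then have "{g 0, g 1} = {p, q}"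
    using ends_arc_param X assms(3) by metis
  then consider "g 0 = p" "g 1 = q" | "g 0 = q" "g 1 = p"
    by (auto simp: doubleton_eq_iff)
  then show ?thesis
  proof cases
    case 1
    then show ?thesis using that g by blast
  next
    case 2
    then show ?thesis by (intro that [OF arc_param_reverse [OF g]]) simp_all
  qed
qed

lemma arc_homeomorphism:
  assumes X: "Hausdorff_space X" and Y: "Hausdorff_space Y"
    and A: "is_segment X A" "ends X A = {p, q}" and B: "is_segment Y B" "ends Y B = {p', q'}"
  shows "\<exists>\<phi>. continuous_map (subtopology X A) Y \<phi> \<and> bij_betw \<phi> A B \<and> \<phi> p = p' \<and> \<phi> q = q'"
proof -
  obtain g where g: "arc_param X A g" "g 0 = p" "g 1 = q"
    by (rule arc_param_from [OF X A])
  obtain k where k: "arc_param Y B k" "k 0 = p'" "k 1 = q'"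
    by (rule arc_param_from [OF Y B])
  let ?\<phi> = "k \<circ> inv_into {0..1} g"
  have "continuous_map (subtopology X A) Y ?\<phi>"
  proof (rule continuous_map_compose)
    show "continuous_map (subtopology X A) (top_of_set {0..1}) (inv_into {0..1} g)"
      using g(1) X param_continuous_inverse [of X "{0..1}" g] by (auto simp: arc_param_def)
    show "continuous_map (top_of_set {0..1}) Y k"
      using k(1) by (simp add: arc_param_def)
  qed
  moreover have "bij_betw ?\<phi> A B"
  proof (rule bij_betw_trans)
    show "bij_betw (inv_into {0..1} g) A {0..1}"
      using g(1) unfolding arc_param_def by (intro bij_betw_inv_into) (simp add: bij_betw_def)
    show "bij_betw k {0..1} B"
      using k(1) by (simp add: arc_param_def bij_betw_def)
  qed
  moreover have "inv_into {0..1} g (g 0) = 0" "inv_into {0..1} g (g 1) = 1"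
    using g(1) by (simp_all add: arc_param_def)
  then have "?\<phi> p = p'" "?\<phi> q = q'"
    using g k by simp_all
  ultimately show ?thesis by blast
qed


section \<open>The boundary of a disc\<close>

lemma disc_param_transition:
  assumes X: "Hausdorff_space X" and h: "disc_param X D h" and k: "disc_param X D k"
  shows "continuous_on (cball 0 1) (inv_into (cball 0 1) k \<circ> h)"
    "inj_on (inv_into (cball 0 1) k \<circ> h) (cball 0 1)"
    "(inv_into (cball 0 1) k \<circ> h) ` cball 0 1 = cball 0 1"
proof -
  have "continuous_map (top_of_set (cball 0 1)) (subtopology X D) h"
    using h by (auto simp: disc_param_def continuous_map_in_subtopology)
  moreover have "continuous_map (subtopology X D) (top_of_set (cball 0 1)) (inv_into (cball 0 1) k)"
    using k X param_continuous_inverse [of X "cball 0 1" k] by (auto simp: disc_param_def)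
  ultimately show "continuous_on (cball 0 1) (inv_into (cball 0 1) k \<circ> h)"
    using continuous_map_compose by fastforce
  show "inj_on (inv_into (cball 0 1) k \<circ> h) (cball 0 1)"
    using h k unfolding disc_param_def by (metis comp_inj_on inj_on_inv_into order_refl)
  show "(inv_into (cball 0 1) k \<circ> h) ` cball 0 1 = cball 0 1"
    using h k unfolding disc_param_def by (metis image_comp inv_into_image_cancel inj_on_imp_bij_betw
        bij_betw_inv_into bij_betw_imp_surj_on)
qed

text \<open>
  By invariance of domain a transition between two charts of a disc maps the open ball to
  itself.
\<close>

lemma disc_param_boundary_unique:
  assumes X: "Hausdorff_space X" and h: "disc_param X D h" and k: "disc_param X D k"
    and z: "norm z \<le> 1" and w: "norm w = 1" and eq: "h z = k w"
  shows "norm z = 1"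
proof (rule ccontr)
  let ?g = "inv_into (cball 0 1) k \<circ> h"
  assume "norm z \<noteq> 1"
  then have "z \<in> ball 0 1" using z by auto
  have "open (?g ` ball 0 1)"
    using disc_param_transition [OF X h k]
    by (intro invariance_of_domain) (auto intro: continuous_on_subset inj_on_subset)
  moreover have "?g ` ball 0 1 \<subseteq> cball 0 1"
    using disc_param_transition(3) [OF X h k] ball_subset_cball by blast
  ultimately have "?g ` ball 0 1 \<subseteq> ball 0 1"
    by (metis interior_cball interior_maximal)
  moreover have "?g z = w"
    using k w by (simp add: eq disc_param_def)
  ultimately show False
    using \<open>z \<in> ball 0 1\<close> w by force
qed

lemma disc_boundary_eq:
  assumes X: "Hausdorff_space X" and h: "disc_param X D h"
  shows "disc_boundary X D = h ` sphere 0 1"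
proof -
  have "k w \<in> h ` sphere 0 1" if k: "disc_param X D k" and w: "norm w = 1" for k w
  proof -
    have "k w \<in> D" using k w by (auto simp: disc_param_def)
    then obtain z where "norm z \<le> 1" "h z = k w"
      using h by (auto simp: disc_param_def)
    then show ?thesis
      using disc_param_boundary_unique [OF X h k _ w] by force
  qed
  moreover have "h z \<in> disc_boundary X D" if "norm z = 1" for z
    unfolding disc_boundary_def disc_chart_iff [OF X] using h that by blast
  ultimately show ?thesis
    unfolding disc_boundary_def disc_chart_iff [OF X] by auto
qed

lemma disc_boundary_subset: "Hausdorff_space X \<Longrightarrow> disc_boundary X D \<subseteq> D"
  unfolding disc_boundary_def by (auto simp: disc_chart_iff disc_param_def)

lemma is_disc_compactin:
  assumes "Hausdorff_space X" "is_disc X D" shows "compactin X D"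
proof -
  obtain h where "disc_param X D h" using assms by (auto simp: is_disc_def disc_chart_iff)
  then show ?thesis
    using param_compactin [of "cball 0 1" X h "cball 0 1"] by (auto simp: disc_param_def)
qed

lemma disc_boundary_compactin:
  assumes "Hausdorff_space X" "is_disc X D" shows "compactin X (disc_boundary X D)"
proof -
  obtain h where "disc_param X D h" using assms by (auto simp: is_disc_def disc_chart_iff)
  moreover from this have "disc_boundary X D = h ` sphere 0 1"
    by (rule disc_boundary_eq [OF assms(1)])
  ultimately show ?thesis
    using param_compactin [of "cball 0 1" X h "sphere 0 1"] by (simp add: disc_param_def)
qed

lemma disc_boundary_connectedin:
  assumes "Hausdorff_space X" "is_disc X D" shows "connectedin X (disc_boundary X D)"
proof -
  obtain h where "disc_param X D h" using assms by (auto simp: is_disc_def disc_chart_iff)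
  moreover from this have "disc_boundary X D = h ` sphere 0 1"
    by (rule disc_boundary_eq [OF assms(1)])
  moreover have "connected (sphere (0::complex) 1)"
    by (rule connected_sphere) simp
  ultimately show ?thesis
    using param_connectedin [of "cball 0 1" X h "sphere 0 1"] by (simp add: disc_param_def)
qed

text \<open>
  The radial extension scales the given map by the norm. As it preserves norms, it is
  continuous at the centre as well.
\<close>

lemma cone_extension:
  fixes g :: "complex \<Rightarrow> complex"
  assumes cont: "continuous_on (sphere 0 1) g" and bij: "bij_betw g (sphere 0 1) (sphere 0 1)"
  obtains G where "continuous_on (cball 0 1) G" "bij_betw G (cball 0 1) (cball 0 1)"
    "\<And>z. norm z = 1 \<Longrightarrow> G z = g z"
proof -
  let ?G = "\<lambda>z. of_real (norm z) * g (sgn z)"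
  have ng: "norm (g u) = 1" if "norm u = 1" for u
    using bij that by (auto simp: bij_betw_def)
  have nG: "norm (?G z) = norm z" for z
    by (cases "z = 0") (auto simp: norm_mult ng norm_sgn)
  have ext: "?G z = g z" if "norm z = 1" for z
    using that by (simp add: sgn_div_norm)
  have cont_G: "continuous_on (cball 0 1) ?G"
    unfolding continuous_on_eq_continuous_within
  proof
    fix z :: complex assume z: "z \<in> cball 0 1"
    show "continuous (at z within cball 0 1) ?G"
    proof (cases "z = 0")
      case True
      have "(?G \<longlongrightarrow> 0) (at 0 within cball 0 1)"
        by (rule Lim_null_comparison [where g = norm]) (auto simp: nG intro!: tendsto_eq_intros)
      then show ?thesis using True by (simp add: continuous_within)
    next
      case False
      have "continuous_on (- {0::complex}) sgn"
        by (intro continuous_on_sgn continuous_on_id) auto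
      moreover have "continuous_on (sgn ` (- {0::complex})) g"
        by (rule continuous_on_subset [OF cont]) (auto simp: norm_sgn split: if_split_asm)
      ultimately have "continuous_on (- {0}) (g \<circ> sgn)"
        by (rule continuous_on_compose)
      then have "continuous_on (- {0}) ?G"
        by (auto simp: o_def intro!: continuous_intros)
      then have "continuous (at z) ?G"
        using False continuous_on_eq_continuous_at [of "- {0::complex}" ?G] by auto
      then show ?thesis using continuous_at_imp_continuous_at_within by blast
    qed
  qed
  have "bij_betw ?G (cball 0 1) (cball 0 1)"
    unfolding bij_betw_def
  proof
    show "inj_on ?G (cball 0 1)"
    proof (rule inj_onI)
      fix x y assume e: "?G x = ?G y"
      then have n: "norm x = norm y" using nG by metis
      show "x = y"
      proof (cases "x = 0")
        case False
        have y: "y \<noteq> 0" using False n by auto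
        with e n False have "g (sgn x) = g (sgn y)" by auto
        moreover have "inj_on g (sphere 0 1)" using bij by (simp add: bij_betw_def)
          moreover have "sgn x \<in> sphere 0 1" "sgn y \<in> sphere 0 1"
            using False y by (auto simp: norm_sgn)
          ultimately have "sgn x = sgn y" by (meson inj_onD)
        then have "norm x *\<^sub>R sgn x = norm y *\<^sub>R sgn y" using n by simp
          then show ?thesis using False y by (simp add: sgn_div_norm)
      qed (use n in auto)
    qed
    have "w \<in> ?G ` cball 0 1" if w: "norm w \<le> 1" for w
    proof (cases "w = 0")
      case False
      then have "sgn w \<in> g ` sphere 0 1" using bij by (auto simp: bij_betw_def norm_sgn)
      then obtain u where u: "norm u = 1" "g u = sgn w" by auto
      have "sgn (of_real (norm w) * u) = u"
        using u(1) False by (simp add: sgn_mult sgn_of_real sgn_div_norm [of u])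
      then have "?G (of_real (norm w) * u) = w"
        using u False by (simp add: norm_mult sgn_div_norm [of w] scaleR_conv_of_real)
      moreover have "norm (of_real (norm w) * u) \<le> 1" using u w by (simp add: norm_mult)
      ultimately show ?thesis by (intro image_eqI [where x = "of_real (norm w) * u"]) auto
    qed (auto intro: image_eqI [of _ _ 0])
    then show "?G ` cball 0 1 = cball 0 1" using nG by auto
  qed
  with cont_G show ?thesis
    by (rule that) (rule ext)
qed

text \<open>
  Alexander's trick: in charts, a homeomorphism between the boundary circles is coned off.
\<close>

lemma disc_extension:
  assumes X: "Hausdorff_space X" and Y: "Hausdorff_space Y"
    and D: "is_disc X D" and E: "is_disc Y E"
    and cont: "continuous_map (subtopology X (disc_boundary X D)) Y \<phi>"
    and bij: "bij_betw \<phi> (disc_boundary X D) (disc_boundary Y E)"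
  shows "\<exists>\<psi>. continuous_map (subtopology X D) Y \<psi> \<and> bij_betw \<psi> D E \<and>
    (\<forall>x \<in> disc_boundary X D. \<psi> x = \<phi> x)"
proof -
  obtain h where h: "disc_param X D h" using X D by (auto simp: is_disc_def disc_chart_iff)
  obtain k where k: "disc_param Y E k" using Y E by (auto simp: is_disc_def disc_chart_iff)
  let ?h' = "inv_into (cball 0 1) h" and ?k' = "inv_into (cball 0 1) k"
  have ch': "continuous_map (subtopology X D) (top_of_set (cball 0 1)) ?h'"
    using h X param_continuous_inverse [of X "cball 0 1" h] by (auto simp: disc_param_def)
  have ck': "continuous_map (subtopology Y E) (top_of_set (cball 0 1)) ?k'"
    using k Y param_continuous_inverse [of Y "cball 0 1" k] by (auto simp: disc_param_def)
  have bD: "disc_boundary X D = h ` sphere 0 1" and bE: "disc_boundary Y E = k ` sphere 0 1"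
    by (rule disc_boundary_eq [OF X h], rule disc_boundary_eq [OF Y k])
  let ?g = "?k' \<circ> \<phi> \<circ> h"
  have bh: "bij_betw h (sphere 0 1) (disc_boundary X D)"
    using h unfolding bD disc_param_def
    by (meson inj_on_imp_bij_betw inj_on_subset sphere_cball)
  have bk: "bij_betw k (sphere 0 1) (disc_boundary Y E)"
    using k unfolding bE disc_param_def
    by (meson inj_on_imp_bij_betw inj_on_subset sphere_cball)
  have k'k: "?k' (k z) = z" if "norm z \<le> 1" for z
    using k that by (simp add: disc_param_def)
  have bk': "bij_betw ?k' (disc_boundary Y E) (sphere 0 1)"
    by (rule bij_betw_byWitness [where f' = k]) (auto simp: bE k'k)
  have "bij_betw ?g (sphere 0 1) (sphere 0 1)"
    by (meson bij_betw_trans bh bij bk')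
  moreover have "continuous_on (sphere 0 1) ?g"
  proof -
    have "continuous_map (top_of_set (sphere 0 1)) (subtopology X (disc_boundary X D)) h"
      using h continuous_map_from_subtopology_mono [of euclidean "cball 0 1" X h "sphere 0 1"]
      by (simp add: disc_param_def continuous_map_in_subtopology bD)
    then have "continuous_map (top_of_set (sphere 0 1)) Y (\<phi> \<circ> h)"
      using cont continuous_map_compose by blast
    moreover have "(\<phi> \<circ> h) ` sphere 0 1 \<subseteq> E"
      using bij disc_boundary_subset [OF Y, of E] by (auto simp: bij_betw_def bD)
    ultimately have "continuous_map (top_of_set (sphere 0 1)) (subtopology Y E) (\<phi> \<circ> h)"
      by (simp add: continuous_map_in_subtopology image_subset_iff_funcset [symmetric])
    then have "continuous_map (top_of_set (sphere 0 1)) (top_of_set (cball 0 1)) (?k' \<circ> (\<phi> \<circ> h))"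
      using ck' continuous_map_compose by blast
    then show ?thesis by (simp add: o_assoc)
  qed
  ultimately obtain G where G: "continuous_on (cball 0 1) G" "bij_betw G (cball 0 1) (cball 0 1)"
    and Gg: "\<And>z. norm z = 1 \<Longrightarrow> G z = ?g z"
    using cone_extension by blast
  let ?\<psi> = "k \<circ> G \<circ> ?h'"
  have "continuous_map (top_of_set (cball 0 1)) (top_of_set (cball 0 1)) G"
    using G by (auto simp: bij_betw_def)
  then have "continuous_map (subtopology X D) Y ?\<psi>"
    using ch' k unfolding disc_param_def by (intro continuous_map_compose) auto
  moreover have "bij_betw ?\<psi> D E"
  proof -
    have "bij_betw ?h' D (cball 0 1)" "bij_betw k (cball 0 1) E"
      using h k by (auto simp: disc_param_def bij_betw_def intro: inj_on_inv_into)
    then show ?thesis by (meson bij_betw_trans G(2))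
  qed
  moreover have "?\<psi> x = \<phi> x" if "x \<in> disc_boundary X D" for x
  proof -
    obtain z where z: "norm z = 1" "x = h z" using \<open>x \<in> _\<close> by (auto simp: bD)
    have "\<phi> x \<in> k ` sphere 0 1" using bij \<open>x \<in> _\<close> unfolding bE by (rule bij_betw_apply)
    then obtain w where w: "norm w = 1" "\<phi> x = k w" by auto
    have "?h' x = z" using z h by (simp add: disc_param_def)
    then show ?thesis using z w Gg by (simp add: k'k)
  qed
  ultimately show ?thesis by blast
qed

lemma disc_homeomorphism:
  assumes X: "Hausdorff_space X" and Y: "Hausdorff_space Y"
    and D: "is_disc X D" and E: "is_disc Y E"
  shows "\<exists>\<psi>. continuous_map (subtopology X D) Y \<psi> \<and> bij_betw \<psi> D E"
proof -
  obtain h where h: "disc_param X D h" using X D by (auto simp: is_disc_def disc_chart_iff)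
  obtain k where k: "disc_param Y E k" using Y E by (auto simp: is_disc_def disc_chart_iff)
  let ?\<psi> = "k \<circ> inv_into (cball 0 1) h"
  have "continuous_map (subtopology X D) Y ?\<psi>"
  proof (rule continuous_map_compose)
    show "continuous_map (subtopology X D) (top_of_set (cball 0 1)) (inv_into (cball 0 1) h)"
      using h X param_continuous_inverse [of X "cball 0 1" h] by (auto simp: disc_param_def)
    show "continuous_map (top_of_set (cball 0 1)) Y k"
      using k by (simp add: disc_param_def)
  qed
  moreover have "bij_betw ?\<psi> D E"
  proof (rule bij_betw_trans)
    show "bij_betw (inv_into (cball 0 1) h) D (cball 0 1)"
      using h unfolding disc_param_def by (intro bij_betw_inv_into) (simp add: bij_betw_def)
    show "bij_betw k (cball 0 1) E"
      using k by (simp add: disc_param_def bij_betw_def)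
  qed
  ultimately show ?thesis by blast
qed


section \<open>Pasting homeomorphisms\<close>

text \<open>
  Continuous maps on finitely many compact pieces that agree on overlaps paste to a continuous
  map. As the pieces overlap, bijectivity is tested on smaller sets \<open>U i\<close> that
  still cover the space and have disjoint images; the space is compact, so a continuous
  bijection suffices.
\<close>

lemma glue_homeomorphism:
  assumes X: "Hausdorff_space X" and Y: "Hausdorff_space Y" and fin: "finite I"
    and K: "\<And>i. i \<in> I \<Longrightarrow> compactin X (K i)"
    and cont: "\<And>i. i \<in> I \<Longrightarrow> continuous_map (subtopology X (K i)) Y (\<phi> i)"
    and agree: "\<And>i j x. \<lbrakk>i \<in> I; j \<in> I; x \<in> K i; x \<in> K j\<rbrakk> \<Longrightarrow> \<phi> i x = \<phi> j x"
    and U: "\<And>i. i \<in> I \<Longrightarrow> U i \<subseteq> K i" and XU: "topspace X = (\<Union>i \<in> I. U i)"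
    and bij: "\<And>i. i \<in> I \<Longrightarrow> bij_betw (\<phi> i) (U i) (W i)"
    and disj: "\<And>i j. \<lbrakk>i \<in> I; j \<in> I; i \<noteq> j\<rbrakk> \<Longrightarrow> W i \<inter> W j = {}"
    and YW: "topspace Y = (\<Union>i \<in> I. W i)"
  shows "\<exists>F. homeomorphic_map X Y F \<and> (\<forall>i \<in> I. \<forall>x \<in> K i. F x = \<phi> i x)"
proof -
  have KX: "K i \<subseteq> topspace X" if "i \<in> I" for i
    by (rule compactin_subset_topspace [OF K [OF that]])
  have XK: "topspace X \<subseteq> (\<Union>i \<in> I. K i)"
    using XU U by blast
  have clo: "closedin X (K i)" if "i \<in> I" for i
    by (rule compactin_imp_closedin [OF X K [OF that]])
  have agree': "\<phi> i x = \<phi> j x" if "i \<in> I" "j \<in> I" "x \<in> topspace X \<inter> K i \<inter> K j" for i j x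
    by (rule agree [OF that(1,2)]) (use that(3) in auto)
  obtain F where F: "continuous_map X Y F"
    and F\<phi>: "\<And>i x. \<lbrakk>i \<in> I; x \<in> topspace X \<inter> K i\<rbrakk> \<Longrightarrow> F x = \<phi> i x"
    using pasting_lemma_exists_closed [OF fin XK clo cont agree'] by metis
  have FK: "F x = \<phi> i x" if "i \<in> I" "x \<in> K i" for i x
    using F\<phi> [OF that(1)] KX [OF that(1)] that(2) by blast
  have FU: "F ` U i = W i" if "i \<in> I" for i
  proof -
    have "F ` U i = \<phi> i ` U i"
      by (rule image_cong [OF HOL.refl]) (use FK [OF that] U [OF that] in blast)
    then show ?thesis using bij [OF that] by (simp add: bij_betw_def)
  qed
  have "topspace X = (\<Union>i \<in> I. K i)"
    using XK KX by blast
  moreover have "compactin X (\<Union>i \<in> I. K i)"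
    using K fin by (intro compactin_Union) auto
  ultimately have "compact_space X"
    by (simp add: compact_space_def)
  moreover have "F ` topspace X = topspace Y"
    unfolding XU YW image_UN using FU by auto
  moreover have "inj_on F (topspace X)"
  proof (rule inj_onI)
    fix x y assume "x \<in> topspace X" "y \<in> topspace X" and eq: "F x = F y"
    then obtain i j where ij: "i \<in> I" "x \<in> U i" "j \<in> I" "y \<in> U j"
      unfolding XU by blast
    then have "F x \<in> W i" "F y \<in> W j" using FU [of i] FU [of j] by auto
    then have "i = j" using eq disj [of i j] ij by auto
    then show "x = y"
    proof -
      have "\<phi> i x = \<phi> i y"
        using eq FK [OF ij(1), of x] FK [OF ij(3), of y] U [OF ij(1)] U [OF ij(3)] ij(2,4) \<open>i = j\<close>
        by (simp add: subset_iff)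
      then show ?thesis
        using bij [of i] ij \<open>i = j\<close> by (auto simp: bij_betw_def dest: inj_onD)
    qed
  qed
  ultimately have "homeomorphic_map X Y F"
    using F Y by (intro continuous_imp_homeomorphic_map)
  with FK show ?thesis by blast
qed


section \<open>Arcs on the boundary circle\<close>

lemma cis_eq_cis_iff: "cis s = cis t \<longleftrightarrow> (\<exists>m::int. s = t + 2 * pi * m)"
  by (simp add: complex_eq_iff) (metis sin_cos_eq_iff)

lemma int_multiple_2pi: "m = 0 \<or> 2 * pi * real_of_int m \<ge> 2 * pi \<or> 2 * pi * real_of_int m \<le> - 2 * pi"
proof -
  consider "m = 0" | "m \<ge> 1" | "m \<le> -1" by linarith
  then show ?thesis
  proof cases
    case 2
    then have "2 * pi * 1 \<le> 2 * pi * real_of_int m" by (intro mult_left_mono) auto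
    then show ?thesis by simp
  next
    case 3
    then have "2 * pi * real_of_int m \<le> 2 * pi * (-1)" by (intro mult_left_mono) auto
    then show ?thesis by simp
  qed simp
qed

lemma no_shift_below:
  "\<lbrakk>a \<le> u + 2 * pi * real_of_int m; u + 2 * pi * real_of_int m \<le> b; b - 2 * pi < u; u < a\<rbrakk> \<Longrightarrow> False"
  using int_multiple_2pi [of m] by (elim disjE) (simp, linarith, linarith)

lemma no_shift_above:
  "\<lbrakk>a \<le> u + 2 * pi * real_of_int m; u + 2 * pi * real_of_int m \<le> b; b < u; u < a + 2 * pi\<rbrakk> \<Longrightarrow> False"
  using int_multiple_2pi [of m] by (elim disjE) (simp, linarith, linarith)

lemma cis_inj:
  assumes "cis s = cis t" "\<bar>s - t\<bar> < 2 * pi" shows "s = t"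
proof -
  obtain m :: int where "s = t + 2 * pi * m" using assms(1) by (auto simp: cis_eq_cis_iff)
  then show ?thesis using int_multiple_2pi [of m] assms(2) by auto
qed

lemma cis_shift [simp]: "cis (t + 2 * pi * real_of_int m) = cis t"
  unfolding cis_eq_cis_iff by blast

lemma shift_into_period: "\<exists>m::int. a \<le> t + 2 * pi * m \<and> t + 2 * pi * m < a + 2 * pi"
proof (intro exI conjI)
  let ?x = "(t - a) / (2 * pi)"
  have "real_of_int \<lfloor>?x\<rfloor> \<le> ?x" "?x < real_of_int \<lfloor>?x\<rfloor> + 1" by linarith+
  then have "2 * pi * real_of_int \<lfloor>?x\<rfloor> \<le> 2 * pi * ?x" "2 * pi * ?x < 2 * pi * (real_of_int \<lfloor>?x\<rfloor> + 1)"
    using pi_gt_zero by (intro mult_left_mono mult_strict_left_mono; simp)+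
  moreover have "2 * pi * ?x = t - a" by simp
  ultimately have "2 * pi * real_of_int \<lfloor>?x\<rfloor> \<le> t - a" "t - a < 2 * pi * real_of_int \<lfloor>?x\<rfloor> + 2 * pi"
    by (simp_all only: distrib_left mult_1_right)
  then show "a \<le> t + 2 * pi * real_of_int (- \<lfloor>?x\<rfloor>)" "t + 2 * pi * real_of_int (- \<lfloor>?x\<rfloor>) < a + 2 * pi"
    by simp_all
qed

lemma sphere_cisE:
  assumes "norm z = 1" obtains t where "z = cis t" "a \<le> t" "t < a + 2 * pi"
proof -
  have "z = cis (Arg z)"
    using assms by (metis cis_Arg norm_zero sgn_div_norm div_by_1 inverse_1 scaleR_one zero_neq_one)
  then show ?thesis
    using shift_into_period [of a "Arg z"] that cis_shift by metis
qed

lemma cis_image_shift: "cis ` {a + 2 * pi * real_of_int m .. b + 2 * pi * real_of_int m} = cis ` {a..b}"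
proof -
  have "{a + 2 * pi * real_of_int m .. b + 2 * pi * real_of_int m} = (\<lambda>x. x + 2 * pi * real_of_int m) ` {a..b}"
    by simp
  then show ?thesis by (simp only: image_image cis_shift)
qed

lemma arc_param_cis:
  assumes h: "disc_param X D h" and st: "s < t" "t < s + 2 * pi"
  shows "arc_param X (h ` cis ` {s..t}) (\<lambda>u. h (cis (s + u * (t - s))))"
proof -
  let ?f = "\<lambda>u. s + u * (t - s)"
  have "continuous_map (top_of_set {0..1}) (top_of_set (cball 0 1)) (\<lambda>u. cis (?f u))"
    by (auto simp: cis_conv_exp intro!: continuous_intros)
  then have "continuous_map (top_of_set {0..1}) X (h \<circ> (\<lambda>u. cis (?f u)))"
    using h continuous_map_compose unfolding disc_param_def by blast
  moreover have "inj_on (\<lambda>u. h (cis (?f u))) {0..1}"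
  proof (rule inj_onI)
    fix u v :: real assume uv: "u \<in> {0..1}" "v \<in> {0..1}" "h (cis (?f u)) = h (cis (?f v))"
    then have "cis (?f u) = cis (?f v)"
      using h by (auto simp: disc_param_def dest!: inj_onD)
    moreover have "\<bar>?f u - ?f v\<bar> < 2 * pi"
    proof -
      have "?f u - ?f v = (u - v) * (t - s)" by (simp add: algebra_simps)
      then have "\<bar>?f u - ?f v\<bar> = \<bar>u - v\<bar> * \<bar>t - s\<bar>" by (simp only: abs_mult)
      also have "\<dots> \<le> 1 * \<bar>t - s\<bar>" using uv by (intro mult_right_mono) auto
      also have "\<dots> < 2 * pi" using st by simp
      finally show ?thesis .
    qed
    ultimately have "u * (t - s) = v * (t - s)" using cis_inj by fastforce
    then show "u = v" using st by simp
  qed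
  moreover have "?f ` {0..1} = {s..t}"
  proof -
    have "x \<in> ?f ` {0..1}" if "s \<le> x" "x \<le> t" for x
      using that st by (intro image_eqI [where x = "(x - s) / (t - s)"]) (auto simp: field_simps)
    moreover have "s \<le> ?f u" "?f u \<le> t" if "u \<in> {0..1}" for u
    proof -
      have "0 \<le> u * (t - s)" "u * (t - s) \<le> 1 * (t - s)"
        using that st by (simp, intro mult_right_mono) auto
      then show "s \<le> ?f u" "?f u \<le> t" by simp_all
    qed
    ultimately show ?thesis by auto
  qed
  then have "h ` cis ` ?f ` {0..1} = h ` cis ` {s..t}" by (simp only:)
  then have "(\<lambda>u. h (cis (?f u))) ` {0..1} = h ` cis ` {s..t}" by (simp only: image_image)
  ultimately show ?thesis by (simp add: arc_param_def o_def)
qed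

lemma cis_arc_segment:
  assumes X: "Hausdorff_space X" and h: "disc_param X D h" and st: "s < t" "t < s + 2 * pi"
  shows "is_segment X (h ` cis ` {s..t})" "ends X (h ` cis ` {s..t}) = {h (cis s), h (cis t)}"
  using arc_param_cis [OF h st] is_segment_iff [OF X] ends_arc_param [OF X] by fastforce+

text \<open>
  An arc in the circle lifts along the exponential map to an arc in the line, that is, to an
  interval, which injectivity forces to be shorter than a full turn.
\<close>

lemma circle_subarc:
  assumes X: "Hausdorff_space X" and h: "disc_param X D h"
    and A: "is_segment X A" "A \<subseteq> h ` sphere 0 1"
  obtains a b where "a < b" "b < a + 2 * pi" "A = h ` cis ` {a..b}"
proof -
  obtain g where g: "arc_param X A g" using A(1) is_segment_iff [OF X] by blast
  let ?h' = "inv_into (cball 0 1) h"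
  let ?f = "?h' \<circ> g"
  have hD: "h ` cball 0 1 = D" and inj_h: "inj_on h (cball 0 1)" using h by (auto simp: disc_param_def)
  have A_D: "A \<subseteq> D" using A(2) hD sphere_cball by blast
  have hh': "h (?h' x) = x" if "x \<in> A" for x
    using that A_D hD by (intro f_inv_into_f) auto
  have nf: "norm (?h' x) = 1" if "x \<in> A" for x
    using that A(2) inj_h by force
  have gA: "g u \<in> A" if "u \<in> {0..1}" for u using g that by (auto simp: arc_param_def)
  have "continuous_map (top_of_set {0..1}) (subtopology X D) g"
    using g A_D by (auto simp: arc_param_def continuous_map_in_subtopology)
  then have "continuous_map (top_of_set {0..1}) (top_of_set (cball 0 1)) ?f"
    using param_continuous_inverse [of X "cball 0 1" h] h X hD
    by (intro continuous_map_compose [where X' = "subtopology X D"]) (auto simp: disc_param_def)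
  then have cf: "continuous_on {0..1} ?f" by simp
  have nf1: "norm (?f u) = 1" if "u \<in> {0..1}" for u using nf [OF gA [OF that]] by simp
  have f0: "?f u \<noteq> 0" if "u \<in> {0..1}" for u using nf1 [OF that] by force
  have "contractible {0..1::real}" by (simp add: convex_imp_contractible)
  then obtain l where l: "continuous_on {0..1} l" "\<And>u. u \<in> {0..1} \<Longrightarrow> ?f u = exp (l u)"
    using continuous_logarithm_on_contractible [OF cf _ f0] by metis
  let ?l = "\<lambda>u. Im (l u)"
  have fl: "?f u = cis (?l u)" if "u \<in> {0..1}" for u
  proof -
    have "exp (Re (l u)) = 1" using nf1 [OF that] l(2) [OF that] by simp
    then show ?thesis using l(2) [OF that] by (simp add: exp_eq_polar)
  qed
  have gl: "g u = h (cis (?l u))" if "u \<in> {0..1}" for u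
    using fl [OF that] hh' [OF gA [OF that]] by simp
  have inj_l: "u = v" if "u \<in> {0..1}" "v \<in> {0..1}" "cis (?l u) = cis (?l v)" for u v
  proof -
    have "g u = g v" using gl [OF that(1)] gl [OF that(2)] that(3) by simp
    then show ?thesis using g that(1,2) unfolding arc_param_def by (meson inj_onD)
  qed
  have "continuous_on {0..1} ?l" using l(1) by (intro continuous_intros)
  then have "connected (?l ` {0..1})" "compact (?l ` {0..1})"
    by (auto intro: connected_continuous_image compact_continuous_image)
  then obtain a b where ab: "?l ` {0..1} = {a..b}" using connected_compact_interval_1 by blast
  have "a < b"
  proof (rule ccontr)
    assume "\<not> a < b"
    then have "{a..b} \<subseteq> {a}" by auto
    moreover have "?l 0 \<in> {a..b}" "?l 1 \<in> {a..b}" unfolding ab [symmetric] by (auto intro!: imageI)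
    ultimately have "?l 0 = ?l 1" by (metis singletonD subsetD)
    then show False using inj_l [of 0 1] by simp
  qed
  moreover have "b < a + 2 * pi"
  proof (rule ccontr)
    assume "\<not> b < a + 2 * pi"
    then have "a \<in> {a..b}" "a + 2 * pi \<in> {a..b}" using \<open>a < b\<close> by auto
    then obtain u v where u: "u \<in> {0..1}" "?l u = a" and v: "v \<in> {0..1}" "?l v = a + 2 * pi"
      unfolding ab [symmetric] by (metis (no_types, lifting) imageE)
    then have "u = v" using cis_shift [of a 1] by (intro inj_l) auto
    then show False using u v by simp
  qed
  moreover have "A = h ` cis ` {a..b}"
  proof -
    have "A = g ` {0..1}" using g by (simp add: arc_param_def)
    also have "\<dots> = (\<lambda>u. h (cis (?l u))) ` {0..1}" using gl by (intro image_cong) auto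
    also have "\<dots> = h ` cis ` ?l ` {0..1}" by (simp only: image_image)
    finally show ?thesis by (simp only: ab)
  qed
  ultimately show ?thesis by (rule that)
qed


section \<open>Discs with marked arcs on the boundary\<close>

text \<open>
  The arcs complementary to the marked set are defined without a chart, so that they depend on
  the disc only.
\<close>

definition gap_arcs :: "'a topology \<Rightarrow> 'a set \<Rightarrow> 'a set \<Rightarrow> 'a set set" where
  "gap_arcs X D M = {A. A \<subseteq> disc_boundary X D \<and> is_segment X A \<and> A \<inter> M = ends X A}"

text \<open>
  The situation of a disc in a ribbon graph: \<open>M\<close> is the union of the discs of the
  other kind, and \<open>SS\<close> consists of the segments in which it meets
  \<open>D\<close>.
\<close>

locale marked_disc =
  fixes X :: "'a topology" and D M :: "'a set" and SS :: "'a set set"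
  assumes X: "Hausdorff_space X" and D: "is_disc X D"
    and fin: "finite SS" and nonempty: "SS \<noteq> {}" and disj: "disjoint SS" and Un: "\<Union> SS = D \<inter> M"
    and seg: "S \<in> SS \<Longrightarrow> is_segment X S" and bdry: "S \<in> SS \<Longrightarrow> S \<subseteq> disc_boundary X D"

locale marked_chart = marked_disc +
  fixes h :: "complex \<Rightarrow> 'a"
  assumes h: "disc_param X D h"
begin

text \<open>
  The marked set is lifted to the line of angles, where it is closed and periodic, and where
  the order of the line replaces the cyclic order of the circle.
\<close>

definition N :: "real set" where "N = {t. h (cis t) \<in> M}"

lemma bD: "disc_boundary X D = h ` sphere 0 1"
  by (rule disc_boundary_eq [OF X h])

lemma h_inj: "h (cis s) = h (cis t) \<Longrightarrow> cis s = cis t"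
  using h by (auto simp: disc_param_def dest: inj_onD)

lemma h_cis_D: "h (cis t) \<in> D"
  using h by (auto simp: disc_param_def)

lemma bdryE: assumes "x \<in> disc_boundary X D" obtains t where "x = h (cis t)"
  using assms sphere_cisE unfolding bD by (metis imageE mem_sphere_0)

lemma N_iff: "t \<in> N \<longleftrightarrow> h (cis t) \<in> \<Union> SS"
  unfolding N_def Un using h_cis_D by simp

lemma NI: "\<lbrakk>S \<in> SS; h (cis t) \<in> S\<rbrakk> \<Longrightarrow> t \<in> N"
  by (auto simp: N_iff)

lemma N_shift [simp]: "t + 2 * pi * real_of_int m \<in> N \<longleftrightarrow> t \<in> N"
  by (simp add: N_def)

lemma closed_preimage:
  assumes "closedin X K" shows "closed {t. h (cis t) \<in> K}"
proof -
  have "continuous_map euclidean (top_of_set (cball 0 1)) cis"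
    unfolding continuous_map_in_subtopology by (auto simp: cis_conv_exp intro!: continuous_intros)
  then have "continuous_map euclidean X (h \<circ> cis)"
    using h continuous_map_compose unfolding disc_param_def by blast
  from closedin_continuous_map_preimage [OF this assms] show ?thesis by simp
qed

lemma closed_N: "closed N"
proof -
  have "closedin X (\<Union> SS)"
    using fin is_segment_closedin [OF X seg] by (intro closedin_Union) auto
  moreover have "N = {t. h (cis t) \<in> \<Union> SS}"
  proof -
    have "t \<in> N \<longleftrightarrow> t \<in> {t. h (cis t) \<in> \<Union> SS}" for t
      unfolding mem_Collect_eq by (rule N_iff)
    then show ?thesis by (rule Set.set_eqI)
  qed
  ultimately show ?thesis using closed_preimage [of "\<Union> SS"] by (simp only:)
qed

lemma seg_arc:
  assumes "S \<in> SS" obtains a b where "a < b" "b < a + 2 * pi" "S = h ` cis ` {a..b}"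
  using circle_subarc [OF X h seg [OF assms]] bdry [OF assms] unfolding bD by blast

lemma N_ex: "\<exists>t. t \<in> N"
proof -
  obtain S where "S \<in> SS" using nonempty by blast
  then obtain a b where "a < b" "b < a + 2 * pi" "S = h ` cis ` {a..b}" by (rule seg_arc)
  then have "h (cis a) \<in> S" by auto
  then show ?thesis using \<open>S \<in> SS\<close> NI by blast
qed

lemma mem_cis_arc: "h (cis t) \<in> h ` cis ` {a..b} \<longleftrightarrow> (\<exists>m::int. a \<le> t + 2 * pi * m \<and> t + 2 * pi * m \<le> b)"
proof
  assume "h (cis t) \<in> h ` cis ` {a..b}"
  then obtain u where u: "a \<le> u" "u \<le> b" "cis u = cis t" using h_inj by force
  then obtain m :: int where "u = t + 2 * pi * m" using cis_eq_cis_iff by blast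
  with u show "\<exists>m::int. a \<le> t + 2 * pi * m \<and> t + 2 * pi * m \<le> b" by blast
next
  assume "\<exists>m::int. a \<le> t + 2 * pi * m \<and> t + 2 * pi * m \<le> b"
  then obtain m :: int where "t + 2 * pi * m \<in> {a..b}" by auto
  then have "cis (t + 2 * pi * m) \<in> cis ` {a..b}" by (rule imageI)
  then show "h (cis t) \<in> h ` cis ` {a..b}" by simp
qed

definition gap :: "real \<Rightarrow> real \<Rightarrow> bool" where
  "gap s t \<longleftrightarrow> s < t \<and> s \<in> N \<and> t \<in> N \<and> (\<forall>u. s < u \<and> u < t \<longrightarrow> u \<notin> N)"

lemma gap_shift: "gap s t \<Longrightarrow> gap (s + 2 * pi * real_of_int m) (t + 2 * pi * real_of_int m)"
proof -
  assume g: "gap s t"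
  have "u \<notin> N" if "s + 2 * pi * m < u" "u < t + 2 * pi * m" for u
  proof -
    have "s < u + 2 * pi * real_of_int (- m)" "u + 2 * pi * real_of_int (- m) < t"
      using that by simp_all
    then have "u + 2 * pi * real_of_int (- m) \<notin> N" using g unfolding gap_def by blast
    then show ?thesis by (simp only: N_shift simp_thms)
  qed
  then show ?thesis using g by (simp add: gap_def)
qed

lemma gap_unique: "\<lbrakk>gap s t; gap s' t'; s < t'; s' < t\<rbrakk> \<Longrightarrow> s = s' \<and> t = t'"
  unfolding gap_def by (metis linorder_neqE_linordered_idom)

text \<open>
  A closed periodic set has a last element before, and a first element after, any point outside
  it.
\<close>

lemma gap_ex:
  assumes "u \<notin> N" obtains s t where "gap s t" "s < u" "u < t"
proof -
  obtain n where n: "n \<in> N" using N_ex by blast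
  obtain m :: int where m: "u \<le> n + 2 * pi * m" using shift_into_period by blast
  obtain k :: int where k: "n + 2 * pi * k < u - 2 * pi + 2 * pi" using shift_into_period by blast
  let ?L = "N \<inter> {..u}" and ?R = "N \<inter> {u..}"
  have L: "?L \<noteq> {}" "bdd_above ?L" "closed ?L"
  proof -
    have "n + 2 * pi * k \<in> ?L" using n k by simp
    then show "?L \<noteq> {}" by blast
  qed (use closed_N in \<open>auto intro: closed_Int\<close>)
  have R: "?R \<noteq> {}" "bdd_below ?R" "closed ?R"
  proof -
    have "n + 2 * pi * m \<in> ?R" using n m by simp
    then show "?R \<noteq> {}" by blast
  qed (use closed_N in \<open>auto intro: closed_Int\<close>)
  let ?s = "Sup ?L" and ?t = "Inf ?R"
  have s: "?s \<in> N" "?s < u" using closed_contains_Sup [OF L] assms by (auto simp: order_less_le)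
  have t: "?t \<in> N" "u < ?t" using closed_contains_Inf [OF R] assms by (auto simp: order_less_le)
  have "v \<notin> N" if "?s < v" "v < ?t" for v
  proof
    assume v: "v \<in> N"
    show False
    proof (cases "v \<le> u")
      case True
      then have "v \<le> ?s" using v L(2) by (intro cSup_upper) auto
      then show False using that by simp
    next
      case False
      then have "?t \<le> v" using v R(2) by (intro cInf_lower) auto
      then show False using that by simp
    qed
  qed
  then have "gap ?s ?t" using s t by (simp add: gap_def)
  then show ?thesis using s t that by blast
qed

text \<open>
  The other segments form a closed set that misses the given one.
\<close>

lemma N_near_seg:
  assumes S: "S \<in> SS" and x: "h (cis x) \<in> S"
  shows "\<exists>e > 0. \<forall>u. \<bar>u - x\<bar> < e \<and> u \<in> N \<longrightarrow> h (cis u) \<in> S"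
proof -
  let ?K = "\<Union> (SS - {S})"
  have "closedin X ?K"
    using fin is_segment_closedin [OF X seg] by (intro closedin_Union) auto
  then have "open (- {t. h (cis t) \<in> ?K})" using closed_preimage open_Compl by blast
  moreover have "h (cis x) \<notin> ?K"
    using x S disj by (auto simp: disjoint_def)
  then have "x \<in> - {t. h (cis t) \<in> ?K}" by simp
  ultimately obtain e where e: "e > 0" "ball x e \<subseteq> - {t. h (cis t) \<in> ?K}"
    by (rule openE)
  have "h (cis u) \<in> S" if "\<bar>u - x\<bar> < e" "u \<in> N" for u
  proof -
    have "u \<in> ball x e" using that by (simp add: dist_real_def)
    then show ?thesis using e that(2) by (auto simp: N_iff)
  qed
  with e show ?thesis by blast
qed

lemma cis_arc_sub_N:
  assumes "S \<in> SS" "S = h ` cis ` {a..b}" "a \<le> u" "u \<le> b" shows "u \<in> N"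
proof -
  have "h (cis u) \<in> S" using assms(2-4) by auto
  then show ?thesis by (rule NI [OF assms(1)])
qed

text \<open>
  The other segments stay away and the segment itself is shorter than a full turn, so the
  angles just before it are unmarked; the gap that contains them ends where the segment begins.
\<close>

lemma gap_left:
  assumes S: "S \<in> SS" and ab: "a < b" "b < a + 2 * pi" "S = h ` cis ` {a..b}"
  obtains s where "gap s a"
proof -
  have aN: "a \<in> N" using cis_arc_sub_N [OF S ab(3)] ab by simp
  have "h (cis a) \<in> S" using ab by auto
  from N_near_seg [OF S this]
  obtain e where e: "e > 0" "\<forall>u. \<bar>u - a\<bar> < e \<and> u \<in> N \<longrightarrow> h (cis u) \<in> S" by blast
  define d where "d = min e (a + 2 * pi - b)"
  have d: "0 < d" "d \<le> e" "d \<le> a + 2 * pi - b" using e(1) ab(2) by (auto simp: d_def)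
  define u0 where "u0 = a - d / 2"
  have u0: "u0 < a" "a - e < u0" "b - 2 * pi < u0"
    using d ab(1,2) by (auto simp: u0_def)
  have out: "u \<notin> N" if "u0 \<le> u" "u < a" for u
  proof
    assume "u \<in> N"
    then have "h (cis u) \<in> S" using e(2) that u0 by auto
    then obtain m :: int where "a \<le> u + 2 * pi * m" "u + 2 * pi * m \<le> b"
      unfolding ab(3) mem_cis_arc by blast
    then show False by (rule no_shift_below) (use that u0 in auto)
  qed
  then have "u0 \<notin> N" using u0 by simp
  then obtain s t where st: "gap s t" "s < u0" "u0 < t" by (rule gap_ex)
  have "t = a"
  proof (rule ccontr)
    assume "t \<noteq> a"
    then consider "t < a" | "a < t" by linarith
    then show False
    proof cases
      case 1 then show False using out [of t] st by (auto simp: gap_def)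
    next
      case 2 then show False using st aN u0 by (auto simp: gap_def)
    qed
  qed
  then show ?thesis using st that by blast
qed

lemma gap_right:
  assumes S: "S \<in> SS" and ab: "a < b" "b < a + 2 * pi" "S = h ` cis ` {a..b}"
  obtains t where "gap b t"
proof -
  have bN: "b \<in> N" using cis_arc_sub_N [OF S ab(3)] ab by simp
  have "h (cis b) \<in> S" using ab by auto
  from N_near_seg [OF S this]
  obtain e where e: "e > 0" "\<forall>u. \<bar>u - b\<bar> < e \<and> u \<in> N \<longrightarrow> h (cis u) \<in> S" by blast
  define d where "d = min e (a + 2 * pi - b)"
  have d: "0 < d" "d \<le> e" "d \<le> a + 2 * pi - b" using e(1) ab(2) by (auto simp: d_def)
  define u0 where "u0 = b + d / 2"
  have u0: "b < u0" "u0 < b + e" "u0 < a + 2 * pi"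
    using d ab(1,2) by (auto simp: u0_def)
  have out: "u \<notin> N" if "b < u" "u \<le> u0" for u
  proof
    assume "u \<in> N"
    then have "h (cis u) \<in> S" using e(2) that u0 by auto
    then obtain m :: int where "a \<le> u + 2 * pi * m" "u + 2 * pi * m \<le> b"
      unfolding ab(3) mem_cis_arc by blast
    then show False by (rule no_shift_above) (use that u0 in auto)
  qed
  then have "u0 \<notin> N" using u0 by simp
  then obtain s t where st: "gap s t" "s < u0" "u0 < t" by (rule gap_ex)
  have "s = b"
  proof (rule ccontr)
    assume "s \<noteq> b"
    then consider "s < b" | "b < s" by linarith
    then show False
    proof cases
      case 2 then show False using out [of s] st by (auto simp: gap_def)
    next
      case 1 then show False using st bN u0 by (auto simp: gap_def)
    qed
  qed
  then show ?thesis using st that by blast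
qed

lemma N_in_seg:
  assumes "t \<in> N"
  obtains S a b where "S \<in> SS" "a < b" "b < a + 2 * pi" "S = h ` cis ` {a..b}" "a \<le> t" "t \<le> b"
proof -
  obtain S where S: "S \<in> SS" "h (cis t) \<in> S" using assms N_iff [of t] by auto
  obtain a b where ab: "a < b" "b < a + 2 * pi" "S = h ` cis ` {a..b}" by (rule seg_arc [OF S(1)])
  then obtain m :: int where m: "a \<le> t + 2 * pi * m" "t + 2 * pi * m \<le> b"
    using S(2) mem_cis_arc by blast
  show ?thesis
  proof (rule that [of S "a + 2 * pi * real_of_int (- m)" "b + 2 * pi * real_of_int (- m)"])
    show "S = h ` cis ` {a + 2 * pi * real_of_int (- m)..b + 2 * pi * real_of_int (- m)}"
      by (simp only: cis_image_shift ab(3))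
  qed (use S ab m in auto)
qed

lemma gap_end_right:
  assumes "gap s t"
  obtains S b where "S \<in> SS" "t < b" "b < t + 2 * pi" "S = h ` cis ` {t..b}"
proof -
  obtain S a b where S: "S \<in> SS" "a < b" "b < a + 2 * pi" "S = h ` cis ` {a..b}" "a \<le> t" "t \<le> b"
    by (rule N_in_seg [of t]) (use assms in \<open>simp add: gap_def\<close>)
  have "t = a"
  proof (rule ccontr)
    assume "t \<noteq> a"
    define u where "u = (max a s + t) / 2"
    have "s < u" "u < t" "a \<le> u" "u \<le> b"
      unfolding u_def using S \<open>t \<noteq> a\<close> assms by (auto simp: gap_def max_def)
    then show False using cis_arc_sub_N [OF S(1,4), of u] assms by (auto simp: gap_def)
  qed
  then show ?thesis using S that by blast
qed

lemma gap_end_left: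
  assumes "gap s t"
  obtains S a where "S \<in> SS" "a < s" "s < a + 2 * pi" "S = h ` cis ` {a..s}"
proof -
  obtain S a b where S: "S \<in> SS" "a < b" "b < a + 2 * pi" "S = h ` cis ` {a..b}" "a \<le> s" "s \<le> b"
    by (rule N_in_seg [of s]) (use assms in \<open>simp add: gap_def\<close>)
  have "s = b"
  proof (rule ccontr)
    assume "s \<noteq> b"
    define u where "u = (min b t + s) / 2"
    have "s < u" "u < t" "a \<le> u" "u \<le> b"
      unfolding u_def using S \<open>s \<noteq> b\<close> assms by (auto simp: gap_def min_def)
    then show False using cis_arc_sub_N [OF S(1,4), of u] assms by (auto simp: gap_def)
  qed
  then show ?thesis using S that by blast
qed

lemma gap_less_2pi: assumes "gap s t" shows "t < s + 2 * pi"
proof (rule ccontr)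
  assume "\<not> t < s + 2 * pi"
  obtain S b where S: "S \<in> SS" "t < b" "b < t + 2 * pi" "S = h ` cis ` {t..b}"
    by (rule gap_end_right [OF assms])
  have sN: "s + 2 * pi \<in> N" using N_shift [of s 1] assms by (simp add: gap_def)
  then have t: "t = s + 2 * pi" using assms \<open>\<not> t < s + 2 * pi\<close> pi_gt_zero unfolding gap_def
    by (metis add_less_cancel_left add.right_neutral linorder_neqE_linordered_idom mult_pos_pos zero_less_numeral)
  define u where "u = (t + b) / 2"
  define v where "v = u - 2 * pi"
  have u: "t \<le> u" "u \<le> b" "v < t" "s < v"
    using S(2,3) t pi_gt_zero by (auto simp: u_def v_def field_simps)
  moreover have "u = v + 2 * pi * real_of_int 1" by (simp add: v_def)
  ultimately have "v \<in> N"
    using cis_arc_sub_N [OF S(1,4), of u] N_shift [of v 1] by simp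
  then show False using u assms unfolding gap_def by blast
qed

text \<open>
  By \<open>circle_subarc\<close> a complementary arc is the image of an interval, and the
  interval meets \<open>N\<close> in its end points only.
\<close>

lemma gap_arcs_eq: "gap_arcs X D M = {h ` cis ` {s..t} |s t. gap s t}"
proof (intro equalityI subsetI)
  fix A assume "A \<in> gap_arcs X D M"
  then have A: "A \<subseteq> h ` sphere 0 1" "is_segment X A" "A \<inter> M = ends X A"
    by (auto simp: gap_arcs_def bD)
  then obtain a b where ab: "a < b" "b < a + 2 * pi" "A = h ` cis ` {a..b}"
    using circle_subarc [OF X h A(2,1)] by metis
  have e: "A \<inter> M = {h (cis a), h (cis b)}"
    using cis_arc_segment(2) [OF X h ab(1,2)] A(3) ab(3) by simp
  have "u \<notin> N" if "a < u" "u < b" for u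
  proof
    assume "u \<in> N"
    then have "h (cis u) \<in> A \<inter> M" using ab that by (auto simp: N_def)
    then have "cis u = cis a \<or> cis u = cis b" using e h_inj by auto
    then show False using cis_inj [of u a] cis_inj [of u b] that ab by auto
  qed
  moreover have "a \<in> N" "b \<in> N" using e by (auto simp: N_def)
  ultimately have "gap a b" using ab by (simp add: gap_def)
  then show "A \<in> {h ` cis ` {s..t} |s t. gap s t}" using ab by blast
next
  fix A assume "A \<in> {h ` cis ` {s..t} |s t. gap s t}"
  then obtain s t where g: "gap s t" and A: "A = h ` cis ` {s..t}" by blast
  have st: "s < t" "t < s + 2 * pi" using g gap_less_2pi by (auto simp: gap_def)
  have "A \<subseteq> disc_boundary X D" unfolding A bD by auto
  moreover have "is_segment X A" "ends X A = {h (cis s), h (cis t)}"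
    unfolding A using cis_arc_segment [OF X h st] by auto
  moreover have "A \<inter> M = {h (cis s), h (cis t)}"
  proof (intro equalityI subsetI)
    fix x assume x: "x \<in> A \<inter> M"
    then obtain u where u: "x = h (cis u)" "s \<le> u" "u \<le> t" by (auto simp: A)
    then have "u \<in> N" using x by (simp add: N_def)
    then have "u = s \<or> u = t" using u g unfolding gap_def by force
    then show "x \<in> {h (cis s), h (cis t)}" using u by blast
  qed (use g in \<open>auto simp: A gap_def N_def\<close>)
  ultimately show "A \<in> gap_arcs X D M" by (simp add: gap_arcs_def)
qed

lemma gap_arcI: "gap s t \<Longrightarrow> h ` cis ` {s..t} \<in> gap_arcs X D M"
  unfolding gap_arcs_eq by blast

lemma gap_arcE: assumes "A \<in> gap_arcs X D M" obtains s t where "gap s t" "A = h ` cis ` {s..t}"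
  using assms unfolding gap_arcs_eq by blast

lemma ends_gap: "gap s t \<Longrightarrow> ends X (h ` cis ` {s..t}) = {h (cis s), h (cis t)}"
  using cis_arc_segment(2) [OF X h _ gap_less_2pi] by (simp add: gap_def)

lemma gap_end_in_seg_end:
  assumes "A \<in> gap_arcs X D M" "p \<in> ends X A" shows "\<exists>S \<in> SS. p \<in> ends X S"
proof -
  obtain s t where st: "gap s t" "A = h ` cis ` {s..t}" using assms(1) by (rule gap_arcE)
  then consider "p = h (cis s)" | "p = h (cis t)" using ends_gap assms(2) by blast
  then show ?thesis
  proof cases
    case 1
    obtain S a where "S \<in> SS" "a < s" "s < a + 2 * pi" "S = h ` cis ` {a..s}"
      by (rule gap_end_left [OF st(1)])
    then show ?thesis using cis_arc_segment(2) [OF X h, of a s] 1 by blast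
  next
    case 2
    obtain S b where "S \<in> SS" "t < b" "b < t + 2 * pi" "S = h ` cis ` {t..b}"
      by (rule gap_end_right [OF st(1)])
    then show ?thesis using cis_arc_segment(2) [OF X h, of t b] 2 by blast
  qed
qed

text \<open>
  From an end of a segment the circle can be left in two directions. One of them leads into the
  segment, so only one complementary arc starts there.
\<close>

lemma unique_gap:
  assumes S: "S \<in> SS" and p: "p \<in> ends X S"
  shows "\<exists>!A. A \<in> gap_arcs X D M \<and> p \<in> ends X A"
proof -
  obtain a b where ab: "a < b" "b < a + 2 * pi" "S = h ` cis ` {a..b}" by (rule seg_arc [OF S])
  have inN: "u \<in> N" if "a \<le> u + 2 * pi * real_of_int m" "u + 2 * pi * real_of_int m \<le> b" for u m
    using cis_arc_sub_N [OF S ab(3) that] by simp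
  have "p = h (cis a) \<or> p = h (cis b)" using p cis_arc_segment(2) [OF X h ab(1,2)] ab(3) by auto
  then show ?thesis
  proof
    assume pa: "p = h (cis a)"
    obtain s0 where s0: "gap s0 a" by (rule gap_left [OF S ab])
    show ?thesis
    proof (rule ex1I [of _ "h ` cis ` {s0..a}"])
      show "h ` cis ` {s0..a} \<in> gap_arcs X D M \<and> p \<in> ends X (h ` cis ` {s0..a})"
        using gap_arcI [OF s0] ends_gap [OF s0] pa by simp
      fix A assume *: "A \<in> gap_arcs X D M \<and> p \<in> ends X A"
      then have "A \<in> gap_arcs X D M" by simp
      then obtain s t where st: "gap s t" "A = h ` cis ` {s..t}" by (rule gap_arcE)
      have p': "p \<in> {h (cis s), h (cis t)}"
        using * ends_gap [OF st(1)] st(2) by simp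
      have "p \<noteq> h (cis s)"
      proof
        assume "p = h (cis s)"
        then have "cis a = cis s" using pa h_inj by simp
        then obtain m :: int where m: "a = s + 2 * pi * m" unfolding cis_eq_cis_iff by blast
        \<comment> \<open>a gap that begins where the segment begins would overlap the segment, for instance at the angle u\<close>
        define u where "u = min ((s + t) / 2) (s + (b - a))"
        have "s < t" using st(1) by (simp add: gap_def)
        moreover have "2 * u \<le> s + t" "u \<le> s + (b - a)"
          unfolding u_def by (simp_all add: min_def field_simps)
        moreover have "s < u" unfolding u_def using ab \<open>s < t\<close> by simp
        ultimately have u: "s < u" "u < t" "a \<le> u + 2 * pi * m" "u + 2 * pi * m \<le> b"
          using m by - linarith+
        then show False using inN [of u m] st(1) by (auto simp: gap_def)
      qed
      then have "cis a = cis t" using p' pa h_inj by auto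
      then obtain m :: int where m: "a = t + 2 * pi * m" unfolding cis_eq_cis_iff by blast
      have "gap (s + 2 * pi * m) a" using gap_shift [OF st(1), of m] m by simp
      then have "s + 2 * pi * m = s0"
        using gap_unique [OF _ s0, of "s + 2 * pi * m" a] s0 by (auto simp: gap_def)
      then show "A = h ` cis ` {s0..a}"
        using cis_image_shift [of s m t] st(2) m by simp
    qed
  next
    assume pb: "p = h (cis b)"
    obtain t0 where t0: "gap b t0" by (rule gap_right [OF S ab])
    show ?thesis
    proof (rule ex1I [of _ "h ` cis ` {b..t0}"])
      show "h ` cis ` {b..t0} \<in> gap_arcs X D M \<and> p \<in> ends X (h ` cis ` {b..t0})"
        using gap_arcI [OF t0] ends_gap [OF t0] pb by simp
      fix A assume *: "A \<in> gap_arcs X D M \<and> p \<in> ends X A"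
      then have "A \<in> gap_arcs X D M" by simp
      then obtain s t where st: "gap s t" "A = h ` cis ` {s..t}" by (rule gap_arcE)
      have p': "p \<in> {h (cis s), h (cis t)}"
        using * ends_gap [OF st(1)] st(2) by simp
      have "p \<noteq> h (cis t)"
      proof
        assume "p = h (cis t)"
        then have "cis b = cis t" using pb h_inj by simp
        then obtain m :: int where m: "b = t + 2 * pi * m" unfolding cis_eq_cis_iff by blast
        define u where "u = max ((s + t) / 2) (t - (b - a))"
        have "s < t" using st(1) by (simp add: gap_def)
        moreover have "s + t \<le> 2 * u" "t - (b - a) \<le> u"
          unfolding u_def by (simp_all add: max_def field_simps)
        moreover have "u < t" unfolding u_def using ab \<open>s < t\<close> by simp
        ultimately have u: "s < u" "u < t" "a \<le> u + 2 * pi * m" "u + 2 * pi * m \<le> b"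
          using m by - linarith+
        then show False using inN [of u m] st(1) by (auto simp: gap_def)
      qed
      then have "cis b = cis s" using p' pb h_inj by auto
      then obtain m :: int where m: "b = s + 2 * pi * m" unfolding cis_eq_cis_iff by blast
      have "gap b (t + 2 * pi * m)" using gap_shift [OF st(1), of m] m by simp
      then have "t + 2 * pi * m = t0"
        using gap_unique [OF _ t0, of b "t + 2 * pi * m"] t0 by (auto simp: gap_def)
      then show "A = h ` cis ` {b..t0}"
        using cis_image_shift [of s m t] st(2) m by simp
    qed
  qed
qed

lemma gap_arcs_overlap:
  assumes A: "A \<in> gap_arcs X D M" and A': "A' \<in> gap_arcs X D M"
    and x: "x \<in> A" "x \<in> A'" "x \<notin> ends X A"
  shows "A = A'"
proof -
  obtain s t where st: "gap s t" "A = h ` cis ` {s..t}" using A by (rule gap_arcE)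
  obtain s' t' where st': "gap s' t'" "A' = h ` cis ` {s'..t'}" using A' by (rule gap_arcE)
  obtain u where u: "x = h (cis u)" "s \<le> u" "u \<le> t" using x(1) st(2) by auto
  have "u \<noteq> s" "u \<noteq> t" using x(3) ends_gap [OF st(1)] st(2) u(1) by auto
  obtain m :: int where m: "s' \<le> u + 2 * pi * m" "u + 2 * pi * m \<le> t'"
    using x(2) unfolding st'(2) u(1) mem_cis_arc by blast
  let ?s = "s' + 2 * pi * real_of_int (- m)" and ?t = "t' + 2 * pi * real_of_int (- m)"
  have "s < ?t" "?s < t" using u m \<open>u \<noteq> s\<close> \<open>u \<noteq> t\<close> by auto
  then have "s = ?s \<and> t = ?t" by (rule gap_unique [OF st(1) gap_shift [OF st'(1)]])
  then show ?thesis using cis_image_shift [of s' "- m" t'] st(2) st'(2) by simp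
qed

lemma boundary_cover: "disc_boundary X D = \<Union> SS \<union> \<Union> (gap_arcs X D M)"
proof (intro equalityI subsetI)
  fix x assume "x \<in> disc_boundary X D"
  then obtain t where t: "x = h (cis t)" by (rule bdryE)
  show "x \<in> \<Union> SS \<union> \<Union> (gap_arcs X D M)"
  proof (cases "t \<in> N")
    case True
    then show ?thesis using t N_iff [of t] by simp
  next
    case False
    then obtain s u where "gap s u" "s < t" "t < u" by (rule gap_ex)
    then have "h ` cis ` {s..u} \<in> gap_arcs X D M" "x \<in> h ` cis ` {s..u}"
      using t gap_arcI by auto
    then show ?thesis by blast
  qed
qed (use bdry in \<open>auto simp: gap_arcs_def\<close>)

lemma chart_gap_ends:
  "{{h (cis s), h (cis t)} |s t. s < t \<and> h (cis s) \<in> M \<and> h (cis t) \<in> M \<and>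
     (\<forall>u. s < u \<and> u < t \<longrightarrow> h (cis u) \<notin> M)} = ends X ` gap_arcs X D M"
proof -
  have "ends X ` gap_arcs X D M = {ends X (h ` cis ` {s..t}) |s t. gap s t}"
    unfolding gap_arcs_eq by blast
  also have "\<dots> = {{h (cis s), h (cis t)} |s t. gap s t}"
    by (intro Collect_cong ex_cong1) (auto simp: ends_gap)
  finally show ?thesis by (simp add: gap_def N_def)
qed

end

context marked_disc
begin

lemma obtain_chart: obtains h where "marked_chart X D M SS h"
proof -
  obtain h where "disc_param X D h" using D X by (auto simp: is_disc_def disc_chart_iff)
  then have "marked_chart X D M SS h" by unfold_locales
  then show ?thesis by (rule that)
qed

lemma gap_arc_ends_in_seg_ends: "\<lbrakk>A \<in> gap_arcs X D M; p \<in> ends X A\<rbrakk> \<Longrightarrow> \<exists>S \<in> SS. p \<in> ends X S"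
  by (rule obtain_chart) (rule marked_chart.gap_end_in_seg_end)

lemma unique_gap_arc: "\<lbrakk>S \<in> SS; p \<in> ends X S\<rbrakk> \<Longrightarrow> \<exists>!A. A \<in> gap_arcs X D M \<and> p \<in> ends X A"
  by (rule obtain_chart) (rule marked_chart.unique_gap)

lemma gap_arcs_disjoint:
  "\<lbrakk>A \<in> gap_arcs X D M; A' \<in> gap_arcs X D M; x \<in> A; x \<in> A'; x \<notin> ends X A\<rbrakk> \<Longrightarrow> A = A'"
  by (rule obtain_chart) (rule marked_chart.gap_arcs_overlap)

lemma disc_boundary_cover: "disc_boundary X D = \<Union> SS \<union> \<Union> (gap_arcs X D M)"
  by (rule obtain_chart) (rule marked_chart.boundary_cover)

lemma inj_on_ends_gap_arcs: "inj_on (ends X) (gap_arcs X D M)"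
proof (rule inj_onI)
  fix A A' assume A: "A \<in> gap_arcs X D M" "A' \<in> gap_arcs X D M" "ends X A = ends X A'"
  then have "is_segment X A" by (simp add: gap_arcs_def)
  from is_segment_ends [OF X this] obtain p q where "ends X A = {p, q}" by metis
  then have "p \<in> ends X A" by simp
  then show "A = A'"
    using gap_arc_ends_in_seg_ends [OF A(1)] unique_gap_arc A by metis
qed

text \<open>
  A complementary arc is determined by its ends, which are among the ends of the finitely many
  segments.
\<close>

lemma finite_gap_arcs: "finite (gap_arcs X D M)"
proof -
  have "finite (ends X S)" if "S \<in> SS" for S
    using is_segment_ends [OF X seg [OF that]] by (metis finite.simps)
  then have "finite (\<Union> (ends X ` SS))" using fin by blast
  moreover have "ends X ` gap_arcs X D M \<subseteq> Pow (\<Union> (ends X ` SS))"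
    using gap_arc_ends_in_seg_ends by blast
  ultimately have "finite (ends X ` gap_arcs X D M)"
    by (meson finite_Pow_iff finite_subset)
  then show ?thesis using inj_on_ends_gap_arcs by (rule finite_imageD)
qed

end


section \<open>Systems of discs meeting along boundary arcs\<close>

text \<open>
  A union of finitely many disjoint closed sets is their topological sum.
\<close>

lemma connected_components_of_partition:
  assumes fin: "finite \<A>" and disj: "disjoint \<A>"
    and A: "\<And>A. A \<in> \<A> \<Longrightarrow> closedin X A \<and> connectedin X A \<and> A \<noteq> {}"
  shows "connected_components_of (subtopology X (\<Union>\<A>)) = \<A>"
proof -
  let ?Y = "subtopology X (\<Union>\<A>)"
  have top: "topspace ?Y = \<Union>\<A>"
    using A closedin_subset by (auto simp: topspace_subtopology)
  have con: "connectedin ?Y A" if "A \<in> \<A>" for A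
    using A [OF that] that by (auto simp: connectedin_subtopology)
  have clo: "closedin ?Y A" if "A \<in> \<A>" for A
    using A [OF that] that by (intro closedin_subset_topspace) auto
  have ope: "openin ?Y A" if "A \<in> \<A>" for A
  proof -
    have "closedin ?Y (\<Union>(\<A> - {A}))"
      using fin clo by (intro closedin_Union) auto
    moreover have "A = topspace ?Y - \<Union>(\<A> - {A})"
      using disj that unfolding top by (auto simp: disjoint_def)
    ultimately show ?thesis by (metis openin_diff openin_topspace)
  qed
  have eq: "C = A" if C: "C \<in> connected_components_of ?Y" and "A \<in> \<A>" "\<not> disjnt C A" for C A
  proof
    show "A \<subseteq> C" using connected_components_of_maximal [OF C con] that by blast
    have "connectedin ?Y C" by (rule connectedin_connected_components_of [OF C])
    then show "C \<subseteq> A" using connectedin_clopen_cases clo ope that by metis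
  qed
  have cov: "\<Union> (connected_components_of ?Y) = \<Union>\<A>"
    using Union_connected_components_of [of ?Y] top by simp
  show ?thesis
  proof (intro equalityI subsetI)
    fix C assume C: "C \<in> connected_components_of ?Y"
    then obtain x where "x \<in> C" using nonempty_connected_components_of by blast
    then obtain A where "A \<in> \<A>" "x \<in> A" using C cov by blast
    then show "C \<in> \<A>" using eq [OF C] \<open>x \<in> C\<close> by (auto simp: disjnt_iff)
  next
    fix A assume "A \<in> \<A>"
    then obtain x where "x \<in> A" using A by blast
    then obtain C where C: "C \<in> connected_components_of ?Y" "x \<in> C" using \<open>A \<in> \<A>\<close> cov by blast
    then show "A \<in> connected_components_of ?Y"
      using eq [OF C(1) \<open>A \<in> \<A>\<close>] \<open>x \<in> A\<close> by (auto simp: disjnt_iff)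
  qed
qed

abbreviation comps :: "'a topology \<Rightarrow> 'a set \<Rightarrow> 'a set set" where
  "comps X S \<equiv> connected_components_of (subtopology X S)"

definition disc_segs :: "'a topology \<Rightarrow> 'a set \<Rightarrow> 'a set set \<Rightarrow> 'a set set" where
  "disc_segs X D \<E> = (\<Union>e \<in> \<E>. comps X (D \<inter> e))"

text \<open>
  The conditions on a ribbon graph, with finitely many segments in place of two on each edge.
  They are symmetric in vertices and edges, so every lemma of this locale also holds with
  vertices and edges exchanged, by \<open>disc_system_swap\<close>.
\<close>

locale disc_system =
  fixes X :: "'a topology" and \<V> \<E> :: "'a set set"
  assumes X: "Hausdorff_space X" and top: "topspace X = \<Union>\<V> \<union> \<Union>\<E>"
    and fin_V: "finite \<V>" and fin_E: "finite \<E>"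
    and disc_V: "v \<in> \<V> \<Longrightarrow> is_disc X v" and disc_E: "e \<in> \<E> \<Longrightarrow> is_disc X e"
    and disj_V: "disjoint \<V>" and disj_E: "disjoint \<E>"
    and seg: "\<lbrakk>v \<in> \<V>; e \<in> \<E>; s \<in> comps X (v \<inter> e)\<rbrakk> \<Longrightarrow> is_segment X s"
    and seg_V: "\<lbrakk>v \<in> \<V>; e \<in> \<E>; s \<in> comps X (v \<inter> e)\<rbrakk> \<Longrightarrow> s \<subseteq> disc_boundary X v"
    and seg_E: "\<lbrakk>v \<in> \<V>; e \<in> \<E>; s \<in> comps X (v \<inter> e)\<rbrakk> \<Longrightarrow> s \<subseteq> disc_boundary X e"
    and fin_seg: "\<lbrakk>v \<in> \<V>; e \<in> \<E>\<rbrakk> \<Longrightarrow> finite (comps X (v \<inter> e))"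

lemma disc_system_swap:
  assumes "disc_system X \<V> \<E>" shows "disc_system X \<E> \<V>"
proof -
  interpret disc_system X \<V> \<E> by fact
  show ?thesis
  proof
    fix v e s
    show "is_segment X s" if "v \<in> \<E>" "e \<in> \<V>" "s \<in> comps X (v \<inter> e)"
      using seg [of e v s] that by (simp add: Int_commute)
    show "s \<subseteq> disc_boundary X v" if "v \<in> \<E>" "e \<in> \<V>" "s \<in> comps X (v \<inter> e)"
      using seg_E [of e v s] that by (simp add: Int_commute)
    show "s \<subseteq> disc_boundary X e" if "v \<in> \<E>" "e \<in> \<V>" "s \<in> comps X (v \<inter> e)"
      using seg_V [of e v s] that by (simp add: Int_commute)
    show "finite (comps X (v \<inter> e))" if "v \<in> \<E>" "e \<in> \<V>"
      using fin_seg [of e v] that by (simp add: Int_commute)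
  qed (use X top fin_V fin_E disc_V disc_E disj_V disj_E in auto)
qed

context disc_system
begin

lemma Union_comps: "\<lbrakk>v \<in> \<V>; e \<in> \<E>\<rbrakk> \<Longrightarrow> \<Union> (comps X (v \<inter> e)) = v \<inter> e"
  using top by (auto simp: Union_connected_components_of)

lemma Union_disc_segs: "v \<in> \<V> \<Longrightarrow> \<Union> (disc_segs X v \<E>) = v \<inter> \<Union>\<E>" (is "_ \<Longrightarrow> ?thesis")
proof -
  assume v: "v \<in> \<V>"
  have "\<Union> (disc_segs X v \<E>) = (\<Union>e \<in> \<E>. \<Union> (comps X (v \<inter> e)))" by (auto simp: disc_segs_def)
  also have "\<dots> = (\<Union>e \<in> \<E>. v \<inter> e)" by (rule SUP_cong) (simp_all add: Union_comps [OF v])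
  finally show ?thesis by auto
qed

text \<open>
  Every point common to a vertex and an edge lies on one of the segments.
\<close>

lemma overlap_boundary:
  assumes "v \<in> \<V>" "e \<in> \<E>" "x \<in> v" "x \<in> e"
  shows "x \<in> disc_boundary X v" "x \<in> disc_boundary X e"
proof -
  have "x \<in> \<Union> (comps X (v \<inter> e))" using Union_comps [OF assms(1,2)] assms(3,4) by simp
  then obtain s where "s \<in> comps X (v \<inter> e)" "x \<in> s" by (rule UnionE)
  then show "x \<in> disc_boundary X v" "x \<in> disc_boundary X e"
    using seg_V [OF assms(1,2)] seg_E [OF assms(1,2)] by auto
qed

lemma disc_segsE:
  assumes "s \<in> disc_segs X v \<E>" obtains e where "e \<in> \<E>" "s \<in> comps X (v \<inter> e)"
  using assms by (auto simp: disc_segs_def)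

lemma comps_subset: "\<lbrakk>s \<in> comps X A\<rbrakk> \<Longrightarrow> s \<subseteq> A"
  using connected_components_of_subset by fastforce

lemma disjoint_disc_segs:
  assumes v: "v \<in> \<V>" shows "disjoint (disc_segs X v \<E>)"
proof (rule disjointI)
  fix s s' assume s: "s \<in> disc_segs X v \<E>" "s' \<in> disc_segs X v \<E>" "s \<noteq> s'"
  obtain e where e: "e \<in> \<E>" "s \<in> comps X (v \<inter> e)" using s(1) by (rule disc_segsE)
  obtain e' where e': "e' \<in> \<E>" "s' \<in> comps X (v \<inter> e')" using s(2) by (rule disc_segsE)
  show "s \<inter> s' = {}"
  proof (cases "e = e'")
    case True
    then show ?thesis using connected_components_of_overlap [of s "subtopology X (v \<inter> e)" s'] e e' s(3) True by auto
  next
    case False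
    then have "e \<inter> e' = {}" using disj_E e(1) e'(1) by (auto simp: disjoint_def)
    then show ?thesis using comps_subset [OF e(2)] comps_subset [OF e'(2)] by blast
  qed
qed

lemma marked_disc:
  assumes v: "v \<in> \<V>" and nb: "v \<inter> \<Union>\<E> \<noteq> {}"
  shows "marked_disc X v (\<Union>\<E>) (disc_segs X v \<E>)"
proof
  show "Hausdorff_space X" "is_disc X v" using X disc_V v by auto
  show "finite (disc_segs X v \<E>)"
    unfolding disc_segs_def using fin_E fin_seg [OF v] by (intro finite_UN_I) auto
  show "\<Union> (disc_segs X v \<E>) = v \<inter> \<Union> \<E>" by (rule Union_disc_segs [OF v])
  then show "disc_segs X v \<E> \<noteq> {}" using nb by auto
  show "disjoint (disc_segs X v \<E>)" by (rule disjoint_disc_segs [OF v])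
  fix S assume "S \<in> disc_segs X v \<E>"
  then obtain e where e: "e \<in> \<E>" "S \<in> comps X (v \<inter> e)" by (rule disc_segsE)
  show "is_segment X S" by (rule seg [OF v e])
  show "S \<subseteq> disc_boundary X v" by (rule seg_V [OF v e])
qed

definition segs :: "'a set set" where "segs = (\<Union>v \<in> \<V>. disc_segs X v \<E>)"

text \<open>
  A disc without segments has no distinguished points on its boundary, and is therefore kept
  apart from the others.
\<close>

definition joined_V :: "'a set set" where "joined_V = {v \<in> \<V>. v \<inter> \<Union>\<E> \<noteq> {}}"

definition gaps_V :: "'a set set" where "gaps_V = (\<Union>v \<in> joined_V. gap_arcs X v (\<Union>\<E>))"

definition points :: "'a set" where "points = \<Union> (ends X ` segs)"

lemma segsE:
  assumes "s \<in> segs" obtains v e where "v \<in> \<V>" "e \<in> \<E>" "s \<in> comps X (v \<inter> e)"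
  using assms by (auto simp: segs_def disc_segs_def)

lemma joined_VD: "v \<in> joined_V \<Longrightarrow> v \<in> \<V>" "v \<in> joined_V \<Longrightarrow> marked_disc X v (\<Union>\<E>) (disc_segs X v \<E>)"
  by (auto simp: joined_V_def intro: marked_disc)

lemma disc_segs_sub_segs: "v \<in> \<V> \<Longrightarrow> disc_segs X v \<E> \<subseteq> segs"
  by (auto simp: segs_def)

lemma gaps_VE:
  assumes "A \<in> gaps_V" obtains v where "v \<in> joined_V" "A \<in> gap_arcs X v (\<Union>\<E>)"
  using assms by (auto simp: gaps_V_def)

lemma segs_segment: "s \<in> segs \<Longrightarrow> is_segment X s"
  by (elim segsE) (rule seg)

lemma disjoint_segs: "disjoint segs"
proof (rule disjointI)
  fix s s' assume s: "s \<in> segs" "s' \<in> segs" "s \<noteq> s'"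
  obtain v e where e: "v \<in> \<V>" "e \<in> \<E>" "s \<in> comps X (v \<inter> e)" using s(1) by (rule segsE)
  obtain v' e' where e': "v' \<in> \<V>" "e' \<in> \<E>" "s' \<in> comps X (v' \<inter> e')" using s(2) by (rule segsE)
  show "s \<inter> s' = {}"
  proof (cases "v = v'")
    case True
    have "s \<in> disc_segs X v \<E>" "s' \<in> disc_segs X v \<E>" using e e' True by (auto simp: disc_segs_def)
    then show ?thesis using disjoint_disc_segs [OF e(1)] s(3) by (auto simp: disjoint_def)
  next
    case False
    then have "v \<inter> v' = {}" using disj_V e(1) e'(1) by (auto simp: disjoint_def)
    then show ?thesis using comps_subset [OF e(3)] comps_subset [OF e'(3)] by blast
  qed
qed

lemma finite_segs: "finite segs"
  unfolding segs_def disc_segs_def using fin_V fin_E fin_seg by (intro finite_UN_I) auto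

lemma gaps_V_segment: "A \<in> gaps_V \<Longrightarrow> is_segment X A"
  by (auto simp: gaps_V_def gap_arcs_def)

lemma gaps_V_Int_E: "A \<in> gaps_V \<Longrightarrow> A \<inter> \<Union>\<E> = ends X A"
  by (auto simp: gaps_V_def gap_arcs_def)

lemma gaps_V_sub_V: "A \<in> gap_arcs X v M \<Longrightarrow> A \<subseteq> v"
  using disc_boundary_subset [OF X] by (auto simp: gap_arcs_def)

lemma finite_gaps_V: "finite gaps_V"
proof -
  have "finite joined_V" using fin_V by (simp add: joined_V_def)
  then show ?thesis
    unfolding gaps_V_def using marked_disc.finite_gap_arcs [OF joined_VD(2)] by (intro finite_UN_I) auto
qed

lemma gaps_V_ends:
  assumes "A \<in> gaps_V" "p \<in> ends X A" shows "\<exists>s \<in> segs. p \<in> ends X s"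
proof -
  obtain v where v: "v \<in> joined_V" "A \<in> gap_arcs X v (\<Union>\<E>)" using assms(1) by (rule gaps_VE)
  show ?thesis
    using marked_disc.gap_arc_ends_in_seg_ends [OF joined_VD(2) [OF v(1)] v(2) assms(2)]
      disc_segs_sub_segs [OF joined_VD(1) [OF v(1)]] by blast
qed

text \<open>
  Complementary arcs on one circle are separated by segments, and those on distinct circles lie
  in disjoint discs.
\<close>

lemma gaps_V_overlap:
  assumes "A \<in> gaps_V" "B \<in> gaps_V" "A \<noteq> B" "x \<in> A" "x \<in> B" shows "x \<in> ends X A"
proof -
  obtain v where v: "v \<in> joined_V" "A \<in> gap_arcs X v (\<Union>\<E>)" using assms(1) by (rule gaps_VE)
  obtain w where w: "w \<in> joined_V" "B \<in> gap_arcs X w (\<Union>\<E>)" using assms(2) by (rule gaps_VE)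
  have "x \<in> v" "x \<in> w" using gaps_V_sub_V v w assms by blast+
  then have "v = w" using disj_V joined_VD(1) v(1) w(1) by (auto simp: disjoint_def)
  then show ?thesis
    using marked_disc.gap_arcs_disjoint [OF joined_VD(2) [OF v(1)] v(2)] w(2) assms(3-5) by metis
qed

lemma segs_sub: assumes "s \<in> segs" shows "s \<subseteq> \<Union>\<E>" "s \<subseteq> \<Union>\<V>"
proof -
  from assms obtain v e where *: "v \<in> \<V>" "e \<in> \<E>" "s \<in> comps X (v \<inter> e)" by (rule segsE)
  then show "s \<subseteq> \<Union>\<E>" "s \<subseteq> \<Union>\<V>" using comps_subset [OF *(3)] by auto
qed

lemma seg_gap_V_overlap:
  assumes "A \<in> gaps_V" "s \<in> segs" "x \<in> A" "x \<in> s" shows "x \<in> ends X A" "x \<in> ends X s"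
proof -
  show x: "x \<in> ends X A" using gaps_V_Int_E [OF assms(1)] segs_sub(1) [OF assms(2)] assms(3,4) by blast
  from gaps_V_ends [OF assms(1) x] obtain s' where s': "s' \<in> segs" "x \<in> ends X s'" by blast
  then have "s' = s" using disjoint_segs assms ends_subset [of X s'] by (auto simp: disjoint_def)
  then show "x \<in> ends X s" using s' by simp
qed

lemma inj_on_ends_segs: "inj_on (ends X) segs"
proof (rule inj_onI)
  fix s s' assume s: "s \<in> segs" "s' \<in> segs" "ends X s = ends X s'"
  obtain p q where "ends X s = {p, q}" by (rule is_segment_ends [OF X segs_segment [OF s(1)]])
  then have "p \<in> s" "p \<in> s'" using s(3) ends_subset [of X s] ends_subset [of X s'] by auto
  then show "s = s'" using disjoint_segs s by (auto simp: disjoint_def)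
qed

lemma inj_on_ends_gaps_V: "inj_on (ends X) gaps_V"
proof (rule inj_onI)
  fix A B assume s: "A \<in> gaps_V" "B \<in> gaps_V" "ends X A = ends X B"
  obtain v where v: "v \<in> joined_V" "A \<in> gap_arcs X v (\<Union>\<E>)" using s(1) by (rule gaps_VE)
  obtain w where w: "w \<in> joined_V" "B \<in> gap_arcs X w (\<Union>\<E>)" using s(2) by (rule gaps_VE)
  obtain p q where "ends X A = {p, q}" by (rule is_segment_ends [OF X gaps_V_segment [OF s(1)]])
  then have "p \<in> A" "p \<in> B" using s(3) ends_subset [of X A] ends_subset [of X B] by auto
  then have "p \<in> v" "p \<in> w" using gaps_V_sub_V v w by blast+
  then have "v = w" using disj_V joined_VD(1) v(1) w(1) by (auto simp: disjoint_def)
  then show "A = B"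
    using marked_disc.inj_on_ends_gap_arcs [OF joined_VD(2) [OF v(1)]] v(2) w(2) s(3) by (simp add: inj_on_def)
qed

lemma joined_V_boundary: "v \<in> joined_V \<Longrightarrow>
    disc_boundary X v = \<Union> (disc_segs X v \<E>) \<union> \<Union> (gap_arcs X v (\<Union>\<E>))"
  by (rule marked_disc.disc_boundary_cover [OF joined_VD(2)])

lemma Union_segs_joined: "\<Union> segs = (\<Union>v \<in> joined_V. \<Union> (disc_segs X v \<E>))"
proof (intro equalityI subsetI)
  fix x assume "x \<in> \<Union> segs"
  then obtain v where v: "v \<in> \<V>" "x \<in> \<Union> (disc_segs X v \<E>)" by (auto simp: segs_def)
  then have "x \<in> v \<inter> \<Union>\<E>" using Union_disc_segs by simp
  then have "v \<in> joined_V" using v(1) by (auto simp: joined_V_def)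
  then show "x \<in> (\<Union>v \<in> joined_V. \<Union> (disc_segs X v \<E>))" using v(2) by blast
next
  fix x assume "x \<in> (\<Union>v \<in> joined_V. \<Union> (disc_segs X v \<E>))"
  then show "x \<in> \<Union> segs" using joined_VD(1) by (auto simp: segs_def)
qed

lemma Union_boundaries: "(\<Union>v \<in> joined_V. disc_boundary X v) = \<Union> segs \<union> \<Union> gaps_V"
proof -
  have "(\<Union>v \<in> joined_V. disc_boundary X v) =
      (\<Union>v \<in> joined_V. \<Union> (disc_segs X v \<E>) \<union> \<Union> (gap_arcs X v (\<Union>\<E>)))"
    by (rule SUP_cong) (simp_all add: joined_V_boundary)
  then show ?thesis unfolding Union_segs_joined gaps_V_def by auto
qed

end


section \<open>Extending a homeomorphism over arcs and over discs\<close>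

definition arc_system :: "'a topology \<Rightarrow> 'a set set \<Rightarrow> bool" where
  "arc_system X \<A> \<longleftrightarrow> finite \<A> \<and> (\<forall>A \<in> \<A>. is_segment X A) \<and>
     (\<forall>A \<in> \<A>. \<forall>B \<in> \<A>. A \<noteq> B \<longrightarrow> A \<inter> B \<subseteq> ends X A)"

lemma arc_system_end_points:
  assumes "arc_system X \<A>" "A \<in> \<A>" "p \<in> A" "p \<in> \<Union> (ends X ` \<A>)"
  shows "p \<in> ends X A"
proof -
  obtain B where B: "B \<in> \<A>" "p \<in> ends X B" using assms(4) by blast
  then have "p \<in> B" using ends_subset [of X B] by blast
  show ?thesis
  proof (cases "A = B")
    case False
    then have "A \<inter> B \<subseteq> ends X A" using assms(1,2) B(1) unfolding arc_system_def by blast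
    then show ?thesis using assms(3) \<open>p \<in> B\<close> by blast
  qed (use B in simp)
qed

lemma bij_betw_minus_image:
  assumes "bij_betw g A B" "S \<subseteq> A" shows "bij_betw g (A - S) (B - g ` S)"
proof -
  have "inj_on g A" "g ` A = B" using assms(1) by (auto simp: bij_betw_def)
  moreover have "g ` (A - S) = g ` A - g ` S"
    by (rule inj_on_image_set_diff [OF \<open>inj_on g A\<close>]) (use assms(2) in auto)
  ultimately show ?thesis by (auto simp: bij_betw_def intro: inj_on_subset)
qed

text \<open>
  Arcs that meet in end points only form a graph; a bijection of its edges that comes from a
  bijection of its end points is realised by a homeomorphism.
\<close>

lemma glue_arcs:
  fixes X :: "'a topology" and Y :: "'b topology"
  assumes X: "Hausdorff_space X" and Y: "Hausdorff_space Y"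
    and A: "arc_system X \<A>" and B: "arc_system Y \<B>"
    and \<beta>: "bij_betw \<beta> \<A> \<B>"
    and f: "inj_on f (\<Union> (ends X ` \<A>))"
    and ends_\<beta>: "\<And>A. A \<in> \<A> \<Longrightarrow> ends Y (\<beta> A) = f ` ends X A"
  shows "\<exists>F. homeomorphic_map (subtopology X (\<Union>\<A>)) (subtopology Y (\<Union>\<B>)) F \<and> (\<forall>A \<in> \<A>. F ` A = \<beta> A)"
proof -
  let ?P = "\<Union> (ends X ` \<A>)"
  have segA: "is_segment X A" if "A \<in> \<A>" for A using A that by (simp add: arc_system_def)
  have segB: "is_segment Y B" if "B \<in> \<B>" for B using B that by (simp add: arc_system_def)
  have \<beta>B: "\<beta> A \<in> \<B>" if "A \<in> \<A>" for A using \<beta> that by (rule bij_betw_apply)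
  have Pf: "f ` ?P = \<Union> (ends Y ` \<B>)"
  proof -
    have "\<Union> (ends Y ` \<B>) = (\<Union>A \<in> \<A>. ends Y (\<beta> A))"
      using \<beta> by (auto simp: bij_betw_def)
    also have "\<dots> = (\<Union>A \<in> \<A>. f ` ends X A)" by (rule SUP_cong) (simp_all add: ends_\<beta>)
    finally show ?thesis by auto
  qed
  have "\<exists>\<phi>. continuous_map (subtopology X A) Y \<phi> \<and> bij_betw \<phi> A (\<beta> A) \<and> (\<forall>p \<in> ends X A. \<phi> p = f p)"
    if "A \<in> \<A>" for A
  proof -
    have "is_segment X A" by (rule segA [OF that])
    from is_segment_ends [OF X this] obtain p q where pq: "ends X A = {p, q}" by metis
    then have "ends Y (\<beta> A) = {f p, f q}" using ends_\<beta> [OF that] by simp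
    from arc_homeomorphism [OF X Y segA [OF that] pq segB [OF \<beta>B [OF that]] this]
    show ?thesis unfolding pq by auto
  qed
  then obtain \<phi> where \<phi>: "\<And>A. A \<in> \<A> \<Longrightarrow> continuous_map (subtopology X A) Y (\<phi> A)"
    "\<And>A. A \<in> \<A> \<Longrightarrow> bij_betw (\<phi> A) A (\<beta> A)"
    "\<And>A p. \<lbrakk>A \<in> \<A>; p \<in> ends X A\<rbrakk> \<Longrightarrow> \<phi> A p = f p" by metis
  \<comment> \<open>the pieces are the closed arcs, which count with their interiors, and the end points\<close>
  define I where "I = Inl ` \<A> \<union> Inr ` ?P"
  define K where "K = case_sum (\<lambda>A. A) (\<lambda>p::'a. {p})"
  define U where "U = case_sum (\<lambda>A. A - ends X A) (\<lambda>p. {p})"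
  define W where "W = case_sum (\<lambda>A. \<beta> A - ends Y (\<beta> A)) (\<lambda>p. {f p})"
  define \<Phi> where "\<Phi> = case_sum \<phi> (\<lambda>_::'a. f)"
  have finA: "finite \<A>" using A by (simp add: arc_system_def)
  have finP: "finite ?P"
  proof (rule finite_UN_I [OF finA])
    fix A assume "A \<in> \<A>"
    from is_segment_ends [OF X segA [OF this]] show "finite (ends X A)"
      by (metis finite.emptyI finite.insertI)
  qed
  have P_A: "?P \<subseteq> \<Union>\<A>" using ends_subset by fastforce
  have top_A: "topspace (subtopology X (\<Union>\<A>)) = \<Union>\<A>"
    using segA is_segment_closedin [OF X] closedin_subset by (fastforce simp: topspace_subtopology)
  have top_B: "topspace (subtopology Y (\<Union>\<B>)) = \<Union>\<B>"
    using segB is_segment_closedin [OF Y] closedin_subset by (fastforce simp: topspace_subtopology)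
  have ends\<phi>: "\<phi> A ` ends X A = ends Y (\<beta> A)" if "A \<in> \<A>" for A
    unfolding ends_\<beta> [OF that] by (rule image_cong [OF HOL.refl]) (rule \<phi>(3) [OF that])
  have "\<exists>F. homeomorphic_map (subtopology X (\<Union>\<A>)) (subtopology Y (\<Union>\<B>)) F \<and> (\<forall>i \<in> I. \<forall>x \<in> K i. F x = \<Phi> i x)"
  proof (rule glue_homeomorphism [where U = U and W = W])
    show "Hausdorff_space (subtopology X (\<Union>\<A>))" "Hausdorff_space (subtopology Y (\<Union>\<B>))"
      using X Y by (simp_all add: Hausdorff_space_subtopology)
    show "finite I" using finA finP by (simp add: I_def)
    show "topspace (subtopology X (\<Union>\<A>)) = (\<Union>i \<in> I. U i)"
    proof -
      have "(\<Union>i \<in> I. U i) = (\<Union>A \<in> \<A>. A - ends X A) \<union> ?P" by (auto simp: I_def U_def)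
      also have "\<dots> = \<Union>\<A>" using P_A by auto
      finally show ?thesis using top_A by simp
    qed
    show "topspace (subtopology Y (\<Union>\<B>)) = (\<Union>i \<in> I. W i)"
    proof -
      have "(\<Union>i \<in> I. W i) = (\<Union>A \<in> \<A>. \<beta> A - ends Y (\<beta> A)) \<union> f ` ?P" by (auto simp: I_def W_def)
      also have "(\<Union>A \<in> \<A>. \<beta> A - ends Y (\<beta> A)) = (\<Union>B \<in> \<B>. B - ends Y B)"
        using \<beta> by (auto simp: bij_betw_def)
      also have "(\<Union>B \<in> \<B>. B - ends Y B) \<union> f ` ?P = \<Union>\<B>" unfolding Pf using ends_subset by fastforce
      finally show ?thesis using top_B by simp
    qed
  next
    fix i assume i: "i \<in> I"
    show "U i \<subseteq> K i" by (cases i) (auto simp: U_def K_def)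
    show "compactin (subtopology X (\<Union>\<A>)) (K i)"
    proof (cases i)
      case (Inl A)
      then have "A \<in> \<A>" using i by (auto simp: I_def)
      then show ?thesis using is_segment_compactin [OF X segA] Inl by (auto simp: compactin_subtopology K_def)
    next
      case (Inr p)
      then have "p \<in> \<Union>\<A>" using i P_A by (auto simp: I_def)
      then have "p \<in> topspace (subtopology X (\<Union>\<A>))" by (simp only: top_A)
      then show ?thesis using Inr by (simp add: K_def)
    qed
    show "continuous_map (subtopology (subtopology X (\<Union>\<A>)) (K i)) (subtopology Y (\<Union>\<B>)) (\<Phi> i)"
    proof (cases i)
      case (Inl A)
      then have A: "A \<in> \<A>" using i by (auto simp: I_def)
      have "subtopology (subtopology X (\<Union>\<A>)) A = subtopology X A"
        unfolding subtopology_subtopology using A by (metis Int_absorb1 Union_upper)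
      moreover have "\<phi> A ` A \<subseteq> \<Union>\<B>" using \<phi>(2) [OF A] \<beta>B [OF A] by (auto simp: bij_betw_def)
      ultimately show ?thesis using \<phi>(1) [OF A] Inl
        by (auto simp: K_def \<Phi>_def continuous_map_in_subtopology)
    next
      case (Inr p)
      then have p: "p \<in> ?P" using i by (auto simp: I_def)
      have "f p \<in> f ` ?P" using p by (rule imageI)
      then have fp: "f p \<in> \<Union>\<B>" unfolding Pf using ends_subset by fastforce
      have "continuous_map (subtopology (subtopology X (\<Union>\<A>)) {p}) (subtopology Y (\<Union>\<B>)) (\<lambda>_. f p)"
        using fp top_B by simp
      then have "continuous_map (subtopology (subtopology X (\<Union>\<A>)) {p}) (subtopology Y (\<Union>\<B>)) f"
        by (rule continuous_map_eq) auto
      then show ?thesis using Inr by (simp add: K_def \<Phi>_def)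
    qed
    show "bij_betw (\<Phi> i) (U i) (W i)"
    proof (cases i)
      case (Inl A)
      then have A: "A \<in> \<A>" using i by (auto simp: I_def)
      have "bij_betw (\<phi> A) (A - ends X A) (\<beta> A - ends Y (\<beta> A))"
        unfolding ends\<phi> [OF A, symmetric]
        using \<phi>(2) [OF A] ends_subset [of X A] by (rule bij_betw_minus_image)
      then show ?thesis using Inl by (simp add: U_def W_def \<Phi>_def)
    qed (simp add: U_def W_def \<Phi>_def)
  next
    fix i j x assume i: "i \<in> I" and j: "j \<in> I" and x: "x \<in> K i" "x \<in> K j"
    have at_P: "\<Phi> k x = f x" if "k \<in> I" "x \<in> K k" "x \<in> ?P" for k
    proof (cases k)
      case (Inl A)
      then have "A \<in> \<A>" "x \<in> A" using that by (auto simp: I_def K_def)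
      then have "x \<in> ends X A" using arc_system_end_points [OF A _ _ that(3)] by simp
      then show ?thesis using \<phi>(3) [OF \<open>A \<in> \<A>\<close>] Inl by (simp add: \<Phi>_def)
    qed (simp add: \<Phi>_def)
    show "\<Phi> i x = \<Phi> j x"
    proof (cases "i = j")
      case False
      have "x \<in> ?P"
      proof (cases i)
        case (Inl A)
        then have A': "A \<in> \<A>" "x \<in> A" using i x by (auto simp: I_def K_def)
        show ?thesis
        proof (cases j)
          case (Inl B)
          then have B': "B \<in> \<A>" "x \<in> B" using j x by (auto simp: I_def K_def)
          have "A \<noteq> B" using False Inl \<open>i = Inl A\<close> by simp
          then have "A \<inter> B \<subseteq> ends X A" using A A' B' unfolding arc_system_def by blast
          then show ?thesis using A' B' by blast
        qed (use j x in \<open>auto simp: I_def K_def\<close>)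
      qed (use i x in \<open>auto simp: I_def K_def\<close>)
      then show ?thesis using at_P [OF i x(1)] at_P [OF j x(2)] by simp
    qed simp
  next
    fix i j assume i: "i \<in> I" and j: "j \<in> I" and ij: "i \<noteq> j"
    have f_end: "f p \<notin> \<beta> A - ends Y (\<beta> A)" if "A \<in> \<A>" "p \<in> ?P" for A p
    proof
      assume fp: "f p \<in> \<beta> A - ends Y (\<beta> A)"
      have "f p \<in> f ` ?P" using that(2) by (rule imageI)
      then have "f p \<in> \<Union> (ends Y ` \<B>)" by (simp only: Pf)
      then show False using arc_system_end_points [OF B \<beta>B [OF that(1)]] fp by blast
    qed
    show "W i \<inter> W j = {}"
    proof (cases i)
      case (Inl A)
      then have A': "A \<in> \<A>" using i by (auto simp: I_def)
      show ?thesis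
      proof (cases j)
        case (Inl B')
        then have B': "B' \<in> \<A>" using j by (auto simp: I_def)
        have "\<beta> A \<noteq> \<beta> B'" using ij Inl \<open>i = Inl A\<close> \<beta> A' B' by (auto simp: bij_betw_def inj_on_def)
        then have "\<beta> A \<inter> \<beta> B' \<subseteq> ends Y (\<beta> A)"
          using B \<beta>B [OF A'] \<beta>B [OF B'] unfolding arc_system_def by blast
        then show ?thesis using \<open>i = Inl A\<close> Inl by (auto simp: W_def)
      next
        case (Inr p)
        then have "p \<in> ?P" using j by (auto simp: I_def)
        from f_end [OF A' this] show ?thesis using Inr \<open>i = Inl A\<close> by (simp add: W_def)
      qed
    next
      case (Inr p)
      then have p: "p \<in> ?P" using i by (auto simp: I_def)
      show ?thesis
      proof (cases j)
        case (Inl B')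
        then have "B' \<in> \<A>" using j by (auto simp: I_def)
        from f_end [OF this p] show ?thesis using Inl \<open>i = Inr p\<close> by (simp add: W_def)
      next
        case (Inr q)
        then have q: "q \<in> ?P" using j by (auto simp: I_def)
        have "p \<noteq> q" using ij Inr \<open>i = Inr p\<close> by simp
        then have "f p \<noteq> f q" using inj_onD [OF f _ p q] by blast
        then show ?thesis using Inr \<open>i = Inr p\<close> by (simp add: W_def)
      qed
    qed
  qed
  then obtain F where F: "homeomorphic_map (subtopology X (\<Union>\<A>)) (subtopology Y (\<Union>\<B>)) F"
    "\<And>i x. \<lbrakk>i \<in> I; x \<in> K i\<rbrakk> \<Longrightarrow> F x = \<Phi> i x" by blast
  have "F ` A = \<beta> A" if "A \<in> \<A>" for A
  proof -
    have "F ` A = \<phi> A ` A"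
      using F(2) [of "Inl A"] that by (intro image_cong HOL.refl) (simp add: I_def K_def \<Phi>_def)
    then show ?thesis using \<phi>(2) [OF that] by (simp add: bij_betw_def)
  qed
  with F(1) show ?thesis by blast
qed


lemma is_segment_not_ends: assumes "Hausdorff_space X" "is_segment X A" shows "ends X A \<noteq> A"
proof -
  obtain g where g: "arc_param X A g" using assms is_segment_iff by blast
  then have "g (1/2) \<in> A" by (auto simp: arc_param_def)
  moreover have "g (1/2) \<noteq> g 0" "g (1/2) \<noteq> g 1"
    using g inj_onD [of g "{0..1}" "1/2" 0] inj_onD [of g "{0..1}" "1/2" 1] by (auto simp: arc_param_def)
  moreover have "ends X A = {g 0, g 1}" by (rule ends_arc_param [OF assms(1) g])
  ultimately show ?thesis by auto
qed

text \<open>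
  Arcs are determined by their ends, and discs of one kind by their boundary circles. If such
  determining sets correspond under an injection \<open>f\<close>, then so do the objects, and
  this is compatible with families of objects.
\<close>

lemma induced_bijection:
  fixes c :: "'k \<Rightarrow> 'a set" and c' :: "'l \<Rightarrow> 'b set"
  assumes inj: "inj_on c \<K>" and inj': "inj_on c' \<K>'" and f: "inj_on f P"
    and P: "\<forall>A \<in> \<K>. c A \<subseteq> P" and im: "c' ` \<K>' = (`) f ` c ` \<K>"
    and b_def: "b = (\<lambda>A. inv_into \<K>' c' (f ` c A))"
  shows "bij_betw b \<K> \<K>'" "\<And>A. A \<in> \<K> \<Longrightarrow> c' (b A) = f ` c A"
    "\<And>\<L> \<L>'. \<lbrakk>\<L> \<subseteq> \<K>; \<L>' \<subseteq> \<K>'; c' ` \<L>' = (`) f ` c ` \<L>\<rbrakk> \<Longrightarrow> b ` \<L> = \<L>'"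
proof -
  have mem: "f ` c A \<in> c' ` \<K>'" if "A \<in> \<K>" for A
    unfolding im using that by blast
  show cb: "c' (b A) = f ` c A" if "A \<in> \<K>" for A
    unfolding b_def by (rule f_inv_into_f [OF mem [OF that]])
  have bK: "b A \<in> \<K>'" if "A \<in> \<K>" for A
    unfolding b_def by (rule inv_into_into [OF mem [OF that]])
  have sub: "b ` \<L> = \<L>'" if L: "\<L> \<subseteq> \<K>" "\<L>' \<subseteq> \<K>'" "c' ` \<L>' = (`) f ` c ` \<L>" for \<L> \<L>'
  proof (intro equalityI subsetI)
    fix B assume "B \<in> b ` \<L>"
    then obtain A where A: "A \<in> \<L>" "B = b A" by blast
    then have "f ` c A \<in> c' ` \<L>'" unfolding L(3) by blast
    then obtain B' where B': "B' \<in> \<L>'" "c' B' = f ` c A" by force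
    have "A \<in> \<K>" using A L(1) by blast
    then have "b A = B'" using inj_onD [OF inj', of "b A" B'] cb B' L(2) bK by auto
    then show "B \<in> \<L>'" using A B' by simp
  next
    fix B assume B: "B \<in> \<L>'"
    then have "c' B \<in> (`) f ` c ` \<L>" using L(3) by blast
    then obtain A where A: "A \<in> \<L>" "c' B = f ` c A" by blast
    have "A \<in> \<K>" using A L(1) by blast
    then have "b A = B" using inj_onD [OF inj', of "b A" B] cb A B L(2) bK by auto
    then show "B \<in> b ` \<L>" using A by blast
  qed
  have "inj_on b \<K>"
  proof (rule inj_onI)
    fix A B assume AB: "A \<in> \<K>" "B \<in> \<K>" "b A = b B"
    then have "f ` c A = f ` c B" using cb by metis
    then have "c A = c B" using inj_on_image_eq_iff [OF f] P AB(1,2) by blast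
    then show "A = B" using inj AB by (auto dest: inj_onD)
  qed
  moreover have "b ` \<K> = \<K>'" by (rule sub [OF order_refl order_refl im])
  ultimately show "bij_betw b \<K> \<K>'" by (simp add: bij_betw_def)
  show "\<And>\<L> \<L>'. \<lbrakk>\<L> \<subseteq> \<K>; \<L>' \<subseteq> \<K>'; c' ` \<L>' = (`) f ` c ` \<L>\<rbrakk> \<Longrightarrow> b ` \<L> = \<L>'" by (rule sub)
qed

context disc_system
begin

text \<open>
  The graph of all boundary circles that are cut into arcs by segments.
\<close>

definition skeleton :: "'a set" where
  "skeleton = (\<Union>v \<in> joined_V. disc_boundary X v) \<union>
     (\<Union>e \<in> disc_system.joined_V \<E> \<V>. disc_boundary X e)"

lemma skeleton_swap: "disc_system.skeleton X \<E> \<V> = skeleton"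
  unfolding skeleton_def disc_system.skeleton_def [OF disc_system_swap [OF disc_system_axioms]] by auto

lemma segs_swap: "disc_system.segs X \<E> \<V> = segs"
  unfolding segs_def disc_system.segs_def [OF disc_system_swap [OF disc_system_axioms]] disc_segs_def
  by (subst SUP_commute) (simp add: Int_commute)

lemma skeleton_eq: "skeleton = \<Union> (segs \<union> gaps_V \<union> disc_system.gaps_V X \<E> \<V>)"
  unfolding skeleton_def Union_boundaries segs_swap
    disc_system.Union_boundaries [OF disc_system_swap [OF disc_system_axioms]] by auto

text \<open>
  Discs of the same kind are disjoint, and discs of different kinds meet in boundary points
  only.
\<close>

lemma V_Int_skeleton:
  assumes v: "v \<in> \<V>"
  shows "v \<inter> skeleton = (if v \<in> joined_V then disc_boundary X v else {})"
proof -
  have 1: "w = v" if "w \<in> joined_V" "x \<in> v" "x \<in> disc_boundary X w" for w x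
  proof (rule ccontr)
    assume "w \<noteq> v"
    then have "w \<inter> v = {}" using disj_V v joined_VD(1) [OF that(1)] by (simp add: disjoint_def)
    then show False using that(2,3) disc_boundary_subset [OF X, of w] by blast
  qed
  have 2: "v \<in> joined_V \<and> x \<in> disc_boundary X v"
    if "e \<in> disc_system.joined_V \<E> \<V>" "x \<in> v" "x \<in> disc_boundary X e" for e x
  proof -
    have "e \<in> \<E>" using disc_system.joined_VD(1) [OF disc_system_swap [OF disc_system_axioms] that(1)] .
    moreover have "x \<in> e" using that(3) disc_boundary_subset [OF X] by blast
    ultimately show ?thesis using overlap_boundary(1) [OF v _ that(2)] v that(2) by (auto simp: joined_V_def)
  qed
  show ?thesis
  proof (cases "v \<in> joined_V")
    case True
    have "v \<inter> skeleton \<subseteq> disc_boundary X v"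
    proof
      fix x assume x: "x \<in> v \<inter> skeleton"
      then consider w where "w \<in> joined_V" "x \<in> disc_boundary X w"
        | e where "e \<in> disc_system.joined_V \<E> \<V>" "x \<in> disc_boundary X e"
        unfolding skeleton_def by blast
      then show "x \<in> disc_boundary X v"
      proof cases
        case 1 then show ?thesis using \<open>\<And>w x. \<lbrakk>w \<in> joined_V; x \<in> v; x \<in> disc_boundary X w\<rbrakk> \<Longrightarrow> w = v\<close> [of w x] x by simp
      next
        case 2 then show ?thesis using \<open>\<And>e x. \<lbrakk>e \<in> _; x \<in> v; x \<in> disc_boundary X e\<rbrakk> \<Longrightarrow> _ \<and> _\<close> [of e x] x by simp
      qed
    qed
    moreover have "disc_boundary X v \<subseteq> v \<inter> skeleton"
      using disc_boundary_subset [OF X] True by (auto simp: skeleton_def)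
    ultimately show ?thesis using True by simp
  next
    case False
    have "x \<notin> skeleton" if "x \<in> v" for x
    proof
      assume "x \<in> skeleton"
      then consider w where "w \<in> joined_V" "x \<in> disc_boundary X w"
        | e where "e \<in> disc_system.joined_V \<E> \<V>" "x \<in> disc_boundary X e"
        unfolding skeleton_def by blast
      then show False
      proof cases
        case (1 w) then show ?thesis using \<open>\<And>w x. \<lbrakk>w \<in> joined_V; x \<in> v; x \<in> disc_boundary X w\<rbrakk> \<Longrightarrow> w = v\<close> [of w x] that False by simp
      next
        case (2 e) then show ?thesis using \<open>\<And>e x. \<lbrakk>e \<in> _; x \<in> v; x \<in> disc_boundary X e\<rbrakk> \<Longrightarrow> _ \<and> _\<close> [of e x] that False by simp
      qed
    qed
    then show ?thesis using False by auto
  qed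
qed

text \<open>
  Segments are disjoint, complementary arcs of one kind are separated by segments, and a
  complementary arc meets the discs of the other kind in its ends only.
\<close>

lemma arc_system: "arc_system X (segs \<union> gaps_V \<union> disc_system.gaps_V X \<E> \<V>)"
proof -
  interpret S: disc_system X \<E> \<V> by (rule disc_system_swap [OF disc_system_axioms])
  have gap_sub_V: "A \<subseteq> \<Union>\<V>" if "A \<in> gaps_V" for A
    using that gaps_V_sub_V joined_VD(1) by (elim gaps_VE) blast
  have gap_sub_E: "A \<subseteq> \<Union>\<E>" if "A \<in> S.gaps_V" for A
    using that S.gaps_V_sub_V S.joined_VD(1) by (elim S.gaps_VE) blast
  have "A \<inter> B \<subseteq> ends X A" if AB: "A \<in> segs \<union> gaps_V \<union> S.gaps_V" "B \<in> segs \<union> gaps_V \<union> S.gaps_V" "A \<noteq> B" for A B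
  proof
    fix x assume "x \<in> A \<inter> B"
    then have x: "x \<in> A" "x \<in> B" by auto
    consider (s) "A \<in> segs" | (g) "A \<in> gaps_V" | (h) "A \<in> S.gaps_V" using AB(1) by blast
    then show "x \<in> ends X A"
    proof cases
      case s
      consider (s') "B \<in> segs" | (g') "B \<in> gaps_V" | (h') "B \<in> S.gaps_V" using AB(2) by blast
      then show ?thesis
      proof cases
        case s' then show ?thesis using s disjoint_segs AB(3) x by (auto simp: disjoint_def)
      next
        case g' then show ?thesis using seg_gap_V_overlap(2) [OF g' s x(2,1)] by simp
      next
        case h' then show ?thesis using S.seg_gap_V_overlap(2) [OF h' _ x(2,1)] s segs_swap by simp
      qed
    next
      case g
      consider (s') "B \<in> segs" | (g') "B \<in> gaps_V" | (h') "B \<in> S.gaps_V" using AB(2) by blast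
      then show ?thesis
      proof cases
        case s' then show ?thesis using seg_gap_V_overlap(1) [OF g s' x] by simp
      next
        case g' then show ?thesis using gaps_V_overlap [OF g g' AB(3) x] by simp
      next
        case h' then show ?thesis using gaps_V_Int_E [OF g] gap_sub_E [OF h'] x by blast
      qed
    next
      case h
      consider (s') "B \<in> segs" | (g') "B \<in> gaps_V" | (h') "B \<in> S.gaps_V" using AB(2) by blast
      then show ?thesis
      proof cases
        case s' then show ?thesis using S.seg_gap_V_overlap(1) [OF h _ x] segs_swap by simp
      next
        case g' then show ?thesis using S.gaps_V_Int_E [OF h] gap_sub_V [OF g'] x by blast
      next
        case h' then show ?thesis using S.gaps_V_overlap [OF h h' AB(3) x] by simp
      qed
    qed
  qed
  moreover have "is_segment X A" if "A \<in> segs \<union> gaps_V \<union> S.gaps_V" for A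
    using that segs_segment gaps_V_segment S.gaps_V_segment by blast
  moreover have "finite (segs \<union> gaps_V \<union> S.gaps_V)"
    using finite_segs finite_gaps_V S.finite_gaps_V by simp
  ultimately show ?thesis unfolding arc_system_def by blast
qed

lemma gaps_V_not_sub_E: "A \<in> gaps_V \<Longrightarrow> \<not> A \<subseteq> \<Union>\<E>"
  using gaps_V_Int_E [of A] is_segment_not_ends [OF X gaps_V_segment, of A] by (auto simp: Int_absorb2)

lemma kinds_disjoint:
  "segs \<inter> gaps_V = {}" "segs \<inter> disc_system.gaps_V X \<E> \<V> = {}" "gaps_V \<inter> disc_system.gaps_V X \<E> \<V> = {}"
proof -
  interpret S: disc_system X \<E> \<V> by (rule disc_system_swap [OF disc_system_axioms])
  show "segs \<inter> gaps_V = {}" using gaps_V_not_sub_E segs_sub(1) by blast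
  show "segs \<inter> S.gaps_V = {}" using S.gaps_V_not_sub_E segs_sub(2) by blast
  have "A \<subseteq> \<Union>\<E>" if "A \<in> S.gaps_V" for A
    using that S.gaps_V_sub_V S.joined_VD(1) by (elim S.gaps_VE) blast
  then show "gaps_V \<inter> S.gaps_V = {}" using gaps_V_not_sub_E by blast
qed

text \<open>
  A homeomorphism between skeletons recognises the vertices by this: their circles are the
  components of the union of all segments and complementary arcs on vertices.
\<close>

lemma boundary_components:
  "comps X (\<Union>v \<in> joined_V. disc_boundary X v) = disc_boundary X ` joined_V"
  "inj_on (disc_boundary X) joined_V"
proof -
  have ne: "disc_boundary X v \<noteq> {}" if "v \<in> \<V>" for v
  proof -
    have "is_disc X v" by (rule disc_V [OF that])
    then obtain h where h: "disc_param X v h" using X by (auto simp: is_disc_def disc_chart_iff)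
    from disc_boundary_eq [OF X h] show ?thesis by simp
  qed
  have eq: "v = w" if "v \<in> joined_V" "w \<in> joined_V" "disc_boundary X v \<inter> disc_boundary X w \<noteq> {}" for v w
  proof -
    have "v \<inter> w \<noteq> {}" using that(3) disc_boundary_subset [OF X] by blast
    then show ?thesis using disj_V joined_VD(1) that(1,2) by (auto simp: disjoint_def)
  qed
  show "inj_on (disc_boundary X) joined_V"
  proof (rule inj_onI)
    fix v w assume *: "v \<in> joined_V" "w \<in> joined_V" "disc_boundary X v = disc_boundary X w"
    then show "v = w" using eq [OF *(1,2)] ne [OF joined_VD(1) [OF *(1)]] by simp
  qed
  show "comps X (\<Union>v \<in> joined_V. disc_boundary X v) = disc_boundary X ` joined_V"
  proof (rule connected_components_of_partition)
    show "finite (disc_boundary X ` joined_V)" using fin_V by (simp add: joined_V_def)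
    show "disjoint (disc_boundary X ` joined_V)"
    proof (rule disjointI)
      fix a b assume ab: "a \<in> disc_boundary X ` joined_V" "b \<in> disc_boundary X ` joined_V" "a \<noteq> b"
      then obtain v w where "v \<in> joined_V" "w \<in> joined_V" "a = disc_boundary X v" "b = disc_boundary X w" by blast
      then show "a \<inter> b = {}" using eq [of v w] ab(3) by auto
    qed
    fix A assume "A \<in> disc_boundary X ` joined_V"
    then obtain v where v: "v \<in> \<V>" "A = disc_boundary X v" using joined_VD(1) by blast
    show "closedin X A \<and> connectedin X A \<and> A \<noteq> {}"
      using compactin_imp_closedin [OF X disc_boundary_compactin [OF X disc_V [OF v(1)]]]
        disc_boundary_connectedin [OF X disc_V [OF v(1)]] ne [OF v(1)] v(2) by simp
  qed
qed

end


section \<open>Disc systems with the same incidences are homeomorphic\<close>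

lemma homeomorphic_map_subset:
  assumes F: "homeomorphic_map (subtopology X S) (subtopology Y T) F"
    and S: "S \<subseteq> topspace X" and T: "T \<subseteq> topspace Y" and A: "A \<subseteq> S"
  shows "homeomorphic_map (subtopology X A) (subtopology Y (F ` A)) F"
proof -
  have FS: "F ` S = T"
    using homeomorphic_imp_surjective_map [OF F] S T by (simp add: Int_absorb1)
  then have "F ` A \<subseteq> T" using A by blast
  then have "homeomorphic_map (subtopology (subtopology X S) A) (subtopology (subtopology Y T) (F ` A)) F"
    using A S T by (intro homeomorphic_map_subtopologies [OF F]) (auto simp: topspace_subtopology)
  moreover have "S \<inter> A = A" "T \<inter> F ` A = F ` A" using A \<open>F ` A \<subseteq> T\<close> by auto
  ultimately show ?thesis by (simp add: subtopology_subtopology)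
qed

lemma homeomorphic_map_restrict_cont:
  assumes F: "homeomorphic_map (subtopology X S) (subtopology Y T) F"
    and S: "S \<subseteq> topspace X" and T: "T \<subseteq> topspace Y" and A: "A \<subseteq> S"
  shows "continuous_map (subtopology X A) Y F" "bij_betw F A (F ` A)"
proof -
  have h: "homeomorphic_map (subtopology X A) (subtopology Y (F ` A)) F"
    by (rule homeomorphic_map_subset [OF assms])
  show "continuous_map (subtopology X A) Y F"
    using homeomorphic_imp_continuous_map [OF h] by (simp add: continuous_map_in_subtopology)
  have "inj_on F (topspace (subtopology X A))" by (rule homeomorphic_imp_injective_map [OF h])
  moreover have "topspace (subtopology X A) = A" using A S by auto
  ultimately show "bij_betw F A (F ` A)" by (simp add: bij_betw_def)
qed

text \<open>
  The homeomorphism of skeletons is extended to each disc separately. The extensions agree with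
  each other since distinct discs meet inside the skeleton only.
\<close>

lemma glue_discs:
  fixes X :: "'a topology" and Y :: "'b topology"
  assumes G: "disc_system X V E" and H: "disc_system Y V' E'"
    and F1: "homeomorphic_map (subtopology X (disc_system.skeleton X V E)) (subtopology Y (disc_system.skeleton Y V' E')) F1"
    and \<sigma>: "bij_betw \<sigma> V V'" and \<iota>: "bij_betw \<iota> E E'"
    and \<sigma>_sk: "\<And>v. v \<in> V \<Longrightarrow> F1 ` (v \<inter> disc_system.skeleton X V E) = \<sigma> v \<inter> disc_system.skeleton Y V' E'"
    and \<iota>_sk: "\<And>e. e \<in> E \<Longrightarrow> F1 ` (e \<inter> disc_system.skeleton X V E) = \<iota> e \<inter> disc_system.skeleton Y V' E'"
  shows "\<exists>F. homeomorphic_map X Y F \<and> (\<forall>v \<in> V. F ` v = \<sigma> v) \<and> (\<forall>e \<in> E. F ` e = \<iota> e)"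
proof -
  interpret G: disc_system X V E by fact
  interpret H: disc_system Y V' E' by fact
  interpret Gs: disc_system X E V by (rule disc_system_swap [OF G])
  interpret Hs: disc_system Y E' V' by (rule disc_system_swap [OF H])
  let ?\<Gamma> = "G.skeleton" and ?\<Gamma>' = "H.skeleton"
  have bd_sub: "disc_boundary X D \<subseteq> topspace X" if "D \<in> V \<union> E" for D
    using that disc_boundary_subset [OF G.X, of D] G.top by blast
  have bd_sub': "disc_boundary Y D \<subseteq> topspace Y" if "D \<in> V' \<union> E'" for D
    using that disc_boundary_subset [OF H.X, of D] H.top by blast
  have \<Gamma>: "?\<Gamma> \<subseteq> topspace X"
    unfolding G.skeleton_def using bd_sub G.joined_VD(1) Gs.joined_VD(1) by (intro Un_least UN_least) blast+
  have \<Gamma>': "?\<Gamma>' \<subseteq> topspace Y"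
    unfolding H.skeleton_def using bd_sub' H.joined_VD(1) Hs.joined_VD(1) by (intro Un_least UN_least) blast+
  have ext: "\<exists>\<psi>. continuous_map (subtopology X D) Y \<psi> \<and> bij_betw \<psi> D D' \<and> (\<forall>x \<in> D \<inter> ?\<Gamma>. \<psi> x = F1 x)"
    if "is_disc X D" "is_disc Y D'" "F1 ` (D \<inter> ?\<Gamma>) = D' \<inter> ?\<Gamma>'"
      and c: "D \<inter> ?\<Gamma> = disc_boundary X D \<or> D \<inter> ?\<Gamma> = {}"
      and c': "D' \<inter> ?\<Gamma>' = disc_boundary Y D' \<or> D' \<inter> ?\<Gamma>' = {}" for D D'
  proof (cases "D \<inter> ?\<Gamma> = {}")
    case True
    then show ?thesis using disc_homeomorphism [OF G.X H.X that(1,2)] by simp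
  next
    case False
    then have D: "D \<inter> ?\<Gamma> = disc_boundary X D" using c by blast
    have "D' \<inter> ?\<Gamma>' \<noteq> {}" using False that(3) by blast
    then have D': "D' \<inter> ?\<Gamma>' = disc_boundary Y D'" using c' by blast
    have sub: "disc_boundary X D \<subseteq> ?\<Gamma>" using D by blast
    have im: "F1 ` disc_boundary X D = disc_boundary Y D'" using that(3) unfolding D D' .
    show ?thesis unfolding D
      using disc_extension [OF G.X H.X that(1,2)] homeomorphic_map_restrict_cont [OF F1 \<Gamma> \<Gamma>' sub]
      unfolding im by blast
  qed
  have cV: "v \<inter> ?\<Gamma> = disc_boundary X v \<or> v \<inter> ?\<Gamma> = {}" if "v \<in> V" for v
    using G.V_Int_skeleton [OF that] by (simp split: if_splits)
  have cE: "v \<inter> ?\<Gamma> = disc_boundary X v \<or> v \<inter> ?\<Gamma> = {}" if "v \<in> E" for v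
    using Gs.V_Int_skeleton [OF that] by (simp add: G.skeleton_swap split: if_splits)
  have cV': "v \<inter> ?\<Gamma>' = disc_boundary Y v \<or> v \<inter> ?\<Gamma>' = {}" if "v \<in> V'" for v
    using H.V_Int_skeleton [OF that] by (simp split: if_splits)
  have cE': "v \<inter> ?\<Gamma>' = disc_boundary Y v \<or> v \<inter> ?\<Gamma>' = {}" if "v \<in> E'" for v
    using Hs.V_Int_skeleton [OF that] by (simp add: H.skeleton_swap split: if_splits)
  have \<sigma>V: "\<sigma> v \<in> V'" if "v \<in> V" for v by (rule bij_betw_apply [OF \<sigma> that])
  have \<iota>E: "\<iota> e \<in> E'" if "e \<in> E" for e by (rule bij_betw_apply [OF \<iota> that])
  have exV: "\<forall>v \<in> V. \<exists>\<psi>. continuous_map (subtopology X v) Y \<psi> \<and> bij_betw \<psi> v (\<sigma> v) \<and> (\<forall>x \<in> v \<inter> ?\<Gamma>. \<psi> x = F1 x)"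
    using ext G.disc_V H.disc_V \<sigma>V \<sigma>_sk cV cV' by simp
  have exE: "\<forall>v \<in> E. \<exists>\<psi>. continuous_map (subtopology X v) Y \<psi> \<and> bij_betw \<psi> v (\<iota> v) \<and> (\<forall>x \<in> v \<inter> ?\<Gamma>. \<psi> x = F1 x)"
    using ext G.disc_E H.disc_E \<iota>E \<iota>_sk cE cE' by simp
  obtain \<psi>V where \<psi>V: "\<forall>v \<in> V. continuous_map (subtopology X v) Y (\<psi>V v) \<and> bij_betw (\<psi>V v) v (\<sigma> v) \<and> (\<forall>x \<in> v \<inter> ?\<Gamma>. \<psi>V v x = F1 x)"
    using bchoice [OF exV] by blast
  obtain \<psi>E where \<psi>E: "\<forall>v \<in> E. continuous_map (subtopology X v) Y (\<psi>E v) \<and> bij_betw (\<psi>E v) v (\<iota> v) \<and> (\<forall>x \<in> v \<inter> ?\<Gamma>. \<psi>E v x = F1 x)"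
    using bchoice [OF exE] by blast
  define J where "J = Inl ` V \<union> Inr ` E"
  \<comment> \<open>None stands for the skeleton, which covers the overlaps of the discs\<close>
  define I where "I = insert None (Some ` J)"
  define D where "D = case_sum (\<lambda>v::'a set. v) (\<lambda>e::'a set. e)"
  define T where "T = case_sum \<sigma> \<iota>"
  define \<psi> where "\<psi> = case_sum \<psi>V \<psi>E"
  have \<psi>: "continuous_map (subtopology X (D d)) Y (\<psi> d)" "bij_betw (\<psi> d) (D d) (T d)"
    "\<And>x. x \<in> D d \<inter> ?\<Gamma> \<Longrightarrow> \<psi> d x = F1 x" if "d \<in> J" for d
    using that \<psi>V \<psi>E by (auto simp: J_def D_def T_def \<psi>_def)
  have T_sk: "F1 ` (D d \<inter> ?\<Gamma>) = T d \<inter> ?\<Gamma>'" if "d \<in> J" for d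
  proof (cases d)
    case (Inl v)
    then show ?thesis using \<sigma>_sk [of v] that by (simp add: J_def D_def T_def image_iff)
  next
    case (Inr e)
    then show ?thesis using \<iota>_sk [of e] that by (simp add: J_def D_def T_def image_iff)
  qed
  have compD: "compactin X (D d)" if "d \<in> J" for d
    using that is_disc_compactin [OF G.X] G.disc_V G.disc_E by (auto simp: J_def D_def)
  have UD: "(\<Union>d \<in> J. D d) = topspace X" by (auto simp: G.top J_def D_def)
  have UT: "(\<Union>d \<in> J. T d) = topspace Y"
    using \<sigma> \<iota> by (auto simp: H.top J_def T_def bij_betw_def)
  have overD: "x \<in> ?\<Gamma>" if d: "d \<in> J" "d' \<in> J" "d \<noteq> d'" and x: "x \<in> D d" "x \<in> D d'" for d d' x
  proof -
    have VE: "x \<in> ?\<Gamma>" if "v \<in> V" "e \<in> E" "x \<in> v" "x \<in> e" for v e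
    proof -
      have "v \<in> G.joined_V" using that by (auto simp: G.joined_V_def)
      then show ?thesis using G.overlap_boundary(1) [OF that] by (auto simp: G.skeleton_def)
    qed
    have VV: "v = w" if "v \<in> V" "w \<in> V" "x \<in> v" "x \<in> w" for v w
      using G.disj_V that by (auto simp only: disjoint_def)
    have EE: "v = w" if "v \<in> E" "w \<in> E" "x \<in> v" "x \<in> w" for v w
      using G.disj_E that by (auto simp only: disjoint_def)
    consider v w where "v \<in> V" "w \<in> V" "d = Inl v" "d' = Inl w" | v w where "v \<in> V" "w \<in> E" "d = Inl v" "d' = Inr w"
      | v w where "v \<in> E" "w \<in> V" "d = Inr v" "d' = Inl w" | v w where "v \<in> E" "w \<in> E" "d = Inr v" "d' = Inr w"
      using d(1,2) unfolding J_def by blast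
    then show ?thesis
    proof cases
      case (1 v w) then show ?thesis using VV [of v w] x d(3) by (auto simp: D_def)
    next
      case (2 v w) then show ?thesis using VE [of v w] x by (auto simp: D_def)
    next
      case (3 v w) then show ?thesis using VE [of w v] x by (auto simp: D_def)
    next
      case (4 v w) then show ?thesis using EE [of v w] x d(3) by (auto simp: D_def)
    qed
  qed
  have overT: "x \<in> ?\<Gamma>'" if d: "d \<in> J" "d' \<in> J" "d \<noteq> d'" and x: "x \<in> T d" "x \<in> T d'" for d d' x
  proof -
    have VE: "x \<in> ?\<Gamma>'" if "v \<in> V'" "e \<in> E'" "x \<in> v" "x \<in> e" for v e
    proof -
      have "v \<in> H.joined_V" using that by (auto simp: H.joined_V_def)
      then show ?thesis using H.overlap_boundary(1) [OF that] by (auto simp: H.skeleton_def)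
    qed
    have VV: "v = w" if "v \<in> V" "w \<in> V" "x \<in> \<sigma> v" "x \<in> \<sigma> w" for v w
    proof -
      have "\<sigma> v = \<sigma> w" using H.disj_V \<sigma>V [OF that(1)] \<sigma>V [OF that(2)] that(3,4) by (auto simp: disjoint_def)
      then show ?thesis using \<sigma> that(1,2) by (auto simp: bij_betw_def dest: inj_onD)
    qed
    have EE: "v = w" if "v \<in> E" "w \<in> E" "x \<in> \<iota> v" "x \<in> \<iota> w" for v w
    proof -
      have "\<iota> v = \<iota> w" using H.disj_E \<iota>E [OF that(1)] \<iota>E [OF that(2)] that(3,4) by (auto simp: disjoint_def)
      then show ?thesis using \<iota> that(1,2) by (auto simp: bij_betw_def dest: inj_onD)
    qed
    consider v w where "v \<in> V" "w \<in> V" "d = Inl v" "d' = Inl w" | v w where "v \<in> V" "w \<in> E" "d = Inl v" "d' = Inr w"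
      | v w where "v \<in> E" "w \<in> V" "d = Inr v" "d' = Inl w" | v w where "v \<in> E" "w \<in> E" "d = Inr v" "d' = Inr w"
      using d(1,2) unfolding J_def by blast
    then show ?thesis
    proof cases
      case (1 v w) then show ?thesis using VV [of v w] x d(3) by (auto simp: T_def)
    next
      case (2 v w) then show ?thesis using VE [OF \<sigma>V \<iota>E, of v w] x by (auto simp: T_def)
    next
      case (3 v w) then show ?thesis using VE [OF \<sigma>V \<iota>E, of w v] x by (auto simp: T_def)
    next
      case (4 v w) then show ?thesis using EE [of v w] x d(3) by (auto simp: T_def)
    qed
  qed
  have comp\<Gamma>: "compactin X ?\<Gamma>"
  proof -
    have "compactin X (\<Union>v \<in> G.joined_V. disc_boundary X v)"
      using G.fin_V disc_boundary_compactin [OF G.X G.disc_V [OF G.joined_VD(1)]]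
      by (intro compactin_Union) (auto simp: G.joined_V_def)
    moreover have "compactin X (\<Union>v \<in> Gs.joined_V. disc_boundary X v)"
      using Gs.fin_V disc_boundary_compactin [OF G.X Gs.disc_V [OF Gs.joined_VD(1)]]
      by (intro compactin_Union) (auto simp: Gs.joined_V_def)
    ultimately show ?thesis unfolding G.skeleton_def by (rule compactin_Un)
  qed
  have F1_bij: "bij_betw F1 ?\<Gamma> ?\<Gamma>'"
  proof -
    have "F1 ` ?\<Gamma> = ?\<Gamma>'" using homeomorphic_imp_surjective_map [OF F1] \<Gamma> \<Gamma>' by (simp add: Int_absorb1)
    then show ?thesis using homeomorphic_map_restrict_cont(2) [OF F1 \<Gamma> \<Gamma>' order_refl] by simp
  qed
  define K where "K = case_option ?\<Gamma> D"
  define U where "U = case_option ?\<Gamma> (\<lambda>d. D d - ?\<Gamma>)"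
  define W where "W = case_option ?\<Gamma>' (\<lambda>d. T d - ?\<Gamma>')"
  define \<Phi> where "\<Phi> = case_option F1 \<psi>"
  have "\<exists>F. homeomorphic_map X Y F \<and> (\<forall>i \<in> I. \<forall>x \<in> K i. F x = \<Phi> i x)"
  proof (rule glue_homeomorphism [where U = U and W = W])
    show "Hausdorff_space X" "Hausdorff_space Y" by (rule G.X, rule H.X)
    show "finite I" using G.fin_V G.fin_E by (simp add: I_def J_def)
    show "topspace X = (\<Union>i \<in> I. U i)" using UD \<Gamma> by (auto simp: I_def U_def)
    show "topspace Y = (\<Union>i \<in> I. W i)" using UT \<Gamma>' by (auto simp: I_def W_def)
  next
    fix i assume i: "i \<in> I"
    show "compactin X (K i)" using i compD comp\<Gamma> by (auto simp: I_def K_def)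
    show "continuous_map (subtopology X (K i)) Y (\<Phi> i)"
      using i \<psi>(1) homeomorphic_map_restrict_cont(1) [OF F1 \<Gamma> \<Gamma>' order_refl] by (auto simp: I_def K_def \<Phi>_def)
    show "U i \<subseteq> K i" using i by (auto simp: I_def U_def K_def)
    show "bij_betw (\<Phi> i) (U i) (W i)"
    proof (cases i)
      case None then show ?thesis using F1_bij by (simp add: U_def W_def \<Phi>_def)
    next
      case (Some d)
      then have d: "d \<in> J" using i by (auto simp: I_def)
      have "bij_betw (\<psi> d) (D d - D d \<inter> ?\<Gamma>) (T d - \<psi> d ` (D d \<inter> ?\<Gamma>))"
        by (rule bij_betw_minus_image [OF \<psi>(2) [OF d]]) auto
      moreover have "\<psi> d ` (D d \<inter> ?\<Gamma>) = T d \<inter> ?\<Gamma>'"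
        unfolding T_sk [OF d, symmetric] by (rule image_cong [OF HOL.refl]) (rule \<psi>(3) [OF d])
      moreover have "D d - D d \<inter> ?\<Gamma> = D d - ?\<Gamma>" "T d - T d \<inter> ?\<Gamma>' = T d - ?\<Gamma>'" by auto
      ultimately show ?thesis using Some by (simp add: U_def W_def \<Phi>_def)
    qed
  next
    fix i j x assume i: "i \<in> I" and j: "j \<in> I" and x: "x \<in> K i" "x \<in> K j"
    have at_\<Gamma>: "\<Phi> k x = F1 x" if "k \<in> I" "x \<in> K k" "x \<in> ?\<Gamma>" for k
      using that \<psi>(3) by (cases k) (auto simp: I_def K_def \<Phi>_def)
    show "\<Phi> i x = \<Phi> j x"
    proof (cases "i = j")
      case False
      then have "x \<in> ?\<Gamma>"
        using i j x overD by (cases i; cases j) (auto simp: I_def K_def)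
      then show ?thesis using at_\<Gamma> [OF i x(1)] at_\<Gamma> [OF j x(2)] by simp
    qed simp
  next
    fix i j assume i: "i \<in> I" and j: "j \<in> I" and ij: "i \<noteq> j"
    then show "W i \<inter> W j = {}"
      using overT by (cases i; cases j) (auto simp: I_def W_def)
  qed
  then obtain F where F: "homeomorphic_map X Y F" "\<And>i x. \<lbrakk>i \<in> I; x \<in> K i\<rbrakk> \<Longrightarrow> F x = \<Phi> i x" by blast
  have FD: "F ` D d = T d" if "d \<in> J" for d
  proof -
    have "F ` D d = \<psi> d ` D d"
      using F(2) [of "Some d"] that by (intro image_cong HOL.refl) (simp add: I_def K_def \<Phi>_def)
    then show ?thesis using \<psi>(2) [OF that] by (simp add: bij_betw_def)
  qed
  have "F ` v = \<sigma> v" if "v \<in> V" for v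
    using FD [of "Inl v"] that by (simp add: J_def D_def T_def)
  moreover have "F ` e = \<iota> e" if "e \<in> E" for e
    using FD [of "Inr e"] that by (simp add: J_def D_def T_def)
  ultimately show ?thesis using F(1) by blast
qed

text \<open>
  The incidences of the end points with the arcs determine a disc system: they determine the
  graph formed by the boundary circles, the circles of the vertices are the components of a
  subgraph, and homeomorphisms of circles extend to the discs.
\<close>

theorem disc_system_unique:
  fixes X :: "'a topology" and Y :: "'b topology"
  assumes G: "disc_system X V E" and H: "disc_system Y V' E'"
    and rE: "\<And>e. e \<in> E \<Longrightarrow> e \<inter> \<Union>V \<noteq> {}" and rE': "\<And>e. e \<in> E' \<Longrightarrow> e \<inter> \<Union>V' \<noteq> {}"
    and \<iota>: "bij_betw \<iota> E E'" and f: "inj_on f (disc_system.points X V E)"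
    and segs: "\<And>e. e \<in> E \<Longrightarrow> ends Y ` disc_segs Y (\<iota> e) V' = (`) f ` ends X ` disc_segs X e V"
    and egaps: "\<And>e. e \<in> E \<Longrightarrow> ends Y ` gap_arcs Y (\<iota> e) (\<Union>V') = (`) f ` ends X ` gap_arcs X e (\<Union>V)"
    and vgaps: "ends Y ` disc_system.gaps_V Y V' E' = (`) f ` ends X ` disc_system.gaps_V X V E"
    and bare: "card {v \<in> V'. v \<inter> \<Union>E' = {}} = card {v \<in> V. v \<inter> \<Union>E = {}}"
  shows "\<exists>F. homeomorphic_map X Y F \<and> (`) F ` V = V' \<and> (\<forall>e \<in> E. F ` e = \<iota> e)"
proof -
  interpret G: disc_system X V E by fact
  interpret H: disc_system Y V' E' by fact
  interpret Gs: disc_system X E V by (rule disc_system_swap [OF G])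
  interpret Hs: disc_system Y E' V' by (rule disc_system_swap [OF H])
  have real_E: "Gs.joined_V = E" "Hs.joined_V = E'" using rE rE' by (auto simp: Gs.joined_V_def Hs.joined_V_def)
  have \<iota>E: "\<iota> e \<in> E'" if "e \<in> E" for e by (rule bij_betw_apply [OF \<iota> that])
  have E': "E' = \<iota> ` E" using \<iota> by (simp add: bij_betw_def)
  have P: "\<forall>A \<in> G.segs. ends X A \<subseteq> G.points" by (auto simp: G.points_def)
  have PV: "\<forall>A \<in> G.gaps_V. ends X A \<subseteq> G.points"
    unfolding G.points_def using G.gaps_V_ends by blast
  have PE: "\<forall>A \<in> Gs.gaps_V. ends X A \<subseteq> G.points"
    unfolding G.points_def using Gs.gaps_V_ends by (simp add: G.segs_swap) blast
  have segs_E: "G.segs = (\<Union>e \<in> E. disc_segs X e V)" using G.segs_swap Gs.segs_def by simp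
  have segs_E': "H.segs = (\<Union>e \<in> E. disc_segs Y (\<iota> e) V')" using H.segs_swap Hs.segs_def E' by simp
  have gaps_E: "Gs.gaps_V = (\<Union>e \<in> E. gap_arcs X e (\<Union>V))" using Gs.gaps_V_def real_E by simp
  have gaps_E': "Hs.gaps_V = (\<Union>e \<in> E. gap_arcs Y (\<iota> e) (\<Union>V'))" using Hs.gaps_V_def real_E E' by simp
  have im_segs: "ends Y ` H.segs = (`) f ` ends X ` G.segs"
    unfolding segs_E segs_E' image_UN using segs by simp
  have im_egaps: "ends Y ` Hs.gaps_V = (`) f ` ends X ` Gs.gaps_V"
    unfolding gaps_E gaps_E' image_UN using egaps by simp
  \<comment> \<open>each kind of arc is matched with the same kind of arc, by means of the ends\<close>
  define \<beta>s where "\<beta>s = (\<lambda>A. inv_into H.segs (ends Y) (f ` ends X A))"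
  define \<beta>v where "\<beta>v = (\<lambda>A. inv_into H.gaps_V (ends Y) (f ` ends X A))"
  define \<beta>e where "\<beta>e = (\<lambda>A. inv_into Hs.gaps_V (ends Y) (f ` ends X A))"
  note bs = induced_bijection [OF G.inj_on_ends_segs H.inj_on_ends_segs f P im_segs \<beta>s_def]
  note bv = induced_bijection [OF G.inj_on_ends_gaps_V H.inj_on_ends_gaps_V f PV vgaps \<beta>v_def]
  note be = induced_bijection [OF Gs.inj_on_ends_gaps_V Hs.inj_on_ends_gaps_V f PE im_egaps \<beta>e_def]
  define \<beta> where "\<beta> = (\<lambda>A. if A \<in> G.segs then \<beta>s A else if A \<in> G.gaps_V then \<beta>v A else \<beta>e A)"
  have \<beta>_eq: "A \<in> G.segs \<Longrightarrow> \<beta> A = \<beta>s A" "A \<in> G.gaps_V \<Longrightarrow> \<beta> A = \<beta>v A" "A \<in> Gs.gaps_V \<Longrightarrow> \<beta> A = \<beta>e A" for A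
    using G.kinds_disjoint by (auto simp: \<beta>_def)
  let ?A = "G.segs \<union> G.gaps_V \<union> Gs.gaps_V" and ?B = "H.segs \<union> H.gaps_V \<union> Hs.gaps_V"
  have b1: "bij_betw \<beta> G.segs H.segs" "bij_betw \<beta> G.gaps_V H.gaps_V" "bij_betw \<beta> Gs.gaps_V Hs.gaps_V"
    using bij_betw_cong [of G.segs \<beta> \<beta>s] bij_betw_cong [of G.gaps_V \<beta> \<beta>v] bij_betw_cong [of Gs.gaps_V \<beta> \<beta>e]
      \<beta>_eq bs(1) bv(1) be(1) by simp_all
  have "bij_betw \<beta> (G.segs \<union> G.gaps_V) (H.segs \<union> H.gaps_V)"
    by (rule bij_betw_combine [OF b1(1,2) H.kinds_disjoint(1)])
  moreover have "(H.segs \<union> H.gaps_V) \<inter> Hs.gaps_V = {}" using H.kinds_disjoint by auto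
  ultimately have bij_\<beta>: "bij_betw \<beta> ?A ?B" using b1(3) bij_betw_combine by blast
  have ends_\<beta>: "ends Y (\<beta> A) = f ` ends X A" if "A \<in> ?A" for A
    using that \<beta>_eq [of A] bs(2) [of A] bv(2) [of A] be(2) [of A] by (elim UnE) simp_all
  have "\<Union> (ends X ` ?A) \<subseteq> G.points" using P PV PE by blast
  then have f': "inj_on f (\<Union> (ends X ` ?A))" using f by (rule inj_on_subset [rotated])
  from glue_arcs [OF G.X H.X G.arc_system H.arc_system bij_\<beta> f' ends_\<beta>]
  obtain F1 where F1: "homeomorphic_map (subtopology X G.skeleton) (subtopology Y H.skeleton) F1"
    and F1_A: "\<And>A. A \<in> ?A \<Longrightarrow> F1 ` A = \<beta> A"
    unfolding G.skeleton_eq H.skeleton_eq by blast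
  have F1_Un: "F1 ` \<Union>\<L> = \<Union> (\<beta> ` \<L>)" if "\<L> \<subseteq> ?A" for \<L>
  proof -
    have "F1 ` \<Union>\<L> = (\<Union>A \<in> \<L>. F1 ` A)" by blast
    also have "\<dots> = (\<Union>A \<in> \<L>. \<beta> A)" using F1_A that by (intro SUP_cong) auto
    finally show ?thesis .
  qed
  have sub_sk: "disc_boundary X D \<subseteq> G.skeleton" if "D \<in> G.joined_V \<or> D \<in> Gs.joined_V" for D
    using that by (auto simp: G.skeleton_def)
  have F1_e: "F1 ` disc_boundary X e = disc_boundary Y (\<iota> e)" if e: "e \<in> E" for e
  proof -
    have L: "disc_segs X e V \<subseteq> G.segs" "disc_segs Y (\<iota> e) V' \<subseteq> H.segs"
      "gap_arcs X e (\<Union>V) \<subseteq> Gs.gaps_V" "gap_arcs Y (\<iota> e) (\<Union>V') \<subseteq> Hs.gaps_V"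
      using e unfolding segs_E segs_E' gaps_E gaps_E' by blast+
    have "\<beta> ` disc_segs X e V = \<beta>s ` disc_segs X e V" using \<beta>_eq(1) L(1) by (intro image_cong) auto
    also have "\<dots> = disc_segs Y (\<iota> e) V'" by (rule bs(3) [OF L(1,2) segs [OF e]])
    finally have 1: "\<beta> ` disc_segs X e V = disc_segs Y (\<iota> e) V'" .
    have "\<beta> ` gap_arcs X e (\<Union>V) = \<beta>e ` gap_arcs X e (\<Union>V)" using \<beta>_eq(3) L(3) by (intro image_cong) auto
    also have "\<dots> = gap_arcs Y (\<iota> e) (\<Union>V')" by (rule be(3) [OF L(3,4) egaps [OF e]])
    finally have 2: "\<beta> ` gap_arcs X e (\<Union>V) = gap_arcs Y (\<iota> e) (\<Union>V')" .
    have bX: "disc_boundary X e = \<Union> (disc_segs X e V) \<union> \<Union> (gap_arcs X e (\<Union>V))"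
      using Gs.joined_V_boundary e real_E by simp
    have bY: "disc_boundary Y (\<iota> e) = \<Union> (disc_segs Y (\<iota> e) V') \<union> \<Union> (gap_arcs Y (\<iota> e) (\<Union>V'))"
      using Hs.joined_V_boundary \<iota>E [OF e] real_E by simp
    have "disc_segs X e V \<subseteq> ?A" "gap_arcs X e (\<Union>V) \<subseteq> ?A" using L by auto
    then show ?thesis unfolding bX bY image_Un by (simp only: F1_Un 1 2)
  qed
  \<comment> \<open>the components of C are the circles of the vertices, so F1 carries circles of vertices to circles of vertices\<close>
  define C where "C = (\<Union>v \<in> G.joined_V. disc_boundary X v)"
  define C' where "C' = (\<Union>v \<in> H.joined_V. disc_boundary Y v)"
  have F1_C: "F1 ` C = C'"
  proof -
    have "F1 ` C = F1 ` \<Union> (G.segs \<union> G.gaps_V)" unfolding C_def G.Union_boundaries by simp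
    also have "\<dots> = \<Union> (\<beta> ` (G.segs \<union> G.gaps_V))" by (rule F1_Un) auto
    also have "\<beta> ` (G.segs \<union> G.gaps_V) = H.segs \<union> H.gaps_V"
      using b1(1,2) by (simp add: image_Un bij_betw_def)
    also have "\<Union> \<dots> = C'" unfolding C'_def H.Union_boundaries by simp
    finally show ?thesis .
  qed
  have bd_sub: "disc_boundary X D \<subseteq> topspace X" if "D \<in> V \<union> E" for D
    using that disc_boundary_subset [OF G.X, of D] G.top by blast
  have bd_sub': "disc_boundary Y D \<subseteq> topspace Y" if "D \<in> V' \<union> E'" for D
    using that disc_boundary_subset [OF H.X, of D] H.top by blast
  have \<Gamma>: "G.skeleton \<subseteq> topspace X"
    unfolding G.skeleton_def using bd_sub G.joined_VD(1) Gs.joined_VD(1) by (intro Un_least UN_least) blast+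
  have \<Gamma>': "H.skeleton \<subseteq> topspace Y"
    unfolding H.skeleton_def using bd_sub' H.joined_VD(1) Hs.joined_VD(1) by (intro Un_least UN_least) blast+
  have "C \<subseteq> G.skeleton" by (auto simp: C_def G.skeleton_def)
  from homeomorphic_map_subset [OF F1 \<Gamma> \<Gamma>' this]
  have "homeomorphic_map (subtopology X C) (subtopology Y C') F1" by (simp only: F1_C)
  from homeomorphic_map_connected_components_of [OF this]
  have bds: "disc_boundary Y ` H.joined_V = (`) F1 ` disc_boundary X ` G.joined_V"
    unfolding C_def C'_def G.boundary_components(1) H.boundary_components(1) .
  have F1_inj: "inj_on F1 G.skeleton"
    using homeomorphic_map_restrict_cont(2) [OF F1 \<Gamma> \<Gamma>' order_refl] by (simp add: bij_betw_def)
  have sub_sk': "\<forall>v \<in> G.joined_V. disc_boundary X v \<subseteq> G.skeleton" using sub_sk by simp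
  define \<sigma>r where "\<sigma>r = (\<lambda>v. inv_into H.joined_V (disc_boundary Y) (F1 ` disc_boundary X v))"
  note sr = induced_bijection [OF G.boundary_components(2) H.boundary_components(2) F1_inj sub_sk' bds \<sigma>r_def]
  have "finite {v \<in> V. v \<inter> \<Union>E = {}}" "finite {v \<in> V'. v \<inter> \<Union>E' = {}}" using G.fin_V H.fin_V by simp_all
  \<comment> \<open>discs that meet no edge can be matched arbitrarily\<close>
  from finite_same_card_bij [OF this bare [symmetric]]
  obtain \<tau> where \<tau>: "bij_betw \<tau> {v \<in> V. v \<inter> \<Union>E = {}} {v \<in> V'. v \<inter> \<Union>E' = {}}" by blast
  define \<sigma> where "\<sigma> = (\<lambda>v. if v \<in> G.joined_V then \<sigma>r v else \<tau> v)"
  have "bij_betw \<sigma> G.joined_V H.joined_V"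
    using sr(1) bij_betw_cong [of G.joined_V \<sigma> \<sigma>r] by (simp add: \<sigma>_def)
  moreover have "bij_betw \<sigma> {v \<in> V. v \<inter> \<Union>E = {}} {v \<in> V'. v \<inter> \<Union>E' = {}}"
    using \<tau> bij_betw_cong [of "{v \<in> V. v \<inter> \<Union>E = {}}" \<sigma> \<tau>] by (simp add: \<sigma>_def G.joined_V_def)
  moreover have "H.joined_V \<inter> {v \<in> V'. v \<inter> \<Union>E' = {}} = {}" by (auto simp: H.joined_V_def)
  ultimately have "bij_betw \<sigma> (G.joined_V \<union> {v \<in> V. v \<inter> \<Union>E = {}}) (H.joined_V \<union> {v \<in> V'. v \<inter> \<Union>E' = {}})"
    by (rule bij_betw_combine)
  moreover have "G.joined_V \<union> {v \<in> V. v \<inter> \<Union>E = {}} = V" "H.joined_V \<union> {v \<in> V'. v \<inter> \<Union>E' = {}} = V'"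
    by (auto simp: G.joined_V_def H.joined_V_def)
  ultimately have \<sigma>: "bij_betw \<sigma> V V'" by simp
  have \<sigma>V: "\<sigma> v \<in> V'" if "v \<in> V" for v by (rule bij_betw_apply [OF \<sigma> that])
  have \<sigma>_sk: "F1 ` (v \<inter> G.skeleton) = \<sigma> v \<inter> H.skeleton" if v: "v \<in> V" for v
  proof (cases "v \<in> G.joined_V")
    case True
    then have "\<sigma> v \<in> H.joined_V" using bij_betw_apply [OF sr(1)] by (simp add: \<sigma>_def)
    moreover have "disc_boundary Y (\<sigma> v) = F1 ` disc_boundary X v" using sr(2) [OF True] True by (simp add: \<sigma>_def)
    ultimately show ?thesis
      using G.V_Int_skeleton [OF v] H.V_Int_skeleton [OF \<sigma>V [OF v]] True by simp
  next
    case False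
    then have "\<tau> v \<in> {v \<in> V'. v \<inter> \<Union>E' = {}}" using v by (intro bij_betw_apply [OF \<tau>]) (auto simp: G.joined_V_def)
    then have "\<sigma> v \<notin> H.joined_V" using False by (simp add: \<sigma>_def H.joined_V_def)
    then show ?thesis using G.V_Int_skeleton [OF v] H.V_Int_skeleton [OF \<sigma>V [OF v]] False by simp
  qed
  have \<iota>_sk: "F1 ` (e \<inter> G.skeleton) = \<iota> e \<inter> H.skeleton" if e: "e \<in> E" for e
    using Gs.V_Int_skeleton [OF e] Hs.V_Int_skeleton [OF \<iota>E [OF e]] real_E e \<iota>E [OF e] F1_e [OF e]
    by (simp add: G.skeleton_swap H.skeleton_swap)
  from glue_discs [OF G H F1 \<sigma> \<iota> \<sigma>_sk \<iota>_sk]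
  obtain F where F: "homeomorphic_map X Y F" "\<forall>v \<in> V. F ` v = \<sigma> v" "\<forall>e \<in> E. F ` e = \<iota> e" by blast
  have "(`) F ` V = \<sigma> ` V" by (rule image_cong [OF HOL.refl]) (use F(2) in simp)
  then have "(`) F ` V = V'" using \<sigma> by (simp add: bij_betw_def)
  with F show ?thesis by blast
qed


section \<open>Ribbon graphs and their arrow presentations\<close>

lemma segments_eq: "segments G v e = comps (surface G) (v \<inter> e)"
  by (simp add: segments_def)

lemma disc_segs_edge: "disc_segs (surface G) e (verts G) = (\<Union>v \<in> verts G. segments G v e)"
  by (simp add: disc_segs_def segments_eq Int_commute)

lemma card_disc_segs_edge:
  "\<lbrakk>ribbon_graph G; e \<in> edges G\<rbrakk> \<Longrightarrow> card (disc_segs (surface G) e (verts G)) = 2"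
  unfolding disc_segs_edge by (simp add: ribbon_graph_def)

lemma ribbon_disc_system:
  assumes G: "ribbon_graph G" shows "disc_system (surface G) (verts G) (edges G)"
proof
  note * = G [unfolded ribbon_graph_def segments_eq]
  show "Hausdorff_space (surface G)" "topspace (surface G) = \<Union> (verts G) \<union> \<Union> (edges G)"
    "finite (verts G)" "finite (edges G)" "disjoint (verts G)" "disjoint (edges G)"
    using * by simp_all
  show "is_disc (surface G) v" if "v \<in> verts G" for v using * that by simp
  show "is_disc (surface G) v" if "v \<in> edges G" for v using * that by simp
  fix v e assume ve: "v \<in> verts G" "e \<in> edges G"
  show "is_segment (surface G) s" if "s \<in> comps (surface G) (v \<inter> e)" for s using * that ve by simp
  show "s \<subseteq> disc_boundary (surface G) v" if "s \<in> comps (surface G) (v \<inter> e)" for s using * that ve by simp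
  show "s \<subseteq> disc_boundary (surface G) e" if "s \<in> comps (surface G) (v \<inter> e)" for s using * that ve by simp
  have "finite (disc_segs (surface G) e (verts G))"
    using card_disc_segs_edge [OF G ve(2)] by (intro card_ge_0_finite) simp
  moreover have "comps (surface G) (v \<inter> e) \<subseteq> disc_segs (surface G) e (verts G)"
    using ve(1) unfolding disc_segs_edge segments_eq by blast
  ultimately show "finite (comps (surface G) (v \<inter> e))" by (rule finite_subset [rotated])
qed

lemma ribbon_edge_marked:
  assumes G: "ribbon_graph G" and e: "e \<in> edges G"
  shows "marked_disc (surface G) e (\<Union> (verts G)) (disc_segs (surface G) e (verts G))"
    "e \<inter> \<Union> (verts G) \<noteq> {}"
proof -
  interpret disc_system "surface G" "edges G" "verts G"
    by (rule disc_system_swap [OF ribbon_disc_system [OF G]])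
  obtain s where s: "s \<in> disc_segs (surface G) e (verts G)"
    using card_disc_segs_edge [OF G e] by fastforce
  then obtain v where "v \<in> verts G" "s \<in> comps (surface G) (e \<inter> v)" by (rule disc_segsE)
  then have "s \<noteq> {}" using nonempty_connected_components_of by blast
  then show nb: "e \<inter> \<Union> (verts G) \<noteq> {}" using Union_disc_segs [OF e] s by blast
  show "marked_disc (surface G) e (\<Union> (verts G)) (disc_segs (surface G) e (verts G))"
    by (rule marked_disc [OF e nb])
qed

lemma ribbon_gaps_eq:
  assumes G: "ribbon_graph G"
  shows "ribbon_gaps G = ends (surface G) ` disc_system.gaps_V (surface G) (verts G) (edges G)"
proof -
  interpret disc_system "surface G" "verts G" "edges G" by (rule ribbon_disc_system [OF G])
  let ?X = "surface G" and ?M = "\<Union> (edges G)"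
  have chart: "marked_chart ?X v ?M (disc_segs ?X v (edges G)) h" if "v \<in> joined_V" "disc_param ?X v h" for v h
    using joined_VD(2) [OF that(1)] that(2) by (simp add: marked_chart_def marked_chart_axioms_def)
  show ?thesis
  proof (intro equalityI subsetI)
    fix g assume "g \<in> ribbon_gaps G"
    then obtain v h s t where v: "v \<in> verts G" and h: "disc_param ?X v h" and st: "s < t"
      "h (cis s) \<in> ?M" "h (cis t) \<in> ?M" "\<forall>u. s < u \<and> u < t \<longrightarrow> h (cis u) \<notin> ?M"
      and g: "g = {h (cis s), h (cis t)}"
      unfolding ribbon_gaps_def disc_chart_iff [OF X] by blast
    have "h (cis s) \<in> v" using h by (auto simp: disc_param_def)
    then have r: "v \<in> joined_V" using v st(2) by (auto simp: joined_V_def)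
    have "g \<in> ends ?X ` gap_arcs ?X v ?M"
      unfolding marked_chart.chart_gap_ends [OF chart [OF r h], symmetric] using st g by blast
    then show "g \<in> ends ?X ` gaps_V" using r by (auto simp: gaps_V_def)
  next
    fix g assume "g \<in> ends ?X ` gaps_V"
    then obtain v where r: "v \<in> joined_V" and g: "g \<in> ends ?X ` gap_arcs ?X v ?M" by (auto simp: gaps_V_def)
    obtain h where h: "disc_param ?X v h"
      using disc_V [OF joined_VD(1) [OF r]] X by (auto simp: is_disc_def disc_chart_iff)
    from g obtain s t where "s < t" "h (cis s) \<in> ?M" "h (cis t) \<in> ?M"
      "\<forall>u. s < u \<and> u < t \<longrightarrow> h (cis u) \<notin> ?M" "g = {h (cis s), h (cis t)}"
      unfolding marked_chart.chart_gap_ends [OF chart [OF r h], symmetric] by blast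
    then show "g \<in> ribbon_gaps G"
      unfolding ribbon_gaps_def disc_chart_iff [OF X] using joined_VD(1) [OF r] h by blast
  qed
qed

fun pair_points :: "'p arrow \<times> 'p arrow \<Rightarrow> 'p set" where
  "pair_points ((a, b), (c, d)) = {a, b, c, d}"

fun pair_distinct :: "'p arrow \<times> 'p arrow \<Rightarrow> bool" where
  "pair_distinct ((a, b), (c, d)) \<longleftrightarrow> distinct [a, b, c, d]"

text \<open>
  The boundary of an edge pairs the four ends of its arrows in two ways: by the segments, and
  by the two free sides of the edge. If both arrows follow one orientation of the boundary, the
  free sides lead from the head of one arrow to the tail of the other.
\<close>

fun seg_ends :: "'p arrow \<times> 'p arrow \<Rightarrow> 'p set set" where
  "seg_ends ((a, b), (c, d)) = {{a, b}, {c, d}}"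

fun free_ends :: "'p arrow \<times> 'p arrow \<Rightarrow> 'p set set" where
  "free_ends ((a, b), (c, d)) = {{b, c}, {d, a}}"

lemma (in marked_disc) SS_components: "comps X (D \<inter> M) = SS"
  unfolding Un [symmetric]
  using fin disj is_segment_closedin [OF X seg] is_segment_connectedin [OF X seg] is_segment_nonempty [OF X seg]
  by (intro connected_components_of_partition) auto

text \<open>
  The chart runs through the four ends in the order of a, b, c, d, and two disjoint arcs of a
  circle leave two complementary arcs.
\<close>

lemma (in marked_chart) two_arcs:
  assumes DM: "D \<inter> M = h ` cis ` {a..b} \<union> h ` cis ` {c..d}"
    and o: "a < b" "b < c" "c < d" "d < a + 2 * pi"
  shows "SS = {h ` cis ` {a..b}, h ` cis ` {c..d}}" "gap b c" "gap d (a + 2 * pi)"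
    "distinct [h (cis a), h (cis b), h (cis c), h (cis d)]"
    "ends X ` SS = {{h (cis a), h (cis b)}, {h (cis c), h (cis d)}}"
    "ends X ` gap_arcs X D M = {{h (cis b), h (cis c)}, {h (cis d), h (cis a)}}"
proof -
  let ?S1 = "h ` cis ` {a..b}" and ?S2 = "h ` cis ` {c..d}"
  have ab: "b < a + 2 * pi" and cd: "d < c + 2 * pi" using o by auto
  have seg1: "is_segment X ?S1" "ends X ?S1 = {h (cis a), h (cis b)}"
    using cis_arc_segment [OF X h o(1) ab] by simp_all
  have seg2: "is_segment X ?S2" "ends X ?S2 = {h (cis c), h (cis d)}"
    using cis_arc_segment [OF X h o(3) cd] by simp_all
  have ne: "h (cis s) \<noteq> h (cis t)" if "a \<le> s" "s < t" "t < a + 2 * pi" for s t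
    using h_inj [of s t] cis_inj [of s t] that by auto
  have S12: "?S1 \<inter> ?S2 = {}"
  proof -
    have False if x1: "x \<in> ?S1" and x2: "x \<in> ?S2" for x
    proof -
      obtain s where s: "s \<in> {a..b}" "x = h (cis s)" using x1 by blast
      obtain t where t: "t \<in> {c..d}" "x = h (cis t)" using x2 by blast
      show False using ne [of s t] s t o by auto
    qed
    then show ?thesis by (meson disjoint_iff)
  qed
  have "comps X (\<Union> {?S1, ?S2}) = {?S1, ?S2}"
  proof (rule connected_components_of_partition)
    show "disjoint {?S1, ?S2}" using S12 by (simp add: disjoint_def Int_commute)
    fix A assume "A \<in> {?S1, ?S2}"
    then have A: "is_segment X A" using seg1(1) seg2(1) by (elim insertE) simp_all
    show "closedin X A \<and> connectedin X A \<and> A \<noteq> {}"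
      using is_segment_closedin [OF X A] is_segment_connectedin [OF X A] is_segment_nonempty [OF X A] by simp
  qed simp
  then show SS: "SS = {?S1, ?S2}" using SS_components DM by simp
  show "distinct [h (cis a), h (cis b), h (cis c), h (cis d)]"
    using ne [of a b] ne [of a c] ne [of a d] ne [of b c] ne [of b d] ne [of c d] o by simp
  show "ends X ` SS = {{h (cis a), h (cis b)}, {h (cis c), h (cis d)}}" using SS seg1 seg2 by simp
  have N: "u \<in> N \<longleftrightarrow> (\<exists>m::int. a \<le> u + 2 * pi * m \<and> u + 2 * pi * m \<le> b) \<or>
      (\<exists>m::int. c \<le> u + 2 * pi * m \<and> u + 2 * pi * m \<le> d)" for u
    unfolding N_iff SS by (simp only: Union_insert Union_empty Un_empty_right Un_iff mem_cis_arc)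
  have inN: "u \<in> N" if "a \<le> u \<and> u \<le> b \<or> c \<le> u \<and> u \<le> d" for u
    using that
  proof
    assume "a \<le> u \<and> u \<le> b"
    then have "h (cis u) \<in> ?S1" by (intro imageI) simp
    then show ?thesis using NI [of ?S1] SS by simp
  next
    assume "c \<le> u \<and> u \<le> d"
    then have "h (cis u) \<in> ?S2" by (intro imageI) simp
    then show ?thesis using NI [of ?S2] SS by simp
  qed
  show g1: "gap b c" unfolding gap_def
  proof (intro conjI allI impI)
    fix u assume u: "b < u \<and> u < c"
    show "u \<notin> N"
    proof
      assume "u \<in> N"
      then consider m :: int where "a \<le> u + 2 * pi * m" "u + 2 * pi * m \<le> b"
        | m :: int where "c \<le> u + 2 * pi * m" "u + 2 * pi * m \<le> d" unfolding N by blast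
      then show False
      proof cases
        case 1 then show ?thesis by (rule no_shift_above) (use u o in auto)
      next
        case 2 then show ?thesis by (rule no_shift_below) (use u o in auto)
      qed
    qed
  qed (use o inN in auto)
  show g2: "gap d (a + 2 * pi)" unfolding gap_def
  proof (intro conjI allI impI)
    show "a + 2 * pi \<in> N" using N_shift [of a 1] inN [of a] o by simp
    fix u assume u: "d < u \<and> u < a + 2 * pi"
    show "u \<notin> N"
    proof
      assume "u \<in> N"
      then consider m :: int where "a \<le> u + 2 * pi * m" "u + 2 * pi * m \<le> b"
        | m :: int where "c \<le> u + 2 * pi * m" "u + 2 * pi * m \<le> d" unfolding N by blast
      then show False
      proof cases
        case 1 then show ?thesis by (rule no_shift_above) (use u o in auto)
      next
        case 2 then show ?thesis by (rule no_shift_above) (use u o in auto)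
      qed
    qed
  qed (use o inN in auto)
  have cis2: "cis (a + 2 * pi) = cis a" using cis_shift [of a 1] by simp
  let ?A1 = "h ` cis ` {b..c}" and ?A2 = "h ` cis ` {d..a + 2 * pi}"
  have A1: "?A1 \<in> gap_arcs X D M" "ends X ?A1 = {h (cis b), h (cis c)}"
    using gap_arcI [OF g1] ends_gap [OF g1] by simp_all
  have A2: "?A2 \<in> gap_arcs X D M" "ends X ?A2 = {h (cis d), h (cis a)}"
    using gap_arcI [OF g2] ends_gap [OF g2] cis2 by simp_all
  have "A = ?A1 \<or> A = ?A2" if A: "A \<in> gap_arcs X D M" for A
  proof -
    obtain s t where st: "gap s t" "A = h ` cis ` {s..t}" using A by (rule gap_arcE)
    then have pA: "h (cis s) \<in> ends X A" using ends_gap [OF st(1)] by simp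
    obtain S where S: "S \<in> SS" "h (cis s) \<in> ends X S" using gap_end_in_seg_end [OF A pA] by blast
    then have "h (cis s) \<in> {h (cis b), h (cis c)} \<or> h (cis s) \<in> {h (cis d), h (cis a)}"
      using SS seg1 seg2 by auto
    then have "h (cis s) \<in> ends X ?A1 \<or> h (cis s) \<in> ends X ?A2" using A1(2) A2(2) by simp
    then show ?thesis using unique_gap [OF S] A pA A1(1) A2(1) by blast
  qed
  then have "gap_arcs X D M = {?A1, ?A2}" using A1(1) A2(1) by blast
  then show "ends X ` gap_arcs X D M = {{h (cis b), h (cis c)}, {h (cis d), h (cis a)}}"
    using A1(2) A2(2) by simp
qed

lemma arrow_pair_data:
  assumes G: "ribbon_graph G" and e: "e \<in> edges G" and AB: "arrow_pair_of G e AB"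
  shows "pair_distinct AB" "ends (surface G) ` disc_segs (surface G) e (verts G) = seg_ends AB"
    "ends (surface G) ` gap_arcs (surface G) e (\<Union> (verts G)) = free_ends AB"
proof -
  have X: "Hausdorff_space (surface G)" using G by (simp add: ribbon_graph_def)
  obtain k a b c d where k: "disc_param (surface G) e k"
    and o: "a < b" "b < c" "c < d" "d < a + 2 * pi"
    and eM: "e \<inter> \<Union> (verts G) = k ` cis ` {a..b} \<union> k ` cis ` {c..d}"
    and ABeq: "AB = ((k (cis a), k (cis b)), (k (cis c), k (cis d)))"
    using AB unfolding arrow_pair_of_def disc_chart_iff [OF X] by blast
  interpret marked_chart "surface G" e "\<Union> (verts G)" "disc_segs (surface G) e (verts G)" k
    using ribbon_edge_marked(1) [OF G e] k by (simp add: marked_chart_def marked_chart_axioms_def)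
  note * = two_arcs [OF eM o]
  show "pair_distinct AB" using *(4) by (simp add: ABeq)
  show "ends (surface G) ` disc_segs (surface G) e (verts G) = seg_ends AB"
    unfolding ABeq seg_ends.simps by (rule *(5))
  show "ends (surface G) ` gap_arcs (surface G) e (\<Union> (verts G)) = free_ends AB"
    unfolding ABeq free_ends.simps by (rule *(6))
qed

lemma arrow_pair_exists:
  assumes G: "ribbon_graph G" and e: "e \<in> edges G"
  shows "\<exists>AB. arrow_pair_of G e AB"
proof -
  let ?X = "surface G" and ?SS = "disc_segs (surface G) e (verts G)"
  have X: "Hausdorff_space ?X" using G by (simp add: ribbon_graph_def)
  interpret marked_disc ?X e "\<Union> (verts G)" ?SS by (rule ribbon_edge_marked(1) [OF G e])
  obtain k where "marked_chart ?X e (\<Union> (verts G)) ?SS k" by (rule obtain_chart)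
  then interpret marked_chart ?X e "\<Union> (verts G)" ?SS k .
  obtain S1 S2 where S: "?SS = {S1, S2}" "S1 \<noteq> S2"
    using card_disc_segs_edge [OF G e] by (auto simp: card_2_iff)
  have in_SS: "S1 \<in> ?SS" "S2 \<in> ?SS" using S by simp_all
  obtain a b where ab: "a < b" "b < a + 2 * pi" "S1 = k ` cis ` {a..b}" by (rule seg_arc [OF in_SS(1)])
  obtain c0 d0 where cd0: "c0 < d0" "d0 < c0 + 2 * pi" "S2 = k ` cis ` {c0..d0}" by (rule seg_arc [OF in_SS(2)])
  \<comment> \<open>lift the second segment to the period that starts with the first one; being disjoint from it, it stays inside\<close>
  obtain m :: int where m: "a \<le> c0 + 2 * pi * m" "c0 + 2 * pi * m < a + 2 * pi"
    using shift_into_period [of a c0] by blast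
  define c where "c = c0 + 2 * pi * m"
  define d where "d = d0 + 2 * pi * m"
  have S2: "S2 = k ` cis ` {c..d}" unfolding c_def d_def cis_image_shift by (rule cd0(3))
  have cd: "c < d" "a \<le> c" "c < a + 2 * pi" using m cd0 by (auto simp: c_def d_def)
  have S12: "S1 \<inter> S2 = {}" using disj S by (auto simp: disjoint_def)
  have "b < c"
  proof (rule ccontr)
    assume "\<not> b < c"
    then have "k (cis c) \<in> S1" "k (cis c) \<in> S2" using ab cd S2 by auto
    then show False using S12 by blast
  qed
  moreover have "d < a + 2 * pi"
  proof (rule ccontr)
    assume "\<not> d < a + 2 * pi"
    then have "a + 2 * pi \<in> {c..d}" using cd by auto
    then have "k (cis (a + 2 * pi)) \<in> S2" unfolding S2 by blast
    moreover have "cis (a + 2 * pi) = cis a" using cis_shift [of a 1] by simp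
    moreover have "k (cis a) \<in> S1" using ab by auto
    ultimately show False using S12 by auto
  qed
  moreover have "e \<inter> \<Union> (verts G) = k ` cis ` {a..b} \<union> k ` cis ` {c..d}"
    using Un S ab(3) S2 by auto
  moreover have "disc_chart ?X e k" using h by (simp add: disc_chart_iff [OF X])
  ultimately show ?thesis unfolding arrow_pair_of_def using ab(1) cd(1) by blast
qed

lemma presents_exists: assumes "ribbon_graph G" shows "\<exists>P. presents G P"
proof -
  have "\<forall>e \<in> edges G. \<exists>AB. arrow_pair_of G e AB" using arrow_pair_exists [OF assms] by blast
  then obtain A where "\<forall>e \<in> edges G. arrow_pair_of G e (A e)" by (rule bchoice [THEN exE])
  then have "presents G \<lparr>arrows = A, gaps = ribbon_gaps G, bare = card {v \<in> verts G. v \<inter> \<Union> (edges G) = {}}\<rparr>"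
    by (simp add: presents_def)
  then show ?thesis by blast
qed

lemma presents_data:
  assumes G: "ribbon_graph G" and P: "presents G P" and e: "e \<in> edges G"
  shows "pair_distinct (arrows P e)"
    "ends (surface G) ` disc_segs (surface G) e (verts G) = seg_ends (arrows P e)"
    "ends (surface G) ` gap_arcs (surface G) e (\<Union> (verts G)) = free_ends (arrows P e)"
  using arrow_pair_data [OF G e] P e by (simp_all add: presents_def)

lemma pair_points_seg_ends: "pair_points AB = \<Union> (seg_ends AB)"
  by (cases AB rule: pair_points.cases) auto

lemma arrow_points_eq: "arrow_points L P = (\<Union>e \<in> L. pair_points (arrows P e))"
proof -
  have "(case AB of ((a, b), (c, d)) \<Rightarrow> {a, b, c, d}) = pair_points AB" for AB :: "'a arrow \<times> 'a arrow"
    by (cases AB rule: pair_points.cases) auto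
  then show ?thesis by (simp add: arrow_points_def)
qed

lemma points_eq_arrow_points:
  assumes G: "ribbon_graph G" and P: "presents G P"
  shows "disc_system.points (surface G) (verts G) (edges G) = arrow_points (edges G) P"
proof -
  interpret disc_system "surface G" "verts G" "edges G" by (rule ribbon_disc_system [OF G])
  interpret S: disc_system "surface G" "edges G" "verts G" by (rule disc_system_swap [OF ribbon_disc_system [OF G]])
  have "points = (\<Union>e \<in> edges G. \<Union> (ends (surface G) ` disc_segs (surface G) e (verts G)))"
    unfolding points_def segs_swap [symmetric] S.segs_def by blast
  also have "\<dots> = (\<Union>e \<in> edges G. \<Union> (seg_ends (arrows P e)))"
    by (rule SUP_cong [OF HOL.refl]) (simp only: presents_data(2) [OF G P])
  finally show ?thesis unfolding arrow_points_eq pair_points_seg_ends .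
qed

lemma presents_arrow_points_disjoint:
  assumes G: "ribbon_graph G" and P: "presents G P" and e: "e \<in> edges G" "e' \<in> edges G" "e \<noteq> e'"
  shows "pair_points (arrows P e) \<inter> pair_points (arrows P e') = {}"
proof -
  interpret S: disc_system "surface G" "edges G" "verts G" by (rule disc_system_swap [OF ribbon_disc_system [OF G]])
  have "pair_points (arrows P x) \<subseteq> x" if "x \<in> edges G" for x
  proof -
    have "\<Union> (ends (surface G) ` disc_segs (surface G) x (verts G)) \<subseteq> \<Union> (disc_segs (surface G) x (verts G))"
      using ends_subset by fastforce
    then show ?thesis
      unfolding pair_points_seg_ends presents_data(2) [OF G P that, symmetric]
      using S.Union_disc_segs [OF that] by blast
  qed
  moreover have "e \<inter> e' = {}" using S.disj_V e by (auto simp: disjoint_def)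
  ultimately show ?thesis using e by blast
qed

text \<open>
  Every end of a segment lies on a single vertex, and there it is an end of exactly one
  complementary arc. Hence the gaps are a perfect matching of the ends of arrows.
\<close>

lemma presents_gaps:
  assumes G: "ribbon_graph G" and P: "presents G P"
  shows "\<And>g. g \<in> gaps P \<Longrightarrow> \<exists>p q. p \<noteq> q \<and> g = {p, q}" "\<Union> (gaps P) = arrow_points (edges G) P"
    "disjoint (gaps P)"
proof -
  interpret disc_system "surface G" "verts G" "edges G" by (rule ribbon_disc_system [OF G])
  have g: "gaps P = ends (surface G) ` gaps_V"
    using P ribbon_gaps_eq [OF G] by (simp add: presents_def)
  have pts: "arrow_points (edges G) P = points" by (rule points_eq_arrow_points [OF G P, symmetric])
  have uniq: "\<exists>!A. A \<in> gaps_V \<and> p \<in> ends (surface G) A" if "p \<in> points" for p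
  proof -
    obtain s where s: "s \<in> segs" "p \<in> ends (surface G) s" using \<open>p \<in> points\<close> by (auto simp: points_def)
    obtain v where v: "v \<in> verts G" "s \<in> disc_segs (surface G) v (edges G)" using s(1) by (auto simp: segs_def)
    have "p \<in> s" using s(2) ends_subset [of "surface G" s] by blast
    then have "p \<in> \<Union> (disc_segs (surface G) v (edges G))" using v(2) by blast
    then have "p \<in> v \<inter> \<Union> (edges G)" unfolding Union_disc_segs [OF v(1)] .
    then have r: "v \<in> joined_V" using v(1) by (auto simp: joined_V_def)
    from marked_disc.unique_gap_arc [OF joined_VD(2) [OF r] v(2) s(2)]
    obtain A where A: "A \<in> gap_arcs (surface G) v (\<Union> (edges G))" "p \<in> ends (surface G) A" by blast
    then have AV: "A \<in> gaps_V" using r by (auto simp: gaps_V_def)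
    have "B = A" if B: "B \<in> gaps_V" "p \<in> ends (surface G) B" for B
    proof (rule ccontr)
      assume "B \<noteq> A"
      obtain w where w: "w \<in> joined_V" "B \<in> gap_arcs (surface G) w (\<Union> (edges G))" using B(1) by (rule gaps_VE)
      have "p \<in> w" using B(2) ends_subset [of "surface G" B] gaps_V_sub_V [OF w(2)] by blast
      then have "w = v" using \<open>p \<in> v \<inter> _\<close> disj_V v(1) joined_VD(1) [OF w(1)] by (auto simp: disjoint_def)
      then show False
        using marked_disc.unique_gap_arc [OF joined_VD(2) [OF r] v(2) s(2)] w(2) A B(2) \<open>B \<noteq> A\<close> by blast
    qed
    then show ?thesis using AV A(2) by blast
  qed
  show "\<exists>p q. p \<noteq> q \<and> x = {p, q}" if x: "x \<in> gaps P" for x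
  proof -
    obtain A where A: "A \<in> gaps_V" "x = ends (surface G) A" using x g by blast
    from is_segment_ends [OF X gaps_V_segment [OF A(1)]] show ?thesis using A(2) by metis
  qed
  have ends_pts: "ends (surface G) A \<subseteq> points" if "A \<in> gaps_V" for A
    using gaps_V_ends [OF that] by (auto simp: points_def)
  show "\<Union> (gaps P) = arrow_points (edges G) P"
  proof
    show "\<Union> (gaps P) \<subseteq> arrow_points (edges G) P" unfolding g pts using ends_pts by blast
    show "arrow_points (edges G) P \<subseteq> \<Union> (gaps P)" unfolding g pts using uniq by blast
  qed
  show "disjoint (gaps P)"
  proof (rule disjointI)
    fix a b assume ab: "a \<in> gaps P" "b \<in> gaps P" "a \<noteq> b"
    then obtain A B where AB: "A \<in> gaps_V" "B \<in> gaps_V" "a = ends (surface G) A" "b = ends (surface G) B"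
      unfolding g by blast
    show "a \<inter> b = {}"
    proof (rule ccontr)
      assume "a \<inter> b \<noteq> {}"
      then obtain p where p: "p \<in> a" "p \<in> b" by blast
      then have "p \<in> points" using ends_pts [OF AB(1)] AB(3) by blast
      then have "A = B" using uniq [of p] AB p by blast
      then show False using ab(3) AB by simp
    qed
  qed
qed


section \<open>The action of words on pairs of arrows\<close>

abbreviation map_pair :: "('p \<Rightarrow> 'q) \<Rightarrow> 'p arrow \<times> 'p arrow \<Rightarrow> 'q arrow \<times> 'q arrow" where
  "map_pair f \<equiv> map_prod (map_prod f f) (map_prod f f)"

lemma same_arrow_pair_unfold:
  "same_arrow_pair ((a, b), (c, d)) AB \<longleftrightarrow>
     AB \<in> {((a, b), (c, d)), ((c, d), (a, b)), ((b, a), (d, c)), ((d, c), (b, a))}"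
  by simp

lemma same_arrow_pair_refl [simp]: "same_arrow_pair AB AB"
  by (cases AB rule: pair_points.cases) simp

lemma same_arrow_pair_sym: "same_arrow_pair AB AB' \<Longrightarrow> same_arrow_pair AB' AB"
  by (cases AB rule: pair_points.cases; cases AB' rule: pair_points.cases) auto

lemma same_arrow_pair_trans:
  "\<lbrakk>same_arrow_pair AB AB'; same_arrow_pair AB' AB''\<rbrakk> \<Longrightarrow> same_arrow_pair AB AB''"
  by (cases AB rule: pair_points.cases; cases AB' rule: pair_points.cases) auto

lemma same_arrow_pair_data:
  assumes "same_arrow_pair AB AB'"
  shows "seg_ends AB' = seg_ends AB" "free_ends AB' = free_ends AB" "pair_points AB' = pair_points AB"
  using assms by (cases AB rule: pair_points.cases; cases AB' rule: pair_points.cases; auto)+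

text \<open>
  A pair of arrows is determined up to the admissible changes by the two pairings of its four
  ends: once a starting point is chosen, following the pairings alternately recovers the cyclic
  sequence.
\<close>

lemma same_arrow_pair_of_data:
  assumes "pair_distinct AB" "seg_ends AB' = seg_ends AB" "free_ends AB' = free_ends AB"
  shows "same_arrow_pair AB AB'"
proof -
  obtain a b c d where AB: "AB = ((a, b), (c, d))" by (cases AB rule: pair_points.cases)
  obtain a' b' c' d' where AB': "AB' = ((a', b'), (c', d'))" by (cases AB' rule: pair_points.cases)
  have d: "a \<noteq> b" "a \<noteq> c" "a \<noteq> d" "b \<noteq> c" "b \<noteq> d" "c \<noteq> d" using assms(1) by (auto simp: AB)
  have s: "{a', b'} = {a, b} \<and> {c', d'} = {c, d} \<or> {a', b'} = {c, d} \<and> {c', d'} = {a, b}"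
    using assms(2) unfolding AB AB' seg_ends.simps doubleton_eq_iff [of "{a', b'}"] .
  have f: "{b', c'} = {b, c} \<and> {d', a'} = {d, a} \<or> {b', c'} = {d, a} \<and> {d', a'} = {b, c}"
    using assms(3) unfolding AB AB' free_ends.simps doubleton_eq_iff [of "{b', c'}"] .
  show ?thesis
    using s f d unfolding AB AB' same_arrow_pair_unfold by (elim disjE) (auto simp: doubleton_eq_iff)
qed

lemma same_arrow_pair_map: "same_arrow_pair AB AB' \<Longrightarrow> same_arrow_pair (map_pair f AB) (map_pair f AB')"
  by (cases AB rule: pair_points.cases; cases AB' rule: pair_points.cases) auto

lemma pair_points_map: "pair_points (map_pair f AB) = f ` pair_points AB"
  by (cases AB rule: pair_points.cases) auto

lemma seg_ends_map: "seg_ends (map_pair f AB) = (`) f ` seg_ends AB"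
  by (cases AB rule: pair_points.cases) auto

lemma free_ends_map: "free_ends (map_pair f AB) = (`) f ` free_ends AB"
  by (cases AB rule: pair_points.cases) auto

lemma map_pair_inverse: "(\<And>x. x \<in> pair_points AB \<Longrightarrow> g (f x) = x) \<Longrightarrow> map_pair g (map_pair f AB) = AB"
  by (cases AB rule: pair_points.cases) auto

lemma generator_op_map: "generator_op g (map_pair f AB) = map_pair f (generator_op g AB)"
  by (cases AB rule: pair_points.cases; cases g) auto

lemma generator_op_same: "same_arrow_pair AB AB' \<Longrightarrow> same_arrow_pair (generator_op g AB) (generator_op g AB')"
  by (cases AB rule: pair_points.cases; cases AB' rule: pair_points.cases; cases g) auto

lemma generator_op_points: "pair_points (generator_op g AB) = pair_points AB"
  by (cases AB rule: pair_points.cases; cases g) auto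

lemma generator_op_distinct: "pair_distinct (generator_op g AB) = pair_distinct AB"
  by (cases AB rule: pair_points.cases; cases g) auto

lemma word_op_Nil [simp]: "word_op [] AB = AB"
  by (simp add: word_op_def)

lemma word_op_Cons [simp]: "word_op (g # w) AB = generator_op g (word_op w AB)"
  by (simp add: word_op_def)

lemma word_op_append: "word_op (u @ v) AB = word_op u (word_op v AB)"
  by (induction u) auto

lemma word_op_map: "word_op w (map_pair f AB) = map_pair f (word_op w AB)"
  by (induction w) (auto simp: generator_op_map)

lemma word_op_same: "same_arrow_pair AB AB' \<Longrightarrow> same_arrow_pair (word_op w AB) (word_op w AB')"
  by (induction w) (auto simp del: generator_op.simps same_arrow_pair.simps intro: generator_op_same)

lemma word_op_points: "pair_points (word_op w AB) = pair_points AB"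
  by (induction w) (simp_all add: generator_op_points del: generator_op.simps)

lemma word_op_distinct: "pair_distinct (word_op w AB) = pair_distinct AB"
  by (induction w) (simp_all add: generator_op_distinct del: generator_op.simps)

text \<open>
  The four admissible presentations of one pair of arrows form an orbit of the Klein four-group
  of rotations and reflections of the cyclic sequence of ends; modulo this group the relations
  of the presentation hold.
\<close>

lemma word_eq_op: "word_eq u v \<Longrightarrow> same_arrow_pair (word_op u AB) (word_op v AB)"
proof (induction arbitrary: AB rule: word_eq.induct)
  case (sym u v)
  then show ?case by (blast intro: same_arrow_pair_sym)
next
  case (trans u v w)
  then show ?case by (blast intro: same_arrow_pair_trans)
next
  case (append u u' v v')
  show ?case
    unfolding word_op_append by (rule same_arrow_pair_trans [OF append.IH(1) word_op_same [OF append.IH(2)]])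
next
  case Delta2
  show ?case by (cases AB rule: pair_points.cases) simp
next
  case Tau2
  show ?case by (cases AB rule: pair_points.cases) simp
next
  case TauDelta3
  show ?case by (cases AB rule: pair_points.cases) simp
qed simp


section \<open>Isomorphisms of arrow presentations\<close>

lemma arrow_points_image:
  assumes "presentation_iso L \<iota> f P Q"
  shows "arrow_points (\<iota> ` L) Q = f ` arrow_points L P"
proof -
  have "pair_points (arrows Q (\<iota> e)) = f ` pair_points (arrows P e)" if "e \<in> L" for e
  proof -
    have "same_arrow_pair (map_pair f (arrows P e)) (arrows Q (\<iota> e))"
      using assms that by (simp add: presentation_iso_def)
    from same_arrow_pair_data(3) [OF this] show ?thesis by (simp add: pair_points_map)
  qed
  then show ?thesis by (simp add: arrow_points_eq image_UN)
qed

lemma presentation_iso_trans: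
  assumes PQ: "presentation_iso L \<iota> f P Q" and QR: "presentation_iso (\<iota> ` L) \<iota>' g Q R"
  shows "presentation_iso L (\<iota>' \<circ> \<iota>) (g \<circ> f) P R"
proof -
  have "inj_on (g \<circ> f) (arrow_points L P)"
    using PQ QR arrow_points_image [OF PQ] unfolding presentation_iso_def by (metis comp_inj_on)
  moreover have "same_arrow_pair (map_pair (g \<circ> f) (arrows P e)) (arrows R ((\<iota>' \<circ> \<iota>) e))" if "e \<in> L" for e
  proof -
    have 1: "same_arrow_pair (map_pair g (map_pair f (arrows P e))) (map_pair g (arrows Q (\<iota> e)))"
      using PQ that by (intro same_arrow_pair_map) (simp add: presentation_iso_def)
    have 2: "same_arrow_pair (map_pair g (arrows Q (\<iota> e))) (arrows R (\<iota>' (\<iota> e)))"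
      using QR that by (simp add: presentation_iso_def)
    have 3: "map_pair g (map_pair f (arrows P e)) = map_pair (g \<circ> f) (arrows P e)"
      by (cases "arrows P e" rule: pair_points.cases) simp
    show ?thesis using same_arrow_pair_trans [OF 1 2] unfolding 3 o_apply .
  qed
  moreover have "gaps R = (`) (g \<circ> f) ` gaps P"
    using PQ QR by (simp add: presentation_iso_def image_image image_comp)
  ultimately show ?thesis using PQ QR by (simp add: presentation_iso_def)
qed

lemma presentation_iso_sym:
  assumes PQ: "presentation_iso L \<iota> f P Q" and \<iota>: "inj_on \<iota> L"
    and gaps: "\<Union> (gaps P) \<subseteq> arrow_points L P"
  shows "presentation_iso (\<iota> ` L) (inv_into L \<iota>) (inv_into (arrow_points L P) f) Q P"
proof -
  let ?g = "inv_into (arrow_points L P) f"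
  have f: "inj_on f (arrow_points L P)" using PQ by (simp add: presentation_iso_def)
  have gf: "?g (f x) = x" if "x \<in> arrow_points L P" for x using f that by simp
  have "inj_on ?g (arrow_points (\<iota> ` L) Q)"
    unfolding arrow_points_image [OF PQ] by (rule inj_on_inv_into) simp
  moreover have "same_arrow_pair (map_pair ?g (arrows Q (\<iota> e))) (arrows P (inv_into L \<iota> (\<iota> e)))" if e: "e \<in> L" for e
  proof -
    have "same_arrow_pair (map_pair ?g (map_pair f (arrows P e))) (map_pair ?g (arrows Q (\<iota> e)))"
      using PQ e by (intro same_arrow_pair_map) (simp add: presentation_iso_def)
    moreover have "pair_points (arrows P e) \<subseteq> arrow_points L P" using e by (auto simp: arrow_points_eq)
    then have "map_pair ?g (map_pair f (arrows P e)) = arrows P e"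
      using gf by (intro map_pair_inverse) auto
    ultimately show ?thesis using same_arrow_pair_sym \<iota> e by simp
  qed
  moreover have "gaps P = (`) ?g ` gaps Q"
  proof -
    have "?g ` f ` x = x" if "x \<in> gaps P" for x
    proof -
      have "x \<subseteq> arrow_points L P" using that gaps by blast
      then show ?thesis using gf by (force simp: image_image)
    qed
    then have "(`) ?g ` (`) f ` gaps P = gaps P" by (simp add: image_image)
    then show ?thesis using PQ by (simp add: presentation_iso_def)
  qed
  ultimately show ?thesis using PQ by (simp add: presentation_iso_def)
qed

lemma arrow_points_apply_words: "arrow_points L (apply_words w P) = arrow_points L P"
  by (simp add: arrow_points_eq apply_words_def word_op_points)

text \<open>
  Isomorphisms of presentations ignore the admissible changes of a pair of arrows, so the words
  on the two sides need to represent the same element of the group only.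
\<close>

lemma presentation_iso_words:
  assumes PQ: "presentation_iso L \<iota> f P Q" and w: "\<And>e. e \<in> L \<Longrightarrow> word_eq (w e) (w' (\<iota> e))"
  shows "presentation_iso L \<iota> f (apply_words w P) (apply_words w' Q)"
proof -
  have "same_arrow_pair (map_pair f (word_op (w e) (arrows P e))) (word_op (w' (\<iota> e)) (arrows Q (\<iota> e)))"
    if e: "e \<in> L" for e
  proof -
    have "same_arrow_pair (word_op (w e) (map_pair f (arrows P e))) (word_op (w e) (arrows Q (\<iota> e)))"
      using PQ e by (intro word_op_same) (simp add: presentation_iso_def)
    from same_arrow_pair_trans [OF this word_eq_op [OF w [OF e]]] show ?thesis
      by (simp only: word_op_map)
  qed
  then show ?thesis using PQ
    by (simp add: presentation_iso_def arrow_points_apply_words) (simp add: apply_words_def)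
qed

lemma apply_words_append: "apply_words u (apply_words v P) = apply_words (\<lambda>e. u e @ v e) P"
  by (simp add: apply_words_def word_op_append)

lemma apply_words_Nil: "apply_words (\<lambda>_. []) P = P"
  by (simp add: apply_words_def)

text \<open>
  Reading off a presentation involves the choice of a chart of each edge and of an order of its
  two arrows, but the two pairings of the ends do not depend on them.
\<close>

lemma presents_unique:
  assumes G: "ribbon_graph G" and P: "presents G P" and Q: "presents G Q"
  shows "presentation_iso (edges G) id id P Q"
proof -
  have "same_arrow_pair (arrows P e) (arrows Q e)" if e: "e \<in> edges G" for e
    using presents_data [OF G P e] presents_data [OF G Q e]
    by (intro same_arrow_pair_of_data) simp_all
  moreover have "map_pair id AB = AB" for AB :: "'a arrow \<times> 'a arrow"
    by (cases AB rule: pair_points.cases) simp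
  ultimately show ?thesis using P Q by (simp add: presentation_iso_def presents_def)
qed

text \<open>
  The ends of arrows are the points in which the boundary circles are cut, so an isomorphism of
  presentations carries precisely the incidences that determine a disc system.
\<close>

theorem ribbon_iso_of_presentation_iso:
  assumes G: "ribbon_graph G" and H: "ribbon_graph H" and P: "presents G P" and Q: "presents H Q"
    and \<iota>: "bij_betw \<iota> (edges G) (edges H)" and f: "presentation_iso (edges G) \<iota> f P Q"
  shows "\<exists>F. ribbon_iso G H F \<and> (\<forall>e \<in> edges G. F ` e = \<iota> e)"
proof -
  have \<iota>E: "\<iota> e \<in> edges H" if "e \<in> edges G" for e by (rule bij_betw_apply [OF \<iota> that])
  have same: "same_arrow_pair (map_pair f (arrows P e)) (arrows Q (\<iota> e))" if "e \<in> edges G" for e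
    using f that by (simp add: presentation_iso_def)
  have "\<exists>F. homeomorphic_map (surface G) (surface H) F \<and> (`) F ` verts G = verts H \<and> (\<forall>e \<in> edges G. F ` e = \<iota> e)"
  proof (rule disc_system_unique [OF ribbon_disc_system [OF G] ribbon_disc_system [OF H]])
    show "e \<inter> \<Union> (verts G) \<noteq> {}" if "e \<in> edges G" for e by (rule ribbon_edge_marked(2) [OF G that])
    show "e \<inter> \<Union> (verts H) \<noteq> {}" if "e \<in> edges H" for e by (rule ribbon_edge_marked(2) [OF H that])
    show "bij_betw \<iota> (edges G) (edges H)" by (rule \<iota>)
    show "inj_on f (disc_system.points (surface G) (verts G) (edges G))"
      unfolding points_eq_arrow_points [OF G P] using f by (simp add: presentation_iso_def)
    show "ends (surface H) ` disc_segs (surface H) (\<iota> e) (verts H) =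
        (`) f ` ends (surface G) ` disc_segs (surface G) e (verts G)" if e: "e \<in> edges G" for e
      unfolding presents_data(2) [OF G P e] presents_data(2) [OF H Q \<iota>E [OF e]] seg_ends_map [symmetric]
      by (rule same_arrow_pair_data(1) [OF same [OF e]])
    show "ends (surface H) ` gap_arcs (surface H) (\<iota> e) (\<Union> (verts H)) =
        (`) f ` ends (surface G) ` gap_arcs (surface G) e (\<Union> (verts G))" if e: "e \<in> edges G" for e
      unfolding presents_data(3) [OF G P e] presents_data(3) [OF H Q \<iota>E [OF e]] free_ends_map [symmetric]
      by (rule same_arrow_pair_data(2) [OF same [OF e]])
    show "ends (surface H) ` disc_system.gaps_V (surface H) (verts H) (edges H) =
        (`) f ` ends (surface G) ` disc_system.gaps_V (surface G) (verts G) (edges G)"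
      unfolding ribbon_gaps_eq [OF G, symmetric] ribbon_gaps_eq [OF H, symmetric]
      using f P Q by (simp add: presentation_iso_def presents_def)
    show "card {v \<in> verts H. v \<inter> \<Union> (edges H) = {}} = card {v \<in> verts G. v \<inter> \<Union> (edges G) = {}}"
      using f P Q by (simp add: presentation_iso_def presents_def)
  qed
  then obtain F where F: "homeomorphic_map (surface G) (surface H) F" "(`) F ` verts G = verts H"
    "\<forall>e \<in> edges G. F ` e = \<iota> e" by (elim exE conjE)
  have "(`) F ` edges G = \<iota> ` edges G" by (rule image_cong [OF HOL.refl]) (use F(3) in simp)
  then have "(`) F ` edges G = edges H" using \<iota> by (simp add: bij_betw_def)
  then have "ribbon_iso G H F" using F(1,2) by (simp add: ribbon_iso_def)
  then show ?thesis using F(3) by (intro exI conjI)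
qed


section \<open>Transport along homeomorphisms\<close>

lemma homeomorphic_map_inverse:
  assumes "homeomorphic_map X Y F"
  obtains g where "homeomorphic_map Y X g" "\<And>x. x \<in> topspace X \<Longrightarrow> g (F x) = x" "\<And>y. y \<in> topspace Y \<Longrightarrow> F (g y) = y"
proof -
  obtain g where g: "homeomorphic_maps X Y F g" using assms by (auto simp: homeomorphic_map_maps)
  have "homeomorphic_maps Y X g F" using g by (rule iffD1 [OF homeomorphic_maps_sym])
  then have "homeomorphic_map Y X g" unfolding homeomorphic_map_maps by blast
  moreover have "\<And>x. x \<in> topspace X \<Longrightarrow> g (F x) = x" "\<And>y. y \<in> topspace Y \<Longrightarrow> F (g y) = y"
    using g by (simp_all add: homeomorphic_maps_def)
  ultimately show ?thesis by (rule that)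
qed

lemma disc_param_push:
  assumes F: "homeomorphic_map X Y F" and h: "disc_param X D h"
  shows "disc_param Y (F ` D) (F \<circ> h)"
proof -
  have "D \<subseteq> topspace X" using h continuous_map_image_subset_topspace by (fastforce simp: disc_param_def)
  then have "inj_on F D" using homeomorphic_imp_injective_map [OF F] by (rule inj_on_subset [rotated])
  then have "inj_on (F \<circ> h) (cball 0 1)" using h by (auto simp: disc_param_def intro: comp_inj_on)
  moreover have "continuous_map (top_of_set (cball 0 1)) Y (F \<circ> h)"
    using h homeomorphic_imp_continuous_map [OF F] continuous_map_compose by (auto simp: disc_param_def)
  moreover have "(F \<circ> h) ` cball 0 1 = F ` D" using h by (auto simp: disc_param_def)
  ultimately show ?thesis by (simp add: disc_param_def)
qed

lemma is_segment_push:
  assumes F: "homeomorphic_map X Y F" and s: "is_segment X s"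
  shows "is_segment Y (F ` s)"
proof -
  have sX: "s \<subseteq> topspace X" using s by (simp add: is_segment_def)
  have FX: "F ` topspace X = topspace Y" by (rule homeomorphic_imp_surjective_map [OF F])
  have FsY: "F ` s \<subseteq> topspace Y" using sX FX by blast
  have "homeomorphic_map (subtopology X s) (subtopology Y (F ` s)) F"
    using sX FsY by (intro homeomorphic_map_subtopologies [OF F]) (simp add: Int_absorb1)
  then have "subtopology Y (F ` s) homeomorphic_space subtopology X s"
    using homeomorphic_space homeomorphic_space_sym by blast
  then show ?thesis using s FsY unfolding is_segment_def by (blast intro: homeomorphic_space_trans)
qed

lemma comps_push:
  assumes F: "homeomorphic_map X Y F" and A: "A \<subseteq> topspace X"
  shows "comps Y (F ` A) = (`) F ` comps X A"
proof -
  have "F ` A \<subseteq> topspace Y" using A homeomorphic_imp_surjective_map [OF F] by blast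
  then have "homeomorphic_map (subtopology X A) (subtopology Y (F ` A)) F"
    using A by (intro homeomorphic_map_subtopologies [OF F]) (simp add: Int_absorb1)
  then show ?thesis by (rule homeomorphic_map_connected_components_of)
qed

lemma disc_boundary_push:
  assumes F: "homeomorphic_map X Y F" and X: "Hausdorff_space X" and Y: "Hausdorff_space Y" and D: "is_disc X D"
  shows "disc_boundary Y (F ` D) = F ` disc_boundary X D"
proof -
  obtain h where h: "disc_param X D h" using D X by (auto simp: is_disc_def disc_chart_iff)
  show ?thesis
    unfolding disc_boundary_eq [OF X h] disc_boundary_eq [OF Y disc_param_push [OF F h]] by (simp add: image_comp)
qed

lemma ribbon_isoD:
  assumes "ribbon_iso G H F"
  shows "homeomorphic_map (surface G) (surface H) F" "verts H = (`) F ` verts G" "edges H = (`) F ` edges G"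
  using assms by (auto simp: ribbon_iso_def)

lemma ribbon_discs_subset:
  assumes "ribbon_graph G" "D \<in> verts G \<union> edges G" shows "D \<subseteq> topspace (surface G)"
  using assms by (auto simp: ribbon_graph_def)

lemma ribbon_iso_graph:
  assumes G: "ribbon_graph G" and iso: "ribbon_iso G H F"
  shows "ribbon_graph H"
proof -
  let ?X = "surface G" and ?Y = "surface H"
  note F = ribbon_isoD [OF iso]
  note inj = homeomorphic_imp_injective_map [OF F(1)]
  note sub = ribbon_discs_subset [OF G]
  have X: "Hausdorff_space ?X" using G by (simp add: ribbon_graph_def)
  have Y: "Hausdorff_space ?Y"
    using X homeomorphic_Hausdorff_space [OF homeomorphic_map_imp_homeomorphic_space [OF F(1)]] by simp
  have top: "topspace ?Y = \<Union> (verts H) \<union> \<Union> (edges H)"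
  proof -
    have "topspace ?Y = F ` topspace ?X" using homeomorphic_imp_surjective_map [OF F(1)] by simp
    also have "topspace ?X = \<Union> (verts G) \<union> \<Union> (edges G)" using G by (simp add: ribbon_graph_def)
    finally show ?thesis unfolding F by auto
  qed
  have Int: "F ` a \<inter> F ` b = F ` (a \<inter> b)" if "a \<subseteq> topspace ?X" "b \<subseteq> topspace ?X" for a b
    using inj_on_image_Int [OF inj that] by simp
  have discX: "is_disc ?X D" if "D \<in> verts G \<union> edges G" for D using G that by (simp add: ribbon_graph_def)
  have disc: "is_disc ?Y (F ` D)" if D: "D \<in> verts G \<union> edges G" for D
  proof -
    obtain h where h: "disc_param ?X D h" using discX [OF D] X by (auto simp: is_disc_def disc_chart_iff)
    from disc_param_push [OF F(1) h] show ?thesis using Y by (auto simp: is_disc_def disc_chart_iff)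
  qed
  have dis: "disjoint ((`) F ` \<D>)" if \<D>: "disjoint \<D>" "\<D> \<subseteq> verts G \<union> edges G" for \<D>
  proof (rule disjointI)
    fix a b assume ab: "a \<in> (`) F ` \<D>" "b \<in> (`) F ` \<D>" "a \<noteq> b"
    then obtain u v where uv: "u \<in> \<D>" "v \<in> \<D>" "a = F ` u" "b = F ` v" by blast
    then have "u \<inter> v = {}" using \<D>(1) ab(3) by (auto simp: disjoint_def)
    moreover have "u \<subseteq> topspace ?X" "v \<subseteq> topspace ?X" using uv \<D>(2) sub by blast+
    ultimately show "a \<inter> b = {}" using Int [of u v] uv by simp
  qed
  have seg: "segments H (F ` v) (F ` e) = (`) F ` segments G v e" if "v \<in> verts G" "e \<in> edges G" for v e
  proof -
    have vX: "v \<subseteq> topspace ?X" "e \<subseteq> topspace ?X" using that sub by simp_all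
    then have "v \<inter> e \<subseteq> topspace ?X" by blast
    then show ?thesis unfolding segments_eq Int [OF vX] by (rule comps_push [OF F(1)])
  qed
  have segG: "is_segment ?X s" "s \<subseteq> disc_boundary ?X v" "s \<subseteq> disc_boundary ?X e"
    if "v \<in> verts G" "e \<in> edges G" "s \<in> segments G v e" for v e s
    using G that unfolding ribbon_graph_def by blast+
  have segH: "is_segment ?Y s \<and> s \<subseteq> disc_boundary ?Y v \<and> s \<subseteq> disc_boundary ?Y e"
    if "v \<in> verts H" "e \<in> edges H" "s \<in> segments H v e" for v e s
  proof -
    obtain v' e' where v': "v' \<in> verts G" "v = F ` v'" and e': "e' \<in> edges G" "e = F ` e'"
      using \<open>v \<in> verts H\<close> \<open>e \<in> edges H\<close> unfolding F by blast
    obtain s' where s': "s' \<in> segments G v' e'" "s = F ` s'"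
      using \<open>s \<in> segments H v e\<close> seg [OF v'(1) e'(1)] v'(2) e'(2) by auto
    note * = segG [OF v'(1) e'(1) s'(1)]
    have "disc_boundary ?Y v = F ` disc_boundary ?X v'" "disc_boundary ?Y e = F ` disc_boundary ?X e'"
      using disc_boundary_push [OF F(1) X Y discX] v' e' by simp_all
    then show ?thesis using is_segment_push [OF F(1) *(1)] *(2,3) s'(2) by auto
  qed
  have card: "card (\<Union>v \<in> verts H. segments H v e) = 2" if "e \<in> edges H" for e
  proof -
    obtain e' where e': "e' \<in> edges G" "e = F ` e'" using \<open>e \<in> edges H\<close> unfolding F by blast
    have "(\<Union>v \<in> verts H. segments H v e) = (\<Union>v \<in> verts G. (`) F ` segments G v e')"
      unfolding F(2) using seg e' by simp
    also have "\<dots> = (`) F ` (\<Union>v \<in> verts G. segments G v e')" by blast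
    finally have eq: "(\<Union>v \<in> verts H. segments H v e) = (`) F ` (\<Union>v \<in> verts G. segments G v e')" .
    have "(\<Union>v \<in> verts G. segments G v e') \<subseteq> Pow (topspace ?X)"
    proof
      fix s assume "s \<in> (\<Union>v \<in> verts G. segments G v e')"
      then obtain v where "v \<in> verts G" "s \<in> segments G v e'" by blast
      from segG(1) [OF this(1) e'(1) this(2)] show "s \<in> Pow (topspace ?X)" by (simp add: is_segment_def)
    qed
    then have "inj_on ((`) F) (\<Union>v \<in> verts G. segments G v e')"
      using inj_on_image_Pow [OF inj] by (rule inj_on_subset [rotated])
    then have "card ((`) F ` (\<Union>v \<in> verts G. segments G v e')) = card (\<Union>v \<in> verts G. segments G v e')"
      by (rule card_image)
    then show ?thesis using G e'(1) eq by (simp add: ribbon_graph_def)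
  qed
  show ?thesis
    unfolding ribbon_graph_def
  proof (intro conjI)
    show "Hausdorff_space ?Y" "topspace ?Y = \<Union> (verts H) \<union> \<Union> (edges H)" by (rule Y, rule top)
    show "disjoint (verts H)" "disjoint (edges H)" unfolding F(2,3) using G dis by (simp_all add: ribbon_graph_def)
    show "finite (verts H)" "finite (edges H)" unfolding F(2,3) using G by (simp_all add: ribbon_graph_def)
    show "\<forall>D \<in> verts H \<union> edges H. is_disc ?Y D" unfolding F(2,3) using disc by blast
    show "\<forall>v \<in> verts H. \<forall>e \<in> edges H. \<forall>s \<in> segments H v e.
        is_segment ?Y s \<and> s \<subseteq> disc_boundary ?Y v \<and> s \<subseteq> disc_boundary ?Y e"
      by (intro ballI) (rule segH)
    show "\<forall>e \<in> edges H. card (\<Union>v \<in> verts H. segments H v e) = 2"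
      by (intro ballI) (rule card)
  qed
qed

lemma ribbon_iso_inverse:
  assumes G: "ribbon_graph G" and iso: "ribbon_iso G H F"
  obtains g where "ribbon_iso H G g" "\<And>x. x \<in> topspace (surface G) \<Longrightarrow> g (F x) = x"
proof -
  note F = ribbon_isoD [OF iso]
  obtain g where g: "homeomorphic_map (surface H) (surface G) g" "\<And>x. x \<in> topspace (surface G) \<Longrightarrow> g (F x) = x"
    using homeomorphic_map_inverse [OF F(1)] by metis
  have gF: "g ` F ` D = D" if "D \<in> verts G \<union> edges G" for D
  proof -
    have "D \<subseteq> topspace (surface G)" by (rule ribbon_discs_subset [OF G that])
    then show ?thesis using g(2) by (force simp: image_image)
  qed
  have gFD: "(`) g ` (`) F ` \<D> = \<D>" if "\<D> \<subseteq> verts G \<union> edges G" for \<D>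
  proof -
    have "(`) g ` (`) F ` \<D> = (\<lambda>D. g ` F ` D) ` \<D>" by (rule image_image)
    also have "\<dots> = (\<lambda>D. D) ` \<D>" using gF that by (intro image_cong) auto
    finally show ?thesis by simp
  qed
  have "(`) g ` verts H = verts G" "(`) g ` edges H = edges G"
    unfolding F(2,3) by (rule gFD; blast)+
  then have "ribbon_iso H G g" using g(1) by (simp add: ribbon_iso_def)
  then show ?thesis using g(2) that by blast
qed

lemma ribbon_gaps_push_subset:
  assumes G: "ribbon_graph G" and iso: "ribbon_iso G H F"
  shows "(`) F ` ribbon_gaps G \<subseteq> ribbon_gaps H"
proof
  note F = ribbon_isoD [OF iso]
  have X: "Hausdorff_space (surface G)" using G by (simp add: ribbon_graph_def)
  have Y: "Hausdorff_space (surface H)" using ribbon_iso_graph [OF G iso] by (simp add: ribbon_graph_def)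
  fix g assume "g \<in> (`) F ` ribbon_gaps G"
  then obtain v h s t where v: "v \<in> verts G" and h: "disc_param (surface G) v h" and st: "s < t"
      "h (cis s) \<in> \<Union> (edges G)" "h (cis t) \<in> \<Union> (edges G)" "\<forall>u. s < u \<and> u < t \<longrightarrow> h (cis u) \<notin> \<Union> (edges G)"
      and g: "g = F ` {h (cis s), h (cis t)}"
    unfolding ribbon_gaps_def disc_chart_iff [OF X] by blast
  have hX: "h (cis u) \<in> topspace (surface G)" for u
    using h ribbon_discs_subset [OF G, of v] v by (auto simp: disc_param_def)
  have EX: "\<Union> (edges G) \<subseteq> topspace (surface G)" using ribbon_discs_subset [OF G] by blast
  have mem: "F x \<in> \<Union> (edges H) \<longleftrightarrow> x \<in> \<Union> (edges G)" if "x \<in> topspace (surface G)" for x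
  proof -
    have "\<Union> (edges H) = F ` \<Union> (edges G)" unfolding F(3) by blast
    then show ?thesis using inj_on_image_mem_iff [OF homeomorphic_imp_injective_map [OF F(1)] that EX] by simp
  qed
  have "disc_chart (surface H) (F ` v) (F \<circ> h)"
    unfolding disc_chart_iff [OF Y] by (rule disc_param_push [OF F(1) h])
  moreover have "F ` v \<in> verts H" unfolding F(2) using v by blast
  moreover have "(F \<circ> h) (cis s) \<in> \<Union> (edges H)" "(F \<circ> h) (cis t) \<in> \<Union> (edges H)"
    "\<forall>u. s < u \<and> u < t \<longrightarrow> (F \<circ> h) (cis u) \<notin> \<Union> (edges H)"
    unfolding o_apply mem [OF hX] using st by blast+
  moreover have "g = {(F \<circ> h) (cis s), (F \<circ> h) (cis t)}" using g by simp
  ultimately show "g \<in> ribbon_gaps H" unfolding ribbon_gaps_def using st(1) by blast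
qed

lemma arrow_pair_of_push:
  assumes G: "ribbon_graph G" and iso: "ribbon_iso G H F" and e: "e \<in> edges G" and AB: "arrow_pair_of G e AB"
  shows "arrow_pair_of H (F ` e) (map_pair F AB)"
proof -
  note F = ribbon_isoD [OF iso]
  have X: "Hausdorff_space (surface G)" using G by (simp add: ribbon_graph_def)
  have Y: "Hausdorff_space (surface H)" using ribbon_iso_graph [OF G iso] by (simp add: ribbon_graph_def)
  obtain k a b c d where k: "disc_param (surface G) e k"
    and o: "a < b" "b < c" "c < d" "d < a + 2 * pi"
    and eM: "e \<inter> \<Union> (verts G) = k ` cis ` {a..b} \<union> k ` cis ` {c..d}"
    and ABeq: "AB = ((k (cis a), k (cis b)), (k (cis c), k (cis d)))"
    using AB unfolding arrow_pair_of_def disc_chart_iff [OF X] by blast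
  have "e \<subseteq> topspace (surface G)" "\<Union> (verts G) \<subseteq> topspace (surface G)"
    using ribbon_discs_subset [OF G] e by blast+
  then have "F ` e \<inter> F ` \<Union> (verts G) = F ` (e \<inter> \<Union> (verts G))"
    using inj_on_image_Int [OF homeomorphic_imp_injective_map [OF F(1)]] by metis
  moreover have "\<Union> (verts H) = F ` \<Union> (verts G)" unfolding F(2) by blast
  ultimately have "F ` e \<inter> \<Union> (verts H) = (F \<circ> k) ` cis ` {a..b} \<union> (F \<circ> k) ` cis ` {c..d}"
    unfolding eM by (simp add: image_Un image_comp)
  moreover have "disc_chart (surface H) (F ` e) (F \<circ> k)"
    unfolding disc_chart_iff [OF Y] by (rule disc_param_push [OF F(1) k])
  moreover have "map_pair F AB = (((F \<circ> k) (cis a), (F \<circ> k) (cis b)), ((F \<circ> k) (cis c), (F \<circ> k) (cis d)))"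
    using ABeq by simp
  ultimately show ?thesis unfolding arrow_pair_of_def using o by blast
qed

lemma arrow_points_subset:
  assumes G: "ribbon_graph G" and P: "presents G P"
  shows "arrow_points (edges G) P \<subseteq> topspace (surface G)"
proof -
  interpret disc_system "surface G" "verts G" "edges G" by (rule ribbon_disc_system [OF G])
  have "ends (surface G) s \<subseteq> topspace (surface G)" if "s \<in> segs" for s
    using segs_segment [OF that] ends_subset [of "surface G" s] by (auto simp: is_segment_def)
  then show ?thesis unfolding points_eq_arrow_points [OF G P, symmetric] points_def by blast
qed

text \<open>
  Composing charts with \<open>F\<close> carries arrows and gaps over; as this applies to the
  inverse as well, no gaps are missed.
\<close>

lemma presents_push:
  assumes G: "ribbon_graph G" and iso: "ribbon_iso G H F" and P: "presents G P"
  shows "\<exists>Q. presents H Q \<and> presentation_iso (edges G) ((`) F) F P Q"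
proof -
  note F = ribbon_isoD [OF iso]
  note H = ribbon_iso_graph [OF G iso]
  note inj = homeomorphic_imp_injective_map [OF F(1)]
  obtain g where g: "ribbon_iso H G g" and gF: "\<And>x. x \<in> topspace (surface G) \<Longrightarrow> g (F x) = x"
    using ribbon_iso_inverse [OF G iso] by metis
  have "inj_on ((`) F) (Pow (topspace (surface G)))" by (rule inj_on_image_Pow [OF inj])
  moreover have "verts G \<union> edges G \<subseteq> Pow (topspace (surface G))" using ribbon_discs_subset [OF G] by blast
  ultimately have injP: "inj_on ((`) F) (verts G \<union> edges G)" by (rule inj_on_subset)
  then have injV: "inj_on ((`) F) (verts G)" and injE: "inj_on ((`) F) (edges G)" by (auto intro: inj_on_subset)
  have gaps: "ribbon_gaps H = (`) F ` ribbon_gaps G"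
  proof
    show "(`) F ` ribbon_gaps G \<subseteq> ribbon_gaps H" by (rule ribbon_gaps_push_subset [OF G iso])
    show "ribbon_gaps H \<subseteq> (`) F ` ribbon_gaps G"
    proof
      fix x assume x: "x \<in> ribbon_gaps H"
      then have gx: "g ` x \<in> ribbon_gaps G" using ribbon_gaps_push_subset [OF H g] by blast
      obtain Q where Q: "presents H Q" using presents_exists [OF H] by blast
      have "\<Union> (ribbon_gaps H) \<subseteq> topspace (surface H)"
        using presents_gaps(2) [OF H Q] arrow_points_subset [OF H Q] Q by (simp add: presents_def)
      then have xX: "x \<subseteq> topspace (surface H)" using x by blast
      have Fg: "F (g y) = y" if "y \<in> topspace (surface H)" for y
      proof -
        obtain z where z: "z \<in> topspace (surface G)" "y = F z"
          using \<open>y \<in> _\<close> homeomorphic_imp_surjective_map [OF F(1)] by blast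
        then show ?thesis using gF by simp
      qed
      have "F ` g ` x = x" using Fg xX by (force simp: image_image)
      then show "x \<in> (`) F ` ribbon_gaps G" using gx by (metis imageI)
    qed
  qed
  have bare: "card {v \<in> verts H. v \<inter> \<Union> (edges H) = {}} = card {v \<in> verts G. v \<inter> \<Union> (edges G) = {}}"
  proof -
    have Int: "F ` v \<inter> \<Union> (edges H) = F ` (v \<inter> \<Union> (edges G))" if "v \<in> verts G" for v
    proof -
      have "v \<subseteq> topspace (surface G)" "\<Union> (edges G) \<subseteq> topspace (surface G)"
        using ribbon_discs_subset [OF G] that by blast+
      moreover have "\<Union> (edges H) = F ` \<Union> (edges G)" unfolding F(3) by blast
      ultimately show ?thesis using inj_on_image_Int [OF inj] by metis
    qed
    have "{v \<in> verts H. v \<inter> \<Union> (edges H) = {}} = (`) F ` {v \<in> verts G. v \<inter> \<Union> (edges G) = {}}"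
    proof (intro equalityI subsetI)
      fix x assume x: "x \<in> {v \<in> verts H. v \<inter> \<Union> (edges H) = {}}"
      then obtain v where v: "v \<in> verts G" "x = F ` v" unfolding F(2) by blast
      then show "x \<in> (`) F ` {v \<in> verts G. v \<inter> \<Union> (edges G) = {}}" using Int [OF v(1)] x by simp
    next
      fix x assume "x \<in> (`) F ` {v \<in> verts G. v \<inter> \<Union> (edges G) = {}}"
      then obtain v where v: "v \<in> verts G" "v \<inter> \<Union> (edges G) = {}" "x = F ` v" by blast
      then show "x \<in> {v \<in> verts H. v \<inter> \<Union> (edges H) = {}}" using Int [OF v(1)] unfolding F(2) by simp
    qed
    moreover have "inj_on ((`) F) {v \<in> verts G. v \<inter> \<Union> (edges G) = {}}" using injV by (rule inj_on_subset) blast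
    ultimately show ?thesis by (simp add: card_image)
  qed
  define Q where "Q = \<lparr>arrows = (\<lambda>e. map_pair F (arrows P (inv_into (edges G) ((`) F) e))),
    gaps = ribbon_gaps H, bare = card {v \<in> verts H. v \<inter> \<Union> (edges H) = {}}\<rparr>"
  have arr: "arrows Q (F ` e) = map_pair F (arrows P e)" if "e \<in> edges G" for e
    using injE that by (simp add: Q_def)
  have "arrow_pair_of H e (arrows Q e)" if e: "e \<in> edges H" for e
  proof -
    obtain e' where e': "e' \<in> edges G" "e = F ` e'" using e unfolding F(3) by blast
    have "arrow_pair_of G e' (arrows P e')" using P e'(1) by (simp add: presents_def)
    from arrow_pair_of_push [OF G iso e'(1) this] show ?thesis using arr e' by simp
  qed
  then have "presents H Q" by (simp add: presents_def Q_def)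
  moreover have "presentation_iso (edges G) ((`) F) F P Q"
    unfolding presentation_iso_def
  proof (intro conjI ballI)
    show "inj_on F (arrow_points (edges G) P)" using inj arrow_points_subset [OF G P] by (rule inj_on_subset)
    show "same_arrow_pair (map_pair F (arrows P e)) (arrows Q (F ` e))" if "e \<in> edges G" for e
      using arr [OF that] by simp
    show "gaps Q = (`) F ` gaps P" using gaps P by (simp add: Q_def presents_def)
    show "bare Q = bare P" using bare P by (simp add: Q_def presents_def)
  qed
  ultimately show ?thesis by blast
qed


section \<open>Two pairings decompose a finite set into cycles\<close>

definition pairing :: "'p set \<Rightarrow> ('p \<Rightarrow> 'p) \<Rightarrow> bool" where
  "pairing X \<alpha> \<longleftrightarrow> (\<forall>x \<in> X. \<alpha> x \<in> X \<and> \<alpha> (\<alpha> x) = x \<and> \<alpha> x \<noteq> x)"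

lemma pairingD:
  assumes "pairing X \<alpha>" "x \<in> X" shows "\<alpha> x \<in> X" "\<alpha> (\<alpha> x) = x" "\<alpha> x \<noteq> x"
  using assms by (auto simp: pairing_def)

fun alternate :: "('p \<Rightarrow> 'p) \<Rightarrow> ('p \<Rightarrow> 'p) \<Rightarrow> 'p \<Rightarrow> nat \<Rightarrow> 'p" where
  "alternate \<alpha> \<beta> x 0 = x"
| "alternate \<alpha> \<beta> x (Suc i) = (if even i then \<alpha> else \<beta>) (alternate \<alpha> \<beta> x i)"

lemma alternate_in: "\<lbrakk>pairing X \<alpha>; pairing X \<beta>; x \<in> X\<rbrakk> \<Longrightarrow> alternate \<alpha> \<beta> x i \<in> X"
  by (induction i) (auto dest: pairingD)

text \<open>
  An alternating sequence cannot meet itself with the wrong parity: peeling off equal steps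
  from both ends would lead to a fixed point of one of the two pairings.
\<close>

lemma alternate_parity:
  assumes \<alpha>: "pairing X \<alpha>" and \<beta>: "pairing X \<beta>" and x: "x \<in> X"
  shows "alternate \<alpha> \<beta> x i \<noteq> alternate \<alpha> \<beta> x (i + 2 * n + 1)"
proof (induction n arbitrary: i)
  case 0
  let ?y = "alternate \<alpha> \<beta> x i"
  have "?y \<in> X" by (rule alternate_in [OF \<alpha> \<beta> x])
  then show ?case using pairingD(3) [OF \<alpha>, of ?y] pairingD(3) [OF \<beta>, of ?y] by auto
next
  case (Suc n)
  let ?s = "alternate \<alpha> \<beta> x"
  let ?\<gamma> = "if even i then \<alpha> else \<beta>"
  have in_X: "?s m \<in> X" for m by (rule alternate_in [OF \<alpha> \<beta> x])
  have inv: "?\<gamma> (?\<gamma> y) = y" if "y \<in> X" for y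
    using that pairingD(2) [OF \<alpha>] pairingD(2) [OF \<beta>] by simp
  show ?case
  proof
    assume "?s i = ?s (i + 2 * Suc n + 1)"
    moreover have "?s (i + 2 * Suc n + 1) = ?\<gamma> (?s (i + 2 * n + 2))" by simp
    ultimately have 1: "?\<gamma> (?s i) = ?s (i + 2 * n + 2)" using inv [OF in_X] by metis
    have 2: "?s (Suc i) = ?\<gamma> (?s i)" by simp
    have 3: "i + 2 * n + 2 = Suc i + 2 * n + 1" by simp
    have "?s (Suc i) = ?s (Suc i + 2 * n + 1)" using 2 unfolding 1 3 .
    then show False using Suc.IH [of "Suc i"] by blast
  qed
qed

lemma alternate_inj_step:
  assumes \<alpha>: "pairing X \<alpha>" and \<beta>: "pairing X \<beta>" and x: "x \<in> X"
  shows "alternate \<alpha> \<beta> x i = alternate \<alpha> \<beta> x (i + 2 * n) \<Longrightarrow> x = alternate \<alpha> \<beta> x (2 * n)"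
proof (induction i)
  case 0
  then show ?case by simp
next
  case (Suc i)
  let ?s = "alternate \<alpha> \<beta> x"
  let ?\<gamma> = "if even i then \<alpha> else \<beta>"
  have in_X: "?s m \<in> X" for m by (rule alternate_in [OF \<alpha> \<beta> x])
  have inv: "?\<gamma> (?\<gamma> y) = y" if "y \<in> X" for y
    using that pairingD(2) [OF \<alpha>] pairingD(2) [OF \<beta>] by simp
  have "?\<gamma> (?s i) = ?\<gamma> (?s (i + 2 * n))" using Suc.prems by simp
  then have "?s i = ?s (i + 2 * n)" using inv in_X by metis
  then show ?case by (rule Suc.IH)
qed

text \<open>
  The sequence repeats itself by finiteness, the steps can be undone, and so the first
  repetition is a return to the start.
\<close>

lemma alternate_cycle:
  assumes fin: "finite X" and \<alpha>: "pairing X \<alpha>" and \<beta>: "pairing X \<beta>" and x: "x \<in> X"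
  obtains k where "k > 0" "alternate \<alpha> \<beta> x (2 * k) = x" "inj_on (alternate \<alpha> \<beta> x) {..<2 * k}"
proof -
  let ?s = "alternate \<alpha> \<beta> x"
  have "\<exists>n > 0. ?s (2 * n) = x"
  proof -
    have "(\<lambda>n. ?s (2 * n)) ` UNIV \<subseteq> X" using alternate_in [OF \<alpha> \<beta> x] by blast
    then have "finite ((\<lambda>n. ?s (2 * n)) ` UNIV)" using fin finite_subset by blast
    then have "\<not> inj (\<lambda>n::nat. ?s (2 * n))" using finite_imageD infinite_UNIV_nat by blast
    then obtain m n :: nat where mn: "m < n" "?s (2 * m) = ?s (2 * n)"
      unfolding inj_on_def by (metis linorder_neqE_nat)
    then have "?s (2 * m) = ?s (2 * m + 2 * (n - m))" by (simp add: algebra_simps)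
    from alternate_inj_step [OF \<alpha> \<beta> x this] show ?thesis using mn(1)
      by (intro exI [of _ "n - m"]) simp
  qed
  define k where "k = (LEAST n. n > 0 \<and> ?s (2 * n) = x)"
  have k: "k > 0 \<and> ?s (2 * k) = x"
    unfolding k_def by (rule LeastI_ex) fact
  have least: "k \<le> n" if "n > 0" "?s (2 * n) = x" for n
    unfolding k_def using that by (intro Least_le) simp
  have ne: "?s i \<noteq> ?s j" if "i < j" "j < 2 * k" for i j
  proof (cases "even (j - i)")
    case True
    then obtain n where n: "j - i = 2 * n" by (elim evenE)
    then have j: "j = i + 2 * n" "n > 0" "n < k" using that by auto
    show ?thesis
    proof
      assume "?s i = ?s j"
      then have "x = ?s (2 * n)" unfolding j(1) by (rule alternate_inj_step [OF \<alpha> \<beta> x])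
      then show False using least [OF j(2)] j(3) by simp
    qed
  next
    case False
    then obtain n where "j - i = 2 * n + 1" by (elim oddE)
    then have "j = i + 2 * n + 1" using that by auto
    then show ?thesis using alternate_parity [OF \<alpha> \<beta> x, of i n] by simp
  qed
  have "inj_on ?s {..<2 * k}"
  proof (rule inj_onI)
    fix i j assume "i \<in> {..<2 * k}" "j \<in> {..<2 * k}" "?s i = ?s j"
    then show "i = j" using ne [of i j] ne [of j i] by (cases i j rule: linorder_cases) auto
  qed
  then show ?thesis using k that by blast
qed

text \<open>
  The cycles are numbered by \<open>j < J\<close>. Position \<open>2 * k j\<close> is a second
  name of position 0, which avoids arithmetic modulo the length.
\<close>

definition cycle_system ::
  "'p set \<Rightarrow> ('p \<Rightarrow> 'p) \<Rightarrow> ('p \<Rightarrow> 'p) \<Rightarrow> nat \<Rightarrow> (nat \<Rightarrow> nat) \<Rightarrow> (nat \<Rightarrow> nat \<Rightarrow> 'p) \<Rightarrow> bool" where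
  "cycle_system X \<alpha> \<beta> J k x \<longleftrightarrow>
     bij_betw (\<lambda>(j, i). x j i) (SIGMA j:{..<J}. {..<2 * k j}) X \<and>
     (\<forall>j < J. k j > 0 \<and> x j (2 * k j) = x j 0 \<and>
       (\<forall>i < k j. \<alpha> (x j (2 * i)) = x j (2 * i + 1) \<and> \<beta> (x j (2 * i + 1)) = x j (2 * i + 2)))"

text \<open>
  The cycle through one element is closed under both pairings, and so is its complement.
\<close>

lemma cycle_system_exists:
  assumes "finite X" "pairing X \<alpha>" "pairing X \<beta>"
  shows "\<exists>J k x. cycle_system X \<alpha> \<beta> J k x"
  using assms
proof (induction "card X" arbitrary: X rule: less_induct)
  case less
  note fin = less.prems(1) and \<alpha> = less.prems(2) and \<beta> = less.prems(3)
  show ?case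
  proof (cases "X = {}")
    case True
    then have "cycle_system X \<alpha> \<beta> 0 (\<lambda>_. 0) (\<lambda>_ _. undefined)"
      by (simp add: cycle_system_def bij_betw_def)
    then show ?thesis by blast
  next
    case False
    then obtain y where y: "y \<in> X" by blast
    let ?s = "alternate \<alpha> \<beta> y"
    obtain n where n: "n > 0" "?s (2 * n) = y" "inj_on ?s {..<2 * n}"
      by (rule alternate_cycle [OF fin \<alpha> \<beta> y])
    let ?O = "?s ` {..<2 * n}"
    have in_X: "?s m \<in> X" for m by (rule alternate_in [OF \<alpha> \<beta> y])
    have O_X: "?O \<subseteq> X" using in_X by blast
    have y_O: "y \<in> ?O" using n(1) by (intro image_eqI [of _ _ 0]) auto
    have next_O: "?s (Suc i) \<in> ?O" if "i < 2 * n" for i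
      using that n(2) y_O by (cases "Suc i = 2 * n") (simp_all del: alternate.simps)
    have prev_O: "\<exists>m < 2 * n. ?s i = ?s (Suc m) \<and> even m = odd i" if "i < 2 * n" for i
    proof (cases i)
      case 0
      have "Suc (2 * n - 1) = 2 * n" using n(1) by simp
      then show ?thesis using 0 n(1,2) by (intro exI [of _ "2 * n - 1"]) (simp del: alternate.simps(2))
    next
      case (Suc m)
      then show ?thesis using that by (intro exI [of _ m]) (simp del: alternate.simps)
    qed
    have \<alpha>\<beta>_O: "\<alpha> z \<in> ?O \<and> \<beta> z \<in> ?O" if z: "z \<in> ?O" for z
    proof -
      obtain i where i: "i < 2 * n" "z = ?s i" using z by blast
      obtain m where m: "m < 2 * n" "?s i = ?s (Suc m)" "even m = odd i" using prev_O [OF i(1)] by blast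
      have sm: "?s m \<in> ?O" using m(1) by blast
      show ?thesis
      proof (cases "even i")
        case True
        have "\<alpha> z = ?s (Suc i)" using True i by simp
        moreover have "z = \<beta> (?s m)" using m True i by simp
        then have "\<beta> z = ?s m" using pairingD(2) [OF \<beta> in_X] by simp
        ultimately show ?thesis using next_O [OF i(1)] sm by simp
      next
        case False
        have "\<beta> z = ?s (Suc i)" using False i by simp
        moreover have "z = \<alpha> (?s m)" using m False i by simp
        then have "\<alpha> z = ?s m" using pairingD(2) [OF \<alpha> in_X] by simp
        ultimately show ?thesis using next_O [OF i(1)] sm by simp
      qed
    qed
    let ?Y = "X - ?O"
    have out: "\<alpha> z \<in> ?Y \<and> \<beta> z \<in> ?Y" if "z \<in> ?Y" for z
    proof -
      have z: "z \<in> X" "z \<notin> ?O" using that by auto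
      have "\<alpha> z \<notin> ?O" using \<alpha>\<beta>_O [of "\<alpha> z"] pairingD(2) [OF \<alpha> z(1)] z(2) by auto
      moreover have "\<beta> z \<notin> ?O" using \<alpha>\<beta>_O [of "\<beta> z"] pairingD(2) [OF \<beta> z(1)] z(2) by auto
      ultimately show ?thesis using pairingD(1) [OF \<alpha> z(1)] pairingD(1) [OF \<beta> z(1)] by blast
    qed
    have "pairing ?Y \<alpha>" "pairing ?Y \<beta>" using out \<alpha> \<beta> by (auto simp: pairing_def)
    moreover have "card ?Y < card X" using y y_O fin by (intro psubset_card_mono) auto
    ultimately obtain J k x where IH: "cycle_system ?Y \<alpha> \<beta> J k x"
      using less.hyps [of ?Y] fin by blast
    define k' where "k' = k(J := n)"
    define x' where "x' = x(J := ?s)"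
    have "bij_betw (\<lambda>(j, i). x' j i) (SIGMA j:{..<Suc J}. {..<2 * k' j}) X"
    proof -
      have "bij_betw (\<lambda>(j, i). x j i) (SIGMA j:{..<J}. {..<2 * k j}) ?Y"
        using IH by (simp add: cycle_system_def)
      moreover have "(SIGMA j:{..<J}. {..<2 * k' j}) = (SIGMA j:{..<J}. {..<2 * k j})"
        by (auto simp: k'_def)
      moreover have "bij_betw (\<lambda>(j, i). x' j i) (SIGMA j:{..<J}. {..<2 * k j}) ?Y =
          bij_betw (\<lambda>(j, i). x j i) (SIGMA j:{..<J}. {..<2 * k j}) ?Y"
        by (rule bij_betw_cong) (auto simp: x'_def)
      ultimately have "bij_betw (\<lambda>(j, i). x' j i) (SIGMA j:{..<J}. {..<2 * k' j}) ?Y" by simp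
      moreover have "bij_betw (\<lambda>(j, i). x' j i) ({J} \<times> {..<2 * n}) ?O"
        unfolding bij_betw_def
      proof
        show "inj_on (\<lambda>(j, i). x' j i) ({J} \<times> {..<2 * n})"
          using n(3) by (auto simp: inj_on_def x'_def)
        show "(\<lambda>(j, i). x' j i) ` ({J} \<times> {..<2 * n}) = ?O"
          by (auto simp: x'_def image_iff)
      qed
      ultimately have "bij_betw (\<lambda>(j, i). x' j i)
          ((SIGMA j:{..<J}. {..<2 * k' j}) \<union> {J} \<times> {..<2 * n}) (?Y \<union> ?O)"
        by (rule bij_betw_combine) auto
      moreover have "?Y \<union> ?O = X" using O_X by blast
      moreover have "(SIGMA j:{..<J}. {..<2 * k' j}) \<union> {J} \<times> {..<2 * n} = (SIGMA j:{..<Suc J}. {..<2 * k' j})"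
        by (auto simp: k'_def less_Suc_eq)
      ultimately show ?thesis by simp
    qed
    moreover have "k' j > 0 \<and> x' j (2 * k' j) = x' j 0 \<and>
       (\<forall>i < k' j. \<alpha> (x' j (2 * i)) = x' j (2 * i + 1) \<and> \<beta> (x' j (2 * i + 1)) = x' j (2 * i + 2))"
      if "j < Suc J" for j
    proof (cases "j = J")
      case True
      then show ?thesis using n by (simp add: k'_def x'_def)
    next
      case False
      then have "j < J" using that by simp
      then show ?thesis using IH by (simp add: k'_def x'_def cycle_system_def)
    qed
    ultimately have "cycle_system X \<alpha> \<beta> (Suc J) k' x'" by (simp add: cycle_system_def)
    then show ?thesis by blast
  qed
qed


section \<open>Every combinatorial arrow presentation comes from a ribbon graph\<close>

text \<open>
  An edge is attached to the vertices along two opposite quarters of its boundary circle. On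
  each of them the modulus of the imaginary part runs once through the unit interval.
\<close>

definition arc1 :: "complex set" where "arc1 = {z. norm z = 1 \<and> 0 \<le> Re z \<and> 0 \<le> Im z}"
definition arc2 :: "complex set" where "arc2 = {z. norm z = 1 \<and> Re z \<le> 0 \<and> Im z \<le> 0}"

lemma cis_arc1: "cis ` {0..pi/2} = arc1"
proof (intro equalityI subsetI)
  fix z assume "z \<in> cis ` {0..pi/2}"
  then show "z \<in> arc1" by (auto simp: arc1_def cos_ge_zero sin_ge_zero)
next
  fix z assume "z \<in> arc1"
  then have z: "norm z = 1" "0 \<le> Re z" "0 \<le> Im z" by (auto simp: arc1_def)
  have sq: "(Re z)\<^sup>2 + (Im z)\<^sup>2 = 1" using z(1) by (simp add: norm_complex_def)
  then have Re1: "Re z \<le> 1" by (metis abs_Re_le_cmod abs_le_iff z(1))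
  have "cos (arccos (Re z)) = Re z" using z Re1 by (intro cos_arccos) auto
  moreover have "sin (arccos (Re z)) = Im z"
  proof -
    have "sin (arccos (Re z)) = sqrt (1 - (Re z)\<^sup>2)" using z Re1 by (intro sin_arccos) auto
    also have "1 - (Re z)\<^sup>2 = (Im z)\<^sup>2" using sq by simp
    finally show ?thesis using z(3) by simp
  qed
  ultimately have "z = cis (arccos (Re z))" by (simp add: complex_eq_iff)
  moreover have "arccos (Re z) \<in> {0..pi/2}"
    using z Re1 arccos_le_pi2 [of "Re z"] arccos_lbound [of "Re z"] by auto
  ultimately show "z \<in> cis ` {0..pi/2}" by (rule image_eqI)
qed

lemma cis_arc2: "cis ` {pi..3*pi/2} = arc2"
proof -
  have "{pi..3*pi/2} = (\<lambda>t. t + pi) ` {0..pi/2}" by simp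
  then have "cis ` {pi..3*pi/2} = (\<lambda>t. cis (t + pi)) ` {0..pi/2}" by (simp only: image_image)
  also have "(\<lambda>t. cis (t + pi)) = (\<lambda>t. - cis t)" by (simp add: complex_eq_iff fun_eq_iff)
  also have "(\<lambda>t. - cis t) ` {0..pi/2} = uminus ` cis ` {0..pi/2}" by (simp only: image_image)
  also have "\<dots> = arc2"
    unfolding cis_arc1
  proof (intro equalityI subsetI)
    fix z assume "z \<in> arc2"
    then have "- z \<in> arc1" by (simp add: arc1_def arc2_def)
    then show "z \<in> uminus ` arc1" by (intro image_eqI [where x = "- z"]) simp_all
  qed (auto simp: arc1_def arc2_def)
  finally show ?thesis .
qed

text \<open>
  Two auxiliary functions on the unit disc: \<open>switch\<close> is 1 on the first quarter and
  0 on the opposite one, and \<open>depth\<close> vanishes on these two quarters only, so that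
  it can serve as the height by which an edge rises above the vertices.
\<close>

definition switch :: "complex \<Rightarrow> real" where "switch z = max 0 (min 1 (Re z + Im z))"

definition depth :: "complex \<Rightarrow> real" where "depth z = (1 - norm z) + max 0 (- (Re z * Im z))"

lemma norm1_squares: "norm z = 1 \<Longrightarrow> (Re z)\<^sup>2 + (Im z)\<^sup>2 = 1"
  by (simp add: norm_complex_def)

lemma switch_arc1: assumes "z \<in> arc1" shows "switch z = 1"
proof -
  have z: "(Re z)\<^sup>2 + (Im z)\<^sup>2 = 1" "0 \<le> Re z" "0 \<le> Im z"
    using assms norm1_squares by (auto simp: arc1_def)
  have "1 \<le> (Re z + Im z)\<^sup>2" using z mult_nonneg_nonneg [OF z(2,3)] by (simp add: power2_sum)
  then have "1 \<le> Re z + Im z" using z(2,3) power2_le_imp_le [of 1 "Re z + Im z"] by simp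
  then show ?thesis by (simp add: switch_def)
qed

lemma switch_arc2: "z \<in> arc2 \<Longrightarrow> switch z = 0"
  by (auto simp: arc2_def switch_def max_def min_def)

lemma depth_nonneg: "norm z \<le> 1 \<Longrightarrow> 0 \<le> depth z"
  by (simp add: depth_def)

lemma depth_0_iff: assumes "norm z \<le> 1" shows "depth z = 0 \<longleftrightarrow> z \<in> arc1 \<union> arc2"
proof -
  have "depth z = 0 \<longleftrightarrow> norm z = 1 \<and> 0 \<le> Re z * Im z"
  proof -
    have "0 \<le> 1 - norm z" "0 \<le> max 0 (- (Re z * Im z))" using assms by simp_all
    then have "depth z = 0 \<longleftrightarrow> 1 - norm z = 0 \<and> max 0 (- (Re z * Im z)) = 0"
      unfolding depth_def by (rule add_nonneg_eq_0_iff)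
    moreover have "max 0 (- (Re z * Im z)) = 0 \<longleftrightarrow> 0 \<le> Re z * Im z" by (simp add: max_def)
    ultimately show ?thesis by auto
  qed
  also have "\<dots> \<longleftrightarrow> z \<in> arc1 \<union> arc2"
    by (auto simp: arc1_def arc2_def zero_le_mult_iff)
  finally show ?thesis .
qed

lemma arc_norm: "z \<in> arc1 \<Longrightarrow> norm z = 1" "z \<in> arc2 \<Longrightarrow> norm z = 1"
  by (auto simp: arc1_def arc2_def)

lemma arc1_inj: assumes "z \<in> arc1" "w \<in> arc1" "Im z = Im w" shows "z = w"
proof -
  have "(Re z)\<^sup>2 + (Im z)\<^sup>2 = 1" "(Re w)\<^sup>2 + (Im w)\<^sup>2 = 1"
    using assms(1,2) by (simp_all add: norm1_squares arc1_def)
  then have "(Re z)\<^sup>2 = (Re w)\<^sup>2" unfolding assms(3) by linarith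
  moreover have "0 \<le> Re z" "0 \<le> Re w" using assms(1,2) by (simp_all add: arc1_def)
  ultimately have "Re z = Re w" by (rule power2_eq_imp_eq)
  with assms(3) show ?thesis by (simp add: complex_eq_iff)
qed

lemma arc2_inj: assumes "z \<in> arc2" "w \<in> arc2" "Im z = Im w" shows "z = w"
proof -
  have "- z \<in> arc1" "- w \<in> arc1" using assms by (auto simp: arc1_def arc2_def)
  then have "- z = - w" using assms(3) by (intro arc1_inj) auto
  then show ?thesis by simp
qed

lemma arc_Im: "z \<in> arc1 \<Longrightarrow> Im z \<in> {0..1}" "z \<in> arc2 \<Longrightarrow> - Im z \<in> {0..1}"
  using abs_Im_le_cmod [of z] by (auto simp: arc1_def arc2_def)

lemma arc_disjoint: "arc1 \<inter> arc2 = {}"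
proof -
  have False if "z \<in> arc1" "z \<in> arc2" for z using switch_arc1 [OF that(1)] switch_arc2 [OF that(2)] by simp
  then show ?thesis by blast
qed

text \<open>
  The first coordinate is the plane that contains the vertices; the other two keep the edges
  apart.
\<close>

type_synonym space = "complex \<times> complex \<times> complex"

text \<open>
  The ends of arrows in cyclic arrangement: each of the \<open>J\<close> cycles alternates
  between arrows, given by \<open>\<alpha>\<close>, and gaps, given by \<open>\<beta>\<close>.
\<close>

locale ribbon_model =
  fixes L :: "'e set" and P :: "('p, 'e) arrow_presentation"
    and \<alpha> \<beta> :: "'p \<Rightarrow> 'p" and J :: nat and k :: "nat \<Rightarrow> nat" and x :: "nat \<Rightarrow> nat \<Rightarrow> 'p"
  assumes finL: "finite L"
    and dist: "e \<in> L \<Longrightarrow> pair_distinct (arrows P e)"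
    and disj: "\<lbrakk>e \<in> L; e' \<in> L; e \<noteq> e'\<rbrakk> \<Longrightarrow> pair_points (arrows P e) \<inter> pair_points (arrows P e') = {}"
    and arr: "\<lbrakk>e \<in> L; arrows P e = ((a, b), (c, d))\<rbrakk> \<Longrightarrow> \<alpha> a = b \<and> \<alpha> c = d"
    and \<alpha>: "pairing (arrow_points L P) \<alpha>"
    and cyc: "cycle_system (arrow_points L P) \<alpha> \<beta> J k x"
    and gaps: "gaps P = {{x j (2 * i + 1), x j (2 * i + 2)} |j i. j < J \<and> i < k j}"
begin

abbreviation X where "X \<equiv> arrow_points L P"

text \<open>
  The circles have radius 1, and their centres have distance at least 4. The period of the
  parametrisation is \<open>2 * k j\<close>, so that the ends on the cycle sit at the integers.
\<close>

definition circ :: "nat \<Rightarrow> real \<Rightarrow> complex" where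
  "circ j t = of_nat (4 * j) + cis (pi * t / real (k j))"

definition loc :: "'p \<Rightarrow> nat \<times> nat" where
  "loc = inv_into (SIGMA j:{..<J}. {..<2 * k j}) (\<lambda>(j, i). x j i)"

abbreviation "cyc_of p \<equiv> fst (loc p)"
abbreviation "idx_of p \<equiv> snd (loc p)"

definition pos :: "'p \<Rightarrow> complex" where "pos p = circ (cyc_of p) (real (idx_of p))"

text \<open>
  The arrow with end \<open>p\<close> occupies the interval from an even position to the next
  one; it has to be traversed backwards if \<open>p\<close> is at the odd position.
\<close>

definition local_par :: "'p \<Rightarrow> real \<Rightarrow> real" where
  "local_par p u = (if even (idx_of p) then u else 1 - u)"

text \<open>
  The path from \<open>p\<close> to \<open>\<alpha> p\<close> on the circle of a vertex.
\<close>

definition arrow_path :: "'p \<Rightarrow> real \<Rightarrow> complex" where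
  "arrow_path p u = circ (cyc_of p) (2 * real (idx_of p div 2) + local_par p u)"

lemma kpos: "j < J \<Longrightarrow> k j > 0"
  using cyc by (simp add: cycle_system_def)

lemma bij_x: "bij_betw (\<lambda>(j, i). x j i) (SIGMA j:{..<J}. {..<2 * k j}) X"
  using cyc by (simp add: cycle_system_def)

lemma loc: assumes "p \<in> X" shows "cyc_of p < J" "idx_of p < 2 * k (cyc_of p)" "x (cyc_of p) (idx_of p) = p"
proof -
  have p: "p \<in> (\<lambda>(j, i). x j i) ` (SIGMA j:{..<J}. {..<2 * k j})"
    using bij_x assms by (simp add: bij_betw_def)
  have "loc p \<in> (SIGMA j:{..<J}. {..<2 * k j})" unfolding loc_def by (rule inv_into_into [OF p])
  then show "cyc_of p < J" "idx_of p < 2 * k (cyc_of p)" by auto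
  have "(\<lambda>(j, i). x j i) (loc p) = p" unfolding loc_def by (rule f_inv_into_f [OF p])
  then show "x (cyc_of p) (idx_of p) = p" by (simp add: case_prod_beta)
qed

lemma loc_x: assumes "j < J" "i < 2 * k j" shows "loc (x j i) = (j, i)"
proof -
  have "loc ((\<lambda>(j, i). x j i) (j, i)) = (j, i)"
    unfolding loc_def using bij_x assms by (intro inv_into_f_f) (auto simp: bij_betw_def)
  then show ?thesis by simp
qed

lemma x_in_X: assumes "j < J" "i < 2 * k j" shows "x j i \<in> X"
  using bij_betw_apply [OF bij_x, of "(j, i)"] assms by simp

lemma x_even: "\<lbrakk>j < J; i < k j\<rbrakk> \<Longrightarrow> \<alpha> (x j (2 * i)) = x j (2 * i + 1)"
  using cyc by (simp add: cycle_system_def)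

lemma arrow_path_0: "arrow_path p 0 = pos p"
proof (cases "even (idx_of p)")
  case True
  then show ?thesis by (auto simp: arrow_path_def pos_def local_par_def elim!: evenE)
next
  case False
  then show ?thesis by (auto simp: arrow_path_def pos_def local_par_def add.commute elim!: oddE)
qed

lemma arrow_path_1: assumes p: "p \<in> X" shows "arrow_path p 1 = pos (\<alpha> p)"
proof (cases "even (idx_of p)")
  case True
  then obtain n where n: "idx_of p = 2 * n" by (elim evenE)
  have nk: "n < k (cyc_of p)" using loc(2) [OF p] n by simp
  have "\<alpha> p = x (cyc_of p) (2 * n + 1)" using x_even [OF loc(1) [OF p] nk] loc(3) [OF p] n by simp
  then have "loc (\<alpha> p) = (cyc_of p, 2 * n + 1)" using loc_x [OF loc(1) [OF p], of "2 * n + 1"] nk by simp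
  then show ?thesis using n by (simp add: arrow_path_def pos_def local_par_def add.commute)
next
  case False
  then obtain n where n: "idx_of p = 2 * n + 1" by (elim oddE)
  have nk: "n < k (cyc_of p)" using loc(2) [OF p] n by simp
  have "x (cyc_of p) (2 * n) \<in> X" using x_in_X [OF loc(1) [OF p]] nk by simp
  moreover have "\<alpha> (x (cyc_of p) (2 * n)) = p" using x_even [OF loc(1) [OF p] nk] loc(3) [OF p] n by simp
  ultimately have "\<alpha> p = x (cyc_of p) (2 * n)" using pairingD(2) [OF \<alpha>] by metis
  then have "loc (\<alpha> p) = (cyc_of p, 2 * n)" using loc_x [OF loc(1) [OF p], of "2 * n"] nk by simp
  then show ?thesis using n by (simp add: arrow_path_def pos_def local_par_def)
qed

text \<open>
  Distinct circles are disjoint because of the distance of their centres.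
\<close>

lemma circ_eq:
  assumes "circ j s = circ j' t" and j: "j < J"
  shows "j = j'" "\<exists>m::int. s = t + 2 * real (k j) * real_of_int m"
proof -
  show cyc_of: "j = j'"
  proof (rule ccontr)
    assume ne: "j \<noteq> j'"
    have "complex_of_real (4 * (real j - real j')) = cis (pi * t / real (k j')) - cis (pi * s / real (k j))"
      using assms(1) by (simp add: circ_def algebra_simps)
    then have "\<bar>4 * (real j - real j')\<bar> = norm (cis (pi * t / real (k j')) - cis (pi * s / real (k j)))"
      by (metis norm_of_real)
    also have "\<dots> \<le> 1 + 1" by (rule norm_triangle_le_diff) simp
    finally have "\<bar>4 * (real j - real j')\<bar> \<le> 2" by simp
    then have le2: "4 * \<bar>real j - real j'\<bar> \<le> 2" by (simp add: abs_mult)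
    have "1 \<le> \<bar>real j - real j'\<bar>" using ne by linarith
    then have "4 * 1 \<le> 4 * \<bar>real j - real j'\<bar>" by (rule mult_left_mono) simp
    also note le2
    finally show False by simp
  qed
  have "cis (pi * s / real (k j)) = cis (pi * t / real (k j))" using assms(1) unfolding cyc_of circ_def by simp
  then obtain m :: int where "pi * s / real (k j) = pi * t / real (k j) + 2 * pi * m"
    unfolding cis_eq_cis_iff by blast
  then have "pi * s = pi * (t + 2 * real (k j) * real_of_int m)" using kpos [OF j] by (simp add: field_simps)
  then have "s = t + 2 * real (k j) * real_of_int m" by simp
  then show "\<exists>m::int. s = t + 2 * real (k j) * real_of_int m" by blast
qed

lemma block_circ_eq:
  assumes eq: "circ j (2 * real n + s) = circ j' (2 * real n' + t)"
    and j: "j < J" and st: "s \<in> {0..1}" "t \<in> {0..1}" and n: "n < k j" "n' < k j'"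
  shows "j = j'" "n = n'" "s = t"
proof -
  show cyc_of: "j = j'" by (rule circ_eq(1) [OF eq j])
  obtain m :: int where m: "2 * real n + s = 2 * real n' + t + 2 * real (k j) * real_of_int m"
    using circ_eq(2) [OF eq j] by blast
  define q :: int where "q = int n - int n' - int (k j) * m"
  have q: "2 * real_of_int q = t - s" using m by (simp add: q_def algebra_simps)
  then have "\<bar>2 * real_of_int q\<bar> \<le> 1" using st by auto
  then have "q = 0" by linarith
  then show "s = t" using q by simp
  have qm: "int n - int n' = int (k j) * m" using \<open>q = 0\<close> by (simp add: q_def)
  have "m = 0"
  proof (rule ccontr)
    assume "m \<noteq> 0"
    then have "int (k j) * 1 \<le> int (k j) * \<bar>m\<bar>" by (intro mult_left_mono) auto
    then have "int (k j) \<le> \<bar>int n - int n'\<bar>" unfolding qm by (simp add: abs_mult)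
    then show False using n cyc_of by simp
  qed
  then show "n = n'" using qm by simp
qed

lemma local_par_01: "u \<in> {0..1} \<Longrightarrow> local_par p u \<in> {0..1}"
  by (auto simp: local_par_def)

lemma arrow_path_eq:
  assumes "arrow_path p u = arrow_path q v" and pq: "p \<in> X" "q \<in> X" and uv: "u \<in> {0..1}" "v \<in> {0..1}"
  shows "cyc_of p = cyc_of q" "idx_of p div 2 = idx_of q div 2" "local_par p u = local_par q v"
  using block_circ_eq [OF assms(1) [unfolded arrow_path_def] loc(1) [OF pq(1)] local_par_01 [OF uv(1)] local_par_01 [OF uv(2)]]
    loc(2) [OF pq(1)] loc(2) [OF pq(2)] by auto

lemma block_eq:
  assumes pq: "p \<in> X" "q \<in> X" "cyc_of p = cyc_of q" "idx_of p div 2 = idx_of q div 2"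
  shows "q = p \<or> q = \<alpha> p"
proof -
  have *: "q = \<alpha> p" if pq: "p \<in> X" "q \<in> X" "cyc_of p = cyc_of q" "idx_of p div 2 = idx_of q div 2" "even (idx_of p)" "odd (idx_of q)" for p q
  proof -
    obtain n where n: "idx_of p = 2 * n" using pq(5) by (elim evenE)
    then have "idx_of q = 2 * n + 1" using pq(4,6) by (auto elim!: oddE)
    then show ?thesis
      using x_even [OF loc(1) [OF pq(1)], of n] n loc(2,3) [OF pq(1)] loc(3) [OF pq(2)] pq(3) by simp
  qed
  consider "even (idx_of p) = even (idx_of q)" | "even (idx_of p)" "odd (idx_of q)" | "odd (idx_of p)" "even (idx_of q)" by blast
  then show ?thesis
  proof cases
    case 1
    then have "idx_of p = idx_of q" using pq(4) by (metis even_two_times_div_two odd_two_times_div_two_succ)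
    then have "p = q" using loc(3) [OF pq(1)] loc(3) [OF pq(2)] pq(3) by metis
    then show ?thesis by simp
  next
    case 2 then show ?thesis using * [OF pq] by simp
  next
    case 3
    then have "p = \<alpha> q" using * [of q p] pq by simp
    then show ?thesis using pairingD(2) [OF \<alpha> pq(2)] by simp
  qed
qed

lemma arrow_path_inj: "\<lbrakk>arrow_path p u = arrow_path p v; p \<in> X; u \<in> {0..1}; v \<in> {0..1}\<rbrakk> \<Longrightarrow> u = v"
  using arrow_path_eq(3) [of p u p v] by (simp add: local_par_def split: if_splits)

lemma pos_inj: "inj_on pos X"
proof (rule inj_onI)
  fix p q assume pq: "p \<in> X" "q \<in> X" "pos p = pos q"
  then have eq: "arrow_path p 0 = arrow_path q 0" by (simp add: arrow_path_0)
  have "local_par p 0 = local_par q 0" "cyc_of p = cyc_of q" "idx_of p div 2 = idx_of q div 2"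
    using arrow_path_eq [OF eq pq(1,2)] by simp_all
  then have "even (idx_of p) = even (idx_of q)" by (auto simp: local_par_def split: if_splits)
  then have "idx_of p = idx_of q" using \<open>idx_of p div 2 = idx_of q div 2\<close> by (metis even_two_times_div_two odd_two_times_div_two_succ)
  then show "p = q" using loc(3) [OF pq(1)] loc(3) [OF pq(2)] \<open>cyc_of p = cyc_of q\<close> by metis
qed

lemma arrow_path_circle: "norm (arrow_path p u - of_nat (4 * cyc_of p)) = 1"
  by (simp add: arrow_path_def circ_def)

lemma continuous_arrow_path: "continuous_on UNIV (arrow_path p)"
proof (cases "even (idx_of p)")
  case True
  then have "arrow_path p = (\<lambda>u. of_nat (4 * cyc_of p) + cis (pi * (2 * real (idx_of p div 2) + u) / real (k (cyc_of p))))"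
    by (simp add: arrow_path_def circ_def local_par_def fun_eq_iff)
  then show ?thesis by (simp add: cis_conv_exp divide_inverse) (intro continuous_intros)
next
  case False
  then have "arrow_path p = (\<lambda>u. of_nat (4 * cyc_of p) + cis (pi * (2 * real (idx_of p div 2) + (1 - u)) / real (k (cyc_of p))))"
    by (simp add: arrow_path_def circ_def local_par_def fun_eq_iff)
  then show ?thesis by (simp add: cis_conv_exp divide_inverse) (intro continuous_intros)
qed

definition tail1 :: "'e \<Rightarrow> 'p" where "tail1 e = fst (fst (arrows P e))"
definition tail2 :: "'e \<Rightarrow> 'p" where "tail2 e = fst (snd (arrows P e))"

lemma tails:
  assumes e: "e \<in> L"
  shows "arrows P e = ((tail1 e, \<alpha> (tail1 e)), (tail2 e, \<alpha> (tail2 e)))"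
    "tail1 e \<in> X" "tail2 e \<in> X" "distinct [tail1 e, \<alpha> (tail1 e), tail2 e, \<alpha> (tail2 e)]"
    "pair_points (arrows P e) = {tail1 e, \<alpha> (tail1 e), tail2 e, \<alpha> (tail2 e)}"
proof -
  obtain a b c d where abcd: "arrows P e = ((a, b), (c, d))" by (cases "arrows P e" rule: pair_points.cases)
  then show eq: "arrows P e = ((tail1 e, \<alpha> (tail1 e)), (tail2 e, \<alpha> (tail2 e)))"
    using arr [OF e abcd] by (simp add: tail1_def tail2_def)
  show pp: "pair_points (arrows P e) = {tail1 e, \<alpha> (tail1 e), tail2 e, \<alpha> (tail2 e)}" by (subst eq) simp
  show "distinct [tail1 e, \<alpha> (tail1 e), tail2 e, \<alpha> (tail2 e)]" using dist [OF e] by (subst (asm) eq) simp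
  have "pair_points (arrows P e) \<subseteq> X" using e by (auto simp: arrow_points_eq)
  then show "tail1 e \<in> X" "tail2 e \<in> X" unfolding pp by simp_all
qed

lemma tails_blocks:
  assumes "e \<in> L" "e' \<in> L" "p \<in> {tail1 e, tail2 e}" "q \<in> {tail1 e', tail2 e'}"
    and "cyc_of p = cyc_of q" "idx_of p div 2 = idx_of q div 2"
  shows "e = e' \<and> p = q"
proof -
  have pX: "p \<in> X" "q \<in> X" using tails(2,3) assms(1-4) by auto
  have qp: "q = p \<or> q = \<alpha> p" by (rule block_eq [OF pX assms(5,6)])
  have "e = e'"
  proof (rule ccontr)
    assume "e \<noteq> e'"
    from disj [OF assms(1,2) this] show False
      unfolding tails(5) [OF assms(1)] tails(5) [OF assms(2)] using assms(3,4) qp by auto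
  qed
  moreover have "p = q" using tails(4) [OF assms(1)] assms(3,4) qp \<open>e = e'\<close> by auto
  ultimately show ?thesis by simp
qed

text \<open>
  Along the two quarters of the boundary this follows the two arrows from tail to head; in
  between it interpolates.
\<close>

definition glue :: "'e \<Rightarrow> complex \<Rightarrow> complex" where
  "glue e z = of_real (switch z) * arrow_path (tail1 e) (Im z) + of_real (1 - switch z) * arrow_path (tail2 e) (- Im z)"

lemma glue_arc1: "z \<in> arc1 \<Longrightarrow> glue e z = arrow_path (tail1 e) (Im z)"
  by (simp add: glue_def switch_arc1)

lemma glue_arc2: "z \<in> arc2 \<Longrightarrow> glue e z = arrow_path (tail2 e) (- Im z)"
  by (simp add: glue_def switch_arc2)

lemma continuous_glue: "continuous_on A (glue e)"
proof -
  have 1: "continuous_on A (\<lambda>z. arrow_path p (Im z))" for p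
    by (rule continuous_on_compose2 [OF continuous_arrow_path]) (auto intro!: continuous_intros)
  have 2: "continuous_on A (\<lambda>z. arrow_path p (- Im z))" for p
    by (rule continuous_on_compose2 [OF continuous_arrow_path]) (auto intro!: continuous_intros)
  show ?thesis unfolding glue_def switch_def by (intro continuous_intros 1 2)
qed

definition num :: "'e \<Rightarrow> nat" where "num = (SOME f. inj_on f L)"

lemma num_inj: "inj_on num L"
proof -
  have "\<exists>f::'e \<Rightarrow> nat. inj_on f L" using finite_imp_inj_to_nat_seg [OF finL] by blast
  then show ?thesis unfolding num_def by (rule someI_ex)
qed

text \<open>
  The modulus of the second coordinate is \<open>depth z\<close>, and where it does not vanish
  its argument tells the edge, as the angles \<open>1 / (n + 1)\<close> are distinct and lie in
  a single period; the third coordinate then gives back \<open>z\<close>. So two edges can have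
  points in common only where both touch the plane of the vertices, which they do along their
  two quarters.
\<close>

definition edge_chart :: "'e \<Rightarrow> complex \<Rightarrow> space" where
  "edge_chart e z = (glue e z, of_real (depth z) * cis (1 / (real (num e) + 1)), of_real (depth z) * z)"

definition vert_chart :: "nat \<Rightarrow> complex \<Rightarrow> space" where
  "vert_chart j z = (of_nat (4 * j) + z, 0, 0)"

definition edge_disc :: "'e \<Rightarrow> space set" where "edge_disc e = edge_chart e ` cball 0 1"
definition vert_disc :: "nat \<Rightarrow> space set" where "vert_disc j = vert_chart j ` cball 0 1"

text \<open>
  The discs with numbers from \<open>J\<close> on are the circles without arrows.
\<close>

definition model :: "space ribbon" where
  "model = \<lparr>surface = top_of_set (\<Union> (vert_disc ` {..<J + bare P}) \<union> \<Union> (edge_disc ` L)),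
     verts = vert_disc ` {..<J + bare P}, edges = edge_disc ` L\<rparr>"

lemma edge_chart_depth0:
  assumes "norm z \<le> 1" shows "fst (snd (edge_chart e z)) = 0 \<longleftrightarrow> z \<in> arc1 \<union> arc2"
  using depth_0_iff [OF assms] by (simp add: edge_chart_def)

lemma edge_chart_arcs: "z \<in> arc1 \<union> arc2 \<Longrightarrow> edge_chart e z = (glue e z, 0, 0)"
  using depth_0_iff [of z] arc_norm by (auto simp: edge_chart_def)

lemma glue_arcs_eq:
  assumes e: "e \<in> L" "e' \<in> L" and z: "z \<in> arc1 \<union> arc2" "w \<in> arc1 \<union> arc2" and eq: "glue e z = glue e' w"
  shows "e = e' \<and> z = w"
proof -
  have ne: "tail1 e \<noteq> tail2 e" "tail1 e' \<noteq> tail2 e'" using tails(4) [OF e(1)] tails(4) [OF e(2)] by simp_all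
  have key: "e = e' \<and> p = q \<and> u = v"
    if "p \<in> {tail1 e, tail2 e}" "q \<in> {tail1 e', tail2 e'}" "u \<in> {0..1}" "v \<in> {0..1}" "arrow_path p u = arrow_path q v" for p q u v
  proof -
    have pX: "p \<in> X" "q \<in> X" using tails(2,3) that(1,2) e by auto
    have "e = e' \<and> p = q" by (rule tails_blocks [OF e that(1,2) arrow_path_eq(1,2) [OF that(5) pX that(3,4)]])
    then show ?thesis using arrow_path_inj [of p u v] that(3-5) pX by simp
  qed
  from z consider "z \<in> arc1" "w \<in> arc1" | "z \<in> arc1" "w \<in> arc2" | "z \<in> arc2" "w \<in> arc1" | "z \<in> arc2" "w \<in> arc2" by blast
  then show ?thesis
  proof cases
    case 1
    then show ?thesis using key [of "tail1 e" "tail1 e'" "Im z" "Im w"] eq arc_Im(1) arc1_inj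
      by (simp add: glue_arc1)
  next
    case 2
    then have "e = e' \<and> tail1 e = tail2 e'" using key [of "tail1 e" "tail2 e'" "Im z" "- Im w"] eq arc_Im
      unfolding glue_arc1 [OF 2(1)] glue_arc2 [OF 2(2)] using 2 by blast
    then show ?thesis using ne by blast
  next
    case 3
    then have "e = e' \<and> tail2 e = tail1 e'" using key [of "tail2 e" "tail1 e'" "- Im z" "Im w"] eq arc_Im
      unfolding glue_arc2 [OF 3(1)] glue_arc1 [OF 3(2)] using 3 by blast
    then show ?thesis using ne by metis
  next
    case 4
    then show ?thesis using key [of "tail2 e" "tail2 e'" "- Im z" "- Im w"] eq arc_Im(2) arc2_inj
      by (simp add: glue_arc2)
  qed
qed

lemma edge_chart_eq:
  assumes e: "e \<in> L" "e' \<in> L" and z: "norm z \<le> 1" "norm w \<le> 1" and eq: "edge_chart e z = edge_chart e' w"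
  shows "e = e' \<and> z = w"
proof -
  have "norm (fst (snd (edge_chart e z))) = norm (fst (snd (edge_chart e' w)))" by (simp only: eq)
  then have d: "depth z = depth w" using depth_nonneg [OF z(1)] depth_nonneg [OF z(2)]
    by (simp add: edge_chart_def norm_mult)
  show ?thesis
  proof (cases "depth z = 0")
    case True
    then have arcs: "z \<in> arc1 \<union> arc2" "w \<in> arc1 \<union> arc2"
      using True d depth_0_iff [OF z(1)] depth_0_iff [OF z(2)] by simp_all
    have "glue e z = glue e' w" using eq by (simp add: edge_chart_def)
    then show ?thesis by (rule glue_arcs_eq [OF e arcs])
  next
    case False
    then have c: "cis (1 / (real (num e) + 1)) = cis (1 / (real (num e') + 1))" and "z = w"
      using eq d by (auto simp: edge_chart_def)
    have "\<bar>1 / (real (num e) + 1) - 1 / (real (num e') + 1)\<bar> < 2 * pi"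
    proof -
      have "0 < 1 / (real n + 1)" "1 / (real n + 1) \<le> 1" for n by simp_all
      note * = this [of "num e"] this [of "num e'"]
      show ?thesis using * pi_gt3 by linarith
    qed
    then have "1 / (real (num e) + 1) = 1 / (real (num e') + 1)" using cis_inj [OF c] by simp
    then have "num e = num e'" by simp
    then show ?thesis using num_inj e \<open>z = w\<close> by (auto dest: inj_onD)
  qed
qed

lemma vert_chart_eq:
  assumes "vert_chart j z = vert_chart j' w" "norm z \<le> 1" "norm w \<le> 1" shows "j = j' \<and> z = w"
proof -
  have eq: "of_nat (4 * j) + z = of_nat (4 * j') + w" using assms(1) by (simp add: vert_chart_def)
  have "j = j'"
  proof (rule ccontr)
    assume ne: "j \<noteq> j'"
    have "complex_of_real (4 * (real j - real j')) = w - z" using eq by (simp add: algebra_simps)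
    then have "\<bar>4 * (real j - real j')\<bar> = norm (w - z)" by (metis norm_of_real)
    also have "\<dots> \<le> 1 + 1" using assms(2,3) norm_triangle_ineq4 [of w z] by simp
    finally have "\<bar>4 * (real j - real j')\<bar> \<le> 2" by simp
    then have le2: "4 * \<bar>real j - real j'\<bar> \<le> 2" by (simp add: abs_mult)
    have "1 \<le> \<bar>real j - real j'\<bar>" using ne by linarith
    then have "4 * 1 \<le> 4 * \<bar>real j - real j'\<bar>" by (rule mult_left_mono) simp
    also note le2
    finally show False by simp
  qed
  then show ?thesis using eq by simp
qed

lemma X_model: "Hausdorff_space (surface model)"
  by (simp add: model_def Hausdorff_space_subtopology)

lemma param_into_model:
  assumes "continuous_on (cball 0 1) h" "inj_on h (cball 0 1)" "h ` cball 0 1 = D" "D \<in> verts model \<union> edges model"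
  shows "disc_param (surface model) D h"
  using assms unfolding disc_param_def
  by (auto simp: model_def continuous_map_in_subtopology)

lemma edge_param: assumes "e \<in> L" shows "disc_param (surface model) (edge_disc e) (edge_chart e)"
proof (rule param_into_model)
  show "continuous_on (cball 0 1) (edge_chart e)"
    unfolding edge_chart_def depth_def by (intro continuous_intros continuous_glue)
  show "inj_on (edge_chart e) (cball 0 1)"
    by (rule inj_onI) (use edge_chart_eq [OF assms assms] in auto)
qed (use assms in \<open>auto simp: edge_disc_def model_def\<close>)

lemma vert_param: assumes "j < J + bare P" shows "disc_param (surface model) (vert_disc j) (vert_chart j)"
proof (rule param_into_model)
  show "continuous_on (cball 0 1) (vert_chart j)"
    unfolding vert_chart_def by (intro continuous_intros)
  show "inj_on (vert_chart j) (cball 0 1)"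
    by (rule inj_onI) (use vert_chart_eq in auto)
qed (use assms in \<open>auto simp: vert_disc_def model_def\<close>)

definition strip1 :: "'e \<Rightarrow> space set" where "strip1 e = edge_chart e ` arc1"
definition strip2 :: "'e \<Rightarrow> space set" where "strip2 e = edge_chart e ` arc2"

lemma strip_in_vert:
  assumes e: "e \<in> L"
  shows "strip1 e \<subseteq> vert_chart (cyc_of (tail1 e)) ` sphere 0 1" "strip2 e \<subseteq> vert_chart (cyc_of (tail2 e)) ` sphere 0 1"
proof -
  have arrow_path: "(arrow_path p u, 0, 0) \<in> vert_chart (cyc_of p) ` sphere 0 1" for p u
    by (rule image_eqI [where x = "arrow_path p u - of_nat (4 * cyc_of p)"]) (use arrow_path_circle [of p u] in \<open>auto simp: vert_chart_def\<close>)
  show "strip1 e \<subseteq> vert_chart (cyc_of (tail1 e)) ` sphere 0 1"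
    unfolding strip1_def using arrow_path by (auto simp: edge_chart_arcs glue_arc1)
  show "strip2 e \<subseteq> vert_chart (cyc_of (tail2 e)) ` sphere 0 1"
    unfolding strip2_def using arrow_path by (auto simp: edge_chart_arcs glue_arc2)
qed

lemma strip_vert_sub:
  assumes e: "e \<in> L"
  shows "strip1 e \<subseteq> vert_disc (cyc_of (tail1 e))" "strip2 e \<subseteq> vert_disc (cyc_of (tail2 e))"
  using strip_in_vert [OF e] unfolding vert_disc_def using sphere_cball by blast+

text \<open>
  A point of an edge in the plane of the vertices has depth 0.
\<close>

lemma edge_meets_vert:
  assumes e: "e \<in> L" and y: "y \<in> edge_disc e" "y \<in> vert_disc j"
  shows "y \<in> strip1 e \<and> j = cyc_of (tail1 e) \<or> y \<in> strip2 e \<and> j = cyc_of (tail2 e)"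
proof -
  obtain z where z: "norm z \<le> 1" "y = edge_chart e z" using y(1) by (auto simp: edge_disc_def)
  have "fst (snd y) = 0" using y(2) by (auto simp: vert_disc_def vert_chart_def)
  then have "z \<in> arc1 \<union> arc2" using edge_chart_depth0 [OF z(1)] z(2) by simp
  then have yS: "y \<in> strip1 e \<or> y \<in> strip2 e" using z(2) by (auto simp: strip1_def strip2_def)
  have same: "j = j'" if "y \<in> vert_disc j'" for j'
    using that y(2) vert_chart_eq by (fastforce simp: vert_disc_def)
  show ?thesis using yS same strip_vert_sub [OF e] by blast
qed

lemma cyc_of_tails: "e \<in> L \<Longrightarrow> cyc_of (tail1 e) < J" "e \<in> L \<Longrightarrow> cyc_of (tail2 e) < J"
  using loc(1) tails(2,3) by simp_all

lemma strips_sub_edge: "strip1 e \<subseteq> edge_disc e" "strip2 e \<subseteq> edge_disc e"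
  unfolding strip1_def strip2_def edge_disc_def using arc_norm by (auto intro!: imageI)

lemma edge_Int_verts:
  assumes e: "e \<in> L" shows "edge_disc e \<inter> \<Union> (verts model) = strip1 e \<union> strip2 e"
proof (intro equalityI subsetI)
  fix y assume "y \<in> edge_disc e \<inter> \<Union> (verts model)"
  then obtain j where "y \<in> edge_disc e" "y \<in> vert_disc j" unfolding model_def by (auto simp del: split_paired_All)
  from edge_meets_vert [OF e this] show "y \<in> strip1 e \<union> strip2 e" by blast
next
  fix y assume y: "y \<in> strip1 e \<union> strip2 e"
  then have "y \<in> vert_disc (cyc_of (tail1 e)) \<or> y \<in> vert_disc (cyc_of (tail2 e))" using strip_vert_sub [OF e] by blast
  then have "y \<in> \<Union> (verts model)" using cyc_of_tails [OF e] by (auto simp: model_def)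
  then show "y \<in> edge_disc e \<inter> \<Union> (verts model)" using y strips_sub_edge by blast
qed

lemma strip_eqs: "strip1 e = edge_chart e ` cis ` {0..pi/2}" "strip2 e = edge_chart e ` cis ` {pi..3*pi/2}"
  by (simp_all only: strip1_def strip2_def cis_arc1 cis_arc2)

lemma strip_segments:
  assumes e: "e \<in> L" shows "is_segment (surface model) (strip1 e)" "is_segment (surface model) (strip2 e)"
  unfolding strip_eqs by (rule cis_arc_segment(1) [OF X_model edge_param [OF e]]; simp)+

lemma strips_disjoint: assumes e: "e \<in> L" shows "strip1 e \<inter> strip2 e = {}"
proof -
  have False if "z \<in> arc1" "w \<in> arc2" "edge_chart e z = edge_chart e w" for z w
  proof -
    have "z = w" using edge_chart_eq [OF e e _ _ that(3)] arc_norm(1) [OF that(1)] arc_norm(2) [OF that(2)] by simp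
    then show False using that(1,2) arc_disjoint by blast
  qed
  then show ?thesis unfolding strip1_def strip2_def by blast
qed

lemma strips_boundary:
  assumes e: "e \<in> L"
  shows "strip1 e \<subseteq> disc_boundary (surface model) (edge_disc e)" "strip2 e \<subseteq> disc_boundary (surface model) (edge_disc e)"
  unfolding disc_boundary_eq [OF X_model edge_param [OF e]] strip1_def strip2_def using arc_norm by auto

lemma strip_nonempty: "e \<in> L \<Longrightarrow> strip1 e \<noteq> {}" "e \<in> L \<Longrightarrow> strip2 e \<noteq> {}"
  using is_segment_nonempty [OF X_model] strip_segments by blast+

text \<open>
  The two quarters are disjoint arcs, hence the components of what the edge shares with the
  vertices; both may lie on the same vertex.
\<close>

lemma model_segments:
  assumes e: "e \<in> L"
  shows "segments model (vert_disc j) (edge_disc e) =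
    (if cyc_of (tail1 e) = j then {strip1 e} else {}) \<union> (if cyc_of (tail2 e) = j then {strip2 e} else {})"
proof -
  let ?A = "(if cyc_of (tail1 e) = j then {strip1 e} else {}) \<union> (if cyc_of (tail2 e) = j then {strip2 e} else {})"
  have "vert_disc j \<inter> edge_disc e = \<Union>?A"
  proof (intro equalityI subsetI)
    fix y assume "y \<in> vert_disc j \<inter> edge_disc e"
    then show "y \<in> \<Union>?A" using edge_meets_vert [OF e, of y j] by auto
  next
    fix y assume "y \<in> \<Union>?A"
    then show "y \<in> vert_disc j \<inter> edge_disc e"
      using strip_vert_sub [OF e] strips_sub_edge [of e] by (auto split: if_splits)
  qed
  moreover have "comps (surface model) (\<Union>?A) = ?A"
  proof (rule connected_components_of_partition)
    show "finite ?A" by simp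
    show "disjoint ?A" using strips_disjoint [OF e] by (simp add: disjoint_def Int_commute)
    fix A assume "A \<in> ?A"
    then have "A = strip1 e \<or> A = strip2 e" by (auto split: if_splits)
    then have "is_segment (surface model) A" using strip_segments [OF e] by blast
    then show "closedin (surface model) A \<and> connectedin (surface model) A \<and> A \<noteq> {}"
      using is_segment_closedin [OF X_model] is_segment_connectedin [OF X_model] is_segment_nonempty [OF X_model] by blast
  qed
  ultimately show ?thesis by (simp only: segments_eq)
qed

lemma edge_disc_disjoint: "\<lbrakk>e \<in> L; e' \<in> L; e \<noteq> e'\<rbrakk> \<Longrightarrow> edge_disc e \<inter> edge_disc e' = {}"
proof -
  assume e: "e \<in> L" "e' \<in> L" "e \<noteq> e'"
  show "edge_disc e \<inter> edge_disc e' = {}"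
  proof (rule equals0I)
    fix y assume "y \<in> edge_disc e \<inter> edge_disc e'"
    then have "y \<in> edge_chart e ` cball 0 1" "y \<in> edge_chart e' ` cball 0 1" by (simp_all add: edge_disc_def)
    then obtain z w where "norm z \<le> 1" "norm w \<le> 1" "edge_chart e z = edge_chart e' w"
      by (elim imageE) simp
    then show False using edge_chart_eq [OF e(1,2)] e(3) by blast
  qed
qed

lemma vert_disc_disjoint: "j \<noteq> j' \<Longrightarrow> vert_disc j \<inter> vert_disc j' = {}"
proof -
  assume j: "j \<noteq> j'"
  show "vert_disc j \<inter> vert_disc j' = {}"
  proof (rule equals0I)
    fix y assume "y \<in> vert_disc j \<inter> vert_disc j'"
    then have "y \<in> vert_chart j ` cball 0 1" "y \<in> vert_chart j' ` cball 0 1" by (simp_all add: vert_disc_def)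
    then obtain z w where "norm z \<le> 1" "norm w \<le> 1" "vert_chart j z = vert_chart j' w"
      by (elim imageE) simp
    then show False using vert_chart_eq j by blast
  qed
qed

lemma model_ribbon: "ribbon_graph model"
  unfolding ribbon_graph_def
proof (intro conjI)
  show "Hausdorff_space (surface model)" by (rule X_model)
  show "topspace (surface model) = \<Union> (verts model) \<union> \<Union> (edges model)" by (simp add: model_def)
  show "finite (verts model)" "finite (edges model)" using finL by (simp_all add: model_def)
  have "is_disc (surface model) (vert_disc j)" if "j < J + bare P" for j
    unfolding is_disc_def disc_chart_iff [OF X_model] using vert_param [OF that] by blast
  moreover have "is_disc (surface model) (edge_disc e)" if "e \<in> L" for e
    unfolding is_disc_def disc_chart_iff [OF X_model] using edge_param [OF that] by blast
  ultimately show "\<forall>D \<in> verts model \<union> edges model. is_disc (surface model) D" by (auto simp: model_def)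
  show "disjoint (verts model)"
  proof (rule disjointI)
    fix a b assume "a \<in> verts model" "b \<in> verts model" "a \<noteq> b"
    then obtain i j where "a = vert_disc i" "b = vert_disc j" by (auto simp: model_def)
    then show "a \<inter> b = {}" using vert_disc_disjoint [of i j] \<open>a \<noteq> b\<close> by blast
  qed
  show "disjoint (edges model)"
  proof (rule disjointI)
    fix a b assume "a \<in> edges model" "b \<in> edges model" "a \<noteq> b"
    then obtain e e' where "e \<in> L" "e' \<in> L" "a = edge_disc e" "b = edge_disc e'" by (auto simp: model_def)
    then show "a \<inter> b = {}" using edge_disc_disjoint \<open>a \<noteq> b\<close> by metis
  qed
  show "\<forall>v \<in> verts model. \<forall>e \<in> edges model. \<forall>s \<in> segments model v e. is_segment (surface model) s \<and>
      s \<subseteq> disc_boundary (surface model) v \<and> s \<subseteq> disc_boundary (surface model) e"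
  proof (intro ballI)
    fix v e s assume v: "v \<in> verts model" and e: "e \<in> edges model" and s: "s \<in> segments model v e"
    obtain j where j: "j < J + bare P" "v = vert_disc j" using v by (auto simp: model_def)
    obtain e0 where e0: "e0 \<in> L" "e = edge_disc e0" using e by (auto simp: model_def)
    have "s = strip1 e0 \<and> cyc_of (tail1 e0) = j \<or> s = strip2 e0 \<and> cyc_of (tail2 e0) = j"
      using s unfolding j(2) e0(2) model_segments [OF e0(1)] by (auto split: if_splits)
    then show "is_segment (surface model) s \<and> s \<subseteq> disc_boundary (surface model) v \<and> s \<subseteq> disc_boundary (surface model) e"
      using strip_segments [OF e0(1)] strips_boundary [OF e0(1)] strip_in_vert [OF e0(1)]
      unfolding j(2) e0(2) disc_boundary_eq [OF X_model vert_param [OF j(1)]] by blast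
  qed
  show "\<forall>e \<in> edges model. card (\<Union>v \<in> verts model. segments model v e) = 2"
  proof
    fix e assume "e \<in> edges model"
    then obtain e0 where e0: "e0 \<in> L" "e = edge_disc e0" by (auto simp: model_def)
    have "(\<Union>v \<in> verts model. segments model v e) = (\<Union>j \<in> {..<J + bare P}. segments model (vert_disc j) (edge_disc e0))"
      by (simp add: model_def e0(2))
    also have "\<dots> = {strip1 e0, strip2 e0}"
    proof (intro equalityI subsetI)
      fix s assume "s \<in> (\<Union>j \<in> {..<J + bare P}. segments model (vert_disc j) (edge_disc e0))"
      then show "s \<in> {strip1 e0, strip2 e0}" by (auto simp: model_segments [OF e0(1)] split: if_splits)
    next
      fix s assume "s \<in> {strip1 e0, strip2 e0}"
      then have "s \<in> segments model (vert_disc (cyc_of (tail1 e0))) (edge_disc e0) \<or>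
          s \<in> segments model (vert_disc (cyc_of (tail2 e0))) (edge_disc e0)"
        by (auto simp: model_segments [OF e0(1)])
      then show "s \<in> (\<Union>j \<in> {..<J + bare P}. segments model (vert_disc j) (edge_disc e0))"
        using cyc_of_tails [OF e0(1)] by (elim disjE) (rule UN_I; simp)+
    qed
    finally have "(\<Union>v \<in> verts model. segments model v e) = {strip1 e0, strip2 e0}" .
    moreover have "strip1 e0 \<noteq> strip2 e0" using strips_disjoint [OF e0(1)] strip_nonempty(1) [OF e0(1)] by auto
    ultimately show "card (\<Union>v \<in> verts model. segments model v e) = 2" by simp
  qed
qed

definition place :: "'p \<Rightarrow> space" where "place p = (pos p, 0, 0)"

lemma model_arrow_pair:
  assumes e: "e \<in> L" shows "arrow_pair_of model (edge_disc e) (map_pair place (arrows P e))"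
proof -
  have mem: "(1::complex) \<in> arc1" "\<i> \<in> arc1" "- 1 \<in> arc2" "- \<i> \<in> arc2" by (simp_all add: arc1_def arc2_def)
  have c: "edge_chart e (cis 0) = place (tail1 e)" "edge_chart e (cis (pi/2)) = place (\<alpha> (tail1 e))"
    "edge_chart e (cis pi) = place (tail2 e)" "edge_chart e (cis (3*pi/2)) = place (\<alpha> (tail2 e))"
  proof -
    have 2: "cis (pi/2) = \<i>" by (simp add: complex_eq_iff)
    have 1: "cis pi = - 1" by (simp add: complex_eq_iff)
    have "cis (3*pi/2) = cis (pi/2) * cis pi" by (simp only: cis_mult) simp
    then have 3: "cis (3*pi/2) = - \<i>" by (simp only: 1 2) simp
    show "edge_chart e (cis 0) = place (tail1 e)" "edge_chart e (cis pi) = place (tail2 e)"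
      unfolding 1 cis_zero using mem by (simp_all add: edge_chart_arcs glue_arc1 glue_arc2 place_def arrow_path_0)
    show "edge_chart e (cis (pi/2)) = place (\<alpha> (tail1 e))" "edge_chart e (cis (3*pi/2)) = place (\<alpha> (tail2 e))"
      unfolding 2 3 using mem tails(2,3) [OF e] by (simp_all add: edge_chart_arcs glue_arc1 glue_arc2 place_def arrow_path_1)
  qed
  show ?thesis
    unfolding arrow_pair_of_def disc_chart_iff [OF X_model]
  proof (intro exI conjI)
    show "disc_param (surface model) (edge_disc e) (edge_chart e)" by (rule edge_param [OF e])
    show "edge_disc e \<inter> \<Union> (verts model) = edge_chart e ` cis ` {0..pi/2} \<union> edge_chart e ` cis ` {pi..3*pi/2}"
      unfolding strip_eqs [symmetric] by (rule edge_Int_verts [OF e])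
    show "map_pair place (arrows P e) = ((edge_chart e (cis 0), edge_chart e (cis (pi/2))),
        edge_chart e (cis pi), edge_chart e (cis (3*pi/2)))"
      unfolding c by (subst tails(1) [OF e]) simp
  qed simp_all
qed

lemma edge_disc_inj: "inj_on edge_disc L"
proof (rule inj_onI)
  fix e e' assume e: "e \<in> L" "e' \<in> L" "edge_disc e = edge_disc e'"
  have "edge_disc e \<noteq> {}" by (simp add: edge_disc_def)
  then show "e = e'" using edge_disc_disjoint [OF e(1,2)] e(3) by auto
qed

lemma vert_disc_inj: "inj vert_disc"
proof (rule injI)
  fix j j' assume j: "vert_disc j = vert_disc j'"
  have "vert_disc j \<noteq> {}" by (simp add: vert_disc_def)
  then show "j = j'" using vert_disc_disjoint [of j j'] j by auto
qed

text \<open>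
  The arrows occupy the intervals that begin at even positions.
\<close>

lemma gap_free:
  assumes j: "j < J" and t: "2 * real i + 1 < t" "t < 2 * real i + 2"
  shows "vert_chart j (cis (pi * t / real (k j))) \<notin> \<Union> (edges model)"
proof
  assume "vert_chart j (cis (pi * t / real (k j))) \<in> \<Union> (edges model)"
  then obtain e where e: "e \<in> L" "vert_chart j (cis (pi * t / real (k j))) \<in> edge_disc e" by (auto simp: model_def)
  have "vert_chart j (cis (pi * t / real (k j))) \<in> vert_disc j" by (auto simp: vert_disc_def)
  from edge_meets_vert [OF e this]
  obtain p u where p: "p \<in> X" "u \<in> {0..1}" and eq: "vert_chart j (cis (pi * t / real (k j))) = (arrow_path p u, 0, 0)"
  proof (elim disjE conjE)
    assume "vert_chart j (cis (pi * t / real (k j))) \<in> strip1 e"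
    then obtain z where z: "z \<in> arc1" "vert_chart j (cis (pi * t / real (k j))) = edge_chart e z" by (auto simp: strip1_def)
    then show thesis using that [of "tail1 e" "Im z"] tails(2) [OF e(1)] arc_Im(1) [OF z(1)]
      by (simp add: edge_chart_arcs glue_arc1)
  next
    assume "vert_chart j (cis (pi * t / real (k j))) \<in> strip2 e"
    then obtain z where z: "z \<in> arc2" "vert_chart j (cis (pi * t / real (k j))) = edge_chart e z" by (auto simp: strip2_def)
    then show thesis using that [of "tail2 e" "- Im z"] tails(3) [OF e(1)] arc_Im(2) [OF z(1)]
      by (simp add: edge_chart_arcs glue_arc2)
  qed
  have "circ j t = circ (cyc_of p) (2 * real (idx_of p div 2) + local_par p u)"
    using eq by (simp add: vert_chart_def circ_def arrow_path_def)
  from circ_eq(2) [OF this j] obtain m :: int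
    where m: "t = 2 * real (idx_of p div 2) + local_par p u + 2 * real (k j) * real_of_int m" by blast
  define q :: int where "q = int (idx_of p div 2) + int (k j) * m"
  have tq: "t = 2 * real_of_int q + local_par p u" using m by (simp add: q_def algebra_simps)
  have "local_par p u \<in> {0..1}" by (rule local_par_01 [OF p(2)])
  then have "2 * real_of_int q < 2 * real i + 2" "2 * real i + 1 < 2 * real_of_int q + 1" using tq t by auto
  then have "real_of_int q < real_of_int (int i + 1)" "real_of_int (int i) < real_of_int q" by simp_all
  then have "q < int i + 1" "int i < q" by (simp_all only: of_int_less_iff)
  then show False by simp
qed

lemma place_in_edges: assumes "p \<in> X" shows "place p \<in> \<Union> (edges model)"
proof -
  obtain e where e: "e \<in> L" "p \<in> pair_points (arrows P e)" using assms by (auto simp: arrow_points_eq)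
  interpret D: disc_system "surface model" "edges model" "verts model"
    by (rule disc_system_swap [OF ribbon_disc_system [OF model_ribbon]])
  have eE: "edge_disc e \<in> edges model" using e by (simp add: model_def)
  have "place p \<in> pair_points (map_pair place (arrows P e))" using e(2) by (simp add: pair_points_map)
  then have "place p \<in> \<Union> (ends (surface model) ` disc_segs (surface model) (edge_disc e) (verts model))"
    unfolding arrow_pair_data(2) [OF model_ribbon eE model_arrow_pair [OF e(1)]] pair_points_seg_ends .
  then have "place p \<in> \<Union> (disc_segs (surface model) (edge_disc e) (verts model))"
    using ends_subset by fastforce
  then show ?thesis using D.Union_disc_segs [OF eE] eE by blast
qed

lemma place_x: "\<lbrakk>j < J; i < 2 * k j\<rbrakk> \<Longrightarrow> place (x j i) = vert_chart j (cis (pi * real i / real (k j)))"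
  by (simp add: place_def pos_def loc_x circ_def vert_chart_def)

lemma place_x_end: "j < J \<Longrightarrow> place (x j (2 * k j)) = vert_chart j (cis (pi * real (2 * k j) / real (k j)))"
proof -
  assume j: "j < J"
  have "x j (2 * k j) = x j 0" using cyc j by (simp add: cycle_system_def)
  moreover have "pi * real (2 * k j) / real (k j) = 0 + 2 * pi * real_of_int 1" using kpos [OF j] by simp
  then have "cis (pi * real (2 * k j) / real (k j)) = cis 0" by (simp only: cis_shift)
  ultimately show ?thesis using place_x [OF j, of 0] kpos [OF j] by simp
qed

lemma place_x_le: "\<lbrakk>j < J; i \<le> 2 * k j\<rbrakk> \<Longrightarrow> place (x j i) = vert_chart j (cis (pi * real i / real (k j)))"
  using place_x [of j i] place_x_end [of j] by (cases "i = 2 * k j") auto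

lemma x_le_in_X: "\<lbrakk>j < J; i \<le> 2 * k j\<rbrakk> \<Longrightarrow> x j i \<in> X"
  using x_in_X [of j i] x_in_X [of j 0] kpos [of j] cyc by (cases "i = 2 * k j") (auto simp: cycle_system_def)

lemma gaps_in_model: assumes g: "g \<in> gaps P" shows "place ` g \<in> ribbon_gaps model"
proof -
  obtain j i where ji: "j < J" "i < k j" "g = {x j (2 * i + 1), x j (2 * i + 2)}" using g unfolding gaps by blast
  let ?s = "pi * real (2 * i + 1) / real (k j)" and ?t = "pi * real (2 * i + 2) / real (k j)"
  have kp: "real (k j) > 0" using kpos [OF ji(1)] by simp
  have p: "place (x j (2 * i + 1)) = vert_chart j (cis ?s)" "place (x j (2 * i + 2)) = vert_chart j (cis ?t)"
    using ji(1,2) by (intro place_x_le; simp)+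
  have inE: "vert_chart j (cis ?s) \<in> \<Union> (edges model)" "vert_chart j (cis ?t) \<in> \<Union> (edges model)"
    unfolding p [symmetric] using ji(1,2) by (intro place_in_edges x_le_in_X; simp)+
  have st: "?s < ?t" using kp by (intro divide_strict_right_mono mult_strict_left_mono) auto
  have free: "vert_chart j (cis u) \<notin> \<Union> (edges model)" if u: "?s < u" "u < ?t" for u
  proof -
    have "pi * real (2 * i + 1) < u * real (k j)" using u(1) kp by (simp only: pos_divide_less_eq)
    then have 1: "real (2 * i + 1) < u * real (k j) / pi" by (simp add: pos_less_divide_eq mult.commute)
    have "u * real (k j) < pi * real (2 * i + 2)" using u(2) kp by (simp only: pos_less_divide_eq)
    then have 2: "u * real (k j) / pi < real (2 * i + 2)" by (simp add: pos_divide_less_eq mult.commute)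
    have "pi * (u * real (k j) / pi) / real (k j) = u" using kp by simp
    then show ?thesis using gap_free [OF ji(1), of i "u * real (k j) / pi"] 1 2 by simp
  qed
  have "vert_disc j \<in> verts model" using ji(1) by (simp add: model_def)
  moreover have "disc_chart (surface model) (vert_disc j) (vert_chart j)"
    unfolding disc_chart_iff [OF X_model] using ji(1) by (intro vert_param) simp
  moreover have "place ` g = {vert_chart j (cis ?s), vert_chart j (cis ?t)}" using ji(3) p by simp
  ultimately show ?thesis unfolding ribbon_gaps_def using st inE free by blast
qed

text \<open>
  Each gap of the presentation is a gap of the model because of the position of its ends. There
  are no others: the gaps of a ribbon graph are disjoint, and those found exhaust the ends.
\<close>

theorem model_presents:
  assumes gapsX: "\<Union> (gaps P) = X" and ne: "\<And>g. g \<in> gaps P \<Longrightarrow> g \<noteq> {}"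
  shows "\<exists>Q. presents model Q \<and> presentation_iso L edge_disc place P Q"
proof -
  define Q where "Q = \<lparr>arrows = (\<lambda>E. map_pair place (arrows P (inv_into L edge_disc E))),
    gaps = ribbon_gaps model, bare = card {v \<in> verts model. v \<inter> \<Union> (edges model) = {}}\<rparr>"
  have arrQ: "arrows Q (edge_disc e) = map_pair place (arrows P e)" if "e \<in> L" for e
    using edge_disc_inj that by (simp add: Q_def)
  have "arrow_pair_of model E (arrows Q E)" if E: "E \<in> edges model" for E
  proof -
    obtain e where e: "e \<in> L" "E = edge_disc e" using E by (auto simp: model_def)
    then show ?thesis using model_arrow_pair arrQ by simp
  qed
  then have Q: "presents model Q" by (simp add: presents_def Q_def)
  have inj: "inj_on place X" using pos_inj by (auto simp: inj_on_def place_def)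
  have ptsQ: "arrow_points (edges model) Q = place ` X"
  proof -
    have "arrow_points (edges model) Q = (\<Union>e \<in> L. pair_points (arrows Q (edge_disc e)))"
      by (simp add: arrow_points_eq model_def)
    also have "\<dots> = (\<Union>e \<in> L. place ` pair_points (arrows P e))"
      by (rule SUP_cong [OF HOL.refl]) (simp add: arrQ pair_points_map)
    finally show ?thesis by (simp add: arrow_points_eq image_UN)
  qed
  have gapsQ: "gaps Q = (`) place ` gaps P"
  proof
    show sub: "(`) place ` gaps P \<subseteq> gaps Q" using gaps_in_model by (auto simp: Q_def)
    show "gaps Q \<subseteq> (`) place ` gaps P"
    proof
      fix g assume g: "g \<in> gaps Q"
      obtain p where p: "p \<in> g" using presents_gaps(1) [OF model_ribbon Q g] by blast
      then have "p \<in> place ` X" using g presents_gaps(2) [OF model_ribbon Q] ptsQ by blast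
      then obtain y where y: "y \<in> X" "p = place y" by blast
      then obtain g' where g': "g' \<in> gaps P" "y \<in> g'" using gapsX by blast
      then have "place ` g' \<in> gaps Q" "p \<in> place ` g'" using sub y by blast+
      then have "g = place ` g'"
        using disjointD [OF presents_gaps(3) [OF model_ribbon Q] g] p by blast
      then show "g \<in> (`) place ` gaps P" using g'(1) by blast
    qed
  qed
  have "{v \<in> verts model. v \<inter> \<Union> (edges model) = {}} = vert_disc ` {J..<J + bare P}"
  proof (intro equalityI subsetI)
    fix v assume v: "v \<in> {v \<in> verts model. v \<inter> \<Union> (edges model) = {}}"
    then obtain j where j: "j < J + bare P" "v = vert_disc j" by (auto simp: model_def)
    have "\<not> j < J"
    proof
      assume "j < J"
      then have x0: "x j 0 \<in> X" "place (x j 0) = vert_chart j (cis 0)"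
        using x_in_X [of j 0] place_x [of j 0] kpos [of j] by simp_all
      then have "place (x j 0) \<in> v" unfolding j(2) vert_disc_def by auto
      then show False using place_in_edges [OF x0(1)] v by blast
    qed
    then show "v \<in> vert_disc ` {J..<J + bare P}" using j by auto
  next
    fix v assume "v \<in> vert_disc ` {J..<J + bare P}"
    then obtain j where j: "J \<le> j" "j < J + bare P" "v = vert_disc j" by auto
    have "False" if "e \<in> L" "y \<in> edge_disc e" "y \<in> v" for y e
    proof -
      have "y \<in> vert_disc j" using that(3) j(3) by simp
      from edge_meets_vert [OF that(1,2) this] show False using cyc_of_tails [OF that(1)] j(1) by linarith
    qed
    then have "v \<inter> \<Union> (edges model) = {}" unfolding model_def by auto
    then show "v \<in> {v \<in> verts model. v \<inter> \<Union> (edges model) = {}}" using j by (simp add: model_def)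
  qed
  then have "bare Q = bare P"
    using card_image [OF inj_on_subset [OF vert_disc_inj subset_UNIV], of "{J..<J + bare P}"] by (simp add: Q_def)
  then have "presentation_iso L edge_disc place P Q"
    using inj gapsQ arrQ by (simp add: presentation_iso_def)
  then show ?thesis using Q by blast
qed

end

text \<open>
  The arrows and the gaps are two pairings of the set of ends. The cycles along which they
  alternate are the boundary circles of the vertices that have to be drawn.
\<close>

theorem realization:
  fixes L :: "'e set" and P :: "('p, 'e) arrow_presentation"
  assumes finL: "finite L"
    and dist: "\<And>e. e \<in> L \<Longrightarrow> pair_distinct (arrows P e)"
    and disj: "\<And>e e'. \<lbrakk>e \<in> L; e' \<in> L; e \<noteq> e'\<rbrakk> \<Longrightarrow> pair_points (arrows P e) \<inter> pair_points (arrows P e') = {}"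
    and gap_pairs: "\<And>g. g \<in> gaps P \<Longrightarrow> \<exists>p q. p \<noteq> q \<and> g = {p, q}"
    and gap_cover: "\<Union> (gaps P) = arrow_points L P" and gap_disj: "disjoint (gaps P)"
  shows "\<exists>(H :: space ribbon) Q \<iota> f. ribbon_graph H \<and> presents H Q \<and> bij_betw \<iota> L (edges H) \<and>
    presentation_iso L \<iota> f P Q"
proof -
  let ?X = "arrow_points L P"
  have pairing: "\<exists>\<alpha>. pairing ?X \<alpha> \<and> (\<forall>g \<in> \<G>. \<forall>p \<in> g. g = {p, \<alpha> p})"
    if pairs: "\<And>g. g \<in> \<G> \<Longrightarrow> \<exists>p q. p \<noteq> q \<and> g = {p, q}" and cover: "\<Union>\<G> = ?X" and dj: "disjoint \<G>" for \<G> :: "'p set set"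
  proof -
    define \<alpha> where "\<alpha> p = (SOME q. q \<noteq> p \<and> {p, q} \<in> \<G>)" for p
    have \<alpha>: "\<alpha> p \<noteq> p \<and> {p, \<alpha> p} \<in> \<G>" if p: "p \<in> ?X" for p
    proof -
      obtain g where g: "g \<in> \<G>" "p \<in> g" using p cover by blast
      obtain a b where "a \<noteq> b" "g = {a, b}" using pairs [OF g(1)] by blast
      then have "\<exists>q. q \<noteq> p \<and> {p, q} \<in> \<G>" using g by (auto simp: insert_commute)
      then show ?thesis unfolding \<alpha>_def by (rule someI_ex)
    qed
    have geq: "g = {p, \<alpha> p}" if "g \<in> \<G>" "p \<in> g" for g p
    proof -
      have "p \<in> ?X" using that cover by blast
      then have "{p, \<alpha> p} \<in> \<G>" using \<alpha> by blast
      then show ?thesis using disjointD [OF dj that(1), of "{p, \<alpha> p}"] that(2) by blast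
    qed
    have "pairing ?X \<alpha>"
      unfolding pairing_def
    proof (intro ballI conjI)
      fix p assume p: "p \<in> ?X"
      then have g: "{p, \<alpha> p} \<in> \<G>" and ne: "\<alpha> p \<noteq> p" using \<alpha> by blast+
      show "\<alpha> p \<in> ?X" using g cover by blast
      show "\<alpha> p \<noteq> p" by (rule ne)
      have "{p, \<alpha> p} = {\<alpha> p, \<alpha> (\<alpha> p)}" using geq [OF g, of "\<alpha> p"] by simp
      then show "\<alpha> (\<alpha> p) = p" using ne by (auto simp: doubleton_eq_iff)
    qed
    then show ?thesis using geq by blast
  qed
  define \<S> where "\<S> = (\<Union>e \<in> L. seg_ends (arrows P e))"
  have "\<exists>\<alpha>. pairing ?X \<alpha> \<and> (\<forall>g \<in> \<S>. \<forall>p \<in> g. g = {p, \<alpha> p})"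
  proof (rule pairing)
    show "\<exists>p q. p \<noteq> q \<and> g = {p, q}" if g: "g \<in> \<S>" for g
    proof -
      obtain e where e: "e \<in> L" "g \<in> seg_ends (arrows P e)" using g by (auto simp: \<S>_def)
      then show ?thesis using dist [OF e(1)] by (cases "arrows P e" rule: pair_points.cases) auto
    qed
    show "\<Union>\<S> = ?X" by (auto simp: \<S>_def arrow_points_eq pair_points_seg_ends)
    show "disjoint \<S>"
    proof (rule disjointI)
      fix g g' assume g: "g \<in> \<S>" "g' \<in> \<S>" "g \<noteq> g'"
      then obtain e e' where e: "e \<in> L" "g \<in> seg_ends (arrows P e)" "e' \<in> L" "g' \<in> seg_ends (arrows P e')"
        by (auto simp: \<S>_def)
      show "g \<inter> g' = {}"
      proof (cases "e = e'")
        case True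
        then show ?thesis using e g(3) dist [OF e(1)] by (cases "arrows P e" rule: pair_points.cases) auto
      next
        case False
        then show ?thesis using disj [OF e(1,3)] e(2,4) unfolding pair_points_seg_ends by blast
      qed
    qed
  qed
  then obtain \<alpha> where \<alpha>: "pairing ?X \<alpha>" "\<forall>g \<in> \<S>. \<forall>p \<in> g. g = {p, \<alpha> p}" by blast
  have "\<exists>\<beta>. pairing ?X \<beta> \<and> (\<forall>g \<in> gaps P. \<forall>p \<in> g. g = {p, \<beta> p})"
    by (rule pairing [OF gap_pairs gap_cover gap_disj])
  then obtain \<beta> where \<beta>: "pairing ?X \<beta>" "\<forall>g \<in> gaps P. \<forall>p \<in> g. g = {p, \<beta> p}" by blast
  have "finite ?X"
  proof -
    have "finite (pair_points AB)" for AB :: "'p arrow \<times> 'p arrow" by (cases AB rule: pair_points.cases) simp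
    then show ?thesis using finL by (simp add: arrow_points_eq)
  qed
  from cycle_system_exists [OF this \<alpha>(1) \<beta>(1)] obtain J k x where cyc: "cycle_system ?X \<alpha> \<beta> J k x" by blast
  have bij: "bij_betw (\<lambda>(j, i). x j i) (SIGMA j:{..<J}. {..<2 * k j}) ?X" using cyc by (simp add: cycle_system_def)
  have step: "k j > 0" "x j (2 * k j) = x j 0" "i < k j \<Longrightarrow> \<beta> (x j (2 * i + 1)) = x j (2 * i + 2)" if "j < J" for j i
    using cyc that by (auto simp: cycle_system_def)
  have odd_in: "x j (2 * i + 1) \<in> ?X" if "j < J" "i < k j" for j i
    using bij_betw_apply [OF bij, of "(j, 2 * i + 1)"] that by simp
  have gaps_eq: "gaps P = {{x j (2 * i + 1), x j (2 * i + 2)} |j i. j < J \<and> i < k j}"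
  proof (intro equalityI subsetI)
    fix g assume "g \<in> {{x j (2 * i + 1), x j (2 * i + 2)} |j i. j < J \<and> i < k j}"
    then obtain j i where ji: "j < J" "i < k j" "g = {x j (2 * i + 1), x j (2 * i + 2)}" by blast
    have g: "g = {x j (2 * i + 1), \<beta> (x j (2 * i + 1))}" using step(3) [OF ji(1,2)] ji(3) by simp
    obtain g' where "g' \<in> gaps P" "x j (2 * i + 1) \<in> g'" using odd_in [OF ji(1,2)] gap_cover by blast
    then show "g \<in> gaps P" using \<beta>(2) g by metis
  next
    fix g assume g: "g \<in> gaps P"
    then obtain p where p: "p \<in> g" using gap_pairs by blast
    then have "p \<in> ?X" using g gap_cover by blast
    then have "p \<in> (\<lambda>(j, i). x j i) ` (SIGMA j:{..<J}. {..<2 * k j})" using bij by (simp add: bij_betw_def)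
    then obtain j i where ji: "j < J" "i < 2 * k j" "p = x j i" by auto
    have gp: "g = {p, \<beta> p}" using \<beta>(2) g p by blast
    have "\<exists>n < k j. p = x j (2 * n + 1) \<or> p = x j (2 * n + 2)"
    proof (cases "even i")
      case False
      then obtain n where "i = 2 * n + 1" by (elim oddE)
      then show ?thesis using ji by (intro exI [of _ n]) auto
    next
      case True
      show ?thesis
      proof (cases "i = 0")
        case True
        have "2 * (k j - 1) + 2 = 2 * k j" using step(1) [OF ji(1)] by simp
        then have "x j (2 * (k j - 1) + 2) = p" using step(2) [OF ji(1)] ji(3) True by simp
        then show ?thesis using step(1) [OF ji(1)] by (intro exI [of _ "k j - 1"]) simp
      next
        case False
        obtain m where "i = 2 * m" using \<open>even i\<close> by (elim evenE)
        then have "i = 2 * (m - 1) + 2" "m - 1 < k j" using False ji(2) by auto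
        then show ?thesis using ji(3) by (intro exI [of _ "m - 1"]) metis
      qed
    qed
    then obtain n where n: "n < k j" "p = x j (2 * n + 1) \<or> p = x j (2 * n + 2)" by blast
    have \<beta>n: "\<beta> (x j (2 * n + 1)) = x j (2 * n + 2)" by (rule step(3) [OF ji(1) n(1)])
    then have "\<beta> (x j (2 * n + 2)) = x j (2 * n + 1)" using pairingD(2) [OF \<beta>(1) odd_in [OF ji(1) n(1)]] by simp
    then have "g = {x j (2 * n + 1), x j (2 * n + 2)}" using n(2) gp \<beta>n by auto
    then show "g \<in> {{x j (2 * i + 1), x j (2 * i + 2)} |j i. j < J \<and> i < k j}" using ji(1) n(1) by blast
  qed
  interpret ribbon_model L P \<alpha> \<beta> J k x
  proof
    show "\<alpha> a = b \<and> \<alpha> c = d" if e: "e \<in> L" and A: "arrows P e = ((a, b), (c, d))" for e a b c d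
    proof -
      have ab: "{a, b} \<in> \<S>" and cd: "{c, d} \<in> \<S>" using e A by (force simp: \<S>_def)+
      have "{a, b} = {a, \<alpha> a}" using bspec [OF bspec [OF \<alpha>(2) ab], of a] by simp
      moreover have "{c, d} = {c, \<alpha> c}" using bspec [OF bspec [OF \<alpha>(2) cd], of c] by simp
      ultimately show ?thesis using dist [OF e] A by (auto simp: doubleton_eq_iff)
    qed
  qed (use finL dist disj \<alpha>(1) cyc gaps_eq in auto)
  have "g \<noteq> {}" if "g \<in> gaps P" for g using gap_pairs [OF that] by blast
  from model_presents [OF gap_cover this] obtain Q where "presents model Q" "presentation_iso L edge_disc place P Q" by blast
  moreover have "bij_betw edge_disc L (edges model)" using edge_disc_inj by (simp add: bij_betw_def model_def)
  ultimately show ?thesis using model_ribbon by blast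
qed


section \<open>Twisted duals exist and are unique\<close>

lemma ribbon_copy:
  fixes H :: "'b ribbon" and j :: "'b \<Rightarrow> 'a"
  assumes j: "inj j"
  shows "\<exists>H' :: 'a ribbon. ribbon_iso H H' j"
proof -
  let ?X = "surface H" and ?A = "j ` topspace (surface H)"
  define Y where "Y = pullback_topology ?A (inv' j) ?X"
  have op: "openin Y (j ` U)" if "openin ?X U" for U
  proof -
    have "U \<subseteq> topspace ?X" using that by (rule openin_subset)
    then have "j ` U = inv' j -` U \<inter> ?A" using j by auto
    then show ?thesis unfolding Y_def openin_pullback_topology using that by blast
  qed
  have opE: "\<exists>U. openin ?X U \<and> S = j ` U" if S: "openin Y S" for S
  proof -
    obtain U where U: "openin ?X U" "S = inv' j -` U \<inter> ?A"
      using S unfolding Y_def openin_pullback_topology by blast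
    have "U \<subseteq> topspace ?X" using U(1) by (rule openin_subset)
    then have "S = j ` U" using j U(2) by auto
    then show ?thesis using U(1) by blast
  qed
  have top: "topspace Y = ?A" unfolding Y_def topspace_pullback_topology using j by auto
  have "homeomorphic_map ?X Y j"
  proof (rule bijective_open_imp_homeomorphic_map)
    show "continuous_map ?X Y j"
      unfolding continuous_map_def
    proof (intro conjI allI impI)
      show "j \<in> topspace ?X \<rightarrow> topspace Y" using top by auto
      fix S assume "openin Y S"
      then obtain U where U: "openin ?X U" "S = j ` U" using opE by blast
      have "{x \<in> topspace ?X. j x \<in> S} = U"
        using openin_subset [OF U(1)] j U(2) by (auto simp: inj_on_def)
      then show "openin ?X {x \<in> topspace ?X. j x \<in> S}" using U(1) by simp
    qed
    show "open_map ?X Y j" unfolding open_map_def using op by blast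
    show "j ` topspace ?X = topspace Y" using top by simp
    show "inj_on j (topspace ?X)" using j by (rule inj_on_subset) simp
  qed
  then have "ribbon_iso H \<lparr>surface = Y, verts = (`) j ` verts H, edges = (`) j ` edges H\<rparr> j"
    by (simp add: ribbon_iso_def)
  then show ?thesis by blast
qed

text \<open>
  There are as many real numbers as sets of natural numbers, and two such sets can be
  interleaved.
\<close>

lemma real_pair_injection: "\<exists>p :: real \<times> real \<Rightarrow> real. inj p"
proof -
  obtain \<phi> :: "nat set \<Rightarrow> real" where \<phi>: "bij \<phi>"
    using nat_sets_eqpoll_reals unfolding eqpoll_def by blast
  define \<psi> where "\<psi> = inv' \<phi>"
  have \<psi>: "inj \<psi>" unfolding \<psi>_def using bij_imp_bij_inv [OF \<phi>] by (rule bij_is_inj)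
  define m :: "nat set \<Rightarrow> nat set \<Rightarrow> nat set" where "m A B = (\<lambda>n. 2 * n) ` A \<union> (\<lambda>n. 2 * n + 1) ` B" for A B
  have mA: "A = {n. 2 * n \<in> m A B}" for A B :: "nat set"
    unfolding m_def by auto presburger
  have mB: "B = {n. 2 * n + 1 \<in> m A B}" for A B :: "nat set"
    unfolding m_def by auto presburger
  have m_inj: "A = A' \<and> B = B'" if "m A B = m A' B'" for A B A' B'
    using mA [of A B] mA [of A' B'] mB [of B A] mB [of B' A'] unfolding that by simp
  have "inj (\<lambda>(x, y). \<phi> (m (\<psi> x) (\<psi> y)))"
  proof (rule injI, clarify)
    fix x y x' y' assume "\<phi> (m (\<psi> x) (\<psi> y)) = \<phi> (m (\<psi> x') (\<psi> y'))"
    then have "m (\<psi> x) (\<psi> y) = m (\<psi> x') (\<psi> y')" using bij_is_inj [OF \<phi>] by (rule injD [rotated])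
    then have "\<psi> x = \<psi> x'" "\<psi> y = \<psi> y'" using m_inj by blast+
    then show "x = x' \<and> y = y'" using injD [OF \<psi>] by blast
  qed
  then show ?thesis by blast
qed

lemma space_injection: "\<exists>j :: space \<Rightarrow> complex. inj j \<and> range j \<subseteq> cball 0 1"
proof -
  obtain p :: "real \<times> real \<Rightarrow> real" where p: "inj p" using real_pair_injection by blast
  have pD: "a = a' \<and> b = b'" if "p (a, b) = p (a', b')" for a b a' b' using injD [OF p that] by simp
  define c where "c z = p (Re z, Im z)" for z :: complex
  have c: "z = w" if "c z = c w" for z w using pD [OF that [unfolded c_def]] by (simp add: complex_eq_iff)
  obtain b :: "real \<Rightarrow> real" where b: "bij_betw b UNIV {0..1}"
    using closed_interval_eqpoll_reals [of 0 1] eqpoll_sym unfolding eqpoll_def by (metis zero_less_one)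
  define j where "j s = complex_of_real (b (p (c (fst s), p (c (fst (snd s)), c (snd (snd s))))))" for s :: space
  have "inj j"
  proof (rule injI)
    fix s t assume "j s = j t"
    then have "b (p (c (fst s), p (c (fst (snd s)), c (snd (snd s))))) =
        b (p (c (fst t), p (c (fst (snd t)), c (snd (snd t)))))"
      unfolding j_def by (simp only: of_real_eq_iff)
    then have "p (c (fst s), p (c (fst (snd s)), c (snd (snd s)))) =
        p (c (fst t), p (c (fst (snd t)), c (snd (snd t))))"
      using b by (auto simp: bij_betw_def dest: injD)
    then have 1: "c (fst s) = c (fst t)"
      and 2: "p (c (fst (snd s)), c (snd (snd s))) = p (c (fst (snd t)), c (snd (snd t)))"
      using pD by blast+
    from pD [OF 2] 1 show "s = t" using c by (metis prod.collapse)
  qed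
  moreover have "j s \<in> cball 0 1" for s
  proof -
    have "b (p (c (fst s), p (c (fst (snd s)), c (snd (snd s))))) \<in> {0..1}" using b by (auto simp: bij_betw_def)
    then show ?thesis by (simp add: j_def)
  qed
  ultimately show ?thesis by blast
qed

text \<open>
  The model has to be moved to the type of points of \<open>G\<close>. As an edge is a disc,
  this type has at least the cardinality of the continuum, and so it contains the points of the
  model.
\<close>

lemma space_embeds:
  fixes G :: "'a ribbon"
  assumes G: "ribbon_graph G" and ne: "edges G \<noteq> {}"
  shows "\<exists>j :: space \<Rightarrow> 'a. inj j"
proof -
  obtain e where "e \<in> edges G" using ne by blast
  then have "is_disc (surface G) e" "Hausdorff_space (surface G)" using G by (auto simp: ribbon_graph_def)
  then obtain h where h: "disc_param (surface G) e h" by (auto simp: is_disc_def disc_chart_iff)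
  obtain j :: "space \<Rightarrow> complex" where j: "inj j" "range j \<subseteq> cball 0 1" using space_injection by blast
  have "inj_on h (range j)" using h j(2) by (auto simp: disc_param_def intro: inj_on_subset)
  then have "inj (h \<circ> j)" using j(1) by (rule comp_inj_on [rotated])
  then show ?thesis by blast
qed

lemma is_twisted_dualI:
  assumes "ribbon_graph H" "bij_betw \<iota> (edges G) (edges H)" "presents G P" "presents H Q"
    "\<forall>e \<in> edges G. w e \<in> \<Gamma> e" "presentation_iso (edges G) \<iota> f (apply_words w P) Q"
  shows "is_twisted_dual G \<Gamma> H \<iota>"
  unfolding is_twisted_dual_def
  by (intro conjI exI [of _ P] exI [of _ Q] exI [of _ w] exI [of _ f]) (fact assms)+

text \<open>
  Words change neither the set of ends nor the gaps, so the twisted presentation inherits from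
  \<open>G\<close> what a realization requires.
\<close>

lemma twisted_dual_exists:
  fixes G :: "'a ribbon"
  assumes G: "ribbon_graph G" and ne: "edges G \<noteq> {}" and \<Gamma>: "\<And>e. e \<in> edges G \<Longrightarrow> \<Gamma> e \<noteq> {}"
  shows "\<exists>H \<iota>. is_twisted_dual G \<Gamma> H \<iota>"
proof -
  obtain P where P: "presents G P" using presents_exists [OF G] by blast
  have "\<forall>e \<in> edges G. \<exists>u. u \<in> \<Gamma> e" using \<Gamma> by (simp add: ex_in_conv)
  from bchoice [OF this] obtain w where w: "\<forall>e \<in> edges G. w e \<in> \<Gamma> e" by blast
  let ?P = "apply_words w P"
  have "\<exists>(H :: space ribbon) Q \<iota> f. ribbon_graph H \<and> presents H Q \<and> bij_betw \<iota> (edges G) (edges H) \<and>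
      presentation_iso (edges G) \<iota> f ?P Q"
  proof (rule realization)
    show "finite (edges G)" using G by (simp add: ribbon_graph_def)
    show "pair_distinct (arrows ?P e)" if "e \<in> edges G" for e
      using presents_data(1) [OF G P that] by (simp add: apply_words_def word_op_distinct)
    show "pair_points (arrows ?P e) \<inter> pair_points (arrows ?P e') = {}"
      if "e \<in> edges G" "e' \<in> edges G" "e \<noteq> e'" for e e'
      using presents_arrow_points_disjoint [OF G P that] by (simp add: apply_words_def word_op_points)
    show "\<exists>p q. p \<noteq> q \<and> g = {p, q}" if "g \<in> gaps ?P" for g
      using presents_gaps(1) [OF G P] that by (simp add: apply_words_def)
    show "\<Union> (gaps ?P) = arrow_points (edges G) ?P"
      unfolding arrow_points_apply_words using presents_gaps(2) [OF G P] by (simp add: apply_words_def)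
    show "disjoint (gaps ?P)" using presents_gaps(3) [OF G P] by (simp add: apply_words_def)
  qed
  then obtain H :: "space ribbon" and Q \<iota> f where H: "ribbon_graph H" "presents H Q"
    and \<iota>: "bij_betw \<iota> (edges G) (edges H)" and f: "presentation_iso (edges G) \<iota> f ?P Q" by blast
  obtain j :: "space \<Rightarrow> 'a" where "inj j" using space_embeds [OF G ne] by blast
  then obtain H' :: "'a ribbon" where iso: "ribbon_iso H H' j" using ribbon_copy by blast
  obtain Q' where Q': "presents H' Q'" "presentation_iso (edges H) ((`) j) j Q Q'"
    using presents_push [OF H(1) iso H(2)] by blast
  have E: "\<iota> ` edges G = edges H" using \<iota> by (simp add: bij_betw_def)
  have "presentation_iso (edges G) ((`) j \<circ> \<iota>) (j \<circ> f) ?P Q'"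
    by (rule presentation_iso_trans [OF f]) (simp add: E Q'(2))
  moreover have "bij_betw ((`) j) (edges H) (edges H')"
    unfolding ribbon_isoD(3) [OF iso]
    by (rule inj_on_imp_bij_betw) (use \<open>inj j\<close> in \<open>auto simp: inj_on_def inj_image_eq_iff\<close>)
  then have "bij_betw ((`) j \<circ> \<iota>) (edges G) (edges H')" by (rule bij_betw_trans [OF \<iota>])
  ultimately have "is_twisted_dual G \<Gamma> H' ((`) j \<circ> \<iota>)"
    unfolding is_twisted_dual_def using ribbon_iso_graph [OF H(1) iso] P Q'(1) w by blast
  then show ?thesis by blast
qed

lemma is_twisted_dualE:
  assumes "is_twisted_dual G \<Gamma> H \<iota>"
  obtains P Q w f where "ribbon_graph H" "bij_betw \<iota> (edges G) (edges H)" "presents G P" "presents H Q"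
    "\<forall>e \<in> edges G. w e \<in> \<Gamma> e" "presentation_iso (edges G) \<iota> f (apply_words w P) Q"
  using assms unfolding is_twisted_dual_def by blast

lemma presentation_iso_same_edges:
  assumes "presentation_iso L \<iota> f P Q" "\<And>e. e \<in> L \<Longrightarrow> \<iota>' e = \<iota> e"
  shows "presentation_iso L \<iota>' f P Q"
  using assms by (simp add: presentation_iso_def)

text \<open>
  Any two presentations of \<open>G\<close> are isomorphic, and this remains so after words for
  the same elements of the group have been applied. Hence the presentations of both twisted
  duals are isomorphic.
\<close>

lemma twisted_dual_unique:
  assumes G: "ribbon_graph G" and H: "is_twisted_dual G \<Gamma> H \<iota>" and K: "is_twisted_dual G \<Gamma> K \<kappa>"
    and \<Gamma>: "\<And>e u v. \<lbrakk>e \<in> edges G; u \<in> \<Gamma> e; v \<in> \<Gamma> e\<rbrakk> \<Longrightarrow> word_eq u v"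
  shows "\<exists>F. ribbon_iso H K F \<and> (\<forall>e \<in> edges G. F ` \<iota> e = \<kappa> e)"
proof -
  obtain P Q w f where h: "ribbon_graph H" "bij_betw \<iota> (edges G) (edges H)" "presents G P" "presents H Q"
    "\<forall>e \<in> edges G. w e \<in> \<Gamma> e" "presentation_iso (edges G) \<iota> f (apply_words w P) Q"
    using H by (rule is_twisted_dualE)
  obtain P' Q' w' f' where k: "ribbon_graph K" "bij_betw \<kappa> (edges G) (edges K)" "presents G P'" "presents K Q'"
    "\<forall>e \<in> edges G. w' e \<in> \<Gamma> e" "presentation_iso (edges G) \<kappa> f' (apply_words w' P') Q'"
    using K by (rule is_twisted_dualE)
  let ?\<iota>' = "inv_into (edges G) \<iota>" and ?f' = "inv_into (arrow_points (edges G) (apply_words w P)) f"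
  have E: "\<iota> ` edges G = edges H" "inj_on \<iota> (edges G)" using h(2) by (simp_all add: bij_betw_def)
  have "\<Union> (gaps (apply_words w P)) \<subseteq> arrow_points (edges G) (apply_words w P)"
    unfolding arrow_points_apply_words using presents_gaps(2) [OF G h(3)] by (simp add: apply_words_def)
  from presentation_iso_sym [OF h(6) E(2) this]
  have 1: "presentation_iso (edges H) ?\<iota>' ?f' Q (apply_words w P)" unfolding E(1) .
  have \<iota>': "?\<iota>' ` edges H = edges G" using bij_betw_inv_into [OF h(2)] by (simp add: bij_betw_def)
  have 2: "presentation_iso (edges G) id id (apply_words w P) (apply_words w' P')"
    by (rule presentation_iso_words [OF presents_unique [OF G h(3) k(3)]]) (use h(5) k(5) \<Gamma> in simp)
  have "presentation_iso (edges H) (id \<circ> ?\<iota>') (id \<circ> ?f') Q (apply_words w' P')"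
    by (rule presentation_iso_trans [OF 1]) (simp only: \<iota>' 2)
  then have 3: "presentation_iso (edges H) ?\<iota>' ?f' Q (apply_words w' P')" by simp
  have 4: "presentation_iso (edges H) (\<kappa> \<circ> ?\<iota>') (f' \<circ> ?f') Q Q'"
    by (rule presentation_iso_trans [OF 3]) (simp only: \<iota>' k(6))
  have "bij_betw (\<kappa> \<circ> ?\<iota>') (edges H) (edges K)"
    by (rule bij_betw_trans [OF bij_betw_inv_into [OF h(2)] k(2)])
  from ribbon_iso_of_presentation_iso [OF h(1) k(1) h(4) k(4) this 4]
  obtain F where F: "ribbon_iso H K F" "\<forall>e \<in> edges H. F ` e = (\<kappa> \<circ> ?\<iota>') e" by blast
  have "F ` \<iota> e = \<kappa> e" if e: "e \<in> edges G" for e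
  proof -
    have "\<iota> e \<in> edges H" using E(1) e by blast
    then show ?thesis using F(2) E(2) e by simp
  qed
  then show ?thesis using F(1) by blast
qed

lemma ribbon_iso_bij_edges:
  assumes G: "ribbon_graph G" and iso: "ribbon_iso G H F"
  shows "bij_betw ((`) F) (edges G) (edges H)"
proof -
  have "inj_on ((`) F) (Pow (topspace (surface G)))"
    by (rule inj_on_image_Pow [OF homeomorphic_imp_injective_map [OF ribbon_isoD(1) [OF iso]]])
  moreover have "edges G \<subseteq> Pow (topspace (surface G))" using ribbon_discs_subset [OF G] by blast
  ultimately have "inj_on ((`) F) (edges G)" by (rule inj_on_subset)
  then show ?thesis unfolding ribbon_isoD(3) [OF iso] by (rule inj_on_imp_bij_betw)
qed

lemma twisted_dual_iso_right:
  assumes H: "is_twisted_dual G \<Gamma> H \<iota>" and iso: "ribbon_iso H K F"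
  shows "is_twisted_dual G \<Gamma> K ((`) F \<circ> \<iota>)"
proof -
  obtain P Q w f where h: "ribbon_graph H" "bij_betw \<iota> (edges G) (edges H)" "presents G P" "presents H Q"
    "\<forall>e \<in> edges G. w e \<in> \<Gamma> e" "presentation_iso (edges G) \<iota> f (apply_words w P) Q"
    using H by (rule is_twisted_dualE)
  obtain Q' where Q': "presents K Q'" "presentation_iso (edges H) ((`) F) F Q Q'"
    using presents_push [OF h(1) iso h(4)] by blast
  have E: "\<iota> ` edges G = edges H" using h(2) by (simp add: bij_betw_def)
  have "presentation_iso (edges G) ((`) F \<circ> \<iota>) (F \<circ> f) (apply_words w P) Q'"
    by (rule presentation_iso_trans [OF h(6)]) (simp only: E Q'(2))
  moreover have "bij_betw ((`) F \<circ> \<iota>) (edges G) (edges K)"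
    by (rule bij_betw_trans [OF h(2) ribbon_iso_bij_edges [OF h(1) iso]])
  ultimately show ?thesis
    unfolding is_twisted_dual_def using ribbon_iso_graph [OF h(1) iso] h(3,5) Q'(1) by blast
qed

lemma twisted_dual_iso_left:
  assumes G: "ribbon_graph G" and iso: "ribbon_iso G G' F" and H: "is_twisted_dual G' \<Gamma>' H \<iota>"
    and \<Gamma>: "\<And>e. e \<in> edges G \<Longrightarrow> \<Gamma> e = \<Gamma>' (F ` e)"
  shows "is_twisted_dual G \<Gamma> H (\<iota> \<circ> (`) F)"
proof -
  obtain P' Q w f where h: "ribbon_graph H" "bij_betw \<iota> (edges G') (edges H)" "presents G' P'" "presents H Q"
    "\<forall>e \<in> edges G'. w e \<in> \<Gamma>' e" "presentation_iso (edges G') \<iota> f (apply_words w P') Q"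
    using H by (rule is_twisted_dualE)
  have G': "ribbon_graph G'" by (rule ribbon_iso_graph [OF G iso])
  obtain P where P: "presents G P" using presents_exists [OF G] by blast
  obtain P1 where P1: "presents G' P1" "presentation_iso (edges G) ((`) F) F P P1"
    using presents_push [OF G iso P] by blast
  have bij: "bij_betw ((`) F) (edges G) (edges G')" by (rule ribbon_iso_bij_edges [OF G iso])
  then have E: "(`) F ` edges G = edges G'" by (simp add: bij_betw_def)
  have "presentation_iso (edges G) (id \<circ> (`) F) (id \<circ> F) P P'"
    by (rule presentation_iso_trans [OF P1(2)]) (simp only: E presents_unique [OF G' P1(1) h(3)])
  then have PP': "presentation_iso (edges G) ((`) F) F P P'" by simp
  have 1: "presentation_iso (edges G) ((`) F) F (apply_words (\<lambda>e. w (F ` e)) P) (apply_words w P')"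
    by (rule presentation_iso_words [OF PP']) (rule word_eq.refl)
  have "presentation_iso (edges G) (\<iota> \<circ> (`) F) (f \<circ> F) (apply_words (\<lambda>e. w (F ` e)) P) Q"
    by (rule presentation_iso_trans [OF 1]) (simp only: E h(6))
  moreover have "\<forall>e \<in> edges G. w (F ` e) \<in> \<Gamma> e" using h(5) E \<Gamma> by blast
  moreover have "bij_betw (\<iota> \<circ> (`) F) (edges G) (edges H)" by (rule bij_betw_trans [OF bij h(2)])
  ultimately show ?thesis by (intro is_twisted_dualI [OF h(1) _ P h(4)])
qed

text \<open>
  In a word the last generator is applied first, so the word of the first operation stands on
  the right.
\<close>

lemma twisted_dual_comp:
  assumes H: "is_twisted_dual G \<Gamma> H \<iota>" and K: "is_twisted_dual H \<Delta> K \<kappa>"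
    and \<Theta>: "\<And>e u v. \<lbrakk>e \<in> edges G; u \<in> \<Gamma> e; v \<in> \<Delta> (\<iota> e)\<rbrakk> \<Longrightarrow> v @ u \<in> \<Theta> e"
  shows "is_twisted_dual G \<Theta> K (\<kappa> \<circ> \<iota>)"
proof -
  obtain P Q w f where h: "ribbon_graph H" "bij_betw \<iota> (edges G) (edges H)" "presents G P" "presents H Q"
    "\<forall>e \<in> edges G. w e \<in> \<Gamma> e" "presentation_iso (edges G) \<iota> f (apply_words w P) Q"
    using H by (rule is_twisted_dualE)
  obtain Q' R w' f' where k: "ribbon_graph K" "bij_betw \<kappa> (edges H) (edges K)" "presents H Q'" "presents K R"
    "\<forall>e \<in> edges H. w' e \<in> \<Delta> e" "presentation_iso (edges H) \<kappa> f' (apply_words w' Q') R"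
    using K by (rule is_twisted_dualE)
  have E: "\<iota> ` edges G = edges H" using h(2) by (simp add: bij_betw_def)
  have 0: "presentation_iso (edges G) (id \<circ> \<iota>) (id \<circ> f) (apply_words w P) Q'"
    by (rule presentation_iso_trans [OF h(6)]) (simp only: E presents_unique [OF h(1,4) k(3)])
  then have "presentation_iso (edges G) \<iota> f (apply_words w P) Q'" by simp
  from presentation_iso_words [OF this, of "\<lambda>e. w' (\<iota> e)" w']
  have 1: "presentation_iso (edges G) \<iota> f (apply_words (\<lambda>e. w' (\<iota> e) @ w e) P) (apply_words w' Q')"
    by (simp add: apply_words_append word_eq.refl)
  have "presentation_iso (edges G) (\<kappa> \<circ> \<iota>) (f' \<circ> f) (apply_words (\<lambda>e. w' (\<iota> e) @ w e) P) R"
    by (rule presentation_iso_trans [OF 1]) (simp only: E k(6))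
  moreover have "\<forall>e \<in> edges G. w' (\<iota> e) @ w e \<in> \<Theta> e" using h(5) k(5) E \<Theta> by blast
  moreover have "bij_betw (\<kappa> \<circ> \<iota>) (edges G) (edges K)" by (rule bij_betw_trans [OF h(2) k(2)])
  ultimately show ?thesis by (intro is_twisted_dualI [OF k(1) _ h(3) k(4)])
qed

lemma twisted_dual_trivial:
  assumes G: "ribbon_graph G" and \<Gamma>: "\<And>e. e \<in> edges G \<Longrightarrow> [] \<in> \<Gamma> e"
  shows "is_twisted_dual G \<Gamma> G id"
proof -
  obtain P where P: "presents G P" using presents_exists [OF G] by blast
  have "presentation_iso (edges G) id id (apply_words (\<lambda>_. []) P) P"
    unfolding apply_words_Nil by (rule presents_unique [OF G P P])
  then show ?thesis by (intro is_twisted_dualI [OF G _ P P]) (simp_all add: \<Gamma>)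
qed

lemma twisted_dual_cong:
  assumes "is_twisted_dual G \<Gamma> H \<iota>" "\<And>e. e \<in> edges G \<Longrightarrow> \<Gamma> e = \<Gamma>' e" "\<And>e. e \<in> edges G \<Longrightarrow> \<iota> e = \<iota>' e"
  shows "is_twisted_dual G \<Gamma>' H \<iota>'"
proof -
  obtain P Q w f where h: "ribbon_graph H" "bij_betw \<iota> (edges G) (edges H)" "presents G P" "presents H Q"
    "\<forall>e \<in> edges G. w e \<in> \<Gamma> e" "presentation_iso (edges G) \<iota> f (apply_words w P) Q"
    using assms(1) by (rule is_twisted_dualE)
  have "bij_betw \<iota>' (edges G) (edges H)" using h(2) assms(3) bij_betw_cong by blast
  moreover have "presentation_iso (edges G) \<iota>' f (apply_words w P) Q"
    by (rule presentation_iso_same_edges [OF h(6)]) (simp add: assms(3))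
  moreover have "\<forall>e \<in> edges G. w e \<in> \<Gamma>' e" using h(5) assms(2) by blast
  ultimately show ?thesis unfolding is_twisted_dual_def using h(1,3,4) by blast
qed


section \<open>The group of twists\<close>

definition cls :: "generator list \<Rightarrow> twist" where "cls u = {w. word_eq u w}"

lemma carrier_twist_group: "carrier twist_group = range cls"
  by (auto simp: twist_group_def quotient_def cls_def)

lemma cls_eq_iff: "cls u = cls v \<longleftrightarrow> word_eq u v"
  unfolding cls_def by (auto intro: word_eq.refl word_eq.sym word_eq.trans)

lemma mult_cls: "cls u \<otimes>\<^bsub>twist_group\<^esub> cls v = cls (u @ v)"
proof -
  have "word_eq (u @ v) w" if "word_eq u u'" "word_eq v v'" "word_eq w (u' @ v')" for u' v' w
    using word_eq.trans [OF word_eq.append [OF that(1,2)] word_eq.sym [OF that(3)]] .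
  moreover have "\<exists>u'. word_eq u u' \<and> (\<exists>v'. word_eq v v' \<and> word_eq w (u' @ v'))" if "word_eq (u @ v) w" for w
    using that word_eq.refl word_eq.sym by blast
  ultimately show ?thesis by (auto simp: twist_group_def cls_def)
qed

lemma one_cls: "\<one>\<^bsub>twist_group\<^esub> = cls []"
  by (auto simp: twist_group_def cls_def intro: word_eq.sym)

text \<open>
  The generators are involutions, so a word is inverted by reversing it.
\<close>

lemma word_eq_rev: "word_eq (rev u @ u) []"
proof (induction u)
  case Nil
  show ?case by (simp add: word_eq.refl)
next
  case (Cons g u)
  have "word_eq [g, g] []" by (cases g) (auto intro: word_eq.Delta2 word_eq.Tau2)
  then have "word_eq (rev u @ ([g, g] @ u)) (rev u @ ([] @ u))"
    by (intro word_eq.append word_eq.refl)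
  then show ?case using word_eq.trans [OF _ Cons.IH] by simp
qed

lemma group_twist_group: "group twist_group"
proof (rule groupI)
  fix x assume "x \<in> carrier twist_group"
  then obtain u where "x = cls u" by (auto simp: carrier_twist_group)
  then have "cls (rev u) \<otimes>\<^bsub>twist_group\<^esub> x = \<one>\<^bsub>twist_group\<^esub>"
    by (simp add: mult_cls one_cls cls_eq_iff word_eq_rev)
  then show "\<exists>y \<in> carrier twist_group. y \<otimes>\<^bsub>twist_group\<^esub> x = \<one>\<^bsub>twist_group\<^esub>"
    by (auto simp: carrier_twist_group)
qed (auto simp: carrier_twist_group mult_cls one_cls)

lemma twist_word_eq: "\<lbrakk>C \<in> carrier twist_group; u \<in> C; v \<in> C\<rbrakk> \<Longrightarrow> word_eq u v"
  by (auto simp: carrier_twist_group cls_def intro: word_eq.sym word_eq.trans)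

lemma twist_nonempty: "C \<in> carrier twist_group \<Longrightarrow> C \<noteq> {}"
  by (auto simp: carrier_twist_group cls_def intro: word_eq.refl)

lemma twist_mult_mem: "\<lbrakk>u \<in> A; v \<in> B\<rbrakk> \<Longrightarrow> u @ v \<in> A \<otimes>\<^bsub>twist_group\<^esub> B"
  by (auto simp: twist_group_def intro: word_eq.refl)

lemma Nil_in_one: "[] \<in> \<one>\<^bsub>twist_group\<^esub>"
  by (simp add: twist_group_def word_eq.refl)

lemma group_twist_power: "group (twist_power n)"
  unfolding twist_power_def by (simp add: group_twist_group)

lemma twist_power_carrier: "\<gamma> \<in> carrier (twist_power n) \<longleftrightarrow>
    (\<forall>i \<in> {1..n}. \<gamma> i \<in> carrier twist_group) \<and> \<gamma> \<in> extensional {1..n}"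
  by (auto simp: twist_power_def PiE_iff)

lemma twist_power_mult: "\<gamma> \<otimes>\<^bsub>twist_power n\<^esub> \<delta> = (\<lambda>i \<in> {1..n}. \<gamma> i \<otimes>\<^bsub>twist_group\<^esub> \<delta> i)"
  by (simp add: twist_power_def)

lemma twist_power_one: "\<one>\<^bsub>twist_power n\<^esub> = (\<lambda>i \<in> {1..n}. \<one>\<^bsub>twist_group\<^esub>)"
  by (simp add: twist_power_def)


section \<open>Semidirect products and actions\<close>

lemma semidirect_product_group:
  assumes N: "group N" and K: "group K" and \<phi>: "\<phi> \<in> hom K (AutoGroup N)"
  shows "group (semidirect_product N K \<phi>)"
proof -
  interpret N: group N by fact
  interpret K: group K by fact
  have auto: "\<phi> y \<in> auto N" if "y \<in> carrier K" for y
    using \<phi> that by (auto simp: hom_def AutoGroup_def)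
  have closed: "\<phi> y x \<in> carrier N" if "y \<in> carrier K" "x \<in> carrier N" for x y
    using auto [OF that(1)] that(2) by (auto simp: auto_def hom_def)
  have mult: "\<phi> y (x \<otimes>\<^bsub>N\<^esub> x') = \<phi> y x \<otimes>\<^bsub>N\<^esub> \<phi> y x'" if "y \<in> carrier K" "x \<in> carrier N" "x' \<in> carrier N" for x x' y
    using auto [OF that(1)] that(2,3) by (auto simp: auto_def hom_def)
  have comp: "\<phi> (y \<otimes>\<^bsub>K\<^esub> y') x = \<phi> y (\<phi> y' x)" if "y \<in> carrier K" "y' \<in> carrier K" "x \<in> carrier N" for x y y'
  proof -
    have "\<phi> (y \<otimes>\<^bsub>K\<^esub> y') = \<phi> y \<otimes>\<^bsub>AutoGroup N\<^esub> \<phi> y'" by (rule hom_mult [OF \<phi> that(1,2)])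
    also have "\<dots> = compose (carrier N) (\<phi> y) (\<phi> y')"
      using auto [OF that(1)] auto [OF that(2)] by (simp add: AutoGroup_def BijGroup_def auto_def)
    finally show ?thesis using that(3) by (simp add: compose_def)
  qed
  have one: "\<phi> \<one>\<^bsub>K\<^esub> x = x" if x: "x \<in> carrier N" for x
  proof -
    interpret A: group "AutoGroup N" by (rule N.AutoGroup)
    have "group_hom K (AutoGroup N) \<phi>" using \<phi> by unfold_locales
    then have "\<phi> \<one>\<^bsub>K\<^esub> = \<one>\<^bsub>AutoGroup N\<^esub>" by (rule group_hom.hom_one)
    then show ?thesis using x by (simp add: AutoGroup_def BijGroup_def)
  qed
  show ?thesis
  proof (rule groupI)
    fix p q assume p: "p \<in> carrier (semidirect_product N K \<phi>)" and q: "q \<in> carrier (semidirect_product N K \<phi>)"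
    then show "p \<otimes>\<^bsub>semidirect_product N K \<phi>\<^esub> q \<in> carrier (semidirect_product N K \<phi>)"
      using closed by (auto simp: semidirect_product_def)
    fix r assume "r \<in> carrier (semidirect_product N K \<phi>)"
    then show "(p \<otimes>\<^bsub>semidirect_product N K \<phi>\<^esub> q) \<otimes>\<^bsub>semidirect_product N K \<phi>\<^esub> r =
        p \<otimes>\<^bsub>semidirect_product N K \<phi>\<^esub> (q \<otimes>\<^bsub>semidirect_product N K \<phi>\<^esub> r)"
      using p q closed by (auto simp: semidirect_product_def mult comp N.m_assoc K.m_assoc)
  next
    show "\<one>\<^bsub>semidirect_product N K \<phi>\<^esub> \<in> carrier (semidirect_product N K \<phi>)" by (simp add: semidirect_product_def)
    fix p assume p: "p \<in> carrier (semidirect_product N K \<phi>)"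
    then show "\<one>\<^bsub>semidirect_product N K \<phi>\<^esub> \<otimes>\<^bsub>semidirect_product N K \<phi>\<^esub> p = p"
      by (auto simp: semidirect_product_def one)
    obtain x y where xy: "p = (x, y)" "x \<in> carrier N" "y \<in> carrier K" using p by (auto simp: semidirect_product_def)
    let ?z = "inv\<^bsub>N\<^esub> (\<phi> (inv\<^bsub>K\<^esub> y) x)"
    have c: "\<phi> (inv\<^bsub>K\<^esub> y) x \<in> carrier N" using closed xy by simp
    have "(?z, inv\<^bsub>K\<^esub> y) \<in> carrier (semidirect_product N K \<phi>)" using c xy by (simp add: semidirect_product_def)
    moreover have "(?z, inv\<^bsub>K\<^esub> y) \<otimes>\<^bsub>semidirect_product N K \<phi>\<^esub> p = \<one>\<^bsub>semidirect_product N K \<phi>\<^esub>"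
      using c xy by (simp add: semidirect_product_def)
    ultimately show "\<exists>q \<in> carrier (semidirect_product N K \<phi>). q \<otimes>\<^bsub>semidirect_product N K \<phi>\<^esub> p = \<one>\<^bsub>semidirect_product N K \<phi>\<^esub>"
      by blast
  qed
qed

text \<open>
  The elements of \<open>BijGroup E\<close> are extensional on \<open>E\<close>, hence the
  restriction.
\<close>

lemma group_action_restrict:
  assumes K: "group K"
    and closed: "\<And>g x. \<lbrakk>g \<in> carrier K; x \<in> E\<rbrakk> \<Longrightarrow> A g x \<in> E"
    and one: "\<And>x. x \<in> E \<Longrightarrow> A \<one>\<^bsub>K\<^esub> x = x"
    and mult: "\<And>g h x. \<lbrakk>g \<in> carrier K; h \<in> carrier K; x \<in> E\<rbrakk> \<Longrightarrow> A (g \<otimes>\<^bsub>K\<^esub> h) x = A g (A h x)"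
  shows "group_action K E (\<lambda>g. \<lambda>x \<in> E. A g x)"
proof -
  interpret K: group K by fact
  have Bij: "(\<lambda>x \<in> E. A g x) \<in> Bij E" if g: "g \<in> carrier K" for g
  proof -
    have gi: "inv\<^bsub>K\<^esub> g \<in> carrier K" using g by simp
    have 1: "A (inv\<^bsub>K\<^esub> g) (A g x) = x" if "x \<in> E" for x
      using mult [OF gi g that] one [OF that] g by simp
    have 2: "A g (A (inv\<^bsub>K\<^esub> g) x) = x" if "x \<in> E" for x
      using mult [OF g gi that] one [OF that] g by simp
    have "bij_betw (A g) E E"
    proof (rule bij_betw_byWitness [where f' = "A (inv\<^bsub>K\<^esub> g)"])
      show "\<forall>x \<in> E. A (inv\<^bsub>K\<^esub> g) (A g x) = x" by (intro ballI) (rule 1)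
      show "\<forall>x \<in> E. A g (A (inv\<^bsub>K\<^esub> g) x) = x" by (intro ballI) (rule 2)
      show "A g ` E \<subseteq> E" by (intro image_subsetI) (rule closed [OF g])
      show "A (inv\<^bsub>K\<^esub> g) ` E \<subseteq> E" by (intro image_subsetI) (rule closed [OF gi])
    qed
    then have "bij_betw (\<lambda>x \<in> E. A g x) E E" by (subst bij_betw_cong [of E _ "A g"]) (simp_all only: restrict_apply if_True)
    then show ?thesis by (simp add: Bij_def)
  qed
  have "(\<lambda>g. \<lambda>x \<in> E. A g x) \<in> hom K (BijGroup E)"
  proof (rule homI)
    show "(\<lambda>x \<in> E. A g x) \<in> carrier (BijGroup E)" if "g \<in> carrier K" for g
      using Bij [OF that] by (simp add: BijGroup_def)
    show "(\<lambda>x \<in> E. A (g \<otimes>\<^bsub>K\<^esub> h) x) = (\<lambda>x \<in> E. A g x) \<otimes>\<^bsub>BijGroup E\<^esub> (\<lambda>x \<in> E. A h x)"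
      if "g \<in> carrier K" "h \<in> carrier K" for g h
    proof
      fix x
      have "(\<lambda>x \<in> E. A g x) \<otimes>\<^bsub>BijGroup E\<^esub> (\<lambda>x \<in> E. A h x) = compose E (\<lambda>x \<in> E. A g x) (\<lambda>x \<in> E. A h x)"
        using Bij [OF that(1)] Bij [OF that(2)] by (simp add: BijGroup_def)
      moreover have "(\<lambda>x \<in> E. A (g \<otimes>\<^bsub>K\<^esub> h) x) x = compose E (\<lambda>x \<in> E. A g x) (\<lambda>x \<in> E. A h x) x"
      proof (cases "x \<in> E")
        case True
        have "A (g \<otimes>\<^bsub>K\<^esub> h) x = A g (A h x)" by (rule mult [OF that True])
        then show ?thesis using True closed [OF that(2) True] by (simp only: compose_def restrict_apply if_True)
      next
        case False
        then show ?thesis by (simp only: compose_def restrict_apply if_False)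
      qed
      ultimately show "(\<lambda>x \<in> E. A (g \<otimes>\<^bsub>K\<^esub> h) x) x = ((\<lambda>x \<in> E. A g x) \<otimes>\<^bsub>BijGroup E\<^esub> (\<lambda>x \<in> E. A h x)) x"
        by (simp only:)
    qed
  qed
  then have "group_hom K (BijGroup E) (\<lambda>g. \<lambda>x \<in> E. A g x)"
    using K group_BijGroup by (simp add: group_hom_def group_hom_axioms_def)
  then show ?thesis by (simp add: group_action_def)
qed


section \<open>Permuting the entries of a tuple of twists\<close>

lemma extensional_comp_permutes:
  assumes "\<pi> permutes S" "f \<in> extensional S" shows "f \<circ> \<pi> \<in> extensional S"
  using assms by (simp add: permutes_not_in extensional_def)

lemma twist_power_comp:
  assumes \<pi>: "\<pi> permutes {1..n}" and \<gamma>: "\<gamma> \<in> carrier (twist_power n)"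
  shows "\<gamma> \<circ> \<pi> \<in> carrier (twist_power n)"
proof -
  have "\<pi> i \<in> {1..n}" if "i \<in> {1..n}" for i using permutes_in_image [OF \<pi>] that by blast
  moreover have "\<gamma> \<circ> \<pi> \<in> extensional {1..n}"
    using \<gamma> unfolding twist_power_carrier by (intro extensional_comp_permutes [OF \<pi>]) (rule conjunct2)
  ultimately show ?thesis
    using \<gamma> unfolding twist_power_carrier o_apply by blast
qed

text \<open>
  Precomposition reverses the order of permutations; the inverse restores it.
\<close>

lemma permute_twists_hom: "permute_twists n \<in> hom (sym_group n) (AutoGroup (twist_power n))"
proof -
  let ?C = "carrier (twist_power n)"
  have auto: "permute_twists n \<pi> \<in> auto (twist_power n)" if \<pi>: "\<pi> permutes {1..n}" for \<pi>
  proof -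
    have \<pi>': "inv' \<pi> permutes {1..n}" by (rule permutes_inv [OF \<pi>])
    have "permute_twists n \<pi> \<in> hom (twist_power n) (twist_power n)"
    proof (rule homI)
      show "permute_twists n \<pi> \<gamma> \<in> ?C" if "\<gamma> \<in> ?C" for \<gamma>
        using twist_power_comp [OF \<pi>' that] that by (simp add: permute_twists_def)
      fix \<gamma> \<delta> assume g: "\<gamma> \<in> ?C" "\<delta> \<in> ?C"
      have gd: "\<gamma> \<otimes>\<^bsub>twist_power n\<^esub> \<delta> \<in> ?C" using g group.is_monoid [OF group_twist_power] monoid.m_closed by metis
      have "(\<gamma> \<otimes>\<^bsub>twist_power n\<^esub> \<delta>) \<circ> inv' \<pi> = (\<gamma> \<circ> inv' \<pi>) \<otimes>\<^bsub>twist_power n\<^esub> (\<delta> \<circ> inv' \<pi>)"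
      proof
        fix i
        show "((\<gamma> \<otimes>\<^bsub>twist_power n\<^esub> \<delta>) \<circ> inv' \<pi>) i = ((\<gamma> \<circ> inv' \<pi>) \<otimes>\<^bsub>twist_power n\<^esub> (\<delta> \<circ> inv' \<pi>)) i"
          using permutes_in_image [OF \<pi>', of i] unfolding twist_power_mult by (simp only: o_apply restrict_apply split: if_split)
      qed
      then show "permute_twists n \<pi> (\<gamma> \<otimes>\<^bsub>twist_power n\<^esub> \<delta>) =
          permute_twists n \<pi> \<gamma> \<otimes>\<^bsub>twist_power n\<^esub> permute_twists n \<pi> \<delta>"
        using g gd by (simp add: permute_twists_def)
    qed
    moreover have "permute_twists n \<pi> \<in> Bij ?C"
    proof -
      have "bij_betw (\<lambda>\<gamma>. \<gamma> \<circ> inv' \<pi>) ?C ?C"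
      proof (rule bij_betw_byWitness [where f' = "\<lambda>\<gamma>. \<gamma> \<circ> \<pi>"])
        show "(\<lambda>\<gamma>. \<gamma> \<circ> inv' \<pi>) ` ?C \<subseteq> ?C" using twist_power_comp [OF \<pi>'] by blast
        show "(\<lambda>\<gamma>. \<gamma> \<circ> \<pi>) ` ?C \<subseteq> ?C" using twist_power_comp [OF \<pi>] by blast
        show "\<forall>\<gamma> \<in> ?C. (\<gamma> \<circ> inv' \<pi>) \<circ> \<pi> = \<gamma>" by (simp only: comp_assoc permutes_inv_o [OF \<pi>] comp_id) simp
        show "\<forall>\<gamma> \<in> ?C. (\<gamma> \<circ> \<pi>) \<circ> inv' \<pi> = \<gamma>" by (simp only: comp_assoc permutes_inv_o [OF \<pi>] comp_id) simp
      qed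
      then have "bij_betw (permute_twists n \<pi>) ?C ?C"
        by (subst bij_betw_cong [of ?C _ "\<lambda>\<gamma>. \<gamma> \<circ> inv' \<pi>"]) (simp_all only: permute_twists_def restrict_apply if_True)
      then show ?thesis by (simp add: Bij_def permute_twists_def)
    qed
    ultimately show ?thesis by (simp add: auto_def)
  qed
  show ?thesis
  proof (rule homI)
    show "permute_twists n \<pi> \<in> carrier (AutoGroup (twist_power n))" if "\<pi> \<in> carrier (sym_group n)" for \<pi>
      using auto that by (simp add: AutoGroup_def sym_group_def)
    fix \<pi> \<rho> assume pr: "\<pi> \<in> carrier (sym_group n)" "\<rho> \<in> carrier (sym_group n)"
    then have p: "\<pi> permutes {1..n}" "\<rho> permutes {1..n}" by (simp_all add: sym_group_def)
    have inv: "inv' (\<pi> \<circ> \<rho>) = inv' \<rho> \<circ> inv' \<pi>"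
      by (rule o_inv_distrib [OF permutes_bij [OF p(1)] permutes_bij [OF p(2)]])
    have "permute_twists n (\<pi> \<circ> \<rho>) = compose ?C (permute_twists n \<pi>) (permute_twists n \<rho>)"
    proof
      fix \<gamma>
      show "permute_twists n (\<pi> \<circ> \<rho>) \<gamma> = compose ?C (permute_twists n \<pi>) (permute_twists n \<rho>) \<gamma>"
        using twist_power_comp [OF permutes_inv [OF p(2)], of \<gamma>]
        by (simp add: permute_twists_def compose_def inv o_assoc)
    qed
    also have "\<dots> = permute_twists n \<pi> \<otimes>\<^bsub>AutoGroup (twist_power n)\<^esub> permute_twists n \<rho>"
      using auto [OF p(1)] auto [OF p(2)] by (simp add: AutoGroup_def BijGroup_def auto_def)
    finally show "permute_twists n (\<pi> \<otimes>\<^bsub>sym_group n\<^esub> \<rho>) =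
        permute_twists n \<pi> \<otimes>\<^bsub>AutoGroup (twist_power n)\<^esub> permute_twists n \<rho>"
      by (simp add: sym_group_def)
  qed
qed


section \<open>Isomorphism classes of ordered ribbon graphs\<close>

lemma ribbon_iso_refl: "ribbon_iso G G id"
  by (simp add: ribbon_iso_def)

lemma ribbon_iso_trans:
  assumes "ribbon_iso G H F" "ribbon_iso H K F'"
  shows "ribbon_iso G K (F' \<circ> F)"
proof -
  have comp: "(`) (F' \<circ> F) ` \<D> = (`) F' ` (`) F ` \<D>" for \<D> by (simp add: image_comp o_def image_image)
  show ?thesis
    using assms homeomorphic_map_compose [of "surface G" "surface H" F "surface K" F']
    unfolding ribbon_iso_def comp by simp
qed

lemma ordered_ribbon_graphsD:
  assumes "(G, l) \<in> ordered_ribbon_graphs n"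
  shows "ribbon_graph G" "l \<in> extensional {1..n}" "bij_betw l {1..n} (edges G)"
  using assms by (simp_all add: ordered_ribbon_graphs_def)

lemma ordered_nth:
  assumes "(G, l) \<in> ordered_ribbon_graphs n"
  shows "i \<in> {1..n} \<Longrightarrow> l i \<in> edges G" "e \<in> edges G \<Longrightarrow> \<exists>i \<in> {1..n}. e = l i"
proof -
  have "l ` {1..n} = edges G" using ordered_ribbon_graphsD(3) [OF assms] by (rule bij_betw_imp_surj_on)
  then show "i \<in> {1..n} \<Longrightarrow> l i \<in> edges G" "e \<in> edges G \<Longrightarrow> \<exists>i \<in> {1..n}. e = l i" by blast+
qed

lemma ordered_isoI:
  assumes "(G, l) \<in> ordered_ribbon_graphs n" "(H, m) \<in> ordered_ribbon_graphs n"
    "ribbon_iso G H F" "\<And>i. i \<in> {1..n} \<Longrightarrow> F ` l i = m i"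
  shows "((G, l), (H, m)) \<in> ordered_iso n"
  using assms unfolding ordered_iso_def by blast

lemma ordered_isoE:
  assumes "((G, l), (H, m)) \<in> ordered_iso n"
  obtains F where "(G, l) \<in> ordered_ribbon_graphs n" "(H, m) \<in> ordered_ribbon_graphs n"
    "ribbon_iso G H F" "\<forall>i \<in> {1..n}. F ` l i = m i"
  using assms unfolding ordered_iso_def by blast

lemma equiv_ordered_iso: "equiv (ordered_ribbon_graphs n) (ordered_iso n)" (is "equiv ?A ?R")
proof (rule equivI)
  show "?R \<subseteq> ?A \<times> ?A"
    unfolding ordered_iso_def by blast
  show "refl_on ?A ?R"
  proof (rule refl_onI)
    fix x :: "'a ordered_ribbon" assume x: "x \<in> ?A"
    obtain G l where "x = (G, l)" by (cases x)
    with x show "(x, x) \<in> ?R" by (auto intro: ordered_isoI [OF _ _ ribbon_iso_refl])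
  qed
  show "sym ?R"
  proof (rule symI)
    fix x y :: "'a ordered_ribbon" assume xy: "(x, y) \<in> ?R"
    obtain G l H m where eq: "x = (G, l)" "y = (H, m)" by (cases x, cases y)
    from xy obtain F where F: "(G, l) \<in> ordered_ribbon_graphs n" "(H, m) \<in> ordered_ribbon_graphs n"
      "ribbon_iso G H F" "\<forall>i \<in> {1..n}. F ` l i = m i" unfolding eq by (rule ordered_isoE)
    obtain g where g: "ribbon_iso H G g" "\<forall>x \<in> topspace (surface G). g (F x) = x"
      by (rule ribbon_iso_inverse [OF ordered_ribbon_graphsD(1) [OF F(1)] F(3)]) (rule that, assumption, simp)
    have "g ` m i = l i" if i: "i \<in> {1..n}" for i
    proof -
      have "l i \<subseteq> topspace (surface G)"
        using ribbon_discs_subset [OF ordered_ribbon_graphsD(1) [OF F(1)]] ordered_nth(1) [OF F(1) i] by blast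
      then have "g ` F ` l i = l i" using g(2) by (force simp: image_image)
      then show ?thesis using F(4) [rule_format, OF i] by simp
    qed
    then show "(y, x) \<in> ?R" unfolding eq by (rule ordered_isoI [OF F(2,1) g(1)])
  qed
  show "trans ?R"
  proof (rule transI)
    fix x y z :: "'a ordered_ribbon" assume xy: "(x, y) \<in> ?R" and yz: "(y, z) \<in> ?R"
    obtain G l H m K k where eq: "x = (G, l)" "y = (H, m)" "z = (K, k)" by (cases x, cases y, cases z)
    from xy obtain F where F: "(G, l) \<in> ordered_ribbon_graphs n" "(H, m) \<in> ordered_ribbon_graphs n"
      "ribbon_iso G H F" "\<forall>i \<in> {1..n}. F ` l i = m i" unfolding eq by (rule ordered_isoE)
    from yz obtain F' where F': "(H, m) \<in> ordered_ribbon_graphs n" "(K, k) \<in> ordered_ribbon_graphs n"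
      "ribbon_iso H K F'" "\<forall>i \<in> {1..n}. F' ` m i = k i" unfolding eq by (rule ordered_isoE)
    have "(F' \<circ> F) ` l i = k i" if "i \<in> {1..n}" for i
      unfolding image_comp [symmetric] F(4) [rule_format, OF that] by (rule F'(4) [rule_format, OF that])
    then show "(x, z) \<in> ?R" unfolding eq
      by (rule ordered_isoI [OF F(1) F'(2) ribbon_iso_trans [OF F(3) F'(3)]])
  qed
qed

lemma mem_iso_class: "y \<in> iso_class n x \<longleftrightarrow> (x, y) \<in> ordered_iso n"
  by (simp add: iso_class_def)

lemma iso_class_self: "x \<in> ordered_ribbon_graphs n \<Longrightarrow> x \<in> iso_class n x"
  unfolding iso_class_def by (rule equiv_class_self [OF equiv_ordered_iso])

lemma iso_class_eqI: "y \<in> iso_class n x \<Longrightarrow> iso_class n x = iso_class n y"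
  unfolding mem_iso_class unfolding iso_class_def by (rule equiv_class_eq [OF equiv_ordered_iso])

lemma iso_class_in_G_or: "x \<in> ordered_ribbon_graphs n \<Longrightarrow> iso_class n x \<in> G_or n"
  unfolding iso_class_def G_or_def by (rule quotientI)

lemma G_orE:
  assumes "C \<in> G_or n"
  obtains G l where "(G, l) \<in> ordered_ribbon_graphs n" "C = iso_class n (G, l)"
  using assms unfolding iso_class_def G_or_def by (elim quotientE) auto


section \<open>Twisting ordered ribbon graphs\<close>

lemma edge_twists_nth:
  assumes "(G, l) \<in> ordered_ribbon_graphs n" "i \<in> {1..n}"
  shows "edge_twists n \<gamma> l (l i) = \<gamma> i"
  unfolding edge_twists_def
  using inv_into_f_f [OF bij_betw_imp_inj_on [OF ordered_ribbon_graphsD(3) [OF assms(1)]] assms(2)] by simp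

lemma edge_twists_carrier:
  assumes "(G, l) \<in> ordered_ribbon_graphs n" "\<gamma> \<in> carrier (twist_power n)"
  shows "\<forall>e \<in> edges G. edge_twists n \<gamma> l e \<in> carrier twist_group"
proof
  fix e assume "e \<in> edges G"
  then obtain i where i: "i \<in> {1..n}" "e = l i" using ordered_nth(2) [OF assms(1)] by blast
  show "edge_twists n \<gamma> l e \<in> carrier twist_group"
    unfolding i(2) edge_twists_nth [OF assms(1) i(1)] using assms(2) i(1) unfolding twist_power_carrier by blast
qed

lemma mem_twisted_dual_class: "(H, m) \<in> twisted_dual_class n G \<Gamma> l \<longleftrightarrow>
    (H, m) \<in> ordered_ribbon_graphs n \<and> (\<exists>\<iota>. is_twisted_dual G \<Gamma> H \<iota> \<and> (\<forall>i \<in> {1..n}. m i = \<iota> (l i)))"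
  by (simp add: twisted_dual_class_def)

lemma twisted_dual_classE:
  assumes "(H, m) \<in> twisted_dual_class n G \<Gamma> l"
  obtains \<iota> where "(H, m) \<in> ordered_ribbon_graphs n" "is_twisted_dual G \<Gamma> H \<iota>"
    "\<forall>i \<in> {1..n}. m i = \<iota> (l i)"
  using assms unfolding mem_twisted_dual_class by blast

lemma twisted_dual_classI:
  assumes "(H, m) \<in> ordered_ribbon_graphs n" "is_twisted_dual G \<Gamma> H \<iota>" "\<And>i. i \<in> {1..n} \<Longrightarrow> m i = \<iota> (l i)"
  shows "(H, m) \<in> twisted_dual_class n G \<Gamma> l"
  using assms unfolding mem_twisted_dual_class by blast

text \<open>
  As \<open>n\<close> is positive there is an edge, and with it there are enough points to
  build the twisted dual.
\<close>

lemma twisted_dual_class_nonempty: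
  assumes n: "n \<ge> 1" and x: "(G, l) \<in> ordered_ribbon_graphs n"
    and \<Gamma>: "\<forall>e \<in> edges G. \<Gamma> e \<in> carrier twist_group"
  shows "\<exists>H m. (H, m) \<in> twisted_dual_class n G \<Gamma> l"
proof -
  note x' = ordered_ribbon_graphsD [OF x]
  have "1 \<in> {1..n}" using n by simp
  then have "edges G \<noteq> {}" using ordered_nth(1) [OF x] by blast
  from twisted_dual_exists [OF x'(1) this, of \<Gamma>] obtain H \<iota> where H: "is_twisted_dual G \<Gamma> H \<iota>"
    using \<Gamma> twist_nonempty by blast
  let ?m = "restrict (\<iota> \<circ> l) {1..n}"
  have r: "ribbon_graph H" "bij_betw \<iota> (edges G) (edges H)" using H by (simp_all add: is_twisted_dual_def)
  have "bij_betw ?m {1..n} (edges H)"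
    by (subst bij_betw_cong [of _ _ "\<iota> \<circ> l"]) (simp, rule bij_betw_trans [OF x'(3) r(2)])
  then have "(H, ?m) \<in> ordered_ribbon_graphs n" using r(1) by (simp add: ordered_ribbon_graphs_def)
  then have "(H, ?m) \<in> twisted_dual_class n G \<Gamma> l" using H by (rule twisted_dual_classI) simp
  then show ?thesis by blast
qed

text \<open>
  Twisted duals are unique up to isomorphism, and a ribbon graph isomorphic to one of them is
  another.
\<close>

lemma twisted_dual_class_eq:
  assumes x: "(G, l) \<in> ordered_ribbon_graphs n"
    and \<Gamma>: "\<forall>e \<in> edges G. \<Gamma> e \<in> carrier twist_group"
    and H: "(H, m) \<in> twisted_dual_class n G \<Gamma> l"
  shows "twisted_dual_class n G \<Gamma> l = iso_class n (H, m)"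
proof -
  obtain \<iota> where \<iota>: "(H, m) \<in> ordered_ribbon_graphs n" "is_twisted_dual G \<Gamma> H \<iota>"
    "\<forall>i \<in> {1..n}. m i = \<iota> (l i)" using H by (rule twisted_dual_classE)
  have "(K, k) \<in> twisted_dual_class n G \<Gamma> l \<longleftrightarrow> (K, k) \<in> iso_class n (H, m)" for K k
  proof
    assume "(K, k) \<in> twisted_dual_class n G \<Gamma> l"
    then obtain \<kappa> where \<kappa>: "(K, k) \<in> ordered_ribbon_graphs n" "is_twisted_dual G \<Gamma> K \<kappa>"
      "\<forall>i \<in> {1..n}. k i = \<kappa> (l i)" by (rule twisted_dual_classE)
    have "word_eq u v" if "e \<in> edges G" "u \<in> \<Gamma> e" "v \<in> \<Gamma> e" for e u v
      using \<Gamma> that by (blast intro: twist_word_eq)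
    then have "\<exists>F. ribbon_iso H K F \<and> (\<forall>e \<in> edges G. F ` \<iota> e = \<kappa> e)"
      by (rule twisted_dual_unique [OF ordered_ribbon_graphsD(1) [OF x] \<iota>(2) \<kappa>(2)])
    then obtain F where F: "ribbon_iso H K F" "\<forall>e \<in> edges G. F ` \<iota> e = \<kappa> e" by blast
    have "F ` m i = k i" if i: "i \<in> {1..n}" for i
      using F(2) ordered_nth(1) [OF x i] by (simp add: \<iota>(3) [rule_format, OF i] \<kappa>(3) [rule_format, OF i])
    then show "(K, k) \<in> iso_class n (H, m)" unfolding mem_iso_class by (rule ordered_isoI [OF \<iota>(1) \<kappa>(1) F(1)])
  next
    assume "(K, k) \<in> iso_class n (H, m)"
    then obtain F where F: "(K, k) \<in> ordered_ribbon_graphs n" "ribbon_iso H K F"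
      "\<forall>i \<in> {1..n}. F ` m i = k i" unfolding mem_iso_class by (rule ordered_isoE)
    show "(K, k) \<in> twisted_dual_class n G \<Gamma> l"
      by (rule twisted_dual_classI [OF F(1) twisted_dual_iso_right [OF \<iota>(2) F(2)]])
        (simp add: F(3) [rule_format, symmetric] \<iota>(3))
  qed
  then show ?thesis by auto
qed

lemma twisted_dual_class_cong:
  assumes "\<And>e. e \<in> edges G \<Longrightarrow> \<Gamma> e = \<Gamma>' e"
  shows "twisted_dual_class n G \<Gamma> l = twisted_dual_class n G \<Gamma>' l"
proof -
  have "is_twisted_dual G \<Gamma> H \<iota> \<longleftrightarrow> is_twisted_dual G \<Gamma>' H \<iota>" for H \<iota>
    by (rule iffI) (erule twisted_dual_cong; simp add: assms)+
  then show ?thesis unfolding twisted_dual_class_def by simp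
qed

text \<open>
  Isomorphic ordered ribbon graphs have the same twisted duals, so the union over a class is
  contributed by each of its members.
\<close>

lemma twist_power_act_class:
  assumes x: "(G, l) \<in> ordered_ribbon_graphs n"
  shows "twist_power_act n \<gamma> (iso_class n (G, l)) = twisted_dual_class n G (edge_twists n \<gamma> l) l"
proof
  show "twisted_dual_class n G (edge_twists n \<gamma> l) l \<subseteq> twist_power_act n \<gamma> (iso_class n (G, l))"
    unfolding twist_power_act_def using iso_class_self [OF x] by blast
  show "twist_power_act n \<gamma> (iso_class n (G, l)) \<subseteq> twisted_dual_class n G (edge_twists n \<gamma> l) l"
  proof
    fix y assume "y \<in> twist_power_act n \<gamma> (iso_class n (G, l))"
    then obtain G' l' H m where y: "y = (H, m)" "(G', l') \<in> iso_class n (G, l)"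
      "(H, m) \<in> twisted_dual_class n G' (edge_twists n \<gamma> l') l'"
      unfolding twist_power_act_def by (cases y) blast
    from y(2) obtain F where F: "(G', l') \<in> ordered_ribbon_graphs n" "ribbon_iso G G' F"
      "\<forall>i \<in> {1..n}. F ` l i = l' i" unfolding mem_iso_class by (rule ordered_isoE)
    from y(3) obtain \<iota> where \<iota>: "(H, m) \<in> ordered_ribbon_graphs n"
      "is_twisted_dual G' (edge_twists n \<gamma> l') H \<iota>" "\<forall>i \<in> {1..n}. m i = \<iota> (l' i)"
      by (rule twisted_dual_classE)
    have "edge_twists n \<gamma> l e = edge_twists n \<gamma> l' (F ` e)" if e: "e \<in> edges G" for e
    proof -
      obtain i where i: "i \<in> {1..n}" "e = l i" using ordered_nth(2) [OF x e] by blast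
      show ?thesis
        unfolding i(2) F(3) [rule_format, OF i(1)] edge_twists_nth [OF x i(1)] edge_twists_nth [OF F(1) i(1)] by (rule HOL.refl)
    qed
    then have "is_twisted_dual G (edge_twists n \<gamma> l) H (\<iota> \<circ> (`) F)"
      by (rule twisted_dual_iso_left [OF ordered_ribbon_graphsD(1) [OF x] F(2) \<iota>(2)])
    then show "y \<in> twisted_dual_class n G (edge_twists n \<gamma> l) l"
      unfolding y(1) by (rule twisted_dual_classI [OF \<iota>(1)]) (simp add: F(3) \<iota>(3))
  qed
qed

lemma twist_power_act_rep:
  assumes n: "n \<ge> 1" and x: "(G, l) \<in> ordered_ribbon_graphs n" and \<gamma>: "\<gamma> \<in> carrier (twist_power n)"
  obtains H m \<iota> where "(H, m) \<in> ordered_ribbon_graphs n"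
    "is_twisted_dual G (edge_twists n \<gamma> l) H \<iota>" "\<forall>i \<in> {1..n}. m i = \<iota> (l i)"
    "twist_power_act n \<gamma> (iso_class n (G, l)) = iso_class n (H, m)"
proof -
  note \<Gamma> = edge_twists_carrier [OF x \<gamma>]
  obtain H m where H: "(H, m) \<in> twisted_dual_class n G (edge_twists n \<gamma> l) l"
    using twisted_dual_class_nonempty [OF n x \<Gamma>] by blast
  obtain \<iota> where \<iota>: "(H, m) \<in> ordered_ribbon_graphs n"
    "is_twisted_dual G (edge_twists n \<gamma> l) H \<iota>" "\<forall>i \<in> {1..n}. m i = \<iota> (l i)"
    using H by (rule twisted_dual_classE)
  have "twist_power_act n \<gamma> (iso_class n (G, l)) = iso_class n (H, m)"
    unfolding twist_power_act_class [OF x] by (rule twisted_dual_class_eq [OF x \<Gamma> H])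
  then show ?thesis by (rule that [OF \<iota>])
qed

lemma twist_power_act_closed:
  assumes "n \<ge> 1" "\<gamma> \<in> carrier (twist_power n)" "C \<in> G_or n"
  shows "twist_power_act n \<gamma> C \<in> G_or n"
proof -
  obtain G l where x: "(G, l) \<in> ordered_ribbon_graphs n" and C: "C = iso_class n (G, l)"
    using assms(3) by (rule G_orE)
  obtain H m \<iota> where H: "(H, m) \<in> ordered_ribbon_graphs n"
    "is_twisted_dual G (edge_twists n \<gamma> l) H \<iota>" "\<forall>i \<in> {1..n}. m i = \<iota> (l i)"
    "twist_power_act n \<gamma> (iso_class n (G, l)) = iso_class n (H, m)"
    using twist_power_act_rep [OF assms(1) x assms(2)] .
  show ?thesis unfolding C H(4) by (rule iso_class_in_G_or [OF H(1)])
qed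

lemma twist_power_act_one:
  assumes "C \<in> G_or n"
  shows "twist_power_act n \<one>\<^bsub>twist_power n\<^esub> C = C"
proof -
  obtain G l where x: "(G, l) \<in> ordered_ribbon_graphs n" and C: "C = iso_class n (G, l)"
    using assms by (rule G_orE)
  have one: "\<one>\<^bsub>twist_power n\<^esub> \<in> carrier (twist_power n)"
    using group_twist_power by (intro monoid.one_closed group.is_monoid)
  have "[] \<in> edge_twists n \<one>\<^bsub>twist_power n\<^esub> l e" if e: "e \<in> edges G" for e
  proof -
    obtain i where i: "i \<in> {1..n}" "e = l i" using ordered_nth(2) [OF x e] by blast
    show ?thesis
      unfolding i(2) edge_twists_nth [OF x i(1)] using i(1) Nil_in_one by (simp add: twist_power_one)
  qed
  then have "is_twisted_dual G (edge_twists n \<one>\<^bsub>twist_power n\<^esub> l) G id"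
    by (rule twisted_dual_trivial [OF ordered_ribbon_graphsD(1) [OF x]])
  then have "(G, l) \<in> twisted_dual_class n G (edge_twists n \<one>\<^bsub>twist_power n\<^esub> l) l"
    by (rule twisted_dual_classI [OF x]) simp
  then show ?thesis
    unfolding C twist_power_act_class [OF x] by (rule twisted_dual_class_eq [OF x edge_twists_carrier [OF x one]])
qed

text \<open>
  The order of the edges is kept by twisting, so the tuples act entry by entry.
\<close>

lemma twist_power_act_mult:
  assumes n: "n \<ge> 1" and \<gamma>: "\<gamma> \<in> carrier (twist_power n)" and \<delta>: "\<delta> \<in> carrier (twist_power n)"
    and "C \<in> G_or n"
  shows "twist_power_act n \<gamma> (twist_power_act n \<delta> C) = twist_power_act n (\<gamma> \<otimes>\<^bsub>twist_power n\<^esub> \<delta>) C"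
proof -
  obtain G l where x: "(G, l) \<in> ordered_ribbon_graphs n" and C: "C = iso_class n (G, l)"
    using assms(4) by (rule G_orE)
  have \<gamma>\<delta>: "\<gamma> \<otimes>\<^bsub>twist_power n\<^esub> \<delta> \<in> carrier (twist_power n)"
    by (rule monoid.m_closed [OF group.is_monoid [OF group_twist_power] \<gamma> \<delta>])
  obtain H m \<iota> where H: "(H, m) \<in> ordered_ribbon_graphs n"
    "is_twisted_dual G (edge_twists n \<delta> l) H \<iota>" "\<forall>i \<in> {1..n}. m i = \<iota> (l i)"
    "twist_power_act n \<delta> (iso_class n (G, l)) = iso_class n (H, m)"
    using twist_power_act_rep [OF n x \<delta>] .
  obtain K k \<kappa> where K: "(K, k) \<in> ordered_ribbon_graphs n"
    "is_twisted_dual H (edge_twists n \<gamma> m) K \<kappa>" "\<forall>i \<in> {1..n}. k i = \<kappa> (m i)"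
    "twist_power_act n \<gamma> (iso_class n (H, m)) = iso_class n (K, k)"
    using twist_power_act_rep [OF n H(1) \<gamma>] .
  have "v @ u \<in> edge_twists n (\<gamma> \<otimes>\<^bsub>twist_power n\<^esub> \<delta>) l e"
    if e: "e \<in> edges G" and u: "u \<in> edge_twists n \<delta> l e" and v: "v \<in> edge_twists n \<gamma> m (\<iota> e)" for e u v
  proof -
    obtain i where i: "i \<in> {1..n}" "e = l i" using ordered_nth(2) [OF x e] by blast
    have "u \<in> \<delta> i" using u unfolding i(2) edge_twists_nth [OF x i(1)] .
    moreover have "v \<in> \<gamma> i" using v unfolding i(2) H(3) [rule_format, OF i(1), symmetric] edge_twists_nth [OF H(1) i(1)] .
    ultimately have "v @ u \<in> \<gamma> i \<otimes>\<^bsub>twist_group\<^esub> \<delta> i" by (intro twist_mult_mem)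
    then show ?thesis
      unfolding i(2) edge_twists_nth [OF x i(1)] twist_power_mult using i(1) by (simp only: restrict_apply if_True)
  qed
  then have "is_twisted_dual G (edge_twists n (\<gamma> \<otimes>\<^bsub>twist_power n\<^esub> \<delta>) l) K (\<kappa> \<circ> \<iota>)"
    by (rule twisted_dual_comp [OF H(2) K(2)])
  then have "(K, k) \<in> twisted_dual_class n G (edge_twists n (\<gamma> \<otimes>\<^bsub>twist_power n\<^esub> \<delta>) l) l"
    by (rule twisted_dual_classI [OF K(1)]) (simp add: K(3) H(3))
  from twisted_dual_class_eq [OF x edge_twists_carrier [OF x \<gamma>\<delta>] this]
  show ?thesis unfolding C H(4) K(4) unfolding twist_power_act_class [OF x] by (rule HOL.sym)
qed


section \<open>Permuting the order of the edges\<close>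

definition reorder :: "nat \<Rightarrow> (nat \<Rightarrow> nat) \<Rightarrow> 'a ordered_ribbon set \<Rightarrow> 'a ordered_ribbon set" where
  "reorder n \<pi> C = (\<Union>(G, l) \<in> C. iso_class n (G, l \<circ> inv' \<pi>))"

lemma ordered_comp_permutes:
  assumes x: "(G, l) \<in> ordered_ribbon_graphs n" and \<pi>: "\<pi> permutes {1..n}"
  shows "(G, l \<circ> \<pi>) \<in> ordered_ribbon_graphs n"
proof -
  note x' = ordered_ribbon_graphsD [OF x]
  have "l \<circ> \<pi> \<in> extensional {1..n}" by (rule extensional_comp_permutes [OF \<pi> x'(2)])
  moreover have "bij_betw (l \<circ> \<pi>) {1..n} (edges G)"
    by (rule bij_betw_trans [OF permutes_imp_bij [OF \<pi>] x'(3)])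
  ultimately show ?thesis using x'(1) by (simp add: ordered_ribbon_graphs_def)
qed

lemma reorder_class:
  assumes x: "(G, l) \<in> ordered_ribbon_graphs n" and \<pi>: "\<pi> permutes {1..n}"
  shows "reorder n \<pi> (iso_class n (G, l)) = iso_class n (G, l \<circ> inv' \<pi>)"
proof -
  note \<pi>' = permutes_inv [OF \<pi>]
  have "iso_class n (G', l' \<circ> inv' \<pi>) = iso_class n (G, l \<circ> inv' \<pi>)" if "(G', l') \<in> iso_class n (G, l)" for G' l'
  proof -
    from that obtain F where F: "(G', l') \<in> ordered_ribbon_graphs n" "ribbon_iso G G' F"
      "\<forall>i \<in> {1..n}. F ` l i = l' i" unfolding mem_iso_class by (rule ordered_isoE)
    have "F ` (l \<circ> inv' \<pi>) i = (l' \<circ> inv' \<pi>) i" if "i \<in> {1..n}" for i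
      unfolding o_apply by (rule F(3) [rule_format]) (simp only: permutes_in_image [OF \<pi>'] that)
    from ordered_isoI [OF ordered_comp_permutes [OF x \<pi>'] ordered_comp_permutes [OF F(1) \<pi>'] F(2) this]
    show ?thesis by (intro iso_class_eqI [symmetric]) (simp only: mem_iso_class)
  qed
  then show ?thesis unfolding reorder_def using iso_class_self [OF x] by fast
qed

lemma reorder_closed:
  assumes "C \<in> G_or n" "\<pi> permutes {1..n}"
  shows "reorder n \<pi> C \<in> G_or n"
proof -
  obtain G l where x: "(G, l) \<in> ordered_ribbon_graphs n" and C: "C = iso_class n (G, l)"
    using assms(1) by (rule G_orE)
  show ?thesis unfolding C reorder_class [OF x assms(2)]
    by (rule iso_class_in_G_or [OF ordered_comp_permutes [OF x permutes_inv [OF assms(2)]]])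
qed

lemma reorder_id:
  assumes "C \<in> G_or n"
  shows "reorder n id C = C"
proof -
  obtain G l where x: "(G, l) \<in> ordered_ribbon_graphs n" and C: "C = iso_class n (G, l)"
    using assms(1) by (rule G_orE)
  show ?thesis unfolding C reorder_class [OF x permutes_id] by simp
qed

lemma reorder_comp:
  assumes "C \<in> G_or n" and \<pi>: "\<pi> permutes {1..n}" and \<rho>: "\<rho> permutes {1..n}"
  shows "reorder n (\<pi> \<circ> \<rho>) C = reorder n \<pi> (reorder n \<rho> C)"
proof -
  obtain G l where x: "(G, l) \<in> ordered_ribbon_graphs n" and C: "C = iso_class n (G, l)"
    using assms(1) by (rule G_orE)
  have "inv' (\<pi> \<circ> \<rho>) = inv' \<rho> \<circ> inv' \<pi>"
    by (rule o_inv_distrib [OF permutes_bij [OF \<pi>] permutes_bij [OF \<rho>]])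
  then show ?thesis
    unfolding C reorder_class [OF x \<rho>] reorder_class [OF x permutes_compose [OF \<rho> \<pi>]]
      reorder_class [OF ordered_comp_permutes [OF x permutes_inv [OF \<rho>]] \<pi>]
    by (simp only: o_assoc)
qed

text \<open>
  The edge \<open>l i\<close> has number \<open>\<pi> i\<close> in the order \<open>l \<circ>
  inv' \<pi>\<close>, and so in both cases \<open>\<gamma> (\<pi> i)\<close> is applied to it.
\<close>

lemma twisted_dual_class_reorder:
  assumes x: "(G, l) \<in> ordered_ribbon_graphs n" and \<pi>: "\<pi> permutes {1..n}"
  shows "twisted_dual_class n G (edge_twists n \<gamma> (l \<circ> inv' \<pi>)) k =
    twisted_dual_class n G (edge_twists n (\<gamma> \<circ> \<pi>) l) k"
proof (rule twisted_dual_class_cong)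
  fix e assume "e \<in> edges G"
  then obtain i where i: "i \<in> {1..n}" "e = l i" using ordered_nth(2) [OF x] by blast
  have i': "\<pi> i \<in> {1..n}" using i(1) by (simp only: permutes_in_image [OF \<pi>])
  have e: "(l \<circ> inv' \<pi>) (\<pi> i) = e" unfolding i(2) by (simp only: o_apply permutes_inverses [OF \<pi>])
  have "edge_twists n \<gamma> (l \<circ> inv' \<pi>) e = \<gamma> (\<pi> i)"
    using edge_twists_nth [OF ordered_comp_permutes [OF x permutes_inv [OF \<pi>]] i', of \<gamma>] unfolding e .
  also have "\<dots> = edge_twists n (\<gamma> \<circ> \<pi>) l e"
    unfolding i(2) edge_twists_nth [OF x i(1)] by simp
  finally show "edge_twists n \<gamma> (l \<circ> inv' \<pi>) e = edge_twists n (\<gamma> \<circ> \<pi>) l e" .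
qed

text \<open>
  The entries of a tuple refer to the numbers of edges. After a change of the numbering the
  same operations are described by the permuted tuple; this commutation rule is the one built
  into the semidirect product.
\<close>

lemma reorder_twist_power_act:
  assumes n: "n \<ge> 1" and \<pi>: "\<pi> permutes {1..n}" and \<gamma>: "\<gamma> \<in> carrier (twist_power n)" and "C \<in> G_or n"
  shows "reorder n \<pi> (twist_power_act n \<gamma> C) = twist_power_act n (\<gamma> \<circ> inv' \<pi>) (reorder n \<pi> C)"
proof -
  obtain G l where x: "(G, l) \<in> ordered_ribbon_graphs n" and C: "C = iso_class n (G, l)"
    using assms(4) by (rule G_orE)
  note \<pi>' = permutes_inv [OF \<pi>]
  note x' = ordered_comp_permutes [OF x \<pi>'] and \<gamma>' = twist_power_comp [OF \<pi>' \<gamma>]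
  obtain H m \<iota> where H: "(H, m) \<in> ordered_ribbon_graphs n"
    "is_twisted_dual G (edge_twists n \<gamma> l) H \<iota>" "\<forall>i \<in> {1..n}. m i = \<iota> (l i)"
    "twist_power_act n \<gamma> (iso_class n (G, l)) = iso_class n (H, m)"
    using twist_power_act_rep [OF n x \<gamma>] .
  have "(\<gamma> \<circ> inv' \<pi>) \<circ> \<pi> = \<gamma>" by (simp only: comp_assoc permutes_inv_o [OF \<pi>] comp_id)
  then have eq: "twisted_dual_class n G (edge_twists n (\<gamma> \<circ> inv' \<pi>) (l \<circ> inv' \<pi>)) (l \<circ> inv' \<pi>) =
      twisted_dual_class n G (edge_twists n \<gamma> l) (l \<circ> inv' \<pi>)"
    using twisted_dual_class_reorder [OF x \<pi>, of "\<gamma> \<circ> inv' \<pi>"] by simp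
  have "(H, m \<circ> inv' \<pi>) \<in> twisted_dual_class n G (edge_twists n \<gamma> l) (l \<circ> inv' \<pi>)"
  proof (rule twisted_dual_classI [OF ordered_comp_permutes [OF H(1) \<pi>'] H(2)])
    show "(m \<circ> inv' \<pi>) i = \<iota> ((l \<circ> inv' \<pi>) i)" if "i \<in> {1..n}" for i
      unfolding o_apply by (rule H(3) [rule_format]) (simp only: permutes_in_image [OF \<pi>'] that)
  qed
  then have "twisted_dual_class n G (edge_twists n (\<gamma> \<circ> inv' \<pi>) (l \<circ> inv' \<pi>)) (l \<circ> inv' \<pi>) =
      iso_class n (H, m \<circ> inv' \<pi>)"
    unfolding eq [symmetric] by (rule twisted_dual_class_eq [OF x' edge_twists_carrier [OF x' \<gamma>']])
  then show ?thesis
    unfolding C H(4) reorder_class [OF x \<pi>] reorder_class [OF H(1) \<pi>] twist_power_act_class [OF x'] by (rule HOL.sym)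
qed

lemma semidirect_action:
  assumes n: "n \<ge> 1"
  shows "group_action (semidirect_product (twist_power n) (sym_group n) (permute_twists n)) (G_or n)
    (\<lambda>p. \<lambda>C \<in> G_or n. twist_power_act n (fst p) (reorder n (snd p) C))"
proof (rule group_action_restrict)
  show "group (semidirect_product (twist_power n) (sym_group n) (permute_twists n))"
    by (rule semidirect_product_group [OF group_twist_power sym_group_is_group permute_twists_hom])
  let ?K = "semidirect_product (twist_power n) (sym_group n) (permute_twists n)"
  have K: "fst p \<in> carrier (twist_power n)" "snd p permutes {1..n}" if "p \<in> carrier ?K" for p
    using that by (auto simp: semidirect_product_def sym_group_def)
  show "twist_power_act n (fst p) (reorder n (snd p) C) \<in> G_or n"
    if "p \<in> carrier ?K" "C \<in> G_or n" for p C
    by (rule twist_power_act_closed [OF n K(1) [OF that(1)] reorder_closed [OF that(2) K(2) [OF that(1)]]])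
  show "twist_power_act n (fst \<one>\<^bsub>?K\<^esub>) (reorder n (snd \<one>\<^bsub>?K\<^esub>) C) = C" if "C \<in> G_or n" for C
    using reorder_id [OF that] twist_power_act_one [OF that] by (simp add: semidirect_product_def sym_group_def)
  fix p q C assume p: "p \<in> carrier ?K" and q: "q \<in> carrier ?K" and C: "C \<in> G_or n"
  have pq: "fst (p \<otimes>\<^bsub>?K\<^esub> q) = fst p \<otimes>\<^bsub>twist_power n\<^esub> (fst q \<circ> inv' (snd p))"
    "snd (p \<otimes>\<^bsub>?K\<^esub> q) = snd p \<circ> snd q"
    using K(1) [OF q] by (simp_all add: semidirect_product_def sym_group_def permute_twists_def split_beta)
  note q' = twist_power_comp [OF permutes_inv [OF K(2) [OF p]] K(1) [OF q]]
    and C' = reorder_closed [OF C K(2) [OF q]]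
  show "twist_power_act n (fst (p \<otimes>\<^bsub>?K\<^esub> q)) (reorder n (snd (p \<otimes>\<^bsub>?K\<^esub> q)) C) =
      twist_power_act n (fst p) (reorder n (snd p) (twist_power_act n (fst q) (reorder n (snd q) C)))"
    unfolding pq reorder_comp [OF C K(2) [OF p] K(2) [OF q]]
      reorder_twist_power_act [OF n K(2) [OF p] K(1) [OF q] C']
    by (rule twist_power_act_mult [OF n K(1) [OF p] q' reorder_closed [OF C' K(2) [OF p]], symmetric])
qed

theorem proposition4p1:
  fixes n :: nat
  assumes "n \<ge> 1"
  shows "permute_twists n \<in> hom (sym_group n) (AutoGroup (twist_power n)) \<and>
    (\<exists>act :: (nat \<Rightarrow> twist) \<times> (nat \<Rightarrow> nat) \<Rightarrow> 'a ordered_ribbon set \<Rightarrow> 'a ordered_ribbon set.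
       group_action (semidirect_product (twist_power n) (sym_group n) (permute_twists n))
         (G_or n) act \<and>
       (\<forall>\<gamma> \<in> carrier (twist_power n). \<forall>\<pi> \<in> carrier (sym_group n).
        \<forall>(G, l) \<in> ordered_ribbon_graphs n.
          act (\<gamma>, \<pi>) (iso_class n (G, l)) = twist_power_act n \<gamma> (iso_class n (G, l \<circ> inv' \<pi>)) \<and>
          twist_power_act n \<gamma> (iso_class n (G, l \<circ> inv' \<pi>)) =
            twisted_dual_class n G (edge_twists n \<gamma> (l \<circ> inv' \<pi>)) (l \<circ> inv' \<pi>) \<and>
          twisted_dual_class n G (edge_twists n \<gamma> (l \<circ> inv' \<pi>)) (l \<circ> inv' \<pi>) =
            twisted_dual_class n G (edge_twists n (\<gamma> \<circ> \<pi>) l) (l \<circ> inv' \<pi>)))"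
proof (intro conjI exI ballI)
  show "permute_twists n \<in> hom (sym_group n) (AutoGroup (twist_power n))" by (rule permute_twists_hom)
  show "group_action (semidirect_product (twist_power n) (sym_group n) (permute_twists n)) (G_or n)
    (\<lambda>p. \<lambda>C \<in> G_or n. twist_power_act n (fst p) (reorder n (snd p) C))"
    by (rule semidirect_action [OF assms])
  fix \<gamma> \<pi> and x :: "'a ordered_ribbon"
  assume \<pi>: "\<pi> \<in> carrier (sym_group n)" and x: "x \<in> ordered_ribbon_graphs n"
  have p: "\<pi> permutes {1..n}" using \<pi> by (simp add: sym_group_def)
  obtain G l where eq: "x = (G, l)" by (cases x)
  have x: "(G, l) \<in> ordered_ribbon_graphs n" using x unfolding eq .
  note x' = ordered_comp_permutes [OF x permutes_inv [OF p]]
  have "(\<lambda>C \<in> G_or n. twist_power_act n (fst (\<gamma>, \<pi>)) (reorder n (snd (\<gamma>, \<pi>)) C)) (iso_class n (G, l)) =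
      twist_power_act n \<gamma> (iso_class n (G, l \<circ> inv' \<pi>))"
    using iso_class_in_G_or [OF x] reorder_class [OF x p] by simp
  then show "case x of (G, l) \<Rightarrow>
      (\<lambda>C \<in> G_or n. twist_power_act n (fst (\<gamma>, \<pi>)) (reorder n (snd (\<gamma>, \<pi>)) C)) (iso_class n (G, l)) =
        twist_power_act n \<gamma> (iso_class n (G, l \<circ> inv' \<pi>)) \<and>
      twist_power_act n \<gamma> (iso_class n (G, l \<circ> inv' \<pi>)) =
        twisted_dual_class n G (edge_twists n \<gamma> (l \<circ> inv' \<pi>)) (l \<circ> inv' \<pi>) \<and>
      twisted_dual_class n G (edge_twists n \<gamma> (l \<circ> inv' \<pi>)) (l \<circ> inv' \<pi>) =
        twisted_dual_class n G (edge_twists n (\<gamma> \<circ> \<pi>) l) (l \<circ> inv' \<pi>)"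
    unfolding eq prod.case
    using twist_power_act_class [OF x'] twisted_dual_class_reorder [OF x p] by (intro conjI) simp_all
qed


end
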